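(* Let $(E,w)$ be a finite vertex weighted graph, $\mathsf{k}$ a field, and $\epsilon$ a full idempotent in $L_{\mathsf{k}}(E,w)$. Then there exist a positive integer $n$ and a hair extension $(E^+,w^+)$ of $(E,w)$ such that $$\mathbb{M}_n\big(\epsilon L_{\mathsf{k}}(E,w)\epsilon\big)\;\cong\; L_{\mathsf{k}}(E^+,w^+)$$ as $\mathsf{k}$-algebras.
   Context: A (directed) graph is a quadruple $E=(E^0,E^1,s,r)$ with sets $E^0$ (vertices) and $E^1$ (edges) and maps $s,r:E^1\to E^0$ (source, range). It is finite if $E^0,E^1$ are finite, and row-finite if each vertex emits finitely many edges ($s^{-1}(v)$ is finite for all $v$). A vertex is a sink if it emits no edges; it is regular if it is not a sink and emits only finitely many edges; $E^0_{\mathrm{reg}}$ is the set of regular vertices. A weighted graph is a pair $(E,w)$ with $E$ a graph and $w:E^1\to\mathbb{N}^+$ a map ($\mathbb{N}^+$ = positive integers). It is finite (row-finite) if $E$ is. For $v\in E^0_{\mathrm{reg}}$ set $w(v):=\max\{w(e): e\in s^{-1}(v)\}$. A row-finite weighted graph is a vertex weighted graph if for every $v\in E^0_{\mathrm{reg}}$ one has $w(e)=w(e')$ for all $e,e'\in s^{-1}(v)$. For a row-finite weighted graph $(E,w)$ and a field $\mathsf{k}$, the weighted Leavitt path algebra $L_{\mathsf{k}}(E,w)$ is the (associative) $\mathsf{k}$-algebra generated by $\{v,e_i,e_i^*: v\in E^0, e\in E^1, 1\le i\le w(e)\}$ subject to the relations (i) $uv=\delta_{uv}u$ for $u,v\in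 E^0$; (ii) $s(e)e_i=e_i=e_ir(e)$ and $r(e)e_i^*=e_i^*=e_i^*s(e)$ for $e\in E^1$, $1\le i\le w(e)$; (iii) $\sum_{e\in s^{-1}(v)}e_ie_j^*=\delta_{ij}v$ for $v\in E^0_{\mathrm{reg}}$, $1\le i,j\le w(v)$; (iv) $\sum_{1\le i\le w(v)}e_i^*f_i=\delta_{ef}r(e)$ for $v\in E^0_{\mathrm{reg}}$, $e,f\in s^{-1}(v)$; where in (iii),(iv) $e_i$ and $e_i^*$ are set to be zero whenever $i>w(e)$. If $(E,w)$ is finite, $L_{\mathsf{k}}(E,w)$ is unital with identity $\sum_{v\in E^0}v$. An idempotent $\epsilon$ of a unital ring $R$ is full if $R\epsilon R=R$ (the two-sided ideal generated by $\epsilon$ is $R$). Hair extension: let $(E,w)$ be a finite weighted graph with $E^0=\{v_1,\dots,v_t\}$ and let $n_1,\dots,n_t$ be positive integers. The hair extension $(E^+(n_1,\dots,n_t),w^+)$ of $(E,w)$ is obtained from $(E,w)$ by adding, for each $i$, new vertices $v_i^1,\dots,v_i^{n_i-1}$ and new edges $e_i^1,\dots,e_i^{n_i-1}$, with $s(e_i^j)=v_i^j$ and $r(e_i^j)=v_i^{j-1}$, where $v_i^0:=v_i$ (nothing is added at $v_i$ if $n_i=1$); $w^+$ extends $w$ with $w^+(e_i^j)=1$ for all $1\le i\le t$, $1\le j\le n_i-1$. A hair extension of $(E,w)$ is any such weighted graph, for some choice of positive integers $n_1,\dots,n_t$. $\mathbb{M}_n(R)$ denotes the ring of $n\times n$ matrices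 over $R$. *)

theory Defs
  imports "Graph_Theory.Digraph" "HOL-Algebra.QuotRing" "HOL-Algebra.Module"
begin

section \<open>Weighted graphs\<close>

text \<open>
  A graph is a \<^typ>\<open>('v, 'e) pre_digraph\<close> satisfying \<^locale>\<open>wf_digraph\<close>; the source and range
  maps are \<^const>\<open>tail\<close> and \<^const>\<open>head\<close>, and \<^term>\<open>out_arcs E v\<close> is the set of edges emitted by \<open>v\<close>.
\<close>

locale weighted_graph = wf_digraph E for E :: "('v, 'e) pre_digraph" +
  fixes w :: "'e \<Rightarrow> nat"
  assumes weight_pos: "e \<in> arcs E \<Longrightarrow> 0 < w e"

locale finite_weighted_graph = weighted_graph E w + fin_digraph E
  for E :: "('v, 'e) pre_digraph" and w :: "'e \<Rightarrow> nat"

locale row_finite_weighted_graph = weighted_graph E w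
  for E :: "('v, 'e) pre_digraph" and w :: "'e \<Rightarrow> nat" +
  assumes row_finite: "v \<in> verts E \<Longrightarrow> finite (out_arcs E v)"

definition regular_verts :: "('v, 'e) pre_digraph \<Rightarrow> 'v set" where
  "regular_verts E = {v \<in> verts E. out_arcs E v \<noteq> {} \<and> finite (out_arcs E v)}"

definition vertex_weight :: "('v, 'e) pre_digraph \<Rightarrow> ('e \<Rightarrow> nat) \<Rightarrow> 'v \<Rightarrow> nat" where
  "vertex_weight E w v = Max (w ` out_arcs E v)"

locale vertex_weighted_graph = row_finite_weighted_graph E w
  for E :: "('v, 'e) pre_digraph" and w :: "'e \<Rightarrow> nat" +
  assumes weight_const:
    "\<lbrakk>v \<in> regular_verts E; e \<in> out_arcs E v; e' \<in> out_arcs E v\<rbrakk> \<Longrightarrow> w e = w e'"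


section \<open>Algebras over a field\<close>

text \<open>
  A (not necessarily commutative) algebra over a field \<open>K\<close> is represented by a record of type
  \<^typ>\<open>('k, 'a) module\<close>, which carries both a ring structure and a scalar multiplication.
\<close>

definition alg_iso :: "('k, 'm) ring_scheme \<Rightarrow> ('k, 'a) module \<Rightarrow> ('k, 'b) module \<Rightarrow> bool" where
  "alg_iso K A B \<longleftrightarrow>
     (\<exists>\<phi> \<in> ring_iso A B. \<forall>c \<in> carrier K. \<forall>x \<in> carrier A. \<phi> (c \<odot>\<^bsub>A\<^esub> x) = c \<odot>\<^bsub>B\<^esub> \<phi> x)"

definition corner :: "('k, 'a) module \<Rightarrow> 'a \<Rightarrow> ('k, 'a) module" where
  "corner A p = A\<lparr>carrier := {p \<otimes>\<^bsub>A\<^esub> x \<otimes>\<^bsub>A\<^esub> p |x. x \<in> carrier A}, one := p\<rparr>"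

definition full_idempotent :: "('a, 'm) ring_scheme \<Rightarrow> 'a \<Rightarrow> bool" where
  "full_idempotent R p \<longleftrightarrow>
     p \<in> carrier R \<and> p \<otimes>\<^bsub>R\<^esub> p = p \<and> Idl\<^bsub>R\<^esub> {p} = carrier R"

definition mat_alg :: "nat \<Rightarrow> ('k, 'a) module \<Rightarrow> ('k, nat \<times> nat \<Rightarrow> 'a) module" where
  "mat_alg n A =
    (let J = {..<n} \<times> {..<n} in
     \<lparr>carrier = J \<rightarrow>\<^sub>E carrier A,
      mult = (\<lambda>M N. \<lambda>(i, j)\<in>J. \<Oplus>\<^bsub>A\<^esub>k\<in>{..<n}. M (i, k) \<otimes>\<^bsub>A\<^esub> N (k, j)),
      one = (\<lambda>(i, j)\<in>J. if i = j then \<one>\<^bsub>A\<^esub> else \<zero>\<^bsub>A\<^esub>),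
      zero = (\<lambda>ij\<in>J. \<zero>\<^bsub>A\<^esub>),
      add = (\<lambda>M N. \<lambda>ij\<in>J. M ij \<oplus>\<^bsub>A\<^esub> N ij),
      smult = (\<lambda>c M. \<lambda>ij\<in>J. c \<odot>\<^bsub>A\<^esub> M ij)\<rparr>)"


section \<open>Free algebras\<close>

text \<open>
  The free unital algebra on \<open>X\<close>: finitely supported \<open>K\<close>-valued functions on the words over \<open>X\<close>,
  multiplied by convolution with respect to concatenation of words.
\<close>

definition conv ::
  "('k, 'm) ring_scheme \<Rightarrow> ('g list \<Rightarrow> 'k) \<Rightarrow> ('g list \<Rightarrow> 'k) \<Rightarrow> ('g list \<Rightarrow> 'k)" where
  "conv K f g = (\<lambda>x. \<Oplus>\<^bsub>K\<^esub>i\<in>{..length x}. f (take i x) \<otimes>\<^bsub>K\<^esub> g (drop i x))"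

definition word :: "('k, 'm) ring_scheme \<Rightarrow> 'g list \<Rightarrow> ('g list \<Rightarrow> 'k)" where
  "word K x = (\<lambda>y. if y = x then \<one>\<^bsub>K\<^esub> else \<zero>\<^bsub>K\<^esub>)"

definition free_alg :: "('k, 'm) ring_scheme \<Rightarrow> 'g set \<Rightarrow> ('k, 'g list \<Rightarrow> 'k) module" where
  "free_alg K X =
     \<lparr>carrier = {f. (\<forall>x. f x \<in> carrier K) \<and> finite {x. f x \<noteq> \<zero>\<^bsub>K\<^esub>}
                   \<and> {x. f x \<noteq> \<zero>\<^bsub>K\<^esub>} \<subseteq> lists X},
      mult = conv K,
      one = word K [],
      zero = (\<lambda>x. \<zero>\<^bsub>K\<^esub>),
      add = (\<lambda>f g x. f x \<oplus>\<^bsub>K\<^esub> g x),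
      smult = (\<lambda>c f x. c \<otimes>\<^bsub>K\<^esub> f x)\<rparr>"

text \<open>The underlying set of the free non-unital algebra on \<open>X\<close>.\<close>

definition aug :: "('k, 'm) ring_scheme \<Rightarrow> 'g set \<Rightarrow> ('g list \<Rightarrow> 'k) set" where
  "aug K X = {f \<in> carrier (free_alg K X). f [] = \<zero>\<^bsub>K\<^esub>}"


section \<open>Weighted Leavitt path algebras\<close>

text \<open>\<open>Edge e i\<close> and \<open>Ghost e i\<close> stand for $e_i$ and $e_i^*$; the index $i$ starts at 1.\<close>

datatype ('v, 'e) gen = Vert 'v | Edge 'e nat | Ghost 'e nat

definition gens :: "('v, 'e) pre_digraph \<Rightarrow> ('e \<Rightarrow> nat) \<Rightarrow> ('v, 'e) gen set" where
  "gens E w = Vert ` verts E \<union> {Edge e i |e i. e \<in> arcs E \<and> 1 \<le> i \<and> i \<le> w e}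
     \<union> {Ghost e i |e i. e \<in> arcs E \<and> 1 \<le> i \<and> i \<le> w e}"

definition gvert :: "('k, 'm) ring_scheme \<Rightarrow> 'v \<Rightarrow> (('v, 'e) gen list \<Rightarrow> 'k)" where
  "gvert K v = word K [Vert v]"

definition gedge :: "('k, 'm) ring_scheme \<Rightarrow> ('e \<Rightarrow> nat) \<Rightarrow> 'e \<Rightarrow> nat \<Rightarrow> (('v, 'e) gen list \<Rightarrow> 'k)" where
  "gedge K w e i = (if i \<le> w e then word K [Edge e i] else (\<lambda>x. \<zero>\<^bsub>K\<^esub>))"

definition gghost :: "('k, 'm) ring_scheme \<Rightarrow> ('e \<Rightarrow> nat) \<Rightarrow> 'e \<Rightarrow> nat \<Rightarrow> (('v, 'e) gen list \<Rightarrow> 'k)" where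
  "gghost K w e i = (if i \<le> w e then word K [Ghost e i] else (\<lambda>x. \<zero>\<^bsub>K\<^esub>))"

text \<open>A relation \<open>l = r\<close> is represented by the element \<open>l - r\<close> of the free algebra.\<close>

definition wlpa_rels ::
  "('k, 'm) ring_scheme \<Rightarrow> ('v, 'e) pre_digraph \<Rightarrow> ('e \<Rightarrow> nat) \<Rightarrow> (('v, 'e) gen list \<Rightarrow> 'k) set" where
  "wlpa_rels K E w =
    (let F = free_alg K (gens E w);
         V = gvert K; A = gedge K w; B = gghost K w in
     {V u \<otimes>\<^bsub>F\<^esub> V v \<ominus>\<^bsub>F\<^esub> (if u = v then V u else \<zero>\<^bsub>F\<^esub>) |u v. u \<in> verts E \<and> v \<in> verts E}
   \<union> {V (tail E e) \<otimes>\<^bsub>F\<^esub> A e i \<ominus>\<^bsub>F\<^esub> A e i |e i. e \<in> arcs E \<and> 1 \<le> i \<and> i \<le> w e}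
   \<union> {A e i \<otimes>\<^bsub>F\<^esub> V (head E e) \<ominus>\<^bsub>F\<^esub> A e i |e i. e \<in> arcs E \<and> 1 \<le> i \<and> i \<le> w e}
   \<union> {V (head E e) \<otimes>\<^bsub>F\<^esub> B e i \<ominus>\<^bsub>F\<^esub> B e i |e i. e \<in> arcs E \<and> 1 \<le> i \<and> i \<le> w e}
   \<union> {B e i \<otimes>\<^bsub>F\<^esub> V (tail E e) \<ominus>\<^bsub>F\<^esub> B e i |e i. e \<in> arcs E \<and> 1 \<le> i \<and> i \<le> w e}
   \<union> {(\<Oplus>\<^bsub>F\<^esub>e\<in>out_arcs E v. A e i \<otimes>\<^bsub>F\<^esub> B e j) \<ominus>\<^bsub>F\<^esub> (if i = j then V v else \<zero>\<^bsub>F\<^esub>) |v i j.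
        v \<in> regular_verts E \<and> 1 \<le> i \<and> i \<le> vertex_weight E w v
        \<and> 1 \<le> j \<and> j \<le> vertex_weight E w v}
   \<union> {(\<Oplus>\<^bsub>F\<^esub>i\<in>{1..vertex_weight E w v}. B e i \<otimes>\<^bsub>F\<^esub> A f i)
        \<ominus>\<^bsub>F\<^esub> (if e = f then V (head E e) else \<zero>\<^bsub>F\<^esub>) |v e f.
        v \<in> regular_verts E \<and> e \<in> out_arcs E v \<and> f \<in> out_arcs E v})"

definition wlpa_ideal ::
  "('k, 'm) ring_scheme \<Rightarrow> ('v, 'e) pre_digraph \<Rightarrow> ('e \<Rightarrow> nat) \<Rightarrow> (('v, 'e) gen list \<Rightarrow> 'k) set" where
  "wlpa_ideal K E w = Idl\<^bsub>free_alg K (gens E w)\<^esub> (wlpa_rels K E w)"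

text \<open>
  The presentation is one of non-unital algebras: the empty word is not identified with the sum of
  the vertices. Accordingly the carrier consists only of the cosets of elements of \<^const>\<open>aug\<close>. All
  relations lie in \<^const>\<open>aug\<close>, so the ideal they generate in the free unital algebra coincides with
  the one they generate in the free non-unital algebra (ring ideals of a unital algebra are closed
  under scalar multiplication). The \<open>one\<close> field is
  meaningful only if the graph is finite.
\<close>

definition wlpa ::
  "('k, 'm) ring_scheme \<Rightarrow> ('v, 'e) pre_digraph \<Rightarrow> ('e \<Rightarrow> nat)
    \<Rightarrow> ('k, (('v, 'e) gen list \<Rightarrow> 'k) set) module" where
  "wlpa K E w =
    (let F = free_alg K (gens E w); I = wlpa_ideal K E w; Q = F Quot I in
     \<lparr>carrier = (+>\<^bsub>F\<^esub>) I ` aug K (gens E w),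
      mult = mult Q,
      one = I +>\<^bsub>F\<^esub> (\<Oplus>\<^bsub>F\<^esub>v\<in>verts E. gvert K v),
      zero = zero Q,
      add = add Q,
      smult = (\<lambda>c U. \<Union>f\<in>U. I +>\<^bsub>F\<^esub> (c \<odot>\<^bsub>F\<^esub> f))\<rparr>)"


section \<open>Hair extensions\<close>

text \<open>
  The pair \<open>(v, j)\<close> is the vertex $v^j$, where $v^0 = v$; the edge \<open>Inr (v, j)\<close> goes from $v^j$ to
  $v^{j-1}$.
\<close>

definition hair_graph ::
  "('v, 'e) pre_digraph \<Rightarrow> ('v \<Rightarrow> nat) \<Rightarrow> ('v \<times> nat, 'e + 'v \<times> nat) pre_digraph" where
  "hair_graph E h =
     \<lparr>verts = {(v, j) |v j. v \<in> verts E \<and> j \<le> h v - 1},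
      arcs = Inl ` arcs E \<union> Inr ` {(v, j) |v j. v \<in> verts E \<and> 1 \<le> j \<and> j \<le> h v - 1},
      tail = case_sum (\<lambda>e. (tail E e, 0)) (\<lambda>(v, j). (v, j)),
      head = case_sum (\<lambda>e. (head E e, 0)) (\<lambda>(v, j). (v, j - 1))\<rparr>"

definition hair_weight :: "('e \<Rightarrow> nat) \<Rightarrow> ('e + 'v \<times> nat \<Rightarrow> nat)" where
  "hair_weight w = case_sum w (\<lambda>_. 1)"

definition hair_extension ::
  "('v, 'e) pre_digraph \<Rightarrow> ('e \<Rightarrow> nat)
    \<Rightarrow> ('v \<times> nat, 'e + 'v \<times> nat) pre_digraph \<Rightarrow> ('e + 'v \<times> nat \<Rightarrow> nat) \<Rightarrow> bool" where
  "hair_extension E w E' w' \<longleftrightarrow>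
     (\<exists>h. (\<forall>v \<in> verts E. 0 < h v) \<and> E' = hair_graph E h \<and> w' = hair_weight w)"

end

(* For a vertex weighted graph the two Cuntz-Krieger type relations are symmetric: at a regular
   vertex t the matrix (e_i), with rows indexed by 1, ..., w(t) and columns by the edges emitted
   by t, is inverted by the matrix (e_i^* ). Hence L acts on the span of normal words, which
   filters L by alternately adjoining letters of the two matrices, and the only relations between
   these letters are the forced ones. A right L-module with such a filtration is a direct sum of
   modules vL with v a vertex: in each step the elements not coming from the previous ones
   contribute new generators. Applied to the image of an idempotent matrix e over L, this gives
   e = f g with g f the diagonal matrix of vertices.
   If 1 = sum_i a_i epsilon b_i with i < n, then the n-fold sum of epsilon L is the sum of L and the
   image of the idempotent matrix (delta_ij epsilon - epsilon b_i a_j epsilon), hence is the sum of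
   modules vL in which every vertex v occurs at least once. The multiplicities are the numbers n_v
   of a hair extension; its vertices (v, j) index matrices x, y over L with x y = epsilon times the
   identity and y x = diag(v). Each hair from v^j to v is a partial isometry, so x and y together
   with the hairs identify the algebra of the hair extension with the matrices over epsilon L
   epsilon, provided that L embeds into it; this holds because the hair extension is represented
   by matrices over L, with the hair edges acting as matrix units. *)

theory Submission
  imports Defs
begin

section \<open>Finite sums\<close>

text \<open>An idempotent matrix over L need not respect the filtration, so degrees of its entries
  say nothing about its image. The axioms of \<open>filtered_module\<close> are therefore chosen to
  survive passage to a submodule of L^m: strictness only asserts that certain elements lie in an
  earlier piece, which can be tested entrywise. So it has to be checked for L alone. There it is a
  statement about coefficients of words, and for these to make sense the normal words must be
  linearly independent. This is not derived by rewriting inside L; L is made to act on the space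
  freely spanned by the normal words, and the action is compared with multiplication in L. Degrees
  count steps rather than letters: one side of letters is reserved for even steps, the other for odd
  steps, so the products formed at step n contain no word of degree n, and once degree n+1 cancels
  they drop to n-1. This gap of two drives the proof that the generators found step by step admit no
  relations. Weights that are constant at each vertex enter because both matrix relations then
  involve honest generators only, with none set to zero.\<close>

context abelian_monoid
begin

lemma finsum_swap:
  assumes "finite A" "finite B" "\<And>a b. a \<in> A \<Longrightarrow> b \<in> B \<Longrightarrow> f a b \<in> carrier G"
  shows "(\<Oplus>a\<in>A. \<Oplus>b\<in>B. f a b) = (\<Oplus>b\<in>B. \<Oplus>a\<in>A. f a b)"
  using assms(1,3)
proof (induction A rule: finite_induct)
  case empty
  then show ?case by simp
next
  case (insert x F)
  have "(\<Oplus>a\<in>insert x F. \<Oplus>b\<in>B. f a b) = (\<Oplus>b\<in>B. f x b) \<oplus> (\<Oplus>b\<in>B. \<Oplus>a\<in>F. f a b)"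
    using insert by (subst finsum_insert) (auto intro!: finsum_closed)
  also have "\<dots> = (\<Oplus>b\<in>B. f x b \<oplus> (\<Oplus>a\<in>F. f a b))"
    using insert by (subst finsum_addf) (auto intro!: finsum_closed)
  also have "\<dots> = (\<Oplus>b\<in>B. \<Oplus>a\<in>insert x F. f a b)"
    using insert by (intro finsum_cong) (auto intro!: finsum_closed simp: finsum_insert)
  finally show ?case .
qed

lemma finsum_mono_neutral:
  assumes "finite B" "A \<subseteq> B" "\<And>i. i \<in> B - A \<Longrightarrow> f i = \<zero>" "\<And>i. i \<in> A \<Longrightarrow> f i \<in> carrier G"
  shows "finsum G f A = finsum G f B"
proof (rule add.finprod_mono_neutral_cong_left)
  show "f \<in> B \<rightarrow> carrier G"
  proof
    fix i assume "i \<in> B"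
    then show "f i \<in> carrier G" by (cases "i \<in> A") (use assms(3,4) in auto)
  qed
qed (use assms in auto)

lemma finsum_delta:
  assumes "finite A" "j \<in> A \<Longrightarrow> f j \<in> carrier G"
  shows "(\<Oplus>i\<in>A. if i = j then f i else \<zero>) = (if j \<in> A then f j else \<zero>)"
proof (cases "j \<in> A")
  case True
  have "(\<Oplus>i\<in>{j}. if i = j then f i else \<zero>) = (\<Oplus>i\<in>A. if i = j then f i else \<zero>)"
    using assms True by (intro finsum_mono_neutral) auto
  then show ?thesis using True assms by (simp add: finsum_insert)
next
  case False
  have "(\<Oplus>i\<in>A. if i = j then f i else \<zero>) = (\<Oplus>i\<in>A. \<zero>)"
    using False by (intro finsum_cong') auto
  then show ?thesis using False by (simp add: finsum_zero)
qed

lemma finsum_delta':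
  assumes "finite A" "j \<in> A \<Longrightarrow> f j \<in> carrier G"
  shows "(\<Oplus>i\<in>A. if j = i then f i else \<zero>) = (if j \<in> A then f j else \<zero>)"
  using finsum_delta[of A j f] assms by (simp add: eq_commute)

lemma finsum_single:
  assumes "finite A" "j \<in> A" "f j \<in> carrier G" "\<And>i. i \<in> A \<Longrightarrow> i \<noteq> j \<Longrightarrow> f i = \<zero>"
  shows "finsum G f A = f j"
  using finsum_mono_neutral[of A "{j}" f] assms by (auto simp: finsum_insert)

lemma finsum_zeroI: "(\<And>i. i \<in> A \<Longrightarrow> f i = \<zero>) \<Longrightarrow> finsum G f A = \<zero>"
  by (rule add.finprod_one_eqI)

end

text \<open>The index set may be infinite: such a sum has the value \<open>\<zero>\<close> by
  convention, and \<open>\<zero> \<in> S\<close> covers it.\<close>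

lemma (in abelian_monoid) finsum_mem:
  assumes "\<And>i. i \<in> A \<Longrightarrow> f i \<in> S" "\<zero> \<in> S" "\<And>x y. x \<in> S \<Longrightarrow> y \<in> S \<Longrightarrow> x \<oplus> y \<in> S" "S \<subseteq> carrier G"
  shows "finsum G f A \<in> S"
  using assms(1)
proof (induction A rule: infinite_finite_induct)
  case (insert x F)
  then have "finsum G f (insert x F) = f x \<oplus> finsum G f F"
    using assms(4) by (intro finsum_insert) auto
  then show ?case using insert assms(3) by auto
qed (use assms(2) in \<open>auto simp: finsum_infinite\<close>)

lemma (in abelian_group) minus_eq_zero_iff:
  assumes "x \<in> carrier G" "y \<in> carrier G"
  shows "x \<ominus> y = \<zero> \<longleftrightarrow> x = y"
proof
  assume "x \<ominus> y = \<zero>"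
  then have "x \<ominus> y \<oplus> y = y" using assms by simp
  then show "x = y" using assms by (simp add: a_minus_def a_assoc l_neg)
qed (use assms in \<open>simp add: a_minus_def r_neg\<close>)

lemma (in abelian_monoid) finsum_addI:
  assumes "\<And>i. i \<in> A \<Longrightarrow> f i \<in> carrier G" "\<And>i. i \<in> A \<Longrightarrow> g i \<in> carrier G"
    "\<And>i. i \<in> A \<Longrightarrow> h i = f i \<oplus> g i"
  shows "finsum G h A = finsum G f A \<oplus> finsum G g A"
proof -
  have "finsum G h A = (\<Oplus>i\<in>A. f i \<oplus> g i)" using assms by (intro finsum_cong') auto
  then show ?thesis using assms by (simp add: finsum_addf Pi_def)
qed

lemma additive_zero:
  assumes "abelian_group A" "abelian_group B" "h \<in> carrier A \<rightarrow> carrier B"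
    "\<And>x y. x \<in> carrier A \<Longrightarrow> y \<in> carrier A \<Longrightarrow> h (x \<oplus>\<^bsub>A\<^esub> y) = h x \<oplus>\<^bsub>B\<^esub> h y"
  shows "h \<zero>\<^bsub>A\<^esub> = \<zero>\<^bsub>B\<^esub>"
proof -
  interpret A: abelian_group A by fact
  interpret B: abelian_group B by fact
  have "h \<zero>\<^bsub>A\<^esub> \<oplus>\<^bsub>B\<^esub> h \<zero>\<^bsub>A\<^esub> = h \<zero>\<^bsub>A\<^esub>" using assms(4)[of "\<zero>\<^bsub>A\<^esub>" "\<zero>\<^bsub>A\<^esub>"] by simp
  moreover have "h \<zero>\<^bsub>A\<^esub> \<in> carrier B" using assms(3) by auto
  ultimately show ?thesis by (metis B.add.l_cancel_one)
qed

lemma additive_minus: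
  assumes "abelian_group A" "abelian_group B" "h \<in> carrier A \<rightarrow> carrier B"
    "\<And>x y. x \<in> carrier A \<Longrightarrow> y \<in> carrier A \<Longrightarrow> h (x \<oplus>\<^bsub>A\<^esub> y) = h x \<oplus>\<^bsub>B\<^esub> h y" "x \<in> carrier A"
  shows "h (\<ominus>\<^bsub>A\<^esub> x) = \<ominus>\<^bsub>B\<^esub> h x"
proof -
  interpret A: abelian_group A by fact
  interpret B: abelian_group B by fact
  have "h (\<ominus>\<^bsub>A\<^esub> x) \<oplus>\<^bsub>B\<^esub> h x = \<zero>\<^bsub>B\<^esub>"
    using assms(4)[of "\<ominus>\<^bsub>A\<^esub> x" x] assms(5) additive_zero[OF assms(1-4)] A.l_neg by simp
  then show ?thesis using B.minus_equality assms(3,5) by (metis A.a_inv_closed Pi_mem)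
qed

text \<open>Stated for bare additive maps because it is applied to coordinate projections, to the
  action on a fixed vector and to non-unital homomorphisms, none of which is a unital ring
  homomorphism. Over an infinite index set both sides are zero.\<close>

lemma additive_finsum:
  assumes "abelian_group A" "abelian_group B" "h \<in> carrier A \<rightarrow> carrier B"
    "\<And>x y. x \<in> carrier A \<Longrightarrow> y \<in> carrier A \<Longrightarrow> h (x \<oplus>\<^bsub>A\<^esub> y) = h x \<oplus>\<^bsub>B\<^esub> h y"
    "\<And>i. i \<in> S \<Longrightarrow> f i \<in> carrier A"
  shows "h (finsum A f S) = finsum B (\<lambda>i. h (f i)) S"
proof -
  interpret A: abelian_group A by fact
  interpret B: abelian_group B by fact
  show ?thesis
    using assms(5)
  proof (induction S rule: infinite_finite_induct)
    case (insert x F)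
    have "h (finsum A f (insert x F)) = h (f x \<oplus>\<^bsub>A\<^esub> finsum A f F)"
      using insert by (subst A.finsum_insert) auto
    also have "\<dots> = h (f x) \<oplus>\<^bsub>B\<^esub> finsum B (\<lambda>i. h (f i)) F"
      using insert by (subst assms(4)) (auto intro!: A.finsum_closed)
    finally show ?case using insert assms(3) by (subst B.finsum_insert) auto
  qed (simp_all add: additive_zero[OF assms(1-4)])
qed


section \<open>Right modules and finitely supported functions\<close>

text \<open>In a right module \<open>a \<odot> z\<close> stands for $z \cdot a$.\<close>

locale rmodule = L?: ring L + M?: abelian_group M for L (structure) and M (structure) +
  assumes act_closed [simp, intro]: "\<lbrakk>a \<in> carrier L; z \<in> carrier M\<rbrakk> \<Longrightarrow> a \<odot>\<^bsub>M\<^esub> z \<in> carrier M"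
    and act_add_left: "\<lbrakk>a \<in> carrier L; b \<in> carrier L; z \<in> carrier M\<rbrakk>
      \<Longrightarrow> (a \<oplus> b) \<odot>\<^bsub>M\<^esub> z = a \<odot>\<^bsub>M\<^esub> z \<oplus>\<^bsub>M\<^esub> b \<odot>\<^bsub>M\<^esub> z"
    and act_add_right: "\<lbrakk>a \<in> carrier L; z \<in> carrier M; z' \<in> carrier M\<rbrakk>
      \<Longrightarrow> a \<odot>\<^bsub>M\<^esub> (z \<oplus>\<^bsub>M\<^esub> z') = a \<odot>\<^bsub>M\<^esub> z \<oplus>\<^bsub>M\<^esub> a \<odot>\<^bsub>M\<^esub> z'"
    and act_mult: "\<lbrakk>a \<in> carrier L; b \<in> carrier L; z \<in> carrier M\<rbrakk>
      \<Longrightarrow> (a \<otimes> b) \<odot>\<^bsub>M\<^esub> z = b \<odot>\<^bsub>M\<^esub> (a \<odot>\<^bsub>M\<^esub> z)"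
    and act_one [simp]: "z \<in> carrier M \<Longrightarrow> \<one> \<odot>\<^bsub>M\<^esub> z = z"
begin

lemma act_finsum_right:
  assumes "a \<in> carrier L" "\<And>i. i \<in> S \<Longrightarrow> f i \<in> carrier M"
  shows "a \<odot>\<^bsub>M\<^esub> (finsum M f S) = (\<Oplus>\<^bsub>M\<^esub>i\<in>S. a \<odot>\<^bsub>M\<^esub> f i)"
  using assms by (intro additive_finsum[of M M "\<lambda>z. a \<odot>\<^bsub>M\<^esub> z"]) (auto simp: act_add_right M.abelian_group_axioms)

lemma act_finsum_left:
  assumes "z \<in> carrier M" "\<And>i. i \<in> S \<Longrightarrow> f i \<in> carrier L"
  shows "(finsum L f S) \<odot>\<^bsub>M\<^esub> z = (\<Oplus>\<^bsub>M\<^esub>i\<in>S. f i \<odot>\<^bsub>M\<^esub> z)"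
  using assms by (intro additive_finsum[of L M "\<lambda>a. a \<odot>\<^bsub>M\<^esub> z"])
    (auto simp: act_add_left M.abelian_group_axioms L.abelian_group_axioms)

lemma act_zero_left [simp]: "z \<in> carrier M \<Longrightarrow> \<zero> \<odot>\<^bsub>M\<^esub> z = \<zero>\<^bsub>M\<^esub>"
  using act_finsum_left[of z "{}"] by simp

lemma act_zero_right [simp]: "a \<in> carrier L \<Longrightarrow> a \<odot>\<^bsub>M\<^esub> \<zero>\<^bsub>M\<^esub> = \<zero>\<^bsub>M\<^esub>"
  using act_finsum_right[of a "{}"] by simp

lemma act_minus_left: "\<lbrakk>a \<in> carrier L; z \<in> carrier M\<rbrakk> \<Longrightarrow> (\<ominus> a) \<odot>\<^bsub>M\<^esub> z = \<ominus>\<^bsub>M\<^esub> (a \<odot>\<^bsub>M\<^esub> z)"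
  by (intro additive_minus[of L M "\<lambda>a. a \<odot>\<^bsub>M\<^esub> z"])
    (auto simp: act_add_left M.abelian_group_axioms L.abelian_group_axioms)

end

text \<open>Over a commutative ring left and right modules agree. Hence \<open>lin\<close> and its
  lemmas, developed for right modules over L, also serve for vector spaces over K.\<close>

lemma module_imp_rmodule: "module K M \<Longrightarrow> rmodule K M"
proof -
  assume "module K M"
  then interpret module K M .
  show ?thesis
    by unfold_locales (auto simp: smult_l_distr smult_r_distr smult_assoc1[symmetric] R.m_comm)
qed

lemma (in rmodule) act_finsumI:
  assumes "\<And>i. i \<in> A \<Longrightarrow> f i \<in> carrier M" "a \<in> carrier L" "\<And>i. i \<in> A \<Longrightarrow> a \<odot>\<^bsub>M\<^esub> f i = h i"
  shows "a \<odot>\<^bsub>M\<^esub> finsum M f A = finsum M h A"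
proof -
  have "h i \<in> carrier M" if "i \<in> A" for i using assms that by (metis act_closed)
  then have "(\<Oplus>\<^bsub>M\<^esub>i\<in>A. a \<odot>\<^bsub>M\<^esub> f i) = finsum M h A" using assms by (intro M.finsum_cong') auto
  then show ?thesis using assms by (simp add: act_finsum_right)
qed

definition supp :: "('a, 'm) ring_scheme \<Rightarrow> ('j \<Rightarrow> 'a) \<Rightarrow> 'j set" where
  "supp L f = {j. f j \<noteq> \<zero>\<^bsub>L\<^esub>}"

text \<open>The direct sum of copies of L indexed by J. Elements are total functions vanishing
  outside J, so enlarging J only enlarges the carrier and one coefficient function can be read over
  several index sets. The ring fields are irrelevant; only the module part of the record is
  used.\<close>

definition fsupp :: "('a, 'm) ring_scheme \<Rightarrow> 'j set \<Rightarrow> ('a, 'j \<Rightarrow> 'a) module" where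
  "fsupp L J =
     \<lparr>carrier = {f. (\<forall>j. f j \<in> carrier L) \<and> finite (supp L f) \<and> supp L f \<subseteq> J},
      mult = undefined, one = undefined,
      zero = (\<lambda>_. \<zero>\<^bsub>L\<^esub>),
      add = (\<lambda>f g j. f j \<oplus>\<^bsub>L\<^esub> g j),
      smult = (\<lambda>a f j. f j \<otimes>\<^bsub>L\<^esub> a)\<rparr>"

definition single :: "('a, 'm) ring_scheme \<Rightarrow> 'j \<Rightarrow> 'a \<Rightarrow> 'j \<Rightarrow> 'a" where
  "single L j a = (\<lambda>i. if i = j then a else \<zero>\<^bsub>L\<^esub>)"

lemma fsupp_simps:
  "zero (fsupp L J) = (\<lambda>_. \<zero>\<^bsub>L\<^esub>)" "add (fsupp L J) = (\<lambda>f g j. f j \<oplus>\<^bsub>L\<^esub> g j)"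
  "smult (fsupp L J) = (\<lambda>a f j. f j \<otimes>\<^bsub>L\<^esub> a)"
  "f \<in> carrier (fsupp L J) \<longleftrightarrow> (\<forall>j. f j \<in> carrier L) \<and> finite (supp L f) \<and> supp L f \<subseteq> J"
  by (simp_all add: fsupp_def)

lemma fsupp_rmodule:
  assumes "ring L"
  shows "rmodule L (fsupp L J)"
proof -
  interpret ring L by fact
  let ?M = "fsupp L J"
  have add: "f \<oplus>\<^bsub>?M\<^esub> g \<in> carrier ?M" if "f \<in> carrier ?M" "g \<in> carrier ?M" for f g
  proof -
    have "supp L (\<lambda>j. f j \<oplus>\<^bsub>L\<^esub> g j) \<subseteq> supp L f \<union> supp L g"
      using that by (auto simp: supp_def fsupp_simps)
    then show ?thesis using that by (auto simp: fsupp_simps intro: finite_subset)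
  qed
  have neg: "(\<lambda>j. \<ominus>\<^bsub>L\<^esub> f j) \<in> carrier ?M" if "f \<in> carrier ?M" for f
  proof -
    have "supp L (\<lambda>j. \<ominus>\<^bsub>L\<^esub> f j) \<subseteq> supp L f"
      using that by (auto simp: supp_def fsupp_simps)
    then show ?thesis using that by (auto simp: fsupp_simps intro: finite_subset)
  qed
  have ag: "abelian_group ?M"
  proof (rule abelian_groupI)
    show "\<exists>y\<in>carrier ?M. y \<oplus>\<^bsub>?M\<^esub> x = \<zero>\<^bsub>?M\<^esub>" if "x \<in> carrier ?M" for x
      using neg[OF that] that by (intro bexI[of _ "\<lambda>j. \<ominus>\<^bsub>L\<^esub> x j"]) (auto simp: fsupp_simps l_neg)
  qed (use add in \<open>auto simp: fsupp_simps(1,2,4) supp_def a_assoc a_comm a_lcomm\<close>)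
  have act: "a \<odot>\<^bsub>?M\<^esub> f \<in> carrier ?M" if "a \<in> carrier L" "f \<in> carrier ?M" for a f
  proof -
    have "supp L (\<lambda>j. f j \<otimes>\<^bsub>L\<^esub> a) \<subseteq> supp L f"
      using that by (auto simp: supp_def fsupp_simps)
    then show ?thesis using that by (auto simp: fsupp_simps intro: finite_subset)
  qed
  interpret abelian_group ?M by fact
  show ?thesis
    by unfold_locales (use act in \<open>auto simp: fsupp_simps l_distr r_distr m_assoc\<close>)
qed

lemma (in ring) single_closed: "a \<in> carrier R \<Longrightarrow> j \<in> J \<Longrightarrow> single R j a \<in> carrier (fsupp R J)"
  by (auto simp: fsupp_simps single_def supp_def intro: finite_subset[of _ "{j}"])

lemma fsupp_finsum_apply:
  assumes "ring L" "\<And>i. i \<in> S \<Longrightarrow> f i \<in> carrier (fsupp L J)"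
  shows "finsum (fsupp L J) f S j = (\<Oplus>\<^bsub>L\<^esub>i\<in>S. f i j)"
proof -
  interpret ring L by fact
  interpret M: rmodule L "fsupp L J" by (rule fsupp_rmodule) fact
  show ?thesis
    using assms(2) by (intro additive_finsum[of "fsupp L J" L "\<lambda>f. f j"])
      (auto simp: M.abelian_group_axioms abelian_group_axioms fsupp_simps)
qed

lemma fsupp_minus_apply:
  assumes "ring L" "f \<in> carrier (fsupp L J)"
  shows "(\<ominus>\<^bsub>fsupp L J\<^esub> f) j = \<ominus>\<^bsub>L\<^esub> f j"
proof -
  interpret ring L by fact
  interpret M: rmodule L "fsupp L J" by (rule fsupp_rmodule) fact
  show ?thesis
    using assms(2) by (intro additive_minus[of "fsupp L J" L "\<lambda>f. f j"])
      (auto simp: M.abelian_group_axioms abelian_group_axioms fsupp_simps)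
qed

lemma fsupp_expand:
  assumes "ring L" "f \<in> carrier (fsupp L J)"
  shows "f = (\<Oplus>\<^bsub>fsupp L J\<^esub>j\<in>supp L f. single L j (f j))"
proof
  fix i
  interpret ring L by fact
  have c: "j \<in> supp L f \<Longrightarrow> single L j (f j) \<in> carrier (fsupp L J)" for j
    using assms(2) by (intro single_closed) (auto simp: fsupp_simps)
  have fin: "finite (supp L f)" using assms(2) by (simp add: fsupp_simps)
  have "(\<Oplus>\<^bsub>fsupp L J\<^esub>j\<in>supp L f. single L j (f j)) i = (\<Oplus>\<^bsub>L\<^esub>j\<in>supp L f. if i = j then f j else \<zero>\<^bsub>L\<^esub>)"
    using c by (subst fsupp_finsum_apply[OF assms(1)]) (auto simp: single_def)
  also have "\<dots> = f i" using fin assms(2) by (subst finsum_delta') (auto simp: fsupp_simps supp_def)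
  finally show "f i = (\<Oplus>\<^bsub>fsupp L J\<^esub>j\<in>supp L f. single L j (f j)) i" by simp
qed

lemma fsupp_induct [consumes 2, case_names zero single add]:
  assumes "ring L" "f \<in> carrier (fsupp L J)"
    and "P (\<lambda>_. \<zero>\<^bsub>L\<^esub>)"
    and "\<And>j a. j \<in> J \<Longrightarrow> a \<in> carrier L \<Longrightarrow> P (single L j a)"
    and "\<And>g h. g \<in> carrier (fsupp L J) \<Longrightarrow> h \<in> carrier (fsupp L J) \<Longrightarrow> P g \<Longrightarrow> P h
      \<Longrightarrow> P (\<lambda>j. g j \<oplus>\<^bsub>L\<^esub> h j)"
  shows "P f"
proof -
  interpret ring L by fact
  interpret M: rmodule L "fsupp L J" by (rule fsupp_rmodule) fact
  have "(\<Oplus>\<^bsub>fsupp L J\<^esub>j\<in>supp L f. single L j (f j)) \<in> {g \<in> carrier (fsupp L J). P g}"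
  proof (rule M.finsum_mem)
    show "single L j (f j) \<in> {g \<in> carrier (fsupp L J). P g}" if "j \<in> supp L f" for j
      using that assms(2,4) single_closed[of "f j" j J] by (auto simp: fsupp_simps(4))
    show "\<zero>\<^bsub>fsupp L J\<^esub> \<in> {g \<in> carrier (fsupp L J). P g}"
      using assms(3) M.zero_closed by (simp add: fsupp_simps(1))
    show "x \<oplus>\<^bsub>fsupp L J\<^esub> y \<in> {g \<in> carrier (fsupp L J). P g}"
      if "x \<in> {g \<in> carrier (fsupp L J). P g}" "y \<in> {g \<in> carrier (fsupp L J). P g}" for x y
      using that M.a_closed[of x y] assms(5)[of x y] by (simp add: fsupp_simps(2))
  qed auto
  then show ?thesis using fsupp_expand[OF assms(1,2)] by auto
qed

context rmodule
begin

text \<open>The linear extension of g to the direct sum. Summing over the support of f, not over the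
  index set, keeps the sum finite and independent of J.\<close>

definition lin :: "('j \<Rightarrow> 'c) \<Rightarrow> ('j \<Rightarrow> 'a) \<Rightarrow> 'c" where
  "lin g f = (\<Oplus>\<^bsub>M\<^esub>j\<in>supp L f. f j \<odot>\<^bsub>M\<^esub> g j)"

lemma lin_superset:
  assumes "g \<in> J \<rightarrow> carrier M" "f \<in> carrier (fsupp L J)" "supp L f \<subseteq> S" "S \<subseteq> J" "finite S"
  shows "lin g f = (\<Oplus>\<^bsub>M\<^esub>j\<in>S. f j \<odot>\<^bsub>M\<^esub> g j)"
  unfolding lin_def using assms
  by (intro M.finsum_mono_neutral) (auto simp: supp_def fsupp_simps Pi_def intro!: act_zero_left)

lemma lin_closed:
  assumes "g \<in> J \<rightarrow> carrier M" "f \<in> carrier (fsupp L J)"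
  shows "lin g f \<in> carrier M"
  unfolding lin_def using assms by (intro M.finsum_closed) (auto simp: fsupp_simps)

lemma lin_add:
  assumes "g \<in> J \<rightarrow> carrier M" "f \<in> carrier (fsupp L J)" "f' \<in> carrier (fsupp L J)"
  shows "lin g (\<lambda>j. f j \<oplus> f' j) = lin g f \<oplus>\<^bsub>M\<^esub> lin g f'"
proof -
  interpret F: rmodule L "fsupp L J" by (rule fsupp_rmodule) (rule L.ring_axioms)
  let ?S = "supp L f \<union> supp L f'"
  have s: "supp L (\<lambda>j. f j \<oplus> f' j) \<subseteq> ?S" using assms by (auto simp: supp_def fsupp_simps)
  have S: "?S \<subseteq> J" "finite ?S" using assms by (auto simp: fsupp_simps)
  have c: "(\<lambda>j. f j \<oplus> f' j) \<in> carrier (fsupp L J)"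
    using F.a_closed[OF assms(2,3)] by (simp add: fsupp_simps(2))
  have "lin g (\<lambda>j. f j \<oplus> f' j) = (\<Oplus>\<^bsub>M\<^esub>j\<in>?S. (f j \<oplus> f' j) \<odot>\<^bsub>M\<^esub> g j)"
    by (rule lin_superset[OF assms(1) c s S])
  also have "\<dots> = (\<Oplus>\<^bsub>M\<^esub>j\<in>?S. f j \<odot>\<^bsub>M\<^esub> g j \<oplus>\<^bsub>M\<^esub> f' j \<odot>\<^bsub>M\<^esub> g j)"
    using assms S by (intro M.finsum_cong) (auto simp: fsupp_simps act_add_left Pi_def simp_implies_def)
  also have "\<dots> = (\<Oplus>\<^bsub>M\<^esub>j\<in>?S. f j \<odot>\<^bsub>M\<^esub> g j) \<oplus>\<^bsub>M\<^esub> (\<Oplus>\<^bsub>M\<^esub>j\<in>?S. f' j \<odot>\<^bsub>M\<^esub> g j)"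
    using assms S by (intro M.finsum_addf) (auto simp: fsupp_simps Pi_iff subset_iff)
  also have "\<dots> = lin g f \<oplus>\<^bsub>M\<^esub> lin g f'"
    using lin_superset[OF assms(1,2) _ S] lin_superset[OF assms(1,3) _ S] by simp
  finally show ?thesis .
qed

lemma lin_zero: "lin g (\<lambda>_. \<zero>) = \<zero>\<^bsub>M\<^esub>"
  by (simp add: lin_def supp_def)

lemma lin_act:
  assumes "g \<in> J \<rightarrow> carrier M" "f \<in> carrier (fsupp L J)" "a \<in> carrier L"
  shows "lin g (\<lambda>j. f j \<otimes> a) = a \<odot>\<^bsub>M\<^esub> lin g f"
proof -
  interpret F: rmodule L "fsupp L J" by (rule fsupp_rmodule) (rule L.ring_axioms)
  have s: "supp L (\<lambda>j. f j \<otimes> a) \<subseteq> supp L f" using assms by (auto simp: supp_def fsupp_simps)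
  have S: "supp L f \<subseteq> J" "finite (supp L f)" using assms by (auto simp: fsupp_simps)
  have c: "(\<lambda>j. f j \<otimes> a) \<in> carrier (fsupp L J)"
    using F.act_closed[OF assms(3,2)] by (simp add: fsupp_simps(3))
  have "lin g (\<lambda>j. f j \<otimes> a) = (\<Oplus>\<^bsub>M\<^esub>j\<in>supp L f. (f j \<otimes> a) \<odot>\<^bsub>M\<^esub> g j)"
    by (rule lin_superset[OF assms(1) c s S])
  also have "\<dots> = (\<Oplus>\<^bsub>M\<^esub>j\<in>supp L f. a \<odot>\<^bsub>M\<^esub> (f j \<odot>\<^bsub>M\<^esub> g j))"
    using assms S by (intro M.finsum_cong) (auto simp: fsupp_simps act_mult Pi_def simp_implies_def)
  also have "\<dots> = a \<odot>\<^bsub>M\<^esub> lin g f"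
    unfolding lin_def using assms S by (intro act_finsum_right[symmetric]) (auto simp: fsupp_simps)
  finally show ?thesis .
qed

lemma lin_single:
  assumes "g j \<in> carrier M" "a \<in> carrier L"
  shows "lin g (single L j a) = a \<odot>\<^bsub>M\<^esub> g j"
proof (cases "a = \<zero>")
  case True
  then have "single L j a = (\<lambda>_. \<zero>)" by (auto simp: single_def)
  then show ?thesis using True assms by (simp add: lin_zero)
next
  case False
  then have "supp L (single L j a) = {j}" by (auto simp: single_def supp_def)
  then show ?thesis using assms by (simp add: lin_def single_def M.finsum_insert)
qed

end

section \<open>Algebras and their evaluation maps\<close>

locale algebra_over = module K B + B?: ring B for K (structure) and B (structure) +
  assumes smult_mult_left: "\<lbrakk>c \<in> carrier K; x \<in> carrier B; y \<in> carrier B\<rbrakk>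
      \<Longrightarrow> (c \<odot>\<^bsub>B\<^esub> x) \<otimes>\<^bsub>B\<^esub> y = c \<odot>\<^bsub>B\<^esub> (x \<otimes>\<^bsub>B\<^esub> y)"
    and smult_mult_right: "\<lbrakk>c \<in> carrier K; x \<in> carrier B; y \<in> carrier B\<rbrakk>
      \<Longrightarrow> x \<otimes>\<^bsub>B\<^esub> (c \<odot>\<^bsub>B\<^esub> y) = c \<odot>\<^bsub>B\<^esub> (x \<otimes>\<^bsub>B\<^esub> y)"

definition alg_hom ::
  "('k, 'm) ring_scheme \<Rightarrow> ('k, 'a) module \<Rightarrow> ('k, 'b) module \<Rightarrow> ('a \<Rightarrow> 'b) \<Rightarrow> bool" where
  "alg_hom K A B \<Phi> \<longleftrightarrow> \<Phi> \<in> carrier A \<rightarrow> carrier B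
     \<and> (\<forall>x\<in>carrier A. \<forall>y\<in>carrier A. \<Phi> (x \<oplus>\<^bsub>A\<^esub> y) = \<Phi> x \<oplus>\<^bsub>B\<^esub> \<Phi> y)
     \<and> (\<forall>x\<in>carrier A. \<forall>y\<in>carrier A. \<Phi> (x \<otimes>\<^bsub>A\<^esub> y) = \<Phi> x \<otimes>\<^bsub>B\<^esub> \<Phi> y)
     \<and> (\<forall>c\<in>carrier K. \<forall>x\<in>carrier A. \<Phi> (c \<odot>\<^bsub>A\<^esub> x) = c \<odot>\<^bsub>B\<^esub> \<Phi> x)"

lemma alg_homD:
  assumes "alg_hom K A B \<Phi>"
  shows "\<And>x. x \<in> carrier A \<Longrightarrow> \<Phi> x \<in> carrier B"
    "\<And>x y. \<lbrakk>x \<in> carrier A; y \<in> carrier A\<rbrakk> \<Longrightarrow> \<Phi> (x \<oplus>\<^bsub>A\<^esub> y) = \<Phi> x \<oplus>\<^bsub>B\<^esub> \<Phi> y"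
    "\<And>x y. \<lbrakk>x \<in> carrier A; y \<in> carrier A\<rbrakk> \<Longrightarrow> \<Phi> (x \<otimes>\<^bsub>A\<^esub> y) = \<Phi> x \<otimes>\<^bsub>B\<^esub> \<Phi> y"
    "\<And>c x. \<lbrakk>c \<in> carrier K; x \<in> carrier A\<rbrakk> \<Longrightarrow> \<Phi> (c \<odot>\<^bsub>A\<^esub> x) = c \<odot>\<^bsub>B\<^esub> \<Phi> x"
  using assms by (auto simp: alg_hom_def)

text \<open>The opposite endomorphism algebra: a product applies its left factor first.
  Homomorphisms into it are thus right actions, in agreement with words that are extended at their
  right end. Maps are extensional, so that equality may be tested on the carrier.\<close>

definition endo_alg :: "('k, 'm) ring_scheme \<Rightarrow> ('k, 'b) module \<Rightarrow> ('k, 'b \<Rightarrow> 'b) module" where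
  "endo_alg K M =
     \<lparr>carrier = {\<phi> \<in> carrier M \<rightarrow>\<^sub>E carrier M.
        (\<forall>x\<in>carrier M. \<forall>y\<in>carrier M. \<phi> (x \<oplus>\<^bsub>M\<^esub> y) = \<phi> x \<oplus>\<^bsub>M\<^esub> \<phi> y) \<and>
        (\<forall>c\<in>carrier K. \<forall>x\<in>carrier M. \<phi> (c \<odot>\<^bsub>M\<^esub> x) = c \<odot>\<^bsub>M\<^esub> \<phi> x)},
      mult = (\<lambda>\<phi> \<psi>. \<lambda>x\<in>carrier M. \<psi> (\<phi> x)),
      one = (\<lambda>x\<in>carrier M. x),
      zero = (\<lambda>x\<in>carrier M. \<zero>\<^bsub>M\<^esub>),
      add = (\<lambda>\<phi> \<psi>. \<lambda>x\<in>carrier M. \<phi> x \<oplus>\<^bsub>M\<^esub> \<psi> x),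
      smult = (\<lambda>c \<phi>. \<lambda>x\<in>carrier M. c \<odot>\<^bsub>M\<^esub> \<phi> x)\<rparr>"

lemma endo_algI:
  assumes "\<And>x. x \<in> carrier M \<Longrightarrow> f x \<in> carrier M"
    "\<And>x y. \<lbrakk>x \<in> carrier M; y \<in> carrier M\<rbrakk> \<Longrightarrow> f (x \<oplus>\<^bsub>M\<^esub> y) = f x \<oplus>\<^bsub>M\<^esub> f y"
    "\<And>c x. \<lbrakk>c \<in> carrier K; x \<in> carrier M\<rbrakk> \<Longrightarrow> f (c \<odot>\<^bsub>M\<^esub> x) = c \<odot>\<^bsub>M\<^esub> f x"
    "module K M"
  shows "(\<lambda>x\<in>carrier M. f x) \<in> carrier (endo_alg K M)"
proof -
  interpret module K M by fact
  show ?thesis using assms(1-3) by (auto simp: endo_alg_def)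
qed

lemma endo_alg_simps:
  "x \<in> carrier M \<Longrightarrow> (\<phi> \<otimes>\<^bsub>endo_alg K M\<^esub> \<psi>) x = \<psi> (\<phi> x)"
  "x \<in> carrier M \<Longrightarrow> \<one>\<^bsub>endo_alg K M\<^esub> x = x"
  "x \<in> carrier M \<Longrightarrow> \<zero>\<^bsub>endo_alg K M\<^esub> x = \<zero>\<^bsub>M\<^esub>"
  "x \<in> carrier M \<Longrightarrow> (\<phi> \<oplus>\<^bsub>endo_alg K M\<^esub> \<psi>) x = \<phi> x \<oplus>\<^bsub>M\<^esub> \<psi> x"
  "x \<in> carrier M \<Longrightarrow> (c \<odot>\<^bsub>endo_alg K M\<^esub> \<phi>) x = c \<odot>\<^bsub>M\<^esub> \<phi> x"
  by (simp_all add: endo_alg_def)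

lemma endo_algD:
  assumes "\<phi> \<in> carrier (endo_alg K M)"
  shows "\<And>x. x \<in> carrier M \<Longrightarrow> \<phi> x \<in> carrier M"
    "\<And>x y. \<lbrakk>x \<in> carrier M; y \<in> carrier M\<rbrakk> \<Longrightarrow> \<phi> (x \<oplus>\<^bsub>M\<^esub> y) = \<phi> x \<oplus>\<^bsub>M\<^esub> \<phi> y"
    "\<And>c x. \<lbrakk>c \<in> carrier K; x \<in> carrier M\<rbrakk> \<Longrightarrow> \<phi> (c \<odot>\<^bsub>M\<^esub> x) = c \<odot>\<^bsub>M\<^esub> \<phi> x"
  using assms by (auto simp: endo_alg_def)

lemma endo_alg_eqI:
  assumes "\<phi> \<in> carrier (endo_alg K M)" "\<psi> \<in> carrier (endo_alg K M)"
    "\<And>x. x \<in> carrier M \<Longrightarrow> \<phi> x = \<psi> x"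
  shows "\<phi> = \<psi>"
  using assms by (auto simp: endo_alg_def intro: PiE_ext)

lemma endo_algebra_over:
  assumes "module K M"
  shows "algebra_over K (endo_alg K M)"
proof -
  interpret module K M by fact
  let ?B = "endo_alg K M"
  have mult: "\<phi> \<otimes>\<^bsub>?B\<^esub> \<psi> \<in> carrier ?B" if "\<phi> \<in> carrier ?B" "\<psi> \<in> carrier ?B" for \<phi> \<psi>
  proof -
    have "(\<lambda>x\<in>carrier M. \<psi> (\<phi> x)) \<in> carrier ?B"
      by (rule endo_algI) (use endo_algD[OF that(1)] endo_algD[OF that(2)] assms in auto)
    then show ?thesis by (simp add: endo_alg_def)
  qed
  have one: "\<one>\<^bsub>?B\<^esub> \<in> carrier ?B" by (auto simp: endo_alg_def)
  have zero: "\<zero>\<^bsub>?B\<^esub> \<in> carrier ?B"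
    by (auto simp: endo_alg_def intro: rmodule.act_zero_right[OF module_imp_rmodule[OF assms], symmetric])
  have add: "\<phi> \<oplus>\<^bsub>?B\<^esub> \<psi> \<in> carrier ?B" if "\<phi> \<in> carrier ?B" "\<psi> \<in> carrier ?B" for \<phi> \<psi>
  proof -
    have "(\<lambda>x\<in>carrier M. \<phi> x \<oplus>\<^bsub>M\<^esub> \<psi> x) \<in> carrier ?B"
      by (rule endo_algI) (use endo_algD[OF that(1)] endo_algD[OF that(2)] assms in \<open>auto simp: M.a_ac smult_r_distr\<close>)
    then show ?thesis by (simp add: endo_alg_def)
  qed
  have smult: "c \<odot>\<^bsub>?B\<^esub> \<phi> \<in> carrier ?B" if "c \<in> carrier K" "\<phi> \<in> carrier ?B" for c \<phi>
  proof -
    have "(\<lambda>x\<in>carrier M. c \<odot>\<^bsub>M\<^esub> \<phi> x) \<in> carrier ?B"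
      by (rule endo_algI) (use endo_algD[OF that(2)] that(1) assms in
        \<open>auto simp: smult_r_distr smult_assoc1[symmetric] R.m_comm\<close>)
    then show ?thesis by (simp add: endo_alg_def)
  qed
  note closed = mult one zero add smult
  note D = endo_algD[of _ K M]
  have ab: "abelian_group ?B"
  proof (rule abelian_groupI)
    fix \<phi> assume p: "\<phi> \<in> carrier ?B"
    have "(\<lambda>x\<in>carrier M. \<ominus>\<^bsub>M\<^esub> \<phi> x) \<in> carrier ?B"
      by (rule endo_algI) (use D[OF p] assms in \<open>auto simp: M.minus_add smult_r_minus\<close>)
    then show "\<exists>y\<in>carrier ?B. y \<oplus>\<^bsub>?B\<^esub> \<phi> = \<zero>\<^bsub>?B\<^esub>"
      by (rule bexI[rotated], intro endo_alg_eqI[where K = K and M = M] closed p)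
        (use D[OF p] in \<open>auto simp: endo_alg_simps M.l_neg\<close>)
  qed (use D closed in \<open>auto intro!: endo_alg_eqI[where K = K and M = M] simp: endo_alg_simps M.a_ac\<close>)
  have mon: "monoid ?B"
    by (rule monoidI)
      (use D closed in \<open>auto intro!: endo_alg_eqI[where K = K and M = M] simp: endo_alg_simps\<close>)
  interpret B: abelian_group ?B by fact
  interpret B: ring ?B
    by (rule ringI[OF ab mon])
      (use D closed in \<open>auto intro!: endo_alg_eqI[where K = K and M = M] simp: endo_alg_simps\<close>)
  show ?thesis
    by unfold_locales
      (use D closed in \<open>auto intro!: endo_alg_eqI[where K = K and M = M]
        simp: endo_alg_simps smult_l_distr smult_r_distr smult_assoc1\<close>)
qed

lemma endo_alg_finsum_apply:
  assumes "module K M" "\<And>i. i \<in> S \<Longrightarrow> f i \<in> carrier (endo_alg K M)" "x \<in> carrier M"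
  shows "finsum (endo_alg K M) f S x = (\<Oplus>\<^bsub>M\<^esub>i\<in>S. f i x)"
proof -
  interpret module K M by fact
  interpret E: algebra_over K "endo_alg K M" by (rule endo_algebra_over) fact
  show ?thesis
    by (rule additive_finsum[of "endo_alg K M" M "\<lambda>f. f x"])
      (use assms(2,3) endo_algD[of _ K M] in \<open>auto simp: endo_alg_simps E.M.abelian_group_axioms M.abelian_group_axioms\<close>)
qed

section \<open>The free algebra\<close>

lemma (in cring) conv_Nil:
  assumes "\<And>x. f x \<in> carrier R" "\<And>x. g x \<in> carrier R"
  shows "conv R f g [] = f [] \<otimes> g []"
  using assms by (simp add: conv_def finsum_0)

text \<open>The factorisations of a nonempty word split into the one with empty left factor and
  those whose left factor starts with the first letter. This recursion makes associativity an
  induction on the word instead of a reindexing of double sums.\<close>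

lemma (in cring) conv_Cons:
  assumes "\<And>x. f x \<in> carrier R" "\<And>x. g x \<in> carrier R"
  shows "conv R f g (a # x) = f [] \<otimes> g (a # x) \<oplus> conv R (\<lambda>y. f (a # y)) g x"
proof -
  have "conv R f g (a # x) = (\<Oplus>i\<in>{..Suc (length x)}. f (take i (a # x)) \<otimes> g (drop i (a # x)))"
    by (simp add: conv_def)
  also have "\<dots> = (\<Oplus>i\<in>{..length x}. f (a # take i x) \<otimes> g (drop i x)) \<oplus> f [] \<otimes> g (a # x)"
    using assms by (subst finsum_Suc2) auto
  finally show ?thesis using assms by (simp add: conv_def a_comm)
qed

lemma (in cring) conv_closed:
  assumes "\<And>x. f x \<in> carrier R" "\<And>x. g x \<in> carrier R"
  shows "conv R f g x \<in> carrier R"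
  using assms unfolding conv_def by (auto intro!: finsum_closed)

lemma (in cring) conv_add_left:
  assumes "\<And>x. f x \<in> carrier R" "\<And>x. f' x \<in> carrier R" "\<And>x. g x \<in> carrier R"
  shows "conv R (\<lambda>x. f x \<oplus> f' x) g x = conv R f g x \<oplus> conv R f' g x"
  using assms unfolding conv_def by (simp add: l_distr finsum_addf Pi_def)

lemma (in cring) conv_add_right:
  assumes "\<And>x. f x \<in> carrier R" "\<And>x. g' x \<in> carrier R" "\<And>x. g x \<in> carrier R"
  shows "conv R f (\<lambda>x. g x \<oplus> g' x) x = conv R f g x \<oplus> conv R f g' x"
  using assms unfolding conv_def by (simp add: r_distr finsum_addf Pi_def)

lemma (in cring) conv_smult_left:
  assumes "\<And>x. f x \<in> carrier R" "\<And>x. g x \<in> carrier R" "c \<in> carrier R"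
  shows "conv R (\<lambda>x. c \<otimes> f x) g x = c \<otimes> conv R f g x"
  using assms unfolding conv_def by (simp add: finsum_rdistr m_assoc Pi_def)

lemma (in cring) conv_smult_right:
  assumes "\<And>x. f x \<in> carrier R" "\<And>x. g x \<in> carrier R" "c \<in> carrier R"
  shows "conv R f (\<lambda>x. c \<otimes> g x) x = c \<otimes> conv R f g x"
  using assms unfolding conv_def by (simp add: finsum_rdistr m_lcomm Pi_def)

lemma (in cring) conv_assoc:
  assumes "\<And>x. f x \<in> carrier R" "\<And>x. g x \<in> carrier R" "\<And>x. h x \<in> carrier R"
  shows "conv R (conv R f g) h x = conv R f (conv R g h) x"
  using assms(1)
\<comment> \<open>The recursion replaces f by \<open>\<lambda>y. f (a # y)\<close>, hence the
  generalisation over f.\<close>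
proof (induction x arbitrary: f)
  case Nil
  then show ?case using assms by (simp add: conv_Nil conv_closed m_assoc)
next
  case (Cons a x)
  let ?fa = "\<lambda>y. f (a # y)" and ?ga = "\<lambda>y. g (a # y)"
  have cl: "\<And>x. conv R f g x \<in> carrier R" "\<And>x. conv R g h x \<in> carrier R" "\<And>x. conv R ?fa g x \<in> carrier R"
      "\<And>x. conv R ?ga h x \<in> carrier R" "\<And>x. conv R (conv R ?fa g) h x \<in> carrier R"
      "\<And>x. conv R ?fa (conv R g h) x \<in> carrier R"
    using Cons.prems assms(2,3) by (auto intro!: conv_closed)
  note c = Cons.prems assms(2,3) cl
  have "conv R (conv R f g) h (a # x)
      = (f [] \<otimes> g []) \<otimes> h (a # x) \<oplus> conv R (\<lambda>y. f [] \<otimes> ?ga y \<oplus> conv R ?fa g y) h x"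
    using c by (simp add: conv_Cons conv_Nil)
  also have "conv R (\<lambda>y. f [] \<otimes> ?ga y \<oplus> conv R ?fa g y) h x
      = f [] \<otimes> conv R ?ga h x \<oplus> conv R (conv R ?fa g) h x"
    using c by (simp add: conv_add_left conv_smult_left)
  also have "conv R (conv R ?fa g) h x = conv R ?fa (conv R g h) x"
    using Cons by simp
  finally show ?case
    using c by (simp add: conv_Cons r_distr m_assoc a_assoc)
qed

lemma (in cring) conv_zero_left:
  assumes "\<And>x. g x \<in> carrier R"
  shows "conv R (\<lambda>_. \<zero>) g x = \<zero>"
  using assms unfolding conv_def by (simp add: finsum_zero)

text \<open>The condition \<open>take (length y) z = y\<close> says that y is a prefix of z, and a
  word has at most one factorisation with left factor y.\<close>

lemma (in cring) conv_single_left: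
  assumes "c \<in> carrier R" "\<And>x. g x \<in> carrier R"
  shows "conv R (single R y c) g z = (if take (length y) z = y then c \<otimes> g (drop (length y) z) else \<zero>)"
proof (induction y arbitrary: z)
  case Nil
  have z: "(\<lambda>x. single R [] c (a # x)) = (\<lambda>_. \<zero>)" for a by (simp add: single_def)
  show ?case
  proof (cases z)
    case Nil
    then show ?thesis using assms by (subst Nil, subst conv_Nil) (auto simp: single_def)
  next
    case (Cons a x)
    then show ?thesis using assms
      by (simp add: conv_Cons[of "single R [] c"] z conv_zero_left) (auto simp: single_def conv_Cons conv_zero_left)
  qed
next
  case (Cons b y)
  show ?case
  proof (cases z)
    case Nil
    then show ?thesis using assms by (subst Nil, subst conv_Nil) (auto simp: single_def)
  next
    case z: (Cons a x)
    have "(\<lambda>u. single R (b # y) c (a # u)) = (if a = b then single R y c else (\<lambda>_. \<zero>))"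
      by (auto simp: single_def)
    moreover have "single R (b # y) c [] = \<zero>" by (simp add: single_def)
    moreover have "conv R (single R (b # y) c) g (a # x)
        = single R (b # y) c [] \<otimes> g (a # x) \<oplus> conv R (\<lambda>u. single R (b # y) c (a # u)) g x"
      using assms by (intro conv_Cons) (auto simp: single_def)
    ultimately show ?thesis using assms Cons.IH[of x] z
      by (auto simp: conv_zero_left)
  qed
qed

lemma (in cring) conv_single:
  assumes "c \<in> carrier R" "d \<in> carrier R"
  shows "conv R (single R x c) (single R y d) = single R (x @ y) (c \<otimes> d)"
proof
  fix z
  show "conv R (single R x c) (single R y d) z = single R (x @ y) (c \<otimes> d) z"
    using assms by (subst conv_single_left)
      (auto simp: single_def, (metis append_take_drop_id)+)
qed

context cring
begin

lemma free_alg_carrier: "carrier (free_alg R X) = carrier (fsupp R (lists X))"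
  by (auto simp: free_alg_def fsupp_def supp_def)

lemma free_alg_simps:
  "zero (free_alg R X) = (\<lambda>_. \<zero>)" "add (free_alg R X) = (\<lambda>f g x. f x \<oplus> g x)"
  "smult (free_alg R X) = (\<lambda>c f x. c \<otimes> f x)" "mult (free_alg R X) = conv R"
  "one (free_alg R X) = single R [] \<one>" "word R x = single R x \<one>"
  by (simp_all add: free_alg_def word_def single_def)

lemma fsupp_fun: "f \<in> carrier (fsupp R J) \<Longrightarrow> f x \<in> carrier R"
  by (simp add: fsupp_def)

lemma free_alg_algebra: "algebra_over R (free_alg R X)"
proof -
  interpret F: rmodule R "fsupp R (lists X)" by (rule fsupp_rmodule) (rule ring_axioms)
  let ?F = "free_alg R X"
  note fs = free_alg_carrier free_alg_simps
  have ab: "abelian_group ?F"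
  proof (rule abelian_groupI)
    show "\<exists>y\<in>carrier ?F. y \<oplus>\<^bsub>?F\<^esub> x = \<zero>\<^bsub>?F\<^esub>" if "x \<in> carrier ?F" for x
      using F.l_neg[of x] F.a_inv_closed[of x] that by (auto simp: fs fsupp_simps(1,2))
    show "x \<oplus>\<^bsub>?F\<^esub> y \<in> carrier ?F" if "x \<in> carrier ?F" "y \<in> carrier ?F" for x y
      using F.a_closed[of x y] that by (auto simp: fs fsupp_simps(1,2))
    show "\<zero>\<^bsub>?F\<^esub> \<in> carrier ?F" using F.zero_closed by (auto simp: fs fsupp_simps(1,2))
  qed (auto simp: fs fsupp_fun a_ac)
  have mult: "conv R f g \<in> carrier ?F" if "f \<in> carrier ?F" "g \<in> carrier ?F" for f g
  proof -
    have c: "\<And>x. f x \<in> carrier R" "\<And>x. g x \<in> carrier R" using that by (auto simp: fs fsupp_fun)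
    have "supp R (conv R f g) \<subseteq> (\<lambda>(x, y). x @ y) ` (supp R f \<times> supp R g)"
    proof
      fix z assume "z \<in> supp R (conv R f g)"
      then have "conv R f g z \<noteq> \<zero>" by (simp add: supp_def)
      then obtain i where "f (take i z) \<otimes> g (drop i z) \<noteq> \<zero>"
        unfolding conv_def using finsum_zeroI[of "{..length z}" "\<lambda>i. f (take i z) \<otimes> g (drop i z)"] by auto
      then have "f (take i z) \<noteq> \<zero>" "g (drop i z) \<noteq> \<zero>" using c l_null r_null by metis+
      then have "take i z \<in> supp R f" "drop i z \<in> supp R g" by (simp_all add: supp_def)
      then have "(take i z, drop i z) \<in> supp R f \<times> supp R g" by simp
      then show "z \<in> (\<lambda>(x, y). x @ y) ` (supp R f \<times> supp R g)"
        by (rule rev_image_eqI) simp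
    qed
    moreover have fin: "finite (supp R f \<times> supp R g)" and "supp R f \<subseteq> lists X" "supp R g \<subseteq> lists X"
      using that by (auto simp: fs fsupp_simps)
    then have "(\<lambda>(x, y). x @ y) ` (supp R f \<times> supp R g) \<subseteq> lists X" by fastforce
    ultimately have "finite (supp R (conv R f g))" "supp R (conv R f g) \<subseteq> lists X"
      using fin by (meson finite_imageI finite_subset, blast)
    then show ?thesis using conv_closed[of f g, OF c] by (simp add: fs fsupp_simps)
  qed
  have one: "single R [] \<one> \<in> carrier ?F"
    using single_closed[of \<one> "[]" "lists X"] by (simp add: fs)
  \<comment> \<open>\<open>conv_Cons\<close> consumes words from the left only, so the right unit
    law is not a direct instance of it; linearity reduces it to monomials.\<close>
  have r_one: "conv R f (single R [] \<one>) = f" if f: "f \<in> carrier ?F" for f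
  proof -
    have "ring R" by (rule ring_axioms)
    from this f[unfolded free_alg_carrier] show ?thesis
    proof (induction rule: fsupp_induct)
      case zero
      then show ?case by (auto simp: conv_zero_left single_def)
    next
      case (single j a)
      then show ?case by (simp add: conv_single)
    next
      case (add g h)
      have "conv R (\<lambda>j. g j \<oplus> h j) (single R [] \<one>) = (\<lambda>x. conv R g (single R [] \<one>) x \<oplus> conv R h (single R [] \<one>) x)"
        using add by (intro ext conv_add_left) (auto simp: fsupp_fun single_def)
      then show ?case using add by simp
    qed
  qed
  have mon: "monoid ?F"
    by (rule monoidI)
      (use mult one r_one in \<open>auto simp: fs fsupp_fun conv_assoc conv_single_left\<close>)
  have rg: "ring ?F"
    by (rule ringI[OF ab mon])
      (auto simp: fs fsupp_fun conv_add_left conv_add_right)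
  interpret R: ring ?F by fact
  have smult: "(\<lambda>x. a \<otimes> f x) \<in> carrier ?F" if "a \<in> carrier R" "f \<in> carrier ?F" for a f
    using F.act_closed[of a f] that by (simp add: fs fsupp_simps(3) fsupp_fun m_comm)
  show ?thesis
    by unfold_locales
      (use smult in \<open>auto simp: fs fsupp_fun l_distr r_distr m_assoc conv_smult_left conv_smult_right\<close>)
qed

end

section \<open>Evaluation of noncommutative polynomials in an algebra\<close>

context algebra_over
begin

lemma rmodule_self: "rmodule K B"
  by (rule module_imp_rmodule) (rule module_axioms)

definition word_val :: "('g \<Rightarrow> 'c) \<Rightarrow> 'g list \<Rightarrow> 'c" where
  "word_val \<psi> x = foldr (\<lambda>g a. \<psi> g \<otimes>\<^bsub>B\<^esub> a) x \<one>\<^bsub>B\<^esub>"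

lemma word_val_closed: "\<lbrakk>\<And>g. g \<in> X \<Longrightarrow> \<psi> g \<in> carrier B; x \<in> lists X\<rbrakk> \<Longrightarrow> word_val \<psi> x \<in> carrier B"
  by (induction x) (auto simp: word_val_def)

lemma word_val_append:
  assumes "\<And>g. g \<in> X \<Longrightarrow> \<psi> g \<in> carrier B" "x \<in> lists X" "y \<in> lists X"
  shows "word_val \<psi> (x @ y) = word_val \<psi> x \<otimes>\<^bsub>B\<^esub> word_val \<psi> y"
  using assms(2)
proof (induction x)
  case Nil
  then show ?case using word_val_closed[of X \<psi> y, OF assms(1,3)] by (simp add: word_val_def)
next
  case (Cons a x)
  then show ?case using word_val_closed[of X \<psi> x, OF assms(1)] word_val_closed[of X \<psi> y, OF assms(1,3)] assms(1)
    by (auto simp: word_val_def B.m_assoc)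
qed

definition ev :: "('g \<Rightarrow> 'c) \<Rightarrow> ('g list \<Rightarrow> 'a) \<Rightarrow> 'c" where
  "ev \<psi> f = rmodule.lin K B (word_val \<psi>) f"

context
  fixes X :: "'g set" and \<psi> :: "'g \<Rightarrow> 'c"
  assumes \<psi>: "\<And>g. g \<in> X \<Longrightarrow> \<psi> g \<in> carrier B"
begin

interpretation S: rmodule K B by (rule rmodule_self)
interpretation F: algebra_over K "free_alg K X" by (rule R.free_alg_algebra)

lemma word_val_fun: "word_val \<psi> \<in> lists X \<rightarrow> carrier B"
  using word_val_closed[of X \<psi>, OF \<psi>] by auto

lemma ev_closed: "f \<in> carrier (free_alg K X) \<Longrightarrow> ev \<psi> f \<in> carrier B"
  unfolding ev_def R.free_alg_carrier by (rule S.lin_closed[OF word_val_fun])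

lemma ev_add: "\<lbrakk>f \<in> carrier (free_alg K X); g \<in> carrier (free_alg K X)\<rbrakk>
  \<Longrightarrow> ev \<psi> (f \<oplus>\<^bsub>free_alg K X\<^esub> g) = ev \<psi> f \<oplus>\<^bsub>B\<^esub> ev \<psi> g"
  unfolding ev_def R.free_alg_carrier R.free_alg_simps by (rule S.lin_add[OF word_val_fun])

lemma ev_smult: "\<lbrakk>c \<in> carrier K; f \<in> carrier (free_alg K X)\<rbrakk>
  \<Longrightarrow> ev \<psi> (c \<odot>\<^bsub>free_alg K X\<^esub> f) = c \<odot>\<^bsub>B\<^esub> ev \<psi> f"
  unfolding ev_def R.free_alg_carrier R.free_alg_simps
  using S.lin_act[OF word_val_fun, of f c] by (simp add: R.fsupp_fun R.m_comm)

lemma ev_single: "\<lbrakk>x \<in> lists X; c \<in> carrier K\<rbrakk> \<Longrightarrow> ev \<psi> (single K x c) = c \<odot>\<^bsub>B\<^esub> word_val \<psi> x"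
  unfolding ev_def by (rule S.lin_single) (use word_val_fun in auto)

lemma ev_mult:
  assumes f: "f \<in> carrier (free_alg K X)" and g: "g \<in> carrier (free_alg K X)"
  shows "ev \<psi> (f \<otimes>\<^bsub>free_alg K X\<^esub> g) = ev \<psi> f \<otimes>\<^bsub>B\<^esub> ev \<psi> g"
proof -
  note fs = R.free_alg_carrier R.free_alg_simps
  have K: "ring K" by (rule R.ring_axioms)
  have z: "ev \<psi> (\<lambda>_. \<zero>) = \<zero>\<^bsub>B\<^esub>" by (simp add: ev_def S.lin_zero)
  have sc: "single K x c \<in> carrier (free_alg K X)" if "x \<in> lists X" "c \<in> carrier K" for x c
    using that by (simp add: fs R.single_closed)
  \<comment> \<open>Both sides are bilinear: the right factor is reduced to a monomial here, the
    left one afterwards.\<close>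
  have 1: "ev \<psi> (single K x c \<otimes>\<^bsub>free_alg K X\<^esub> g) = ev \<psi> (single K x c) \<otimes>\<^bsub>B\<^esub> ev \<psi> g"
    if x: "x \<in> lists X" "c \<in> carrier K" for x c
    using K g[unfolded R.free_alg_carrier]
  proof (induction rule: fsupp_induct)
    case zero
    have "single K x c \<otimes>\<^bsub>free_alg K X\<^esub> \<zero>\<^bsub>free_alg K X\<^esub> = \<zero>\<^bsub>free_alg K X\<^esub>"
      using sc[OF x] by simp
    then show ?case using ev_closed[OF sc[OF x]] z by (simp add: R.free_alg_simps(1))
  next
    case (single y d)
    then show ?case using x word_val_closed[of X \<psi> x, OF \<psi>] word_val_closed[of X \<psi> y, OF \<psi>]
      by (simp add: R.free_alg_simps(4) R.conv_single ev_single word_val_append[OF \<psi>]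
          smult_mult_left smult_mult_right smult_assoc1[symmetric] R.m_comm)
  next
    case (add g h)
    then have gh: "g \<in> carrier (free_alg K X)" "h \<in> carrier (free_alg K X)"
      by (simp_all add: R.free_alg_carrier)
    have "ev \<psi> (single K x c \<otimes>\<^bsub>free_alg K X\<^esub> (g \<oplus>\<^bsub>free_alg K X\<^esub> h)) = ev \<psi> (single K x c) \<otimes>\<^bsub>B\<^esub> ev \<psi> (g \<oplus>\<^bsub>free_alg K X\<^esub> h)"
      using gh sc[OF x] add(3,4)
      by (simp add: F.B.r_distr ev_add ev_closed B.r_distr)
    then show ?case by (simp add: R.free_alg_simps(2))
  qed
  show ?thesis
    using K f[unfolded R.free_alg_carrier]
  proof (induction rule: fsupp_induct)
    case zero
    have "\<zero>\<^bsub>free_alg K X\<^esub> \<otimes>\<^bsub>free_alg K X\<^esub> g = \<zero>\<^bsub>free_alg K X\<^esub>" using g by simp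
    then show ?case using ev_closed[OF g] z by (simp add: R.free_alg_simps(1))
  next
    case (single y d)
    then show ?case using 1 by simp
  next
    case (add f h)
    then have fh: "f \<in> carrier (free_alg K X)" "h \<in> carrier (free_alg K X)"
      by (simp_all add: R.free_alg_carrier)
    have "ev \<psi> ((f \<oplus>\<^bsub>free_alg K X\<^esub> h) \<otimes>\<^bsub>free_alg K X\<^esub> g) = ev \<psi> (f \<oplus>\<^bsub>free_alg K X\<^esub> h) \<otimes>\<^bsub>B\<^esub> ev \<psi> g"
      using fh g add(3,4) by (simp add: F.B.l_distr ev_add ev_closed B.l_distr)
    then show ?case by (simp add: R.free_alg_simps(2))
  qed
qed

lemma ev_word: "x \<in> lists X \<Longrightarrow> ev \<psi> (word K x) = word_val \<psi> x"
  using ev_single[of x \<one>] word_val_closed[of X \<psi> x, OF \<psi>] by (simp add: R.free_alg_simps(6))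

text \<open>A two-sided ideal that contains the relations contains the ideal generated by them; in
  this form the lemma lets evaluation descend to the quotient.\<close>

lemma ev_kernel_ideal: "ideal {f \<in> carrier (free_alg K X). ev \<psi> f = \<zero>\<^bsub>B\<^esub>} (free_alg K X)"
proof -
  have "ev \<psi> \<one>\<^bsub>free_alg K X\<^esub> = \<one>\<^bsub>B\<^esub>"
    using ev_single[of "[]" \<one>] by (simp add: R.free_alg_simps(5) word_val_def)
  then have "ring_hom_ring (free_alg K X) B (ev \<psi>)"
    by (intro ring_hom_ringI) (auto simp: F.B.ring_axioms B.ring_axioms ev_closed ev_add ev_mult)
  then show ?thesis
    using ring_hom_ring.kernel_is_ideal by (auto simp: a_kernel_def' )
qed

end

end

section \<open>The weighted Leavitt path algebra and its universal property\<close>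

text \<open>The defining relations read in an arbitrary ring. The convention that $e_i$ vanishes for
  i > w(e) does not appear, because for vertex weighted graphs \<open>vertex_weight E w v\<close> is
  the weight of every edge emitted by v.\<close>

definition wlpa_family ::
  "('v, 'e) pre_digraph \<Rightarrow> ('e \<Rightarrow> nat) \<Rightarrow> ('a, 'n) ring_scheme \<Rightarrow> (('v, 'e) gen \<Rightarrow> 'a) \<Rightarrow> bool" where
  "wlpa_family E w B \<psi> \<longleftrightarrow>
     (\<forall>g\<in>gens E w. \<psi> g \<in> carrier B) \<and>
     (\<forall>u\<in>verts E. \<forall>v\<in>verts E.
        \<psi> (Vert u) \<otimes>\<^bsub>B\<^esub> \<psi> (Vert v) = (if u = v then \<psi> (Vert u) else \<zero>\<^bsub>B\<^esub>)) \<and>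
     (\<forall>e\<in>arcs E. \<forall>i\<in>{1..w e}.
        \<psi> (Vert (tail E e)) \<otimes>\<^bsub>B\<^esub> \<psi> (Edge e i) = \<psi> (Edge e i)
      \<and> \<psi> (Edge e i) \<otimes>\<^bsub>B\<^esub> \<psi> (Vert (head E e)) = \<psi> (Edge e i)
      \<and> \<psi> (Vert (head E e)) \<otimes>\<^bsub>B\<^esub> \<psi> (Ghost e i) = \<psi> (Ghost e i)
      \<and> \<psi> (Ghost e i) \<otimes>\<^bsub>B\<^esub> \<psi> (Vert (tail E e)) = \<psi> (Ghost e i)) \<and>
     (\<forall>v\<in>regular_verts E. \<forall>i\<in>{1..vertex_weight E w v}. \<forall>j\<in>{1..vertex_weight E w v}.
        (\<Oplus>\<^bsub>B\<^esub>e\<in>out_arcs E v. \<psi> (Edge e i) \<otimes>\<^bsub>B\<^esub> \<psi> (Ghost e j))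
          = (if i = j then \<psi> (Vert v) else \<zero>\<^bsub>B\<^esub>)) \<and>
     (\<forall>v\<in>regular_verts E. \<forall>e\<in>out_arcs E v. \<forall>f\<in>out_arcs E v.
        (\<Oplus>\<^bsub>B\<^esub>i\<in>{1..vertex_weight E w v}. \<psi> (Ghost e i) \<otimes>\<^bsub>B\<^esub> \<psi> (Edge f i))
          = (if e = f then \<psi> (Vert (head E e)) else \<zero>\<^bsub>B\<^esub>))"

locale finite_vertex_weighted = K?: field K + finite_weighted_graph E w + vertex_weighted_graph E w
  for K :: "('k, 'm) ring_scheme" (structure) and E :: "('v, 'e) pre_digraph" and w :: "'e \<Rightarrow> nat"
begin

lemma out_arcs_weight:
  assumes "e \<in> out_arcs E v" "v \<in> verts E"
  shows "w e = vertex_weight E w v"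
proof -
  have fin: "finite (out_arcs E v)" using assms row_finite by blast
  then have "v \<in> regular_verts E" using assms by (auto simp: regular_verts_def)
  then have "w ` out_arcs E v = {w e}" using assms weight_const by blast
  then show ?thesis by (simp add: vertex_weight_def)
qed

lemma regular_vertsD:
  assumes "v \<in> regular_verts E"
  shows "v \<in> verts E" "finite (out_arcs E v)" "out_arcs E v \<noteq> {}"
    "\<And>e. e \<in> out_arcs E v \<Longrightarrow> w e = vertex_weight E w v \<and> e \<in> arcs E \<and> tail E e = v \<and> head E e \<in> verts E"
  using assms out_arcs_weight by (auto simp: regular_verts_def)

abbreviation "X \<equiv> gens E w"
abbreviation "reg \<equiv> regular_verts E"
abbreviation "wt \<equiv> vertex_weight E w"
abbreviation "F \<equiv> free_alg K X"
abbreviation "I \<equiv> wlpa_ideal K E w"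
abbreviation "L \<equiv> wlpa K E w"
abbreviation cl :: "(('v, 'e) gen list \<Rightarrow> 'k) \<Rightarrow> (('v, 'e) gen list \<Rightarrow> 'k) set" where
  "cl f \<equiv> I +>\<^bsub>F\<^esub> f"

abbreviation mult_L (infixl "\<cdot>" 70) where "a \<cdot> b \<equiv> a \<otimes>\<^bsub>L\<^esub> b"

lemma gens_iff [simp]:
  "Vert v \<in> X \<longleftrightarrow> v \<in> verts E" "Edge e i \<in> X \<longleftrightarrow> e \<in> arcs E \<and> i \<in> {1..w e}"
  "Ghost e i \<in> X \<longleftrightarrow> e \<in> arcs E \<and> i \<in> {1..w e}"
  by (auto simp: gens_def)

sublocale F: algebra_over K F by (rule K.free_alg_algebra)

lemma word_closed: "x \<in> lists X \<Longrightarrow> word K x \<in> carrier F"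
  unfolding K.free_alg_carrier K.free_alg_simps by (rule K.single_closed) auto

lemma word_mult: "word K x \<otimes>\<^bsub>F\<^esub> word K y = word K (x @ y)"
  unfolding K.free_alg_simps by (simp add: K.conv_single)

lemma zero_word: "(\<lambda>x. \<zero>) = \<zero>\<^bsub>F\<^esub>"
  by (simp add: K.free_alg_simps)

text \<open>Used in both directions: for the quotient map it shows that the generators of L satisfy
  the relations, and for an evaluation map it shows that the relation elements are killed.\<close>

lemma hom_rels_iff:
  assumes "ring_hom_ring F B h"
  shows "(\<forall>r\<in>wlpa_rels K E w. h r = \<zero>\<^bsub>B\<^esub>) \<longleftrightarrow> wlpa_family E w B (\<lambda>g. h (word K [g]))"
proof -
  interpret B: ring B using assms by (simp add: ring_hom_ring_def)
  interpret h: ring_hom_ring F B h by fact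
  let ?V = "\<lambda>v. word K [Vert v :: ('v, 'e) gen]" and ?A = "\<lambda>e i. word K [Edge e i :: ('v, 'e) gen]"
    and ?B = "\<lambda>e i. word K [Ghost e i :: ('v, 'e) gen]"
  have V: "?V v \<in> carrier F" if "v \<in> verts E" for v using that by (intro word_closed) auto
  have A: "?A e i \<in> carrier F" "?B e i \<in> carrier F" if "e \<in> arcs E" "i \<in> {1..w e}" for e i
    using that by (auto intro!: word_closed)
  have VV: "?V (tail E e) \<in> carrier F" "?V (head E e) \<in> carrier F" if "e \<in> arcs E" for e
    using that V by auto
  let ?z = "\<lambda>x y. h (x \<ominus>\<^bsub>F\<^esub> y) = \<zero>\<^bsub>B\<^esub>"
  have mz: "x \<ominus>\<^bsub>B\<^esub> y = \<zero>\<^bsub>B\<^esub> \<longleftrightarrow> x = y" if "x \<in> carrier B" "y \<in> carrier B" for x y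
    using that by (rule B.minus_eq_zero_iff)
  have hm: "h (x \<ominus>\<^bsub>F\<^esub> y) = \<zero>\<^bsub>B\<^esub> \<longleftrightarrow> h x = h y" if "x \<in> carrier F" "y \<in> carrier F" for x y
  proof -
    have "h (x \<ominus>\<^bsub>F\<^esub> y) = h x \<ominus>\<^bsub>B\<^esub> h y" using that by (simp add: a_minus_def h.hom_a_inv)
    then show ?thesis using that by (simp add: mz)
  qed
  have hs: "h (finsum F f S) = finsum B (\<lambda>i. h (f i)) S" if "\<And>i. i \<in> S \<Longrightarrow> f i \<in> carrier F" for f S
    by (rule additive_finsum[of F B h]) (auto simp: F.M.abelian_group_axioms B.abelian_group_axioms that)
  have 1: "?z (?V u \<otimes>\<^bsub>F\<^esub> ?V v) (if u = v then ?V u else \<zero>\<^bsub>F\<^esub>)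
      \<longleftrightarrow> h (?V u) \<otimes>\<^bsub>B\<^esub> h (?V v) = (if u = v then h (?V u) else \<zero>\<^bsub>B\<^esub>)"
    if "u \<in> verts E" "v \<in> verts E" for u v
    using that V by (subst hm) auto
  have 2: "?z (x \<otimes>\<^bsub>F\<^esub> y) z \<longleftrightarrow> h x \<otimes>\<^bsub>B\<^esub> h y = h z"
    if "x \<in> carrier F" "y \<in> carrier F" "z \<in> carrier F" for x y z
    using that by (subst hm) auto
  have 3: "?z (\<Oplus>\<^bsub>F\<^esub>e\<in>out_arcs E v. ?A e i \<otimes>\<^bsub>F\<^esub> ?B e j) (if i = j then ?V v else \<zero>\<^bsub>F\<^esub>)
      \<longleftrightarrow> (\<Oplus>\<^bsub>B\<^esub>e\<in>out_arcs E v. h (?A e i) \<otimes>\<^bsub>B\<^esub> h (?B e j)) = (if i = j then h (?V v) else \<zero>\<^bsub>B\<^esub>)"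
    if v: "v \<in> reg" and ij: "i \<in> {1..wt v}" "j \<in> {1..wt v}" for v i j
  proof -
    have c: "?A e i \<in> carrier F" "?B e j \<in> carrier F" if "e \<in> out_arcs E v" for e
      using A[of e] regular_vertsD(4)[OF v that] ij by auto
    have "h (\<Oplus>\<^bsub>F\<^esub>e\<in>out_arcs E v. ?A e i \<otimes>\<^bsub>F\<^esub> ?B e j) = (\<Oplus>\<^bsub>B\<^esub>e\<in>out_arcs E v. h (?A e i) \<otimes>\<^bsub>B\<^esub> h (?B e j))"
      using c by (subst hs) (auto intro!: B.finsum_cong')
    then show ?thesis using c V[OF regular_vertsD(1)[OF v]]
      by (subst hm) (auto intro!: F.M.finsum_closed)
  qed
  have 4: "?z (\<Oplus>\<^bsub>F\<^esub>i\<in>{1..wt v}. ?B e i \<otimes>\<^bsub>F\<^esub> ?A f i) (if e = f then ?V (head E e) else \<zero>\<^bsub>F\<^esub>)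
      \<longleftrightarrow> (\<Oplus>\<^bsub>B\<^esub>i\<in>{1..wt v}. h (?B e i) \<otimes>\<^bsub>B\<^esub> h (?A f i)) = (if e = f then h (?V (head E e)) else \<zero>\<^bsub>B\<^esub>)"
    if v: "v \<in> reg" and ef: "e \<in> out_arcs E v" "f \<in> out_arcs E v" for v e f
  proof -
    have c: "?B e i \<in> carrier F" "?A f i \<in> carrier F" if "i \<in> {1..wt v}" for i
      using A regular_vertsD(4)[OF v ef(1)] regular_vertsD(4)[OF v ef(2)] that by auto
    have "h (\<Oplus>\<^bsub>F\<^esub>i\<in>{1..wt v}. ?B e i \<otimes>\<^bsub>F\<^esub> ?A f i) = (\<Oplus>\<^bsub>B\<^esub>i\<in>{1..wt v}. h (?B e i) \<otimes>\<^bsub>B\<^esub> h (?A f i))"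
      using c by (subst hs) (auto intro!: B.finsum_cong')
    then show ?thesis using c V regular_vertsD(4)[OF v ef(1)]
      by (subst hm) (auto intro!: F.M.finsum_closed)
  qed
  have g: "\<forall>g\<in>X. h (word K [g]) \<in> carrier B" by (auto intro!: h.hom_closed word_closed)
  have ball2: "(\<forall>r\<in>{f e i |e i. P e i}. Q r) \<longleftrightarrow> (\<forall>e i. P e i \<longrightarrow> Q (f e i))"
    for f :: "'c \<Rightarrow> 'd \<Rightarrow> 'f" and P Q by blast
  have ball3: "(\<forall>r\<in>{f e i j |e i j. P e i j}. Q r) \<longleftrightarrow> (\<forall>e i j. P e i j \<longrightarrow> Q (f e i j))"
    for f :: "'c \<Rightarrow> 'd \<Rightarrow> 'g \<Rightarrow> 'f" and P Q by blast
  have G: "gedge K w e i = ?A e i" "gghost K w e i = ?B e i" if "i \<in> {1..w e}" for e i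
    using that by (simp_all add: gedge_def gghost_def)
  have all3: "(\<forall>x y z. x \<in> S \<and> y \<in> S1 x \<and> z \<in> S2 x \<longrightarrow> P x y z) \<longleftrightarrow> (\<forall>x\<in>S. \<forall>y\<in>S1 x. \<forall>z\<in>S2 x. P x y z)"
    for S :: "'x set" and S1 :: "'x \<Rightarrow> 'y set" and S2 :: "'x \<Rightarrow> 'z set" and P by blast
  have all2: "(\<forall>x y. x \<in> S \<and> y \<in> S1 x \<longrightarrow> P x y) \<longleftrightarrow> (\<forall>x\<in>S. \<forall>y\<in>S1 x. P x y)"
    for S :: "'x set" and S1 :: "'x \<Rightarrow> 'y set" and P by blast
  have all2': "(\<forall>e i. e \<in> arcs E \<and> 1 \<le> i \<and> i \<le> w e \<longrightarrow> P e i) \<longleftrightarrow> (\<forall>e\<in>arcs E. \<forall>i\<in>{1..w e}. P e i)"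
    for P by auto
  have D1: "(\<forall>u v. u \<in> verts E \<and> v \<in> verts E \<longrightarrow> ?z (?V u \<otimes>\<^bsub>F\<^esub> ?V v) (if u = v then ?V u else \<zero>\<^bsub>F\<^esub>))
    \<longleftrightarrow> (\<forall>u\<in>verts E. \<forall>v\<in>verts E. h (?V u) \<otimes>\<^bsub>B\<^esub> h (?V v) = (if u = v then h (?V u) else \<zero>\<^bsub>B\<^esub>))"
    unfolding all2 by (intro ball_cong refl 1)
  have all3': "(\<forall>v i j. v \<in> reg \<and> 1 \<le> i \<and> i \<le> wt v \<and> 1 \<le> j \<and> j \<le> wt v \<longrightarrow> P v i j)
    \<longleftrightarrow> (\<forall>v\<in>reg. \<forall>i\<in>{1..wt v}. \<forall>j\<in>{1..wt v}. P v i j)" for P by auto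
  let ?Q = "\<lambda>P. \<forall>e i. e \<in> arcs E \<and> 1 \<le> i \<and> i \<le> w e \<longrightarrow> P e i" and ?R = "\<lambda>P. \<forall>e\<in>arcs E. \<forall>i\<in>{1..w e}. P e i"
  have D2: "?Q (\<lambda>e i. ?z (a e i \<otimes>\<^bsub>F\<^esub> b e i) (c e i))
    \<longleftrightarrow> ?R (\<lambda>e i. h (a' e i) \<otimes>\<^bsub>B\<^esub> h (b' e i) = h (c' e i))"
    if "\<And>e i. e \<in> arcs E \<Longrightarrow> i \<in> {1..w e} \<Longrightarrow> a' e i \<in> carrier F"
      "\<And>e i. e \<in> arcs E \<Longrightarrow> i \<in> {1..w e} \<Longrightarrow> b' e i \<in> carrier F"
      "\<And>e i. e \<in> arcs E \<Longrightarrow> i \<in> {1..w e} \<Longrightarrow> c' e i \<in> carrier F"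
      "\<And>e i. i \<in> {1..w e} \<Longrightarrow> a e i = a' e i \<and> b e i = b' e i \<and> c e i = c' e i" for a b c a' b' c'
    unfolding all2'
  proof (intro ball_cong refl)
    fix e i assume "e \<in> arcs E" "i \<in> {1..w e}"
    then show "(?z (a e i \<otimes>\<^bsub>F\<^esub> b e i) (c e i)) \<longleftrightarrow> h (a' e i) \<otimes>\<^bsub>B\<^esub> h (b' e i) = h (c' e i)"
      using 2[OF that(1-3)] that(4) by metis
  qed
  have s1: "(\<Oplus>\<^bsub>F\<^esub>e\<in>out_arcs E v. gedge K w e i \<otimes>\<^bsub>F\<^esub> gghost K w e j)
      = (\<Oplus>\<^bsub>F\<^esub>e\<in>out_arcs E v. ?A e i \<otimes>\<^bsub>F\<^esub> ?B e j)"
    if "v \<in> reg" "i \<in> {1..wt v}" "j \<in> {1..wt v}" for v i j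
    using regular_vertsD(4)[OF that(1)] that(2,3)
    by (intro F.M.finsum_cong') (auto simp: G intro!: F.B.m_closed word_closed)
  have s2: "(\<Oplus>\<^bsub>F\<^esub>i\<in>{1..wt v}. gghost K w e i \<otimes>\<^bsub>F\<^esub> gedge K w f i)
      = (\<Oplus>\<^bsub>F\<^esub>i\<in>{1..wt v}. ?B e i \<otimes>\<^bsub>F\<^esub> ?A f i)"
    if "v \<in> reg" "e \<in> out_arcs E v" "f \<in> out_arcs E v" for v e f
    using regular_vertsD(4)[OF that(1)] that(2,3)
    by (intro F.M.finsum_cong') (auto simp: G intro!: F.B.m_closed word_closed)
  have D3: "(\<forall>v i j. v \<in> reg \<and> 1 \<le> i \<and> i \<le> wt v \<and> 1 \<le> j \<and> j \<le> wt v \<longrightarrow>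
      ?z (\<Oplus>\<^bsub>F\<^esub>e\<in>out_arcs E v. gedge K w e i \<otimes>\<^bsub>F\<^esub> gghost K w e j) (if i = j then ?V v else \<zero>\<^bsub>F\<^esub>))
    \<longleftrightarrow> (\<forall>v\<in>reg. \<forall>i\<in>{1..wt v}. \<forall>j\<in>{1..wt v}.
      (\<Oplus>\<^bsub>B\<^esub>e\<in>out_arcs E v. h (?A e i) \<otimes>\<^bsub>B\<^esub> h (?B e j)) = (if i = j then h (?V v) else \<zero>\<^bsub>B\<^esub>))"
    unfolding all3' by (intro ball_cong refl) (subst s1, assumption+, rule 3)
  have D4: "(\<forall>v e f. v \<in> reg \<and> e \<in> out_arcs E v \<and> f \<in> out_arcs E v \<longrightarrow>
      ?z (\<Oplus>\<^bsub>F\<^esub>i\<in>{1..wt v}. gghost K w e i \<otimes>\<^bsub>F\<^esub> gedge K w f i) (if e = f then ?V (head E e) else \<zero>\<^bsub>F\<^esub>))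
    \<longleftrightarrow> (\<forall>v\<in>reg. \<forall>e\<in>out_arcs E v. \<forall>f\<in>out_arcs E v.
      (\<Oplus>\<^bsub>B\<^esub>i\<in>{1..wt v}. h (?B e i) \<otimes>\<^bsub>B\<^esub> h (?A f i)) = (if e = f then h (?V (head E e)) else \<zero>\<^bsub>B\<^esub>))"
    unfolding all3 by (intro ball_cong refl) (subst s2, assumption+, rule 4)
  have T: "\<And>e i. e \<in> arcs E \<Longrightarrow> i \<in> {1..w e} \<Longrightarrow> ?V (tail E e) \<in> carrier F"
    "\<And>e i. e \<in> arcs E \<Longrightarrow> i \<in> {1..w e} \<Longrightarrow> ?V (head E e) \<in> carrier F"
    using VV by auto
  have E1: "?Q (\<lambda>e i. ?z (?V (tail E e) \<otimes>\<^bsub>F\<^esub> gedge K w e i) (gedge K w e i))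
    \<longleftrightarrow> ?R (\<lambda>e i. h (?V (tail E e)) \<otimes>\<^bsub>B\<^esub> h (?A e i) = h (?A e i))"
    by (rule D2) (use T A G in \<open>blast+\<close>)
  have E2: "?Q (\<lambda>e i. ?z (gedge K w e i \<otimes>\<^bsub>F\<^esub> ?V (head E e)) (gedge K w e i))
    \<longleftrightarrow> ?R (\<lambda>e i. h (?A e i) \<otimes>\<^bsub>B\<^esub> h (?V (head E e)) = h (?A e i))"
    by (rule D2) (use T A G in \<open>blast+\<close>)
  have E3: "?Q (\<lambda>e i. ?z (?V (head E e) \<otimes>\<^bsub>F\<^esub> gghost K w e i) (gghost K w e i))
    \<longleftrightarrow> ?R (\<lambda>e i. h (?V (head E e)) \<otimes>\<^bsub>B\<^esub> h (?B e i) = h (?B e i))"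
    by (rule D2) (use T A G in \<open>blast+\<close>)
  have E4: "?Q (\<lambda>e i. ?z (gghost K w e i \<otimes>\<^bsub>F\<^esub> ?V (tail E e)) (gghost K w e i))
    \<longleftrightarrow> ?R (\<lambda>e i. h (?B e i) \<otimes>\<^bsub>B\<^esub> h (?V (tail E e)) = h (?B e i))"
    by (rule D2) (use T A G in \<open>blast+\<close>)
  show ?thesis
    unfolding wlpa_rels_def Let_def gvert_def ball_Un ball2 ball3 D1 D3 D4 E1 E2 E3 E4 wlpa_family_def ball_conj_distrib
    using g by blast
qed

end

context finite_vertex_weighted
begin

text \<open>Dropping the empty word from the index set makes the induction principle for finitely
  supported functions available on the augmentation part.\<close>

lemma aug_fsupp: "aug K X = carrier (fsupp K (lists X - {[]}))"
proof -
  have "supp K f \<subseteq> lists X - {[]} \<longleftrightarrow> supp K f \<subseteq> lists X \<and> f [] = \<zero>" for f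
    unfolding subset_Diff_insert by (simp add: supp_def)
  then show ?thesis
    unfolding aug_def K.free_alg_carrier by (simp add: fsupp_simps set_eq_iff conj_assoc)
qed

lemma aug_carrier: "f \<in> aug K X \<Longrightarrow> f \<in> carrier F"
  by (simp add: aug_def)

lemma aug_add: "f \<in> aug K X \<Longrightarrow> g \<in> aug K X \<Longrightarrow> f \<oplus>\<^bsub>F\<^esub> g \<in> aug K X"
  using F.M.a_closed[of f g] by (simp add: aug_def K.free_alg_simps)

lemma aug_mult: "f \<in> aug K X \<Longrightarrow> g \<in> aug K X \<Longrightarrow> f \<otimes>\<^bsub>F\<^esub> g \<in> aug K X"
  using F.B.m_closed[of f g] K.conv_Nil[of f g] K.fsupp_fun[of f "lists X"] K.fsupp_fun[of g "lists X"]
  by (simp add: aug_def K.free_alg_simps K.free_alg_carrier)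

lemma aug_smult: "c \<in> carrier K \<Longrightarrow> f \<in> aug K X \<Longrightarrow> c \<odot>\<^bsub>F\<^esub> f \<in> aug K X"
  using F.smult_closed[of c f] by (simp add: aug_def K.free_alg_simps)

lemma aug_zero: "\<zero>\<^bsub>F\<^esub> \<in> aug K X"
  using F.M.zero_closed by (simp add: aug_def K.free_alg_simps)

lemma aug_word: "x \<in> lists X \<Longrightarrow> x \<noteq> [] \<Longrightarrow> word K x \<in> aug K X"
  using word_closed[of x] by (simp add: aug_def word_def)

lemma aug_neg: "f \<in> aug K X \<Longrightarrow> \<ominus>\<^bsub>F\<^esub> f \<in> aug K X"
proof -
  assume f: "f \<in> aug K X"
  have "\<ominus>\<^bsub>F\<^esub> f = (\<ominus> \<one>) \<odot>\<^bsub>F\<^esub> f" using aug_carrier[OF f] by (simp add: F.smult_l_minus)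
  then show ?thesis using aug_smult f by simp
qed

lemma aug_induct [consumes 1, case_names word add smult zero]:
  assumes "f \<in> aug K X"
    and "\<And>g x. g \<in> X \<Longrightarrow> x \<in> lists X \<Longrightarrow> P (word K (g # x))"
    and "\<And>f g. f \<in> aug K X \<Longrightarrow> g \<in> aug K X \<Longrightarrow> P f \<Longrightarrow> P g \<Longrightarrow> P (f \<oplus>\<^bsub>F\<^esub> g)"
    and "\<And>c f. c \<in> carrier K \<Longrightarrow> f \<in> aug K X \<Longrightarrow> P f \<Longrightarrow> P (c \<odot>\<^bsub>F\<^esub> f)"
    and "P \<zero>\<^bsub>F\<^esub>"
  shows "P f"
proof -
  have "ring K" by (rule K.ring_axioms)
  from this assms(1)[unfolded aug_fsupp] show ?thesis
  proof (induction rule: fsupp_induct)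
    case zero
    then show ?case using assms(5) by (simp add: K.free_alg_simps)
  next
    case (single j a)
    then obtain g x where j: "j = g # x" "g \<in> X" "x \<in> lists X" by (cases j) auto
    have "single K j a = a \<odot>\<^bsub>F\<^esub> word K j"
      using single by (auto simp: K.free_alg_simps single_def)
    then show ?case using assms(4)[of a "word K j"] assms(2)[of g x] aug_word[of j] j single by auto
  next
    case (add g h)
    then show ?case using assms(3)[of g h] by (simp add: aug_fsupp K.free_alg_simps)
  qed
qed

lemma wlpa_rels_closed: "wlpa_rels K E w \<subseteq> carrier F"
proof -
  have V: "gvert K v \<in> carrier F" if "v \<in> verts E" for v
    using that unfolding gvert_def by (intro word_closed) auto
  have A: "gedge K w e i \<in> carrier F" "gghost K w e i \<in> carrier F" if "e \<in> arcs E" "1 \<le> i" for e i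
    using that F.M.zero_closed unfolding zero_word[symmetric]
    by (auto simp: gedge_def gghost_def intro!: word_closed)
  have VV: "gvert K (tail E e) \<in> carrier F" "gvert K (head E e) \<in> carrier F" if "e \<in> arcs E" for e
    using that V by auto
  have 3: "(\<Oplus>\<^bsub>F\<^esub>e\<in>out_arcs E v. gedge K w e i \<otimes>\<^bsub>F\<^esub> gghost K w e j) \<in> carrier F"
    if "1 \<le> i" "1 \<le> j" for v i j
    using A that by (intro F.M.finsum_closed) auto
  have 4: "(\<Oplus>\<^bsub>F\<^esub>i\<in>{1..n}. gghost K w e i \<otimes>\<^bsub>F\<^esub> gedge K w f i) \<in> carrier F"
    if "e \<in> arcs E" "f \<in> arcs E" for e f n
    using A that by (intro F.M.finsum_closed) auto
  have r: "v \<in> verts E" if "v \<in> reg" for v using regular_vertsD(1)[OF that] .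
  show ?thesis
    unfolding wlpa_rels_def Let_def
    using V A VV 3 4 r by (auto intro!: F.M.minus_closed simp del: One_nat_def)
qed

sublocale I: ideal I F
  unfolding wlpa_ideal_def by (rule F.B.genideal_ideal) (rule wlpa_rels_closed)

abbreviation "Q \<equiv> F Quot I"

sublocale Q: ring Q
  by (rule I.quotient_is_ring)

sublocale cl: ring_hom_ring F Q "\<lambda>f. cl f"
  by (rule I.rcos_ring_hom_ring)

lemma cl_rels: "r \<in> wlpa_rels K E w \<Longrightarrow> cl r = \<zero>\<^bsub>Q\<^esub>"
  using F.B.genideal_self[OF wlpa_rels_closed] I.a_rcos_const
  by (auto simp: wlpa_ideal_def FactRing_def)

definition gen :: "('v, 'e) gen \<Rightarrow> (('v, 'e) gen list \<Rightarrow> 'k) set" where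
  "gen g = cl (word K [g])"

abbreviation "vert v \<equiv> gen (Vert v)"

lemma wlpa_simps:
  "carrier L = cl ` aug K X" "mult L = mult Q" "add L = add Q" "zero L = zero Q"
  "one L = cl (\<Oplus>\<^bsub>F\<^esub>v\<in>verts E. gvert K v)"
  by (simp_all add: wlpa_def Let_def)

lemma cl_eq_iff: "\<lbrakk>f \<in> carrier F; g \<in> carrier F\<rbrakk> \<Longrightarrow> cl f = cl g \<longleftrightarrow> f \<ominus>\<^bsub>F\<^esub> g \<in> I"
proof -
  assume f: "f \<in> carrier F" and g: "g \<in> carrier F"
  have z: "\<zero>\<^bsub>Q\<^esub> = I" unfolding FactRing_def by simp
  have "cl h = I \<longleftrightarrow> h \<in> I" if "h \<in> carrier F" for h
    using I.a_rcos_self[OF that] I.a_rcos_const[of h] by metis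
  then have "f \<ominus>\<^bsub>F\<^esub> g \<in> I \<longleftrightarrow> cl (f \<ominus>\<^bsub>F\<^esub> g) = \<zero>\<^bsub>Q\<^esub>" using f g z by simp
  also have "cl (f \<ominus>\<^bsub>F\<^esub> g) = cl f \<ominus>\<^bsub>Q\<^esub> cl g" using f g by (simp add: a_minus_def cl.hom_a_inv)
  finally show ?thesis using f g by (simp add: Q.minus_eq_zero_iff)
qed

lemma I_smult: "\<lbrakk>c \<in> carrier K; f \<in> I\<rbrakk> \<Longrightarrow> c \<odot>\<^bsub>F\<^esub> f \<in> I"
proof -
  assume c: "c \<in> carrier K" and f: "f \<in> I"
  have "c \<odot>\<^bsub>F\<^esub> f = (c \<odot>\<^bsub>F\<^esub> \<one>\<^bsub>F\<^esub>) \<otimes>\<^bsub>F\<^esub> f"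
    using c f by (simp add: F.smult_mult_left)
  then show ?thesis using I.I_l_closed[OF f, of "c \<odot>\<^bsub>F\<^esub> \<one>\<^bsub>F\<^esub>"] c by simp
qed

text \<open>The definition of the scalar multiple takes a union over all representatives; since the
  ideal is stable under scalars, every member of that union is the same coset.\<close>

lemma wlpa_smult: "\<lbrakk>c \<in> carrier K; f \<in> carrier F\<rbrakk> \<Longrightarrow> c \<odot>\<^bsub>L\<^esub> cl f = cl (c \<odot>\<^bsub>F\<^esub> f)"
proof -
  assume c: "c \<in> carrier K" and f: "f \<in> carrier F"
  have "cl (c \<odot>\<^bsub>F\<^esub> g) = cl (c \<odot>\<^bsub>F\<^esub> f)" if "g \<in> cl f" for g
  proof -
    have g: "g \<in> carrier F" using that f F.a_r_coset_subset_G[OF I.a_subset f] by blast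
    have "cl g = cl f" using that f I.a_repr_independence'[of g f] by simp
    then have "g \<ominus>\<^bsub>F\<^esub> f \<in> I" using g f cl_eq_iff by simp
    then have "c \<odot>\<^bsub>F\<^esub> (g \<ominus>\<^bsub>F\<^esub> f) \<in> I" using c I_smult by simp
    also have "c \<odot>\<^bsub>F\<^esub> (g \<ominus>\<^bsub>F\<^esub> f) = c \<odot>\<^bsub>F\<^esub> g \<ominus>\<^bsub>F\<^esub> c \<odot>\<^bsub>F\<^esub> f"
      using c f g by (simp add: a_minus_def F.smult_r_distr F.smult_r_minus)
    finally show ?thesis using c f g by (subst cl_eq_iff) auto
  qed
  moreover have "f \<in> cl f" using f by (rule I.a_rcos_self)
  ultimately have "(\<Union>g\<in>cl f. cl (c \<odot>\<^bsub>F\<^esub> g)) = cl (c \<odot>\<^bsub>F\<^esub> f)" by blast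
  then show ?thesis unfolding wlpa_def Let_def by (simp only: module.simps)
qed

lemma cl_closed: "f \<in> aug K X \<Longrightarrow> cl f \<in> carrier L"
  by (simp add: wlpa_simps)

lemma gen_closed: "g \<in> X \<Longrightarrow> gen g \<in> carrier L"
  unfolding gen_def by (intro cl_closed aug_word) auto

lemma wlpa_subset: "carrier L \<subseteq> carrier Q"
  using aug_carrier by (auto simp: wlpa_simps)

lemma wlpa_abelian_group: "abelian_group L"
proof (rule abelian_groupI)
  fix x y assume "x \<in> carrier L" "y \<in> carrier L"
  then obtain f g where fg: "f \<in> aug K X" "g \<in> aug K X" "x = cl f" "y = cl g" by (auto simp: wlpa_simps)
  then have "x \<oplus>\<^bsub>L\<^esub> y = cl (f \<oplus>\<^bsub>F\<^esub> g)" using aug_carrier by (simp add: wlpa_simps)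
  then show "x \<oplus>\<^bsub>L\<^esub> y \<in> carrier L" using aug_add[OF fg(1,2)] cl_closed by simp
next
  fix x assume "x \<in> carrier L"
  then obtain f where f: "f \<in> aug K X" "x = cl f" by (auto simp: wlpa_simps)
  show "\<exists>y\<in>carrier L. y \<oplus>\<^bsub>L\<^esub> x = \<zero>\<^bsub>L\<^esub>"
  proof (rule bexI[of _ "cl (\<ominus>\<^bsub>F\<^esub> f)"])
    show "cl (\<ominus>\<^bsub>F\<^esub> f) \<oplus>\<^bsub>L\<^esub> x = \<zero>\<^bsub>L\<^esub>"
      using aug_carrier[OF f(1)] by (simp add: wlpa_simps f(2) Q.l_neg)
  qed (use aug_neg[OF f(1)] cl_closed in simp)
next
  show "\<zero>\<^bsub>L\<^esub> \<in> carrier L"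
    using cl_closed[OF aug_zero] by (simp add: wlpa_simps(4))
qed (use wlpa_subset Q.a_assoc Q.a_comm in \<open>auto simp: wlpa_simps(3,4) subset_iff\<close>)

interpretation L: abelian_group L by (rule wlpa_abelian_group)

text \<open>L has the operations of Q, but a smaller carrier and a unit of its own. Until L is known
  to be a ring, its sums are transferred to Q, where the distributive laws are available.\<close>

lemma wlpa_finsum:
  assumes "\<And>i. i \<in> S \<Longrightarrow> f i \<in> carrier L"
  shows "finsum L f S = finsum Q f S"
  using assms
proof (induction S rule: infinite_finite_induct)
  case (insert x S)
  have "finsum L f (insert x S) = f x \<oplus>\<^bsub>L\<^esub> finsum L f S"
    using insert by (intro L.finsum_insert) auto
  moreover have "finsum Q f (insert x S) = f x \<oplus>\<^bsub>Q\<^esub> finsum Q f S"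
    using insert wlpa_subset by (intro Q.finsum_insert) auto
  ultimately show ?case using insert by (simp add: wlpa_simps(3))
qed (simp_all add: wlpa_simps)

lemma wlpa_mult_closed: "x \<in> carrier L \<Longrightarrow> y \<in> carrier L \<Longrightarrow> x \<cdot> y \<in> carrier L"
proof -
  assume "x \<in> carrier L" "y \<in> carrier L"
  then obtain f g where fg: "f \<in> aug K X" "g \<in> aug K X" "x = cl f" "y = cl g" by (auto simp: wlpa_simps)
  then have "x \<cdot> y = cl (f \<otimes>\<^bsub>F\<^esub> g)" using aug_carrier by (simp add: wlpa_simps)
  then show "x \<cdot> y \<in> carrier L" using aug_mult[OF fg(1,2)] cl_closed by simp
qed

lemma wlpa_family_cong:
  assumes "ring B" "wlpa_family E w B \<psi>" "\<And>g. g \<in> X \<Longrightarrow> \<psi>' g = \<psi> g"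
  shows "wlpa_family E w B \<psi>'"
proof -
  have 1: "\<psi>' (Vert v) = \<psi> (Vert v)" if "v \<in> verts E" for v using assms(3) that by simp
  have 2: "\<psi>' (Edge e i) = \<psi> (Edge e i)" "\<psi>' (Ghost e i) = \<psi> (Ghost e i)" if "e \<in> arcs E" "i \<in> {1..w e}" for e i
    using assms(3) that by simp_all
  have 3: "\<psi>' (Vert (tail E e)) = \<psi> (Vert (tail E e))" "\<psi>' (Vert (head E e)) = \<psi> (Vert (head E e))" if "e \<in> arcs E" for e
    using 1 that by simp_all
  interpret B: ring B by fact
  have c: "\<psi> g \<in> carrier B" if "g \<in> X" for g using assms(2) that by (simp add: wlpa_family_def)
  have s1: "(\<Oplus>\<^bsub>B\<^esub>e\<in>out_arcs E v. \<psi>' (Edge e i) \<otimes>\<^bsub>B\<^esub> \<psi>' (Ghost e j))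
      = (\<Oplus>\<^bsub>B\<^esub>e\<in>out_arcs E v. \<psi> (Edge e i) \<otimes>\<^bsub>B\<^esub> \<psi> (Ghost e j))"
    if "v \<in> reg" "i \<in> {1..wt v}" "j \<in> {1..wt v}" for v i j
    using regular_vertsD(4)[OF that(1)] that(2,3) 2 c by (intro B.finsum_cong') auto
  have s2: "(\<Oplus>\<^bsub>B\<^esub>i\<in>{1..wt v}. \<psi>' (Ghost e i) \<otimes>\<^bsub>B\<^esub> \<psi>' (Edge f i))
      = (\<Oplus>\<^bsub>B\<^esub>i\<in>{1..wt v}. \<psi> (Ghost e i) \<otimes>\<^bsub>B\<^esub> \<psi> (Edge f i))"
    if "v \<in> reg" "e \<in> out_arcs E v" "f \<in> out_arcs E v" for v e f
    using regular_vertsD(4)[OF that(1)] that(2,3) 2 c by (intro B.finsum_cong') auto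
  have 4: "e \<in> arcs E" "v \<in> verts E" if "e \<in> out_arcs E v" "v \<in> reg" for e v
    using regular_vertsD[OF that(2)] that(1) by auto
  show ?thesis
    using assms(2) c unfolding wlpa_family_def
    by (elim conjE, intro conjI ballI) (simp_all only: assms(3) 1 2 3 4 s1 s2 simp_thms regular_vertsD(1))
qed

lemma wlpa_family_gen: "wlpa_family E w L gen"
proof -
  have Q: "wlpa_family E w Q gen"
    using hom_rels_iff[OF cl.ring_hom_ring_axioms] cl_rels by (simp add: gen_def[abs_def])
  have s1: "(\<Oplus>\<^bsub>L\<^esub>e\<in>out_arcs E v. gen (Edge e i) \<otimes>\<^bsub>Q\<^esub> gen (Ghost e j))
      = (\<Oplus>\<^bsub>Q\<^esub>e\<in>out_arcs E v. gen (Edge e i) \<otimes>\<^bsub>Q\<^esub> gen (Ghost e j))"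
    if "v \<in> reg" "i \<in> {1..wt v}" "j \<in> {1..wt v}" for v i j
    using regular_vertsD(4)[OF that(1)] that(2,3) wlpa_mult_closed[unfolded wlpa_simps(2)] gen_closed
    by (intro wlpa_finsum) auto
  have s2: "(\<Oplus>\<^bsub>L\<^esub>i\<in>{1..wt v}. gen (Ghost e i) \<otimes>\<^bsub>Q\<^esub> gen (Edge f i))
      = (\<Oplus>\<^bsub>Q\<^esub>i\<in>{1..wt v}. gen (Ghost e i) \<otimes>\<^bsub>Q\<^esub> gen (Edge f i))"
    if "v \<in> reg" "e \<in> out_arcs E v" "f \<in> out_arcs E v" for v e f
    using regular_vertsD(4)[OF that(1)] that(2,3) wlpa_mult_closed[unfolded wlpa_simps(2)] gen_closed
    by (intro wlpa_finsum) auto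
  show ?thesis
    using Q gen_closed unfolding wlpa_family_def wlpa_simps(2,4)
    by (elim conjE, intro conjI ballI) (simp_all only: s1 s2 simp_thms)
qed

lemma wlpa_mult_cl: "\<lbrakk>f \<in> carrier F; g \<in> carrier F\<rbrakk> \<Longrightarrow> cl f \<cdot> cl g = cl (f \<otimes>\<^bsub>F\<^esub> g)"
  by (simp add: wlpa_simps(2))

lemma wlpa_add_cl: "\<lbrakk>f \<in> carrier F; g \<in> carrier F\<rbrakk> \<Longrightarrow> cl f \<oplus>\<^bsub>L\<^esub> cl g = cl (f \<oplus>\<^bsub>F\<^esub> g)"
  by (simp add: wlpa_simps(3))

lemma cl_finsum: "(\<And>i. i \<in> S \<Longrightarrow> f i \<in> aug K X) \<Longrightarrow> cl (finsum F f S) = (\<Oplus>\<^bsub>L\<^esub>i\<in>S. cl (f i))"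
proof -
  assume f: "\<And>i. i \<in> S \<Longrightarrow> f i \<in> aug K X"
  have "cl (finsum F f S) = (\<Oplus>\<^bsub>Q\<^esub>i\<in>S. cl (f i))"
    by (rule additive_finsum[of F Q "\<lambda>f. cl f"])
      (use f aug_carrier in \<open>auto simp: F.M.abelian_group_axioms Q.abelian_group_axioms\<close>)
  then show ?thesis using wlpa_finsum[of S "\<lambda>i. cl (f i)"] f cl_closed by simp
qed

lemma wlpa_one: "\<one>\<^bsub>L\<^esub> = (\<Oplus>\<^bsub>L\<^esub>v\<in>verts E. vert v)"
  unfolding wlpa_simps(5) gen_def gvert_def by (rule cl_finsum) (auto intro: aug_word)

lemma wlpa_cases: "a \<in> carrier L \<Longrightarrow> (\<And>f. f \<in> aug K X \<Longrightarrow> a = cl f \<Longrightarrow> thesis) \<Longrightarrow> thesis"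
  by (auto simp: wlpa_simps)

text \<open>Generators regarded as arrows: a ghost edge runs from the range of its edge back to the
  source.\<close>

definition "gsource g = (case g of Vert v \<Rightarrow> v | Edge e i \<Rightarrow> tail E e | Ghost e i \<Rightarrow> head E e)"
definition "gtarget g = (case g of Vert v \<Rightarrow> v | Edge e i \<Rightarrow> head E e | Ghost e i \<Rightarrow> tail E e)"

lemma gen_verts: "g \<in> X \<Longrightarrow> gsource g \<in> verts E" "g \<in> X \<Longrightarrow> gtarget g \<in> verts E"
  by (cases g; simp add: gsource_def gtarget_def)+

lemma vert_gen:
  assumes "v \<in> verts E" "g \<in> X"
  shows "vert v \<cdot> gen g = (if v = gsource g then gen g else \<zero>\<^bsub>L\<^esub>)"
    "gen g \<cdot> vert v = (if v = gtarget g then gen g else \<zero>\<^bsub>L\<^esub>)"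
proof -
  have f: "vert v \<cdot> vert u = (if v = u then vert v else \<zero>\<^bsub>L\<^esub>)" if "u \<in> verts E" for u
    using wlpa_family_gen assms(1) that by (simp add: wlpa_family_def)
  have f': "vert u \<cdot> vert v = (if u = v then vert u else \<zero>\<^bsub>L\<^esub>)" if "u \<in> verts E" for u
    using wlpa_family_gen assms(1) that by (simp add: wlpa_family_def)
  have s: "vert (gsource g) \<cdot> gen g = gen g" "gen g \<cdot> vert (gtarget g) = gen g"
    using wlpa_family_gen assms(2) by (cases g; simp add: wlpa_family_def gsource_def gtarget_def)+
  have c: "vert u \<in> carrier Q" if "u \<in> verts E" for u using gen_closed[of "Vert u"] that wlpa_subset by auto
  have cg: "gen g \<in> carrier Q" using gen_closed[OF assms(2)] wlpa_subset by auto
  note c' = c[OF assms(1)] c[OF gen_verts(1)[OF assms(2)]] c[OF gen_verts(2)[OF assms(2)]] cg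
  have "vert v \<otimes>\<^bsub>Q\<^esub> (vert (gsource g) \<otimes>\<^bsub>Q\<^esub> gen g) = (vert v \<otimes>\<^bsub>Q\<^esub> vert (gsource g)) \<otimes>\<^bsub>Q\<^esub> gen g"
    using c' by (simp only: Q.m_assoc)
  then show "vert v \<cdot> gen g = (if v = gsource g then gen g else \<zero>\<^bsub>L\<^esub>)"
    using f[OF gen_verts(1)[OF assms(2)]] s(1) cg by (auto simp: wlpa_simps(2,4))
  have "(gen g \<otimes>\<^bsub>Q\<^esub> vert (gtarget g)) \<otimes>\<^bsub>Q\<^esub> vert v = gen g \<otimes>\<^bsub>Q\<^esub> (vert (gtarget g) \<otimes>\<^bsub>Q\<^esub> vert v)"
    using c' by (simp only: Q.m_assoc)
  then show "gen g \<cdot> vert v = (if v = gtarget g then gen g else \<zero>\<^bsub>L\<^esub>)"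
    using f'[OF gen_verts(2)[OF assms(2)]] s(2) cg by (auto simp: wlpa_simps(2,4))
qed

lemma wlpa_one_gen:
  assumes "g \<in> X"
  shows "\<one>\<^bsub>L\<^esub> \<cdot> gen g = gen g" "gen g \<cdot> \<one>\<^bsub>L\<^esub> = gen g"
proof -
  have c: "vert u \<in> carrier L" if "u \<in> verts E" for u using gen_closed[of "Vert u"] that by auto
  have cQ: "vert u \<in> carrier Q" if "u \<in> verts E" for u using c[OF that] wlpa_subset by auto
  have g: "gen g \<in> carrier Q" using gen_closed[OF assms] wlpa_subset by auto
  have one: "\<one>\<^bsub>L\<^esub> = (\<Oplus>\<^bsub>Q\<^esub>v\<in>verts E. vert v)"
    unfolding wlpa_one by (rule wlpa_finsum) (rule c)
  have "\<one>\<^bsub>L\<^esub> \<cdot> gen g = (\<Oplus>\<^bsub>Q\<^esub>v\<in>verts E. vert v \<otimes>\<^bsub>Q\<^esub> gen g)"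
    unfolding one wlpa_simps(2) using cQ g by (intro Q.finsum_ldistr) auto
  also have "\<dots> = (\<Oplus>\<^bsub>Q\<^esub>v\<in>verts E. if v = gsource g then gen g else \<zero>\<^bsub>Q\<^esub>)"
    using vert_gen(1)[OF _ assms] g by (intro Q.finsum_cong') (auto simp: wlpa_simps(2,4))
  also have "\<dots> = gen g" using g gen_verts(1)[OF assms] by (subst Q.finsum_delta) auto
  finally show "\<one>\<^bsub>L\<^esub> \<cdot> gen g = gen g" .
  have "gen g \<cdot> \<one>\<^bsub>L\<^esub> = (\<Oplus>\<^bsub>Q\<^esub>v\<in>verts E. gen g \<otimes>\<^bsub>Q\<^esub> vert v)"
    unfolding one wlpa_simps(2) using cQ g by (intro Q.finsum_rdistr) auto
  also have "\<dots> = (\<Oplus>\<^bsub>Q\<^esub>v\<in>verts E. if v = gtarget g then gen g else \<zero>\<^bsub>Q\<^esub>)"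
    using vert_gen(2)[OF _ assms] g by (intro Q.finsum_cong') (auto simp: wlpa_simps(2,4))
  also have "\<dots> = gen g" using g gen_verts(2)[OF assms] by (subst Q.finsum_delta) auto
  finally show "gen g \<cdot> \<one>\<^bsub>L\<^esub> = gen g" .
qed

lemma wlpa_one_closed: "\<one>\<^bsub>L\<^esub> \<in> carrier L"
  unfolding wlpa_one by (rule L.finsum_closed) (auto intro: gen_closed)

lemma wlpa_unit:
  assumes "a \<in> carrier L"
  shows "\<one>\<^bsub>L\<^esub> \<cdot> a = a \<and> a \<cdot> \<one>\<^bsub>L\<^esub> = a"
proof -
  obtain f where f: "f \<in> aug K X" "a = cl f" using assms by (rule wlpa_cases)
  obtain u where u: "u \<in> aug K X" "\<one>\<^bsub>L\<^esub> = cl u" using wlpa_one_closed by (rule wlpa_cases)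
  have uQ: "\<one>\<^bsub>L\<^esub> \<in> carrier Q" using wlpa_one_closed wlpa_subset by auto
  have wQ: "cl (word K x) \<in> carrier Q" if "x \<in> lists X" for x using word_closed[OF that] by simp
  have "\<one>\<^bsub>L\<^esub> \<otimes>\<^bsub>Q\<^esub> cl f = cl f \<and> cl f \<otimes>\<^bsub>Q\<^esub> \<one>\<^bsub>L\<^esub> = cl f"
    using f(1)
  proof (induction rule: aug_induct)
    case (word g x)
    \<comment> \<open>The left unit law is decided by the first letter of the word and the right one
      by the last, so the word is factored at both ends.\<close>
    let ?y = "butlast (g # x)" and ?h = "last (g # x)"
    have gx: "g # x = ?y @ [?h]" by (rule append_butlast_last_id[symmetric]) simp
    have y: "?y \<in> lists X" "?h \<in> X" proof -
      have "?y @ [?h] \<in> lists X" using word(1,2) unfolding gx[symmetric] by simp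
      then show "?y \<in> lists X" "?h \<in> X" unfolding append_in_lists_conv by simp_all
    qed
    have 1: "cl (word K (g # x)) = gen g \<otimes>\<^bsub>Q\<^esub> cl (word K x)"
      using word_mult[of "[g]" x] word word_closed[of "[g]"] word_closed[of x] by (simp add: gen_def flip: cl.hom_mult)
    have 2: "cl (word K (g # x)) = cl (word K ?y) \<otimes>\<^bsub>Q\<^esub> gen ?h"
    proof -
      have "word K (g # x) = word K ?y \<otimes>\<^bsub>F\<^esub> word K [?h]"
        unfolding word_mult by (rule arg_cong[OF gx])
      moreover have "word K [?h] \<in> carrier F" "word K ?y \<in> carrier F" using y by (auto intro!: word_closed simp del: butlast.simps last.simps)
      ultimately show ?thesis unfolding gen_def by (metis cl.hom_mult)
    qed
    have g: "gen g \<in> carrier Q" "gen ?h \<in> carrier Q" using gen_closed[OF word(1)] gen_closed[OF y(2)] wlpa_subset by auto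
    have "\<one>\<^bsub>L\<^esub> \<otimes>\<^bsub>Q\<^esub> cl (word K (g # x)) = (\<one>\<^bsub>L\<^esub> \<otimes>\<^bsub>Q\<^esub> gen g) \<otimes>\<^bsub>Q\<^esub> cl (word K x)"
      unfolding 1 using uQ g wQ[OF word(2)] by (simp only: Q.m_assoc)
    also have "\<dots> = cl (word K (g # x))" using wlpa_one_gen(1)[OF word(1)] 1 by (simp add: wlpa_simps(2))
    finally have A: "\<one>\<^bsub>L\<^esub> \<otimes>\<^bsub>Q\<^esub> cl (word K (g # x)) = cl (word K (g # x))" .
    have "cl (word K (g # x)) \<otimes>\<^bsub>Q\<^esub> \<one>\<^bsub>L\<^esub> = cl (word K ?y) \<otimes>\<^bsub>Q\<^esub> (gen ?h \<otimes>\<^bsub>Q\<^esub> \<one>\<^bsub>L\<^esub>)"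
      unfolding 2 using uQ g wQ[OF y(1)] by (simp only: Q.m_assoc)
    also have "\<dots> = cl (word K (g # x))" using wlpa_one_gen(2)[OF y(2)] 2 by (simp add: wlpa_simps(2))
    finally show ?case using A by simp
  next
    case (add f g)
    then show ?case using aug_carrier uQ by (simp add: Q.l_distr Q.r_distr)
  next
    \<comment> \<open>The quotient ring Q carries no scalar multiplication, so the scalar is moved
      past the unit in F, through the representative u.\<close>
    case (smult c f)
    note c = smult(1) aug_carrier[OF smult(2)] aug_carrier[OF u(1)]
    have "cl (u \<otimes>\<^bsub>F\<^esub> f) = cl f" "cl (f \<otimes>\<^bsub>F\<^esub> u) = cl f" using smult(3) c u(2) by simp_all
    then have "c \<odot>\<^bsub>L\<^esub> cl (u \<otimes>\<^bsub>F\<^esub> f) = c \<odot>\<^bsub>L\<^esub> cl f" "c \<odot>\<^bsub>L\<^esub> cl (f \<otimes>\<^bsub>F\<^esub> u) = c \<odot>\<^bsub>L\<^esub> cl f" by simp_all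
    then have "cl (u \<otimes>\<^bsub>F\<^esub> (c \<odot>\<^bsub>F\<^esub> f)) = cl (c \<odot>\<^bsub>F\<^esub> f)" "cl ((c \<odot>\<^bsub>F\<^esub> f) \<otimes>\<^bsub>F\<^esub> u) = cl (c \<odot>\<^bsub>F\<^esub> f)"
      using c by (simp_all add: wlpa_smult F.smult_mult_left F.smult_mult_right del: cl.hom_mult)
    then show ?case using c u(2) by simp
  next
    case zero
    then show ?case using uQ by simp
  qed
  then show ?thesis by (simp add: f(2) wlpa_simps(2))
qed

lemma wlpa_algebra: "algebra_over K L"
proof -
  have cQ: "\<And>x. x \<in> carrier L \<Longrightarrow> x \<in> carrier Q" using wlpa_subset by auto
  have mon: "monoid L"
  proof (rule monoidI)
    show "x \<cdot> y \<cdot> z = x \<cdot> (y \<cdot> z)" if "x \<in> carrier L" "y \<in> carrier L" "z \<in> carrier L" for x y z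
      using that[THEN cQ] by (simp add: wlpa_simps(2) Q.m_assoc)
  qed (use wlpa_mult_closed wlpa_one_closed wlpa_unit in auto)
  interpret L: ring L
    by (rule ringI[OF wlpa_abelian_group mon]) (use cQ in \<open>auto simp: wlpa_simps(2,3) Q.l_distr Q.r_distr\<close>)
  have smult_one: "\<one> \<odot>\<^bsub>L\<^esub> x = x" if "x \<in> carrier L" for x
    using that by (rule wlpa_cases) (simp add: wlpa_smult aug_carrier)
  show ?thesis
  proof (unfold_locales; (erule smult_one)?)
    fix a x assume a: "a \<in> carrier K" and x: "x \<in> carrier L"
    obtain f where f: "f \<in> aug K X" "x = cl f" using x by (rule wlpa_cases)
    note fc = aug_carrier[OF f(1)]
    show "a \<odot>\<^bsub>L\<^esub> x \<in> carrier L"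
      using a f(1) fc aug_smult by (simp add: f(2) wlpa_smult cl_closed)
    { fix b assume b: "b \<in> carrier K"
      show "(a \<oplus> b) \<odot>\<^bsub>L\<^esub> x = a \<odot>\<^bsub>L\<^esub> x \<oplus>\<^bsub>L\<^esub> b \<odot>\<^bsub>L\<^esub> x"
        using a b fc by (simp add: f(2) wlpa_smult wlpa_add_cl F.smult_l_distr del: cl.hom_add)
      show "(a \<otimes> b) \<odot>\<^bsub>L\<^esub> x = a \<odot>\<^bsub>L\<^esub> (b \<odot>\<^bsub>L\<^esub> x)"
        using a b fc by (simp add: f(2) wlpa_smult F.smult_assoc1) }
    { fix y assume y: "y \<in> carrier L"
      obtain g where g: "g \<in> aug K X" "y = cl g" using y by (rule wlpa_cases)
      note gc = aug_carrier[OF g(1)]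
      show "a \<odot>\<^bsub>L\<^esub> (x \<oplus>\<^bsub>L\<^esub> y) = a \<odot>\<^bsub>L\<^esub> x \<oplus>\<^bsub>L\<^esub> a \<odot>\<^bsub>L\<^esub> y"
        using a fc gc by (simp add: f(2) g(2) wlpa_smult wlpa_add_cl F.smult_r_distr del: cl.hom_add)
      show "(a \<odot>\<^bsub>L\<^esub> x) \<cdot> y = a \<odot>\<^bsub>L\<^esub> (x \<cdot> y)"
        using a fc gc by (simp add: f(2) g(2) wlpa_smult wlpa_mult_cl F.smult_mult_left del: cl.hom_mult)
      show "x \<cdot> (a \<odot>\<^bsub>L\<^esub> y) = a \<odot>\<^bsub>L\<^esub> (x \<cdot> y)"
        using a fc gc by (simp add: f(2) g(2) wlpa_smult wlpa_mult_cl F.smult_mult_right del: cl.hom_mult) }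
  qed
qed

lemma wlpa_induct [consumes 1, case_names gen zero add mult smult]:
  assumes "a \<in> carrier L"
    and "\<And>g. g \<in> X \<Longrightarrow> P (gen g)" and "P \<zero>\<^bsub>L\<^esub>"
    and "\<And>a b. a \<in> carrier L \<Longrightarrow> b \<in> carrier L \<Longrightarrow> P a \<Longrightarrow> P b \<Longrightarrow> P (a \<oplus>\<^bsub>L\<^esub> b)"
    and "\<And>a b. a \<in> carrier L \<Longrightarrow> b \<in> carrier L \<Longrightarrow> P a \<Longrightarrow> P b \<Longrightarrow> P (a \<cdot> b)"
    and "\<And>c a. c \<in> carrier K \<Longrightarrow> a \<in> carrier L \<Longrightarrow> P a \<Longrightarrow> P (c \<odot>\<^bsub>L\<^esub> a)"
  shows "P a"
proof -
  obtain f where f: "f \<in> aug K X" "a = cl f" using assms(1) by (rule wlpa_cases)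
  have "P (cl f)"
    using f(1)
  proof (induction rule: aug_induct)
    case (word g x)
    from word(2,1) show ?case
    proof (induction x arbitrary: g rule: lists.induct)
      case Nil
      then show ?case using assms(2) by (simp add: gen_def)
    next
      case (Cons h x)
      have hx: "word K (h # x) \<in> aug K X" using Cons by (intro aug_word) auto
      have "cl (word K (g # h # x)) = gen g \<cdot> cl (word K (h # x))"
        using word_mult[of "[g]" "h # x"] aug_carrier[OF hx] word_closed[of "[g]"] Cons(4)
        by (simp add: gen_def wlpa_simps(2) flip: cl.hom_mult)
      then show ?case using assms(5)[of "gen g" "cl (word K (h # x))"] assms(2) gen_closed cl_closed[OF hx] Cons by simp
    qed
  next
    case (add f g)
    then show ?case using assms(4)[of "cl f" "cl g"] cl_closed aug_carrier by (simp add: wlpa_add_cl del: cl.hom_add)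
  next
    case (smult c f)
    then show ?case using assms(6)[of c "cl f"] cl_closed aug_carrier by (simp add: wlpa_smult)
  next
    case zero
    then show ?case using assms(3) by (simp add: wlpa_simps(4))
  qed
  then show ?thesis by (simp add: f(2))
qed

text \<open>Evaluation is a unital homomorphism on the free unital algebra, but only its restriction
  to \<open>aug\<close> descends to L. The resulting map is therefore not claimed to be
  unital.\<close>

theorem wlpa_universal:
  fixes B :: "('k, 'b) module"
  assumes "algebra_over K B" "wlpa_family E w B \<psi>"
  obtains \<Phi> where "alg_hom K L B \<Phi>" "\<And>g. g \<in> X \<Longrightarrow> \<Phi> (gen g) = \<psi> g"
proof -
  interpret B: algebra_over K B by fact
  have \<psi>: "\<And>g. g \<in> X \<Longrightarrow> \<psi> g \<in> carrier B" using assms(2) by (simp add: wlpa_family_def)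
  have evw: "B.ev \<psi> (word K [g]) = \<psi> g" if "g \<in> X" for g
    using B.ev_word[of X \<psi> "[g]", OF \<psi>] that \<psi> by (simp add: B.word_val_def)
  interpret h: ring_hom_ring F B "B.ev \<psi>"
  proof (rule ring_hom_ringI)
    have "B.ev \<psi> (word K []) = \<one>\<^bsub>B\<^esub>" using B.ev_word[of X \<psi> "[]", OF \<psi>] by (simp add: B.word_val_def)
    then show "B.ev \<psi> \<one>\<^bsub>F\<^esub> = \<one>\<^bsub>B\<^esub>" by (simp add: free_alg_def)
  qed (use B.ev_closed[of X \<psi>, OF \<psi>] B.ev_add[of X \<psi>, OF \<psi>] B.ev_mult[of X \<psi>, OF \<psi>] F.ring_axioms B.B.ring_axioms in auto)
  have "wlpa_family E w B (\<lambda>g. B.ev \<psi> (word K [g]))"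
    by (rule wlpa_family_cong[OF B.B.ring_axioms assms(2)]) (simp add: evw)
  then have rels: "\<forall>r\<in>wlpa_rels K E w. B.ev \<psi> r = \<zero>\<^bsub>B\<^esub>"
    using hom_rels_iff[OF h.ring_hom_ring_axioms] by simp
  have "I \<subseteq> {f \<in> carrier F. B.ev \<psi> f = \<zero>\<^bsub>B\<^esub>}"
    unfolding wlpa_ideal_def using rels wlpa_rels_closed B.ev_kernel_ideal[of X \<psi>, OF \<psi>]
    by (intro F.B.genideal_minimal) auto
  then have ker: "B.ev \<psi> f = \<zero>\<^bsub>B\<^esub>" if "f \<in> I" for f using that by auto
  have eq: "B.ev \<psi> f = B.ev \<psi> g" if "f \<in> carrier F" "g \<in> carrier F" "cl f = cl g" for f g
  proof -
    have "f \<ominus>\<^bsub>F\<^esub> g \<in> I" using that cl_eq_iff by simp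
    then have "B.ev \<psi> (f \<ominus>\<^bsub>F\<^esub> g) = \<zero>\<^bsub>B\<^esub>" by (rule ker)
    then have "B.ev \<psi> f \<ominus>\<^bsub>B\<^esub> B.ev \<psi> g = \<zero>\<^bsub>B\<^esub>" using that by (simp add: a_minus_def h.hom_a_inv)
    then show ?thesis using that by (simp add: B.M.minus_eq_zero_iff)
  qed
  \<comment> \<open>Any representative may be chosen, since evaluation vanishes on the ideal; it is
    taken in \<open>aug\<close> because only such cosets belong to L.\<close>
  define \<Phi> where "\<Phi> a = B.ev \<psi> (SOME f. f \<in> aug K X \<and> cl f = a)" for a
  have \<Phi>: "\<Phi> (cl f) = B.ev \<psi> f" if "f \<in> aug K X" for f
  proof -
    let ?g = "SOME g. g \<in> aug K X \<and> cl g = cl f"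
    have "?g \<in> aug K X \<and> cl ?g = cl f" using someI[of "\<lambda>g. g \<in> aug K X \<and> cl g = cl f" f] that by simp
    then show ?thesis unfolding \<Phi>_def using that aug_carrier eq by blast
  qed
  show thesis
  proof (rule that)
    show "\<Phi> (gen g) = \<psi> g" if "g \<in> X" for g
      using \<Phi>[of "word K [g]"] evw that by (simp add: gen_def aug_word)
    show "alg_hom K L B \<Phi>"
      unfolding alg_hom_def
    proof (intro conjI ballI funcsetI)
      fix x assume "x \<in> carrier L"
      then obtain f where f: "f \<in> aug K X" "x = cl f" by (rule wlpa_cases)
      note fc = aug_carrier[OF f(1)]
      show "\<Phi> x \<in> carrier B" using f fc by (simp add: \<Phi>)
      show "\<Phi> (c \<odot>\<^bsub>L\<^esub> x) = c \<odot>\<^bsub>B\<^esub> \<Phi> x" if "c \<in> carrier K" for c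
        using that f fc B.ev_smult[of X \<psi> c f, OF \<psi>] by (simp add: \<Phi> wlpa_smult aug_smult)
      fix y assume "y \<in> carrier L"
      then obtain g where g: "g \<in> aug K X" "y = cl g" by (rule wlpa_cases)
      note gc = aug_carrier[OF g(1)]
      show "\<Phi> (x \<oplus>\<^bsub>L\<^esub> y) = \<Phi> x \<oplus>\<^bsub>B\<^esub> \<Phi> y"
        using f g fc gc by (simp add: \<Phi> wlpa_add_cl aug_add del: cl.hom_add)
      show "\<Phi> (x \<cdot> y) = \<Phi> x \<otimes>\<^bsub>B\<^esub> \<Phi> y"
        using f g fc gc by (simp add: \<Phi> wlpa_mult_cl aug_mult del: cl.hom_mult)
    qed
  qed
qed

end

section \<open>Right modules with a strict filtration are direct sums of modules vL\<close>

section \<open>Filtered modules are free\<close>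

text \<open>
  The relations of a vertex weighted Leavitt path algebra are symmetric in the two families of
  places attached to a regular vertex \<open>t\<close>: the indices \<open>1, \<dots>, w t\<close> (side \<open>True\<close>), all located at
  \<open>t\<close>, and the edges emitted by \<open>t\<close> (side \<open>False\<close>), located at their ranges. Here \<open>x True t i e\<close>
  is $e_i$ and \<open>x False t e i\<close> is $e_i^*$.
\<close>

locale two_sided = ring L for L :: "('a, 'm) ring_scheme" (structure) +
  fixes \<kappa> :: "'a set" and V :: "'v set" and p :: "'v \<Rightarrow> 'a"
    and T :: "'t set" and P :: "bool \<Rightarrow> 't \<Rightarrow> 'q set" and loc :: "bool \<Rightarrow> 't \<Rightarrow> 'q \<Rightarrow> 'v"
    and x :: "bool \<Rightarrow> 't \<Rightarrow> 'q \<Rightarrow> 'q \<Rightarrow> 'a"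
  assumes kappa_closed: "\<kappa> \<subseteq> carrier L" "\<one> \<in> \<kappa>" "\<And>a b. a \<in> \<kappa> \<Longrightarrow> b \<in> \<kappa> \<Longrightarrow> a \<oplus> b \<in> \<kappa>"
      "\<And>a b. a \<in> \<kappa> \<Longrightarrow> b \<in> \<kappa> \<Longrightarrow> a \<otimes> b \<in> \<kappa>" "\<And>a. a \<in> \<kappa> \<Longrightarrow> \<ominus> a \<in> \<kappa>"
    and kappa_central: "\<And>a b. a \<in> \<kappa> \<Longrightarrow> b \<in> carrier L \<Longrightarrow> a \<otimes> b = b \<otimes> a"
    and kappa_inv: "\<And>a. a \<in> \<kappa> \<Longrightarrow> a \<noteq> \<zero> \<Longrightarrow> \<exists>b\<in>\<kappa>. a \<otimes> b = \<one>"
    and finite_V: "finite V" and finite_T: "finite T" and finite_P: "t \<in> T \<Longrightarrow> finite (P s t)"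
    and p_closed: "v \<in> V \<Longrightarrow> p v \<in> carrier L"
    and p_mult: "u \<in> V \<Longrightarrow> v \<in> V \<Longrightarrow> p u \<otimes> p v = (if u = v then p u else \<zero>)"
    and p_sum: "(\<Oplus>v\<in>V. p v) = \<one>"
    and loc_V: "t \<in> T \<Longrightarrow> q \<in> P s t \<Longrightarrow> loc s t q \<in> V"
    and x_closed: "\<lbrakk>t \<in> T; q \<in> P s t; q' \<in> P (\<not> s) t\<rbrakk> \<Longrightarrow> x s t q q' \<in> carrier L"
    and p_x: "\<lbrakk>t \<in> T; q \<in> P s t; q' \<in> P (\<not> s) t\<rbrakk> \<Longrightarrow> p (loc s t q) \<otimes> x s t q q' = x s t q q'"
    and x_p: "\<lbrakk>t \<in> T; q \<in> P s t; q' \<in> P (\<not> s) t\<rbrakk> \<Longrightarrow> x s t q q' \<otimes> p (loc (\<not> s) t q') = x s t q q'"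
    and x_x: "\<lbrakk>t \<in> T; q \<in> P s t; q'' \<in> P s t\<rbrakk>
      \<Longrightarrow> (\<Oplus>q'\<in>P (\<not> s) t. x s t q q' \<otimes> x (\<not> s) t q' q'') = (if q = q'' then p (loc s t q) else \<zero>)"
    and generated: "\<And>S. \<lbrakk>S \<subseteq> carrier L; \<kappa> \<subseteq> S; \<And>v. v \<in> V \<Longrightarrow> p v \<in> S;
        \<And>s t q q'. \<lbrakk>t \<in> T; q \<in> P s t; q' \<in> P (\<not> s) t\<rbrakk> \<Longrightarrow> x s t q q' \<in> S;
        \<And>a b. a \<in> S \<Longrightarrow> b \<in> S \<Longrightarrow> a \<oplus> b \<in> S; \<And>a b. a \<in> S \<Longrightarrow> b \<in> S \<Longrightarrow> a \<otimes> b \<in> S\<rbrakk> \<Longrightarrow> S = carrier L"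
begin

lemma kappa_carrier: "a \<in> \<kappa> \<Longrightarrow> a \<in> carrier L"
  using kappa_closed(1) by auto

lemma kappa_zero: "\<zero> \<in> \<kappa>"
  using kappa_closed(3)[OF kappa_closed(2) kappa_closed(5)[OF kappa_closed(2)]] by (simp add: r_neg)

lemma x_p_other:
  assumes "t \<in> T" "q \<in> P s t" "q' \<in> P (\<not> s) t" "u \<in> V"
  shows "x s t q q' \<otimes> p u = (if u = loc (\<not> s) t q' then x s t q q' else \<zero>)"
proof -
  have "x s t q q' \<otimes> p u = x s t q q' \<otimes> (p (loc (\<not> s) t q') \<otimes> p u)"
    using x_p[OF assms(1-3)] x_closed[OF assms(1-3)] p_closed assms loc_V by (metis m_assoc)
  then show ?thesis
    using p_mult[OF loc_V[OF assms(1,3)] assms(4)] x_p[OF assms(1-3)] x_closed[OF assms(1-3)] by auto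
qed

text \<open>A general combination of the letters of one side. The coefficients depend on both
  places, one for each matrix entry. The sum over q is innermost because, for fixed q', it is this
  sum that the inverse matrix can undo.\<close>

definition comb :: "('a, 'b, 'n) module_scheme \<Rightarrow> bool \<Rightarrow> ('t \<Rightarrow> 'q \<Rightarrow> 'q \<Rightarrow> 'b) \<Rightarrow> 'b" where
  "comb N s \<alpha> = (\<Oplus>\<^bsub>N\<^esub>t\<in>T. \<Oplus>\<^bsub>N\<^esub>q'\<in>P (\<not> s) t. \<Oplus>\<^bsub>N\<^esub>q\<in>P s t. x s t q q' \<odot>\<^bsub>N\<^esub> \<alpha> t q q')"

definition places :: "bool \<Rightarrow> 'b set \<Rightarrow> ('t \<Rightarrow> 'q \<Rightarrow> 'q \<Rightarrow> 'b) set" where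
  "places s S = {\<alpha>. \<forall>t\<in>T. \<forall>q\<in>P s t. \<forall>q'\<in>P (\<not> s) t. \<alpha> t q q' \<in> S}"

lemma placesD: "\<lbrakk>\<alpha> \<in> places s S; t \<in> T; q \<in> P s t; q' \<in> P (\<not> s) t\<rbrakk> \<Longrightarrow> \<alpha> t q q' \<in> S"
  by (simp add: places_def)

lemma places_mono: "S \<subseteq> S' \<Longrightarrow> places s S \<subseteq> places s S'"
  by (auto simp: places_def)

context
  fixes N :: "('a, 'b, 'n) module_scheme"
  assumes N: "rmodule L N"
begin

interpretation N: rmodule L N by (rule N)

lemma comb_mem:
  assumes "S \<subseteq> carrier N" "\<zero>\<^bsub>N\<^esub> \<in> S" "\<And>y z. y \<in> S \<Longrightarrow> z \<in> S \<Longrightarrow> y \<oplus>\<^bsub>N\<^esub> z \<in> S"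
    "\<And>t q q'. \<lbrakk>t \<in> T; q \<in> P s t; q' \<in> P (\<not> s) t\<rbrakk> \<Longrightarrow> x s t q q' \<odot>\<^bsub>N\<^esub> \<alpha> t q q' \<in> S"
  shows "comb N s \<alpha> \<in> S"
  unfolding comb_def using assms
  by (intro N.M.finsum_mem) auto

lemma term_closed: "\<lbrakk>\<alpha> \<in> places s (carrier N); t \<in> T; q \<in> P s t; q' \<in> P (\<not> s) t\<rbrakk>
  \<Longrightarrow> x s t q q' \<odot>\<^bsub>N\<^esub> \<alpha> t q q' \<in> carrier N"
  using N.act_closed[OF x_closed[of t q s q'] placesD[of \<alpha> s "carrier N" t q q']] by blast

lemma comb_closed: "\<alpha> \<in> places s (carrier N) \<Longrightarrow> comb N s \<alpha> \<in> carrier N"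
  by (rule comb_mem) (simp_all add: term_closed)

lemma comb_cong:
  assumes "\<alpha> \<in> places s (carrier N)"
    "\<And>t q q'. \<lbrakk>t \<in> T; q \<in> P s t; q' \<in> P (\<not> s) t\<rbrakk> \<Longrightarrow> x s t q q' \<odot>\<^bsub>N\<^esub> \<alpha> t q q' = x s t q q' \<odot>\<^bsub>N\<^esub> \<beta> t q q'"
  shows "comb N s \<alpha> = comb N s \<beta>"
proof -
  have c: "x s t q q' \<odot>\<^bsub>N\<^esub> \<beta> t q q' \<in> carrier N" if "t \<in> T" "q \<in> P s t" "q' \<in> P (\<not> s) t" for t q q'
    using assms(2)[OF that] term_closed[OF assms(1) that] by simp
  show ?thesis
    unfolding comb_def using assms(2) c by (intro N.M.finsum_cong') (auto intro!: N.M.finsum_closed)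
qed

lemma comb_add:
  assumes "\<alpha> \<in> places s (carrier N)" "\<beta> \<in> places s (carrier N)"
  shows "comb N s (\<lambda>t q q'. \<alpha> t q q' \<oplus>\<^bsub>N\<^esub> \<beta> t q q') = comb N s \<alpha> \<oplus>\<^bsub>N\<^esub> comb N s \<beta>"
  unfolding comb_def
  using assms term_closed x_closed placesD[OF assms(1)] placesD[OF assms(2)]
  by (intro N.M.finsum_addI N.M.finsum_closed funcsetI) (auto simp: N.act_add_right)

lemma comb_act:
  assumes "\<alpha> \<in> places s (carrier N)" "\<beta> \<in> places s (carrier N)" "a \<in> carrier L"
    "\<And>t q q'. \<lbrakk>t \<in> T; q \<in> P s t; q' \<in> P (\<not> s) t\<rbrakk> \<Longrightarrow> a \<odot>\<^bsub>N\<^esub> (x s t q q' \<odot>\<^bsub>N\<^esub> \<alpha> t q q') = x s t q q' \<odot>\<^bsub>N\<^esub> \<beta> t q q'"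
  shows "a \<odot>\<^bsub>N\<^esub> comb N s \<alpha> = comb N s \<beta>"
  unfolding comb_def using assms term_closed
  by (intro N.act_finsumI N.M.finsum_closed funcsetI) auto

lemma comb_kappa:
  assumes "\<alpha> \<in> places s (carrier N)" "a \<in> \<kappa>"
  shows "a \<odot>\<^bsub>N\<^esub> comb N s \<alpha> = comb N s (\<lambda>t q q'. a \<odot>\<^bsub>N\<^esub> \<alpha> t q q')"
proof -
  have "a \<odot>\<^bsub>N\<^esub> (x s t q q' \<odot>\<^bsub>N\<^esub> \<alpha> t q q') = x s t q q' \<odot>\<^bsub>N\<^esub> (a \<odot>\<^bsub>N\<^esub> \<alpha> t q q')"
    if "t \<in> T" "q \<in> P s t" "q' \<in> P (\<not> s) t" for t q q'
    using that assms kappa_central x_closed placesD[OF assms(1)] kappa_carrier by (metis N.act_mult)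
  then show ?thesis
    using assms kappa_carrier placesD[OF assms(1)] by (intro comb_act) (auto simp: places_def)
qed

lemma comb_p:
  assumes "\<alpha> \<in> places s (carrier N)" "u \<in> V"
  shows "p u \<odot>\<^bsub>N\<^esub> comb N s \<alpha> = comb N s (\<lambda>t q q'. if u = loc (\<not> s) t q' then \<alpha> t q q' else \<zero>\<^bsub>N\<^esub>)"
proof -
  have "p u \<odot>\<^bsub>N\<^esub> (x s t q q' \<odot>\<^bsub>N\<^esub> \<alpha> t q q') = x s t q q' \<odot>\<^bsub>N\<^esub> (if u = loc (\<not> s) t q' then \<alpha> t q q' else \<zero>\<^bsub>N\<^esub>)"
    if "t \<in> T" "q \<in> P s t" "q' \<in> P (\<not> s) t" for t q q'
    using that assms x_closed[OF that] placesD[OF assms(1) that] p_closed x_p_other[OF that assms(2)]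
    by (subst N.act_mult[symmetric]) auto
  then show ?thesis
    using assms p_closed placesD[OF assms(1)] by (intro comb_act) (auto simp: places_def)
qed

text \<open>Multiplication by the matrix of one side and then by the matrix of the other gives back
  each entry, cut down by the idempotent at its location: interchange the two sums and apply
  \<open>x_x\<close>.\<close>

lemma x_inverse:
  assumes t: "t \<in> T" "q \<in> P s t" and \<gamma>: "\<And>q1. q1 \<in> P s t \<Longrightarrow> \<gamma> q1 \<in> carrier N"
  shows "(\<Oplus>\<^bsub>N\<^esub>q'\<in>P (\<not> s) t. x (\<not> s) t q' q \<odot>\<^bsub>N\<^esub> (\<Oplus>\<^bsub>N\<^esub>q1\<in>P s t. x s t q1 q' \<odot>\<^bsub>N\<^esub> \<gamma> q1)) = p (loc s t q) \<odot>\<^bsub>N\<^esub> \<gamma> q"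
proof -
  have xc: "x s t q1 q' \<in> carrier L" "x (\<not> s) t q' q \<in> carrier L" if "q1 \<in> P s t" "q' \<in> P (\<not> s) t" for q1 q'
    using x_closed[of t q1 s q'] x_closed[of t q' "\<not> s" q] t that by simp_all
  have "(\<Oplus>\<^bsub>N\<^esub>q'\<in>P (\<not> s) t. x (\<not> s) t q' q \<odot>\<^bsub>N\<^esub> (\<Oplus>\<^bsub>N\<^esub>q1\<in>P s t. x s t q1 q' \<odot>\<^bsub>N\<^esub> \<gamma> q1))
      = (\<Oplus>\<^bsub>N\<^esub>q'\<in>P (\<not> s) t. \<Oplus>\<^bsub>N\<^esub>q1\<in>P s t. (x s t q1 q' \<otimes> x (\<not> s) t q' q) \<odot>\<^bsub>N\<^esub> \<gamma> q1)"
    using xc t(2) \<gamma> by (intro N.M.finsum_cong' refl N.act_finsumI) (auto simp: N.act_mult intro!: N.M.finsum_closed N.act_closed)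
  also have "\<dots> = (\<Oplus>\<^bsub>N\<^esub>q1\<in>P s t. \<Oplus>\<^bsub>N\<^esub>q'\<in>P (\<not> s) t. (x s t q1 q' \<otimes> x (\<not> s) t q' q) \<odot>\<^bsub>N\<^esub> \<gamma> q1)"
    using xc t \<gamma> finite_P by (intro N.M.finsum_swap) (auto intro!: N.act_closed)
  also have "\<dots> = (\<Oplus>\<^bsub>N\<^esub>q1\<in>P s t. if q1 = q then p (loc s t q1) \<odot>\<^bsub>N\<^esub> \<gamma> q1 else \<zero>\<^bsub>N\<^esub>)"
  proof (rule N.M.finsum_cong')
    fix q1 assume q1: "q1 \<in> P s t"
    have "(\<Oplus>\<^bsub>N\<^esub>q'\<in>P (\<not> s) t. (x s t q1 q' \<otimes> x (\<not> s) t q' q) \<odot>\<^bsub>N\<^esub> \<gamma> q1)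
        = (\<Oplus>q'\<in>P (\<not> s) t. x s t q1 q' \<otimes> x (\<not> s) t q' q) \<odot>\<^bsub>N\<^esub> \<gamma> q1"
      using xc[OF q1] xc(2)[OF t(2)] \<gamma>[OF q1] by (intro N.act_finsum_left[symmetric]) auto
    then show "(\<Oplus>\<^bsub>N\<^esub>q'\<in>P (\<not> s) t. (x s t q1 q' \<otimes> x (\<not> s) t q' q) \<odot>\<^bsub>N\<^esub> \<gamma> q1)
        = (if q1 = q then p (loc s t q1) \<odot>\<^bsub>N\<^esub> \<gamma> q1 else \<zero>\<^bsub>N\<^esub>)"
      using x_x[OF t(1) q1 t(2)] \<gamma>[OF q1] by simp
  qed (use p_closed loc_V t \<gamma> in \<open>auto intro!: N.act_closed\<close>)
  also have "\<dots> = p (loc s t q) \<odot>\<^bsub>N\<^esub> \<gamma> q"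
    using p_closed loc_V t \<gamma> finite_P by (subst N.M.finsum_delta) (auto intro!: N.act_closed)
  finally show ?thesis .
qed

lemma comb_single:
  assumes "t \<in> T" "q \<in> P s t" "q' \<in> P (\<not> s) t" "y \<in> carrier N"
  shows "x s t q q' \<odot>\<^bsub>N\<^esub> y = comb N s (\<lambda>t1 q1 q1'. if t1 = t \<and> q1 = q \<and> q1' = q' then y else \<zero>\<^bsub>N\<^esub>)"
proof -
  let ?\<alpha> = "\<lambda>t1 q1 q1'. if t1 = t \<and> q1 = q \<and> q1' = q' then y else \<zero>\<^bsub>N\<^esub>"
  have "comb N s ?\<alpha> = (\<Oplus>\<^bsub>N\<^esub>q1'\<in>P (\<not> s) t. \<Oplus>\<^bsub>N\<^esub>q1\<in>P s t. x s t q1 q1' \<odot>\<^bsub>N\<^esub> ?\<alpha> t q1 q1')"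
    unfolding comb_def using assms finite_T x_closed
    by (intro N.M.finsum_single) (auto intro!: N.M.finsum_closed N.M.finsum_zeroI)
  also have "\<dots> = (\<Oplus>\<^bsub>N\<^esub>q1\<in>P s t. x s t q1 q' \<odot>\<^bsub>N\<^esub> ?\<alpha> t q1 q')"
    using assms finite_P x_closed
    by (intro N.M.finsum_single) (auto intro!: N.M.finsum_closed N.M.finsum_zeroI)
  also have "\<dots> = x s t q q' \<odot>\<^bsub>N\<^esub> ?\<alpha> t q q'"
    using assms finite_P x_closed by (intro N.M.finsum_single) auto
  finally show ?thesis by simp
qed

end

end

lemma (in two_sided) comb_hom:
  assumes "rmodule L N" "rmodule L N'" "f \<in> carrier N \<rightarrow> carrier N'"
    "\<And>y z. \<lbrakk>y \<in> carrier N; z \<in> carrier N\<rbrakk> \<Longrightarrow> f (y \<oplus>\<^bsub>N\<^esub> z) = f y \<oplus>\<^bsub>N'\<^esub> f z"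
    "\<And>a y. \<lbrakk>a \<in> carrier L; y \<in> carrier N\<rbrakk> \<Longrightarrow> f (a \<odot>\<^bsub>N\<^esub> y) = a \<odot>\<^bsub>N'\<^esub> f y"
    "\<alpha> \<in> places s (carrier N)"
  shows "f (comb N s \<alpha>) = comb N' s (\<lambda>t q q'. f (\<alpha> t q q'))"
proof -
  interpret N: rmodule L N by fact
  interpret N': rmodule L N' by fact
  have fs: "f (finsum N g S) = (\<Oplus>\<^bsub>N'\<^esub>i\<in>S. f (g i))" if "\<And>i. i \<in> S \<Longrightarrow> g i \<in> carrier N" for g and S :: "'i set"
    using that assms(3,4) by (intro additive_finsum) (auto simp: N.M.abelian_group_axioms N'.M.abelian_group_axioms)
  have c: "x s t q q' \<odot>\<^bsub>N\<^esub> \<alpha> t q q' \<in> carrier N" if "t \<in> T" "q \<in> P s t" "q' \<in> P (\<not> s) t" for t q q'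
    using term_closed[OF assms(1,6) that] .
  have fsI: "f (finsum N g S) = finsum N' h S"
    if "\<And>i. i \<in> S \<Longrightarrow> g i \<in> carrier N" "\<And>i. i \<in> S \<Longrightarrow> f (g i) = h i" for g h and S :: "'i set"
  proof -
    have "h i \<in> carrier N'" if "i \<in> S" for i
      using \<open>i \<in> S \<Longrightarrow> g i \<in> carrier N\<close> \<open>i \<in> S \<Longrightarrow> f (g i) = h i\<close> that assms(3) by (metis Pi_mem)
    then show ?thesis using that by (subst fs) (auto intro!: N'.M.finsum_cong')
  qed
  show ?thesis
    unfolding comb_def using c assms(5) x_closed placesD[OF assms(6)]
    by (intro fsI N.M.finsum_closed funcsetI) auto
qed

text \<open>
  \<open>U_strict\<close> says that, modulo \<open>U (Suc k)\<close>, the only relations with coefficients in \<open>U (Suc k)\<close>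
  between the letters of side \<open>even (Suc k)\<close> are those forced by \<open>x_x\<close>: in such a relation the
  coefficients come from \<open>U k\<close> by multiplication with letters of the other side.
\<close>

locale filtered_module = two_sided L \<kappa> V p T P loc x + M?: rmodule L M
  for L :: "('a, 'm) ring_scheme" (structure) and \<kappa> :: "'a set" and V :: "'v set" and p :: "'v \<Rightarrow> 'a"
    and T :: "'t set" and P :: "bool \<Rightarrow> 't \<Rightarrow> 'q set" and loc :: "bool \<Rightarrow> 't \<Rightarrow> 'q \<Rightarrow> 'v"
    and x :: "bool \<Rightarrow> 't \<Rightarrow> 'q \<Rightarrow> 'q \<Rightarrow> 'a" and M :: "('a, 'b, 'n) module_scheme" (structure) +
  fixes U :: "nat \<Rightarrow> 'b set"
  assumes U_carrier: "U k \<subseteq> carrier M" and U_0: "U 0 = {\<zero>\<^bsub>M\<^esub>}" and U_zero: "\<zero>\<^bsub>M\<^esub> \<in> U k"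
    and U_add: "\<lbrakk>y \<in> U k; z \<in> U k\<rbrakk> \<Longrightarrow> y \<oplus>\<^bsub>M\<^esub> z \<in> U k"
    and U_kappa: "\<lbrakk>c \<in> \<kappa>; z \<in> U k\<rbrakk> \<Longrightarrow> c \<odot>\<^bsub>M\<^esub> z \<in> U k"
    and U_p: "\<lbrakk>v \<in> V; z \<in> U k\<rbrakk> \<Longrightarrow> p v \<odot>\<^bsub>M\<^esub> z \<in> U k"
    and U_mono: "U k \<subseteq> U (Suc k)"
    and U_step: "\<lbrakk>z \<in> U k; t \<in> T; q \<in> P (even k) t; q' \<in> P (odd k) t\<rbrakk> \<Longrightarrow> x (even k) t q q' \<odot>\<^bsub>M\<^esub> z \<in> U (Suc k)"
    and U_strict: "\<lbrakk>s = even (Suc k); \<alpha> \<in> places s (U (Suc k)); comb M s \<alpha> \<in> U (Suc k);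
        t \<in> T; q' \<in> P (\<not> s) t; q'' \<in> P (\<not> s) t\<rbrakk>
      \<Longrightarrow> (\<Oplus>\<^bsub>M\<^esub>q\<in>P s t. x s t q q'' \<odot>\<^bsub>M\<^esub> \<alpha> t q q') \<in> U k"
    and U_exhaust: "carrier M = (\<Union>k. U k)"
begin

lemma U_mem: "z \<in> U k \<Longrightarrow> z \<in> carrier M"
  using U_carrier by auto

lemma rmod: "rmodule L M"
  by (rule M.rmodule_axioms)

lemma U_places: "\<alpha> \<in> places s (U k) \<Longrightarrow> \<alpha> \<in> places s (carrier M)"
  using places_mono[OF U_carrier] by blast

text \<open>The part of the next piece that is forced by the present one: its elements, and their
  products with the letters allowed at this step. New generators are counted modulo this
  part.\<close>

definition old :: "nat \<Rightarrow> 'b set" where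
  "old k = {u \<oplus>\<^bsub>M\<^esub> comb M (even k) \<alpha> |u \<alpha>. u \<in> U k \<and> \<alpha> \<in> places (even k) (U k)}"

lemma comb_U: "\<alpha> \<in> places (even k) (U k) \<Longrightarrow> comb M (even k) \<alpha> \<in> U (Suc k)"
  by (rule comb_mem[OF rmod]) (use U_carrier U_zero U_add U_step in \<open>auto simp: places_def\<close>)

lemma old_U: "old k \<subseteq> U (Suc k)"
  using comb_U U_mono U_add unfolding old_def by blast

lemma old_carrier: "z \<in> old k \<Longrightarrow> z \<in> carrier M"
  using old_U U_carrier by blast

lemma old_add: "\<lbrakk>y \<in> old k; z \<in> old k\<rbrakk> \<Longrightarrow> y \<oplus>\<^bsub>M\<^esub> z \<in> old k"
proof -
  assume "y \<in> old k" "z \<in> old k"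
  then obtain u \<alpha> u' \<alpha>' where *: "u \<in> U k" "\<alpha> \<in> places (even k) (U k)" "y = u \<oplus>\<^bsub>M\<^esub> comb M (even k) \<alpha>"
    "u' \<in> U k" "\<alpha>' \<in> places (even k) (U k)" "z = u' \<oplus>\<^bsub>M\<^esub> comb M (even k) \<alpha>'"
    by (auto simp: old_def)
  have c: "comb M (even k) \<alpha> \<in> carrier M" "comb M (even k) \<alpha>' \<in> carrier M"
    using * comb_closed[OF rmod] U_places by auto
  have "y \<oplus>\<^bsub>M\<^esub> z = (u \<oplus>\<^bsub>M\<^esub> u') \<oplus>\<^bsub>M\<^esub> (comb M (even k) \<alpha> \<oplus>\<^bsub>M\<^esub> comb M (even k) \<alpha>')"
    using * c U_mem by (simp add: M.a_ac)
  also have "comb M (even k) \<alpha> \<oplus>\<^bsub>M\<^esub> comb M (even k) \<alpha>'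
      = comb M (even k) (\<lambda>t q q'. \<alpha> t q q' \<oplus>\<^bsub>M\<^esub> \<alpha>' t q q')"
    using * U_places by (simp add: comb_add[OF rmod])
  also have "(u \<oplus>\<^bsub>M\<^esub> u') \<oplus>\<^bsub>M\<^esub> \<dots> \<in> old k"
    unfolding old_def using * U_add by (auto simp: places_def intro!: exI)
  finally show ?thesis .
qed

lemma old_kappa: "\<lbrakk>c \<in> \<kappa>; z \<in> old k\<rbrakk> \<Longrightarrow> c \<odot>\<^bsub>M\<^esub> z \<in> old k"
proof -
  assume c: "c \<in> \<kappa>" and "z \<in> old k"
  then obtain u \<alpha> where *: "u \<in> U k" "\<alpha> \<in> places (even k) (U k)" "z = u \<oplus>\<^bsub>M\<^esub> comb M (even k) \<alpha>"
    by (auto simp: old_def)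
  have "comb M (even k) \<alpha> \<in> carrier M" using * comb_closed[OF rmod] U_places by auto
  then have "c \<odot>\<^bsub>M\<^esub> z = c \<odot>\<^bsub>M\<^esub> u \<oplus>\<^bsub>M\<^esub> c \<odot>\<^bsub>M\<^esub> comb M (even k) \<alpha>"
    using * c U_mem kappa_carrier by (simp add: act_add_right)
  also have "c \<odot>\<^bsub>M\<^esub> comb M (even k) \<alpha> = comb M (even k) (\<lambda>t q q'. c \<odot>\<^bsub>M\<^esub> \<alpha> t q q')"
    using * c U_places by (simp add: comb_kappa[OF rmod])
  also have "c \<odot>\<^bsub>M\<^esub> u \<oplus>\<^bsub>M\<^esub> \<dots> \<in> old k"
    unfolding old_def using * c U_kappa by (auto simp: places_def intro!: exI)
  finally show ?thesis .
qed

lemma U_old: "u \<in> U k \<Longrightarrow> u \<in> old k"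
proof -
  assume u: "u \<in> U k"
  have "comb M (even k) (\<lambda>_ _ _. \<zero>\<^bsub>M\<^esub>) = \<zero>\<^bsub>M\<^esub>"
    using comb_mem[OF rmod, of "{\<zero>\<^bsub>M\<^esub>}" "even k" "\<lambda>_ _ _. \<zero>\<^bsub>M\<^esub>"] x_closed by simp
  then have "u = u \<oplus>\<^bsub>M\<^esub> comb M (even k) (\<lambda>_ _ _. \<zero>\<^bsub>M\<^esub>)" using U_mem[OF u] by simp
  then show "u \<in> old k" unfolding old_def using u U_zero by (auto simp: places_def intro!: exI)
qed

text \<open>Independence over the field \<open>\<kappa>\<close>, not over L, and modulo the old
  part. Each element carries the vertex that fixes it, because it is to generate a summand
  isomorphic to vL.\<close>

definition indep :: "nat \<Rightarrow> ('v \<times> 'b) set \<Rightarrow> bool" where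
  "indep k Z \<longleftrightarrow> Z \<subseteq> {(v, z). v \<in> V \<and> z \<in> U (Suc k) \<and> p v \<odot>\<^bsub>M\<^esub> z = z} \<and>
     (\<forall>c \<in> carrier (fsupp L Z). (\<forall>j. c j \<in> \<kappa>) \<longrightarrow> lin snd c \<in> old k \<longrightarrow> (\<forall>j. c j = \<zero>))"

definition span :: "nat \<Rightarrow> ('v \<times> 'b) set \<Rightarrow> 'b set" where
  "span k Z = {u \<oplus>\<^bsub>M\<^esub> lin snd c |u c. u \<in> old k \<and> c \<in> carrier (fsupp L Z) \<and> (\<forall>j. c j \<in> \<kappa>)}"

lemma fsupp_mono: "Z \<subseteq> Z' \<Longrightarrow> carrier (fsupp L Z) \<subseteq> carrier (fsupp L Z')"
  unfolding fsupp_def by auto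

lemma snd_fun: "Z \<subseteq> {(v, z). v \<in> V \<and> z \<in> U (Suc k) \<and> p v \<odot>\<^bsub>M\<^esub> z = z} \<Longrightarrow> snd \<in> Z \<rightarrow> carrier M"
  using U_mem by auto

lemma fsupp_add: "c \<in> carrier (fsupp L Z) \<Longrightarrow> d \<in> carrier (fsupp L Z) \<Longrightarrow> (\<lambda>j. c j \<oplus> d j) \<in> carrier (fsupp L Z)"
proof -
  interpret F: rmodule L "fsupp L Z" by (rule fsupp_rmodule) (rule ring_axioms)
  show "c \<in> carrier (fsupp L Z) \<Longrightarrow> d \<in> carrier (fsupp L Z) \<Longrightarrow> (\<lambda>j. c j \<oplus> d j) \<in> carrier (fsupp L Z)"
    using F.M.a_closed[of c d] by (simp add: fsupp_simps(2))
qed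

lemma fsupp_act: "c \<in> carrier (fsupp L Z) \<Longrightarrow> a \<in> carrier L \<Longrightarrow> (\<lambda>j. c j \<otimes> a) \<in> carrier (fsupp L Z)"
proof -
  interpret F: rmodule L "fsupp L Z" by (rule fsupp_rmodule) (rule ring_axioms)
  show "c \<in> carrier (fsupp L Z) \<Longrightarrow> a \<in> carrier L \<Longrightarrow> (\<lambda>j. c j \<otimes> a) \<in> carrier (fsupp L Z)"
    using F.act_closed[of a c] by (simp add: fsupp_simps(3))
qed

text \<open>A basis of a quotient vector space, chosen among elements fixed by a single vertex
  idempotent. Zorn's lemma gives a maximal independent set; it spans because \<open>\<kappa>\<close>
  is a field and because every element is the sum of its components at the vertices.\<close>

lemma indep_basis: "\<exists>Z. indep k Z \<and> U (Suc k) \<subseteq> span k Z"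
proof -
  have "\<exists>Z\<in>{Z. indep k Z}. \<forall>Z'\<in>{Z. indep k Z}. Z \<subseteq> Z' \<longrightarrow> Z' = Z"
  proof (rule subset_Zorn')
    fix C assume C: "subset.chain {Z. indep k Z} C"
    then have i: "indep k Z" if "Z \<in> C" for Z using that by (auto simp: subset_chain_def)
    have "\<forall>j. c j = \<zero>"
      if c: "c \<in> carrier (fsupp L (\<Union> C))" "\<forall>j. c j \<in> \<kappa>" "lin snd c \<in> old k" for c
    proof (cases "C = {}")
      case True
      then show ?thesis using c(1) by (auto simp: fsupp_simps supp_def)
    next
      case False
      \<comment> \<open>A dependence relation involves finitely many elements, so it already lives
        in one member of the chain.\<close>
      then obtain Z where Z: "Z \<in> C" "supp L c \<subseteq> Z"
        using finite_subset_Union_chain[of "supp L c" C "{Z. indep k Z}"] c(1) C by (auto simp: fsupp_simps)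
      then have "c \<in> carrier (fsupp L Z)" using c(1) by (simp add: fsupp_simps)
      then show ?thesis using i[OF Z(1)] c unfolding indep_def by blast
    qed
    moreover have "\<Union> C \<subseteq> {(v, z). v \<in> V \<and> z \<in> U (Suc k) \<and> p v \<odot>\<^bsub>M\<^esub> z = z}"
      using i unfolding indep_def by blast
    ultimately show "\<Union> C \<in> {Z. indep k Z}" by (simp add: indep_def)
  qed
  then obtain Z where Z: "indep k Z" and max: "\<And>Z'. indep k Z' \<Longrightarrow> Z \<subseteq> Z' \<Longrightarrow> Z' = Z" by auto
  have Zs: "Z \<subseteq> {(v, z). v \<in> V \<and> z \<in> U (Suc k) \<and> p v \<odot>\<^bsub>M\<^esub> z = z}" using Z by (simp add: indep_def)
  note sf = snd_fun[OF Zs]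
  have zero: "(\<lambda>_. \<zero>) \<in> carrier (fsupp L Z)" by (simp add: fsupp_simps supp_def)
  have old_span: "u \<in> span k Z" if "u \<in> old k" for u
  proof -
    have "u = u \<oplus>\<^bsub>M\<^esub> lin snd (\<lambda>_. \<zero>)" using old_carrier[OF that] by (simp add: lin_zero)
    then show ?thesis unfolding span_def using that zero kappa_zero by blast
  qed
  have span_add: "y \<oplus>\<^bsub>M\<^esub> z \<in> span k Z" if yz: "y \<in> span k Z" "z \<in> span k Z" for y z
  proof -
    obtain u c u' c' where *: "y = u \<oplus>\<^bsub>M\<^esub> lin snd c" "u \<in> old k" "c \<in> carrier (fsupp L Z)" "\<forall>j. c j \<in> \<kappa>"
      "z = u' \<oplus>\<^bsub>M\<^esub> lin snd c'" "u' \<in> old k" "c' \<in> carrier (fsupp L Z)" "\<forall>j. c' j \<in> \<kappa>"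
      using yz unfolding span_def by blast
    have "y \<oplus>\<^bsub>M\<^esub> z = (u \<oplus>\<^bsub>M\<^esub> u') \<oplus>\<^bsub>M\<^esub> (lin snd c \<oplus>\<^bsub>M\<^esub> lin snd c')"
      using * old_carrier lin_closed[OF sf] by (simp add: M.a_ac)
    also have "lin snd c \<oplus>\<^bsub>M\<^esub> lin snd c' = lin snd (\<lambda>j. c j \<oplus> c' j)"
      using * by (simp add: lin_add[OF sf])
    also have "(u \<oplus>\<^bsub>M\<^esub> u') \<oplus>\<^bsub>M\<^esub> \<dots> \<in> span k Z"
      unfolding span_def using * old_add fsupp_add kappa_closed(3) by blast
    finally show ?thesis .
  qed
  have hom_span: "z \<in> span k Z" if z: "z \<in> U (Suc k)" "p v \<odot>\<^bsub>M\<^esub> z = z" "v \<in> V" for v z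
  proof (cases "(v, z) \<in> Z")
    case True
    have "z = \<zero>\<^bsub>M\<^esub> \<oplus>\<^bsub>M\<^esub> lin snd (single L (v, z) \<one>)"
      using U_mem[OF z(1)] by (simp add: lin_single)
    moreover have "single L (v, z) \<one> \<in> carrier (fsupp L Z)" using True by (simp add: single_closed)
    moreover have "single L (v, z) \<one> j \<in> \<kappa>" for j using kappa_zero kappa_closed(2) by (simp add: single_def)
    moreover have "\<zero>\<^bsub>M\<^esub> \<in> old k" using U_old U_zero by blast
    ultimately show ?thesis unfolding span_def by blast
  next
    case False
    let ?Z = "insert (v, z) Z"
    have Z's: "?Z \<subseteq> {(v, z). v \<in> V \<and> z \<in> U (Suc k) \<and> p v \<odot>\<^bsub>M\<^esub> z = z}" using Zs z by auto
    \<comment> \<open>By maximality there is a nontrivial relation involving z; solving it for z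
      puts z into the span.\<close>
    have "\<not> indep k ?Z" using max[of ?Z] False by blast
    then obtain c i where c: "c \<in> carrier (fsupp L ?Z)" "\<forall>j. c j \<in> \<kappa>" "lin snd c \<in> old k" "c i \<noteq> \<zero>"
      using Z's unfolding indep_def by blast
    have zc: "z \<in> carrier M" using U_mem z(1) .
    define a where "a = c (v, z)"
    define c0 where "c0 = (\<lambda>j. if j = (v, z) then \<zero> else c j)"
    have ak: "a \<in> \<kappa>" using c(2) by (simp add: a_def)
    have c0: "c0 \<in> carrier (fsupp L Z)" "\<forall>j. c0 j \<in> \<kappa>"
    proof -
      have "supp L c0 = supp L c - {(v, z)}" by (auto simp: c0_def supp_def)
      then show "c0 \<in> carrier (fsupp L Z)" using c(1) by (auto simp: fsupp_simps c0_def)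
      show "\<forall>j. c0 j \<in> \<kappa>" using c(2) kappa_zero by (simp add: c0_def)
    qed
    have s: "single L (v, z) a \<in> carrier (fsupp L ?Z)" using ak kappa_carrier by (simp add: single_closed)
    have "c = (\<lambda>j. single L (v, z) a j \<oplus> c0 j)"
      using c(2) kappa_carrier by (auto simp: c0_def single_def a_def)
    then have "lin snd c = lin snd (\<lambda>j. single L (v, z) a j \<oplus> c0 j)" by simp
    also have "\<dots> = lin snd (single L (v, z) a) \<oplus>\<^bsub>M\<^esub> lin snd c0"
      using s c0(1) fsupp_mono[of Z ?Z] by (intro lin_add[OF snd_fun[OF Z's]]) blast+
    finally have lc: "lin snd c = a \<odot>\<^bsub>M\<^esub> z \<oplus>\<^bsub>M\<^esub> lin snd c0"
      using zc ak kappa_carrier by (simp add: lin_single)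
    \<comment> \<open>Otherwise the relation would only involve Z, which is independent.\<close>
    have "a \<noteq> \<zero>"
    proof
      assume a0: "a = \<zero>"
      then have "c = c0" by (auto simp: c0_def a_def)
      then show False using Z c0 c unfolding indep_def by blast
    qed
    then obtain b where b: "b \<in> \<kappa>" "a \<otimes> b = \<one>" using kappa_inv ak by blast
    have l0: "lin snd c0 \<in> carrier M" using lin_closed[OF sf c0(1)] .
    note kc = kappa_carrier[OF ak] kappa_carrier[OF b(1)]
    have "b \<odot>\<^bsub>M\<^esub> lin snd c = b \<odot>\<^bsub>M\<^esub> (a \<odot>\<^bsub>M\<^esub> z) \<oplus>\<^bsub>M\<^esub> b \<odot>\<^bsub>M\<^esub> lin snd c0"
      unfolding lc using kc zc l0 by (simp add: act_add_right)
    also have "b \<odot>\<^bsub>M\<^esub> (a \<odot>\<^bsub>M\<^esub> z) = z" using kc zc b by (simp flip: act_mult)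
    finally have "z = b \<odot>\<^bsub>M\<^esub> lin snd c \<oplus>\<^bsub>M\<^esub> (\<ominus> b) \<odot>\<^bsub>M\<^esub> lin snd c0"
      using kc zc l0 by (simp add: act_minus_left M.a_assoc M.r_neg)
    also have "(\<ominus> b) \<odot>\<^bsub>M\<^esub> lin snd c0 = lin snd (\<lambda>j. c0 j \<otimes> (\<ominus> b))"
      using kc c0(1) by (simp add: lin_act[OF sf])
    finally have ze: "z = b \<odot>\<^bsub>M\<^esub> lin snd c \<oplus>\<^bsub>M\<^esub> lin snd (\<lambda>j. c0 j \<otimes> (\<ominus> b))" .
    moreover have "(\<lambda>j. c0 j \<otimes> (\<ominus> b)) \<in> carrier (fsupp L Z)" using fsupp_act[OF c0(1), of "\<ominus> b"] kc by simp
    moreover have "\<forall>j. c0 j \<otimes> (\<ominus> b) \<in> \<kappa>" using kappa_closed(4)[OF _ kappa_closed(5)[OF b(1)]] c0(2) by simp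
    moreover have "b \<odot>\<^bsub>M\<^esub> lin snd c \<in> old k" by (rule old_kappa[OF b(1) c(3)])
    ultimately show ?thesis unfolding span_def by blast
  qed
  have "z \<in> span k Z" if z: "z \<in> U (Suc k)" for z
  proof -
    have zc: "z \<in> carrier M" using U_mem z .
    have "z = (\<Oplus>\<^bsub>M\<^esub>v\<in>V. p v \<odot>\<^bsub>M\<^esub> z)"
      using zc p_closed p_sum act_finsum_left[of z V p] by simp
    also have "\<dots> \<in> span k Z"
    proof (rule M.finsum_mem)
      show "p v \<odot>\<^bsub>M\<^esub> z \<in> span k Z" if v: "v \<in> V" for v
        using U_p[OF v z] v zc p_closed[OF v] p_mult[OF v v]
        by (intro hom_span[of _ v]) (auto simp flip: act_mult)
      show "\<zero>\<^bsub>M\<^esub> \<in> span k Z" using old_span U_old U_zero by blast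
      show "span k Z \<subseteq> carrier M" using old_carrier lin_closed[OF sf] by (auto simp: span_def)
    qed (rule span_add)
    finally show ?thesis .
  qed
  then show ?thesis using Z by blast
qed

end

context filtered_module
begin

declare split_paired_All [simp del] split_paired_Ex [simp del]

definition new :: "nat \<Rightarrow> ('v \<times> 'b) set" where
  "new k = (SOME Z. indep k Z \<and> U (Suc k) \<subseteq> span k Z)"

lemma new: "indep k (new k)" "U (Suc k) \<subseteq> span k (new k)"
  using someI_ex[OF indep_basis[of k]] by (simp_all add: new_def)

text \<open>The tag k records the step at which a generator is adjoined; without it equal pairs from
  different steps would be confused.\<close>

definition X :: "(nat \<times> 'v \<times> 'b) set" where
  "X = {(k, v, z). (v, z) \<in> new k}"

definition g :: "nat \<times> 'v \<times> 'b \<Rightarrow> 'b" where "g = (\<lambda>(k, v, z). z)"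
definition vt :: "nat \<times> 'v \<times> 'b \<Rightarrow> 'v" where "vt = (\<lambda>(k, v, z). v)"

lemma X_props: "j \<in> X \<Longrightarrow> vt j \<in> V" "j \<in> X \<Longrightarrow> g j \<in> U (Suc (fst j))" "j \<in> X \<Longrightarrow> p (vt j) \<odot>\<^bsub>M\<^esub> g j = g j"
proof -
  have n: "new k \<subseteq> {(v, z). v \<in> V \<and> z \<in> U (Suc k) \<and> p v \<odot>\<^bsub>M\<^esub> z = z}" for k
    using new(1) unfolding indep_def by blast
  show "j \<in> X \<Longrightarrow> vt j \<in> V" "j \<in> X \<Longrightarrow> g j \<in> U (Suc (fst j))" "j \<in> X \<Longrightarrow> p (vt j) \<odot>\<^bsub>M\<^esub> g j = g j"
    using n[of "fst j"] by (cases j; force simp: X_def g_def vt_def)+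
qed

lemma g_fun: "g \<in> X \<rightarrow> carrier M"
  using X_props(2) U_mem by blast

abbreviation "Y \<equiv> fsupp L X"

lemma Y_rmod: "rmodule L Y"
  by (rule fsupp_rmodule) (rule ring_axioms)

interpretation Y: rmodule L Y by (rule Y_rmod)

lemma Y_apply: "y \<in> carrier Y \<Longrightarrow> y j \<in> carrier L" "y \<in> carrier Y \<Longrightarrow> j \<notin> X \<Longrightarrow> y j = \<zero>"
  unfolding fsupp_def supp_def by auto

abbreviation f :: "(nat \<times> 'v \<times> 'b \<Rightarrow> 'a) \<Rightarrow> 'b" where "f \<equiv> lin g"

lemma f_closed: "y \<in> carrier Y \<Longrightarrow> f y \<in> carrier M"
  by (rule lin_closed[OF g_fun])

lemma f_add: "y \<in> carrier Y \<Longrightarrow> z \<in> carrier Y \<Longrightarrow> f (y \<oplus>\<^bsub>Y\<^esub> z) = f y \<oplus>\<^bsub>M\<^esub> f z"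
  unfolding fsupp_simps(2) by (rule lin_add[OF g_fun])

lemma f_act: "a \<in> carrier L \<Longrightarrow> y \<in> carrier Y \<Longrightarrow> f (a \<odot>\<^bsub>Y\<^esub> y) = a \<odot>\<^bsub>M\<^esub> f y"
  unfolding fsupp_simps(3) by (rule lin_act[OF g_fun])

lemma f_zero: "f \<zero>\<^bsub>Y\<^esub> = \<zero>\<^bsub>M\<^esub>"
  by (simp add: fsupp_simps(1) lin_zero)

lemma f_minus: "y \<in> carrier Y \<Longrightarrow> f (\<ominus>\<^bsub>Y\<^esub> y) = \<ominus>\<^bsub>M\<^esub> f y"
  using f_closed f_add by (intro additive_minus[of Y M f]) (auto simp: Y.M.abelian_group_axioms M.abelian_group_axioms)

lemma f_finsum: "(\<And>i. i \<in> S \<Longrightarrow> h i \<in> carrier Y) \<Longrightarrow> f (finsum Y h S) = (\<Oplus>\<^bsub>M\<^esub>i\<in>S. f (h i))"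
  using f_closed f_add by (intro additive_finsum[of Y M f]) (auto simp: Y.M.abelian_group_axioms M.abelian_group_axioms)

lemma f_comb: "\<alpha> \<in> places s (carrier Y) \<Longrightarrow> f (comb Y s \<alpha>) = comb M s (\<lambda>t q q'. f (\<alpha> t q q'))"
  using f_closed f_add f_act by (intro comb_hom[OF Y_rmod rmod]) auto

text \<open>Projection of the free module onto the direct sum of the modules vL, with v the vertex
  of the respective generator. The projective module of interest is thus the set of fixed points of
  \<open>pp\<close> inside a free module, and no separate construction is needed. \<open>f\<close>
  does not see the projection, because each generator is fixed by its vertex.\<close>

definition pp :: "(nat \<times> 'v \<times> 'b \<Rightarrow> 'a) \<Rightarrow> nat \<times> 'v \<times> 'b \<Rightarrow> 'a" where
  "pp y = (\<lambda>j. if j \<in> X then p (vt j) \<otimes> y j else \<zero>)"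

lemma pp_closed: "y \<in> carrier Y \<Longrightarrow> pp y \<in> carrier Y"
proof -
  assume y: "y \<in> carrier Y"
  have "supp L (pp y) \<subseteq> supp L y" using Y_apply[OF y] p_closed X_props(1) by (auto simp: supp_def pp_def)
  moreover have "pp y j \<in> carrier L" for j using Y_apply[OF y] p_closed X_props(1) by (simp add: pp_def)
  ultimately show ?thesis using y by (auto simp: fsupp_simps intro: finite_subset)
qed

lemma f_pp: "y \<in> carrier Y \<Longrightarrow> f (pp y) = f y"
proof -
  assume y: "y \<in> carrier Y"
  have s: "supp L (pp y) \<subseteq> supp L y" using Y_apply[OF y] p_closed X_props(1) by (auto simp: supp_def pp_def)
  have S: "supp L y \<subseteq> X" "finite (supp L y)" using y by (auto simp: fsupp_simps)
  have "f (pp y) = (\<Oplus>\<^bsub>M\<^esub>j\<in>supp L y. pp y j \<odot>\<^bsub>M\<^esub> g j)"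
    by (rule lin_superset[OF g_fun pp_closed[OF y] s S])
  also have "\<dots> = (\<Oplus>\<^bsub>M\<^esub>j\<in>supp L y. y j \<odot>\<^bsub>M\<^esub> g j)"
  proof (rule M.finsum_cong')
    fix j assume "j \<in> supp L y"
    then have j: "j \<in> X" using S by auto
    then have "pp y j \<odot>\<^bsub>M\<^esub> g j = y j \<odot>\<^bsub>M\<^esub> (p (vt j) \<odot>\<^bsub>M\<^esub> g j)"
      using Y_apply(1)[OF y, of j] p_closed[OF X_props(1)[OF j]] funcset_mem[OF g_fun j] j by (simp add: pp_def act_mult)
    then show "pp y j \<odot>\<^bsub>M\<^esub> g j = y j \<odot>\<^bsub>M\<^esub> g j" using X_props(3)[OF j] by simp
  qed (use S g_fun Y_apply(1)[OF y] in \<open>auto intro!: act_closed\<close>)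
  finally show ?thesis by (simp add: lin_def)
qed

definition coeffs :: "nat \<Rightarrow> (nat \<times> 'v \<times> 'b \<Rightarrow> 'a) set" where
  "coeffs k = {c \<in> carrier Y. \<forall>j. c j \<in> \<kappa> \<and> (c j \<noteq> \<zero> \<longrightarrow> fst j = k)}"

text \<open>The filtration that the direct sum must have if it is to match U: earlier elements, the
  generators adjoined at this step with coefficients in \<open>\<kappa>\<close>, and the products
  with the letters of this step.\<close>

primrec YF :: "nat \<Rightarrow> (nat \<times> 'v \<times> 'b \<Rightarrow> 'a) set" where
  "YF 0 = {\<zero>\<^bsub>Y\<^esub>}"
| "YF (Suc k) = {y \<oplus>\<^bsub>Y\<^esub> pp c \<oplus>\<^bsub>Y\<^esub> comb Y (even k) \<alpha> |y c \<alpha>.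
     y \<in> YF k \<and> c \<in> coeffs k \<and> \<alpha> \<in> places (even k) (YF k)}"

declare YF.simps(2) [simp del]

lemma zero_coeffs: "\<zero>\<^bsub>Y\<^esub> \<in> coeffs k"
  using Y.M.zero_closed kappa_zero by (simp add: coeffs_def fsupp_simps(1))

lemma pp_zero: "pp \<zero>\<^bsub>Y\<^esub> = \<zero>\<^bsub>Y\<^esub>"
  using p_closed X_props(1) by (auto simp: pp_def fsupp_simps(1))

lemma comb_zero: "comb Y s (\<lambda>_ _ _. \<zero>\<^bsub>Y\<^esub>) = \<zero>\<^bsub>Y\<^esub>"
  using comb_mem[OF Y_rmod, of "{\<zero>\<^bsub>Y\<^esub>}" s "\<lambda>_ _ _. \<zero>\<^bsub>Y\<^esub>"] x_closed by simp

lemma YF_carrier: "YF k \<subseteq> carrier Y"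
proof (induction k)
  case (Suc k)
  then show ?case using places_mono[OF Suc] comb_closed[OF Y_rmod, of _ "even k"] pp_closed
    by (auto simp: coeffs_def YF.simps(2) intro!: Y.M.a_closed)
qed simp

lemma YF_mem: "y \<in> YF k \<Longrightarrow> y \<in> carrier Y"
  using YF_carrier by blast

lemma YF_places: "\<alpha> \<in> places s (YF k) \<Longrightarrow> \<alpha> \<in> places s (carrier Y)"
  using places_mono[OF YF_carrier] by blast

lemma YF_SucI: "\<lbrakk>y \<in> YF k; c \<in> coeffs k; \<alpha> \<in> places (even k) (YF k)\<rbrakk>
  \<Longrightarrow> y \<oplus>\<^bsub>Y\<^esub> pp c \<oplus>\<^bsub>Y\<^esub> comb Y (even k) \<alpha> \<in> YF (Suc k)"
  by (auto simp: YF.simps(2))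

lemma YF_zero: "\<zero>\<^bsub>Y\<^esub> \<in> YF k"
proof (induction k)
  case (Suc k)
  then show ?case using YF_SucI[OF Suc zero_coeffs, of "\<lambda>_ _ _. \<zero>\<^bsub>Y\<^esub>"]
    by (simp add: places_def pp_zero comb_zero)
qed simp

lemma YF_mono: "YF k \<subseteq> YF (Suc k)"
proof
  fix y assume y: "y \<in> YF k"
  then show "y \<in> YF (Suc k)" using YF_SucI[OF y zero_coeffs, of "\<lambda>_ _ _. \<zero>\<^bsub>Y\<^esub>"] YF_mem[OF y] YF_zero
    by (simp add: places_def pp_zero comb_zero)
qed

lemma YF_mono': "k \<le> l \<Longrightarrow> YF k \<subseteq> YF l"
  by (induction l rule: dec_induct) (use YF_mono in blast)+

lemma coeffs_add: "c \<in> coeffs k \<Longrightarrow> d \<in> coeffs k \<Longrightarrow> c \<oplus>\<^bsub>Y\<^esub> d \<in> coeffs k"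
proof -
  assume c: "c \<in> coeffs k" and d: "d \<in> coeffs k"
  have "c j \<oplus> d j \<in> \<kappa>" for j using c d kappa_closed(3) by (simp add: coeffs_def)
  moreover have "fst j = k" if "c j \<oplus> d j \<noteq> \<zero>" for j
    using that c d by (cases "c j = \<zero>"; cases "d j = \<zero>") (simp_all add: coeffs_def)
  moreover have "c \<oplus>\<^bsub>Y\<^esub> d \<in> carrier Y" using c d by (intro Y.M.a_closed) (simp_all add: coeffs_def)
  ultimately show "c \<oplus>\<^bsub>Y\<^esub> d \<in> coeffs k" by (simp add: coeffs_def fsupp_simps(2))
qed

lemma coeffs_act: "a \<in> \<kappa> \<Longrightarrow> c \<in> coeffs k \<Longrightarrow> a \<odot>\<^bsub>Y\<^esub> c \<in> coeffs k"
proof -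
  assume c: "c \<in> coeffs k" and a: "a \<in> \<kappa>"
  have "c j \<otimes> a \<in> \<kappa>" for j using c a kappa_closed(4) by (simp add: coeffs_def)
  moreover have "fst j = k" if "c j \<otimes> a \<noteq> \<zero>" for j
    using that c kappa_carrier[OF a] by (cases "c j = \<zero>") (simp_all add: coeffs_def)
  moreover have "a \<odot>\<^bsub>Y\<^esub> c \<in> carrier Y" using c kappa_carrier[OF a] by (intro Y.act_closed) (simp_all add: coeffs_def)
  ultimately show "a \<odot>\<^bsub>Y\<^esub> c \<in> coeffs k" by (simp add: coeffs_def fsupp_simps(3))
qed

lemma pp_add: "c \<in> carrier Y \<Longrightarrow> d \<in> carrier Y \<Longrightarrow> pp (c \<oplus>\<^bsub>Y\<^esub> d) = pp c \<oplus>\<^bsub>Y\<^esub> pp d"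
  using Y_apply p_closed X_props(1) by (auto simp: pp_def fsupp_simps(2) r_distr)

lemma YF_add: "\<lbrakk>y \<in> YF k; z \<in> YF k\<rbrakk> \<Longrightarrow> y \<oplus>\<^bsub>Y\<^esub> z \<in> YF k"
proof (induction k arbitrary: y z)
  case (Suc k)
  then obtain y0 c \<alpha> z0 d \<beta> where *: "y = y0 \<oplus>\<^bsub>Y\<^esub> pp c \<oplus>\<^bsub>Y\<^esub> comb Y (even k) \<alpha>" "y0 \<in> YF k" "c \<in> coeffs k"
    "\<alpha> \<in> places (even k) (YF k)" "z = z0 \<oplus>\<^bsub>Y\<^esub> pp d \<oplus>\<^bsub>Y\<^esub> comb Y (even k) \<beta>" "z0 \<in> YF k" "d \<in> coeffs k"
    "\<beta> \<in> places (even k) (YF k)" by (auto simp: YF.simps(2))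
  have cl: "y0 \<in> carrier Y" "z0 \<in> carrier Y" "c \<in> carrier Y" "d \<in> carrier Y" "comb Y (even k) \<alpha> \<in> carrier Y" "comb Y (even k) \<beta> \<in> carrier Y"
    using * YF_mem YF_places comb_closed[OF Y_rmod] by (auto simp: coeffs_def)
  have "y \<oplus>\<^bsub>Y\<^esub> z = (y0 \<oplus>\<^bsub>Y\<^esub> z0) \<oplus>\<^bsub>Y\<^esub> (pp c \<oplus>\<^bsub>Y\<^esub> pp d) \<oplus>\<^bsub>Y\<^esub> (comb Y (even k) \<alpha> \<oplus>\<^bsub>Y\<^esub> comb Y (even k) \<beta>)"
    using cl pp_closed * by (simp add: Y.M.a_ac)
  also have "\<dots> = (y0 \<oplus>\<^bsub>Y\<^esub> z0) \<oplus>\<^bsub>Y\<^esub> pp (c \<oplus>\<^bsub>Y\<^esub> d) \<oplus>\<^bsub>Y\<^esub> comb Y (even k) (\<lambda>t q q'. \<alpha> t q q' \<oplus>\<^bsub>Y\<^esub> \<beta> t q q')"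
    using cl * YF_places by (simp add: pp_add comb_add[OF Y_rmod])
  also have "\<dots> \<in> YF (Suc k)"
    by (intro YF_SucI) (use * Suc.IH coeffs_add in \<open>auto simp: places_def\<close>)
  finally show ?case .
qed simp

lemma YF_kappa: "\<lbrakk>a \<in> \<kappa>; y \<in> YF k\<rbrakk> \<Longrightarrow> a \<odot>\<^bsub>Y\<^esub> y \<in> YF k"
proof (induction k arbitrary: y)
  case 0
  then show ?case using kappa_carrier by simp
next
  case (Suc k)
  then obtain y0 c \<alpha> where *: "y = y0 \<oplus>\<^bsub>Y\<^esub> pp c \<oplus>\<^bsub>Y\<^esub> comb Y (even k) \<alpha>" "y0 \<in> YF k" "c \<in> coeffs k"
    "\<alpha> \<in> places (even k) (YF k)" by (auto simp: YF.simps(2))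
  have cl: "y0 \<in> carrier Y" "c \<in> carrier Y" "comb Y (even k) \<alpha> \<in> carrier Y" "a \<in> carrier L"
    using * YF_mem YF_places comb_closed[OF Y_rmod] Suc kappa_carrier by (auto simp: coeffs_def)
  have "a \<odot>\<^bsub>Y\<^esub> y = a \<odot>\<^bsub>Y\<^esub> y0 \<oplus>\<^bsub>Y\<^esub> a \<odot>\<^bsub>Y\<^esub> pp c \<oplus>\<^bsub>Y\<^esub> a \<odot>\<^bsub>Y\<^esub> comb Y (even k) \<alpha>"
    using cl pp_closed * by (simp add: Y.act_add_right)
  also have "a \<odot>\<^bsub>Y\<^esub> pp c = pp (a \<odot>\<^bsub>Y\<^esub> c)"
    using cl Y_apply(1)[of c] p_closed X_props(1) by (auto simp: pp_def fsupp_simps(3) m_assoc)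
  also have "a \<odot>\<^bsub>Y\<^esub> comb Y (even k) \<alpha> = comb Y (even k) (\<lambda>t q q'. a \<odot>\<^bsub>Y\<^esub> \<alpha> t q q')"
    using * Suc YF_places by (simp add: comb_kappa[OF Y_rmod])
  also have "a \<odot>\<^bsub>Y\<^esub> y0 \<oplus>\<^bsub>Y\<^esub> pp (a \<odot>\<^bsub>Y\<^esub> c) \<oplus>\<^bsub>Y\<^esub> \<dots> \<in> YF (Suc k)"
  proof (rule YF_SucI)
    show "a \<odot>\<^bsub>Y\<^esub> c \<in> coeffs k"
      by (rule coeffs_act[OF Suc(2) *(3)])
  qed (use * Suc in \<open>auto simp: places_def\<close>)
  finally show ?case .
qed

lemma YF_p: "\<lbrakk>u \<in> V; y \<in> YF k\<rbrakk> \<Longrightarrow> p u \<odot>\<^bsub>Y\<^esub> y \<in> YF k"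
proof (induction k arbitrary: y)
  case 0
  then show ?case using p_closed by simp
next
  case (Suc k)
  then obtain y0 c \<alpha> where *: "y = y0 \<oplus>\<^bsub>Y\<^esub> pp c \<oplus>\<^bsub>Y\<^esub> comb Y (even k) \<alpha>" "y0 \<in> YF k" "c \<in> coeffs k"
    "\<alpha> \<in> places (even k) (YF k)" by (auto simp: YF.simps(2))
  have cl: "y0 \<in> carrier Y" "c \<in> carrier Y" "comb Y (even k) \<alpha> \<in> carrier Y" "p u \<in> carrier L"
    using * YF_mem YF_places comb_closed[OF Y_rmod] Suc p_closed by (auto simp: coeffs_def)
  \<comment> \<open>Coefficients in \<open>\<kappa>\<close> commute with \<open>p u\<close>, so
    acting by \<open>p u\<close> multiplies the vertex idempotents and keeps exactly the generators
    located at u.\<close>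
  let ?c = "\<lambda>j. if vt j = u then c j else \<zero>"
  have c: "?c \<in> coeffs k"
  proof -
    have "supp L ?c \<subseteq> supp L c" by (auto simp: supp_def)
    then have "?c \<in> carrier Y" using cl(2) by (auto simp: fsupp_simps intro: finite_subset)
    then show ?thesis using *(3) kappa_zero by (auto simp: coeffs_def)
  qed
  have "p u \<odot>\<^bsub>Y\<^esub> y = p u \<odot>\<^bsub>Y\<^esub> y0 \<oplus>\<^bsub>Y\<^esub> p u \<odot>\<^bsub>Y\<^esub> pp c \<oplus>\<^bsub>Y\<^esub> p u \<odot>\<^bsub>Y\<^esub> comb Y (even k) \<alpha>"
    using cl pp_closed * by (simp add: Y.act_add_right)
  also have "p u \<odot>\<^bsub>Y\<^esub> pp c = pp ?c"
  proof
    fix j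
    have ck: "c j \<in> \<kappa>" "c j \<in> carrier L" using *(3) kappa_carrier by (auto simp: coeffs_def)
    show "(p u \<odot>\<^bsub>Y\<^esub> pp c) j = pp ?c j"
    proof (cases "j \<in> X")
      case True
      then have "p (vt j) \<otimes> c j \<otimes> p u = (p (vt j) \<otimes> p u) \<otimes> c j"
        using ck p_closed X_props(1) cl(4) kappa_central[OF ck(1) cl(4)] by (simp add: m_assoc)
      then show ?thesis using True p_mult[OF X_props(1)[OF True] Suc(2)] ck p_closed X_props(1)[OF True]
        by (simp add: pp_def fsupp_simps(3))
    qed (use cl in \<open>simp add: pp_def fsupp_simps(3)\<close>)
  qed
  also have "p u \<odot>\<^bsub>Y\<^esub> comb Y (even k) \<alpha>
      = comb Y (even k) (\<lambda>t q q'. if u = loc (\<not> even k) t q' then \<alpha> t q q' else \<zero>\<^bsub>Y\<^esub>)"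
    using * Suc YF_places by (intro comb_p[OF Y_rmod]) auto
  also have "p u \<odot>\<^bsub>Y\<^esub> y0 \<oplus>\<^bsub>Y\<^esub> pp ?c \<oplus>\<^bsub>Y\<^esub> \<dots> \<in> YF (Suc k)"
    by (intro YF_SucI c) (use * Suc YF_zero in \<open>auto simp: places_def\<close>)
  finally show ?case .
qed

lemma YF_minus: "y \<in> YF k \<Longrightarrow> \<ominus>\<^bsub>Y\<^esub> y \<in> YF k"
  using YF_kappa[OF kappa_closed(5)[OF kappa_closed(2)], of y k] YF_mem[of y k]
  by (simp add: Y.act_minus_left)

lemma YF_comb: "\<alpha> \<in> places (even k) (YF k) \<Longrightarrow> comb Y (even k) \<alpha> \<in> YF (Suc k)"
  using YF_SucI[OF YF_zero zero_coeffs] YF_places comb_closed[OF Y_rmod] by (simp add: pp_zero)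

lemma YF_step: "\<lbrakk>y \<in> YF k; t \<in> T; q \<in> P (even k) t; q' \<in> P (odd k) t\<rbrakk> \<Longrightarrow> x (even k) t q q' \<odot>\<^bsub>Y\<^esub> y \<in> YF (Suc k)"
  using YF_mem[of y k] YF_zero by (subst comb_single[OF Y_rmod]) (auto intro!: YF_comb simp: places_def)

lemma YF_single: "j \<in> X \<Longrightarrow> single L j (p (vt j)) \<in> YF (Suc (fst j))"
proof -
  assume j: "j \<in> X"
  have "single L j \<one> \<in> carrier Y" using j by (simp add: single_closed)
  then have c: "single L j \<one> \<in> coeffs (fst j)"
    using kappa_closed(2) kappa_zero by (auto simp: coeffs_def single_def)
  have "pp (single L j \<one>) = single L j (p (vt j))"
  proof
    fix i
    show "pp (single L j \<one>) i = single L j (p (vt j)) i"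
      using j p_closed[OF X_props(1)] by (cases "i = j") (simp_all add: pp_def single_def)
  qed
  then show ?thesis
    using YF_SucI[OF YF_zero c, of "\<lambda>_ _ _. \<zero>\<^bsub>Y\<^esub>"] YF_zero j p_closed[OF X_props(1)[OF j]]
    by (simp add: comb_zero places_def single_closed)
qed

lemma f_coeffs:
  assumes "c \<in> coeffs k"
  shows "(\<lambda>(v, z). c (k, v, z)) \<in> carrier (fsupp L (new k))" "f c = lin snd (\<lambda>(v, z). c (k, v, z))"
proof -
  let ?c = "\<lambda>(v, z). c (k, v, z)"
  have c: "c \<in> carrier Y" "\<And>j. c j \<noteq> \<zero> \<Longrightarrow> fst j = k" using assms by (auto simp: coeffs_def)
  have s: "supp L c = Pair k ` supp L ?c" using c(2) by (fastforce simp: supp_def image_iff)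
  have fin: "finite (supp L ?c)" using c(1) s by (simp add: fsupp_simps finite_image_iff inj_on_def)
  have sub: "supp L ?c \<subseteq> new k" using c(1) s by (auto simp: fsupp_simps X_def)
  show 1: "?c \<in> carrier (fsupp L (new k))"
    using c(1) fin sub by (auto simp: fsupp_simps)
  have "f c = (\<Oplus>\<^bsub>M\<^esub>j\<in>Pair k ` supp L ?c. c j \<odot>\<^bsub>M\<^esub> g j)" by (simp add: lin_def s)
  also have "\<dots> = (\<Oplus>\<^bsub>M\<^esub>j\<in>supp L ?c. c (k, j) \<odot>\<^bsub>M\<^esub> g (k, j))"
  proof (rule M.finsum_reindex)
    have "c j \<odot>\<^bsub>M\<^esub> g j \<in> carrier M" if "j \<in> supp L c" for j
      using that c(1) g_fun Y_apply(1)[OF c(1), of j] by (intro act_closed) (auto simp: fsupp_simps(4) simp del: split_paired_All)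
    then show "(\<lambda>j. c j \<odot>\<^bsub>M\<^esub> g j) \<in> Pair k ` supp L ?c \<rightarrow> carrier M" unfolding s[symmetric] by blast
  qed (simp add: inj_on_def)
  also have "\<dots> = lin snd ?c" by (simp add: lin_def g_def case_prod_unfold)
  finally show "f c = lin snd ?c" .
qed

text \<open>By construction U is exhausted step by step by the old part and the span of the new
  generators; both have obvious preimages.\<close>

lemma f_image: "f ` YF k = U k"
proof (induction k)
  case 0
  then show ?case by (simp add: U_0 f_zero)
next
  case (Suc k)
  have 1: "f (comb Y (even k) \<alpha>) = comb M (even k) (\<lambda>t q q'. f (\<alpha> t q q'))" "(\<lambda>t q q'. f (\<alpha> t q q')) \<in> places (even k) (U k)"
    if "\<alpha> \<in> places (even k) (YF k)" for \<alpha>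
    using that YF_places f_comb Suc by (auto simp: places_def)
  have 2: "f (y \<oplus>\<^bsub>Y\<^esub> pp c \<oplus>\<^bsub>Y\<^esub> comb Y (even k) \<alpha>)
      = f y \<oplus>\<^bsub>M\<^esub> f c \<oplus>\<^bsub>M\<^esub> comb M (even k) (\<lambda>t q q'. f (\<alpha> t q q'))"
    if "y \<in> YF k" "c \<in> coeffs k" "\<alpha> \<in> places (even k) (YF k)" for y c \<alpha>
    using that YF_mem YF_places comb_closed[OF Y_rmod] 1 pp_closed
    by (simp add: f_add f_pp coeffs_def)
  show ?case
  proof (intro equalityI subsetI)
    fix z assume "z \<in> f ` YF (Suc k)"
    then obtain y c \<alpha> where *: "y \<in> YF k" "c \<in> coeffs k" "\<alpha> \<in> places (even k) (YF k)"
      "z = f y \<oplus>\<^bsub>M\<^esub> f c \<oplus>\<^bsub>M\<^esub> comb M (even k) (\<lambda>t q q'. f (\<alpha> t q q'))"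
      using 2 by (auto simp: YF.simps(2))
    have "f y \<in> U (Suc k)" using *(1) Suc U_mono by blast
    moreover have "f c \<in> U (Suc k)"
    proof -
      have "c j \<odot>\<^bsub>M\<^esub> g j \<in> U (Suc k)" if "j \<in> supp L c" for j
        using that *(2) X_props(2)[of j] U_kappa[of "c j" "g j" "Suc k"] by (auto simp: coeffs_def fsupp_simps supp_def)
      then show ?thesis unfolding lin_def
        by (intro M.finsum_mem) (use U_zero U_add U_carrier in auto)
    qed
    moreover have "comb M (even k) (\<lambda>t q q'. f (\<alpha> t q q')) \<in> U (Suc k)"
      using 1(2)[OF *(3)] comb_U by blast
    ultimately show "z \<in> U (Suc k)" unfolding *(4) using U_add by blast
  next
    fix z assume "z \<in> U (Suc k)"
    then obtain o' c where z: "z = o' \<oplus>\<^bsub>M\<^esub> lin snd c" "o' \<in> old k" "c \<in> carrier (fsupp L (new k))" "\<forall>j. c j \<in> \<kappa>"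
      using new(2)[of k] by (auto simp: span_def)
    obtain u \<alpha> where u: "u \<in> U k" "\<alpha> \<in> places (even k) (U k)" "o' = u \<oplus>\<^bsub>M\<^esub> comb M (even k) \<alpha>"
      using z(2) by (auto simp: old_def)
    define h where "h = (\<lambda>z. SOME y. y \<in> YF k \<and> f y = z)"
    have h: "h z \<in> YF k" "f (h z) = z" if "z \<in> U k" for z
      using someI_ex[of "\<lambda>y. y \<in> YF k \<and> f y = z"] that Suc unfolding h_def by (metis (mono_tags, lifting) image_iff)+
    \<comment> \<open>The coefficients c over the generators of step k, regarded as coefficients
      over all generators.\<close>
    define d where "d = (\<lambda>j. if fst j = k then c (snd j) else \<zero>)"
    have dc: "(\<lambda>(v, z). d (k, v, z)) = c" by (auto simp: d_def)
    have "supp L d = Pair k ` supp L c" by (auto simp: d_def supp_def split: if_splits)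
    then have "d \<in> carrier Y" using z(3) kappa_zero by (auto simp: fsupp_simps X_def d_def)
    then have d: "d \<in> coeffs k" using z(4) kappa_zero by (simp add: coeffs_def) (simp add: d_def)
    let ?\<beta> = "\<lambda>t q q'. h (\<alpha> t q q')"
    have b: "?\<beta> \<in> places (even k) (YF k)" using u(2) h by (auto simp: places_def)
    have "comb M (even k) (\<lambda>t q q'. f (?\<beta> t q q')) = comb M (even k) \<alpha>"
      using h placesD[OF u(2)] by (intro comb_cong[OF rmod, symmetric] U_places[OF u(2)]) auto
    then have "f (h u \<oplus>\<^bsub>Y\<^esub> pp d \<oplus>\<^bsub>Y\<^esub> comb Y (even k) ?\<beta>) = u \<oplus>\<^bsub>M\<^esub> lin snd c \<oplus>\<^bsub>M\<^esub> comb M (even k) \<alpha>"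
      using 2[OF h(1)[OF u(1)] d b] f_coeffs(2)[OF d] dc h(2)[OF u(1)] by simp
    also have "\<dots> = z"
    proof -
      have "snd \<in> new k \<rightarrow> carrier M" using new(1)[of k, unfolded indep_def] by (intro snd_fun[of _ k]) (rule conjunct1)
      then have "lin snd c \<in> carrier M" using z(3) by (rule lin_closed)
      moreover have "comb M (even k) \<alpha> \<in> carrier M" using comb_closed[OF rmod U_places[OF u(2)]] .
      ultimately show ?thesis using z(1) u(3) U_mem[OF u(1)] by (simp add: M.a_ac)
    qed
    finally have "z = f (h u \<oplus>\<^bsub>Y\<^esub> pp d \<oplus>\<^bsub>Y\<^esub> comb Y (even k) ?\<beta>)" by (rule sym)
    then show "z \<in> f ` YF (Suc k)" using YF_SucI[OF h(1)[OF u(1)] d b] by (rule image_eqI)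
  qed
qed

text \<open>Induction on the step. An element of the kernel loses its new generators by
  independence; its combination of letters is then shown, by strictness, to lie two steps earlier,
  so the element itself belongs to the previous piece.\<close>

lemma f_inj: "y \<in> YF k \<Longrightarrow> f y = \<zero>\<^bsub>M\<^esub> \<Longrightarrow> y = \<zero>\<^bsub>Y\<^esub>"
proof (induction k arbitrary: y)
  case (Suc k)
  then obtain y0 c \<alpha> where *: "y = y0 \<oplus>\<^bsub>Y\<^esub> pp c \<oplus>\<^bsub>Y\<^esub> comb Y (even k) \<alpha>" "y0 \<in> YF k" "c \<in> coeffs k"
    "\<alpha> \<in> places (even k) (YF k)" by (auto simp: YF.simps(2))
  let ?s = "even k"
  let ?f\<alpha> = "\<lambda>t q q'. f (\<alpha> t q q')"
  have cl: "y0 \<in> carrier Y" "c \<in> carrier Y" "comb Y ?s \<alpha> \<in> carrier Y" "pp c \<in> carrier Y"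
    using * YF_mem YF_places comb_closed[OF Y_rmod] pp_closed by (auto simp: coeffs_def)
  have f\<alpha>: "?f\<alpha> \<in> places ?s (U k)" using *(4) f_image[of k] by (auto simp: places_def)
  have fc: "f (comb Y ?s \<alpha>) = comb M ?s ?f\<alpha>" using YF_places[OF *(4)] by (rule f_comb)
  have fy0: "f y0 \<in> U k" using *(2) f_image[of k] by blast
  note fcl = f_closed[OF cl(1)] f_closed[OF cl(2)] f_closed[OF cl(3)]
  have sum: "f y0 \<oplus>\<^bsub>M\<^esub> f c \<oplus>\<^bsub>M\<^esub> f (comb Y ?s \<alpha>) = \<zero>\<^bsub>M\<^esub>"
    using Suc.prems(2) cl unfolding *(1) by (simp add: f_add f_pp)
  have "f c = (\<ominus> \<one>) \<odot>\<^bsub>M\<^esub> (f y0 \<oplus>\<^bsub>M\<^esub> f (comb Y ?s \<alpha>))"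
  proof -
    have "f c \<oplus>\<^bsub>M\<^esub> (f y0 \<oplus>\<^bsub>M\<^esub> f (comb Y ?s \<alpha>)) = \<zero>\<^bsub>M\<^esub>" using sum fcl by (simp add: M.a_ac)
    then show ?thesis using fcl by (simp add: act_minus_left M.minus_equality)
  qed
  moreover have "f y0 \<oplus>\<^bsub>M\<^esub> f (comb Y ?s \<alpha>) \<in> old k" unfolding fc old_def using fy0 f\<alpha> by blast
  ultimately have fold: "f c \<in> old k" using old_kappa[OF kappa_closed(5)[OF kappa_closed(2)]] by simp
  \<comment> \<open>The image of the new part equals minus the image of the other two terms, hence
    lies in \<open>old k\<close>, and the generators of step k are independent modulo
    \<open>old k\<close>.\<close>
  have c0: "c = \<zero>\<^bsub>Y\<^esub>"
  proof -
    have "\<forall>j. (\<lambda>(v, z). c (k, v, z)) j = \<zero>"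
    proof -
      have "\<forall>j. (\<lambda>(v, z). c (k, v, z)) j \<in> \<kappa>" using *(3) by (simp add: coeffs_def case_prod_unfold)
      moreover have "lin snd (\<lambda>(v, z). c (k, v, z)) \<in> old k" using f_coeffs(2)[OF *(3)] fold by simp
      ultimately show ?thesis using new(1)[of k] f_coeffs(1)[OF *(3)] unfolding indep_def by blast
    qed
    then have "c j = \<zero>" if "fst j = k" for j using that by (cases j) auto
    then have "c j = \<zero>" for j using *(3) by (cases "fst j = k") (auto simp: coeffs_def)
    then show ?thesis by (auto simp: fsupp_simps(1))
  qed
  have y: "y = y0 \<oplus>\<^bsub>Y\<^esub> comb Y ?s \<alpha>" using *(1) cl by (simp add: c0 pp_zero)
  have "comb Y ?s \<alpha> \<in> YF k"
  \<comment> \<open>For k = 0 all coefficients are zero. Strictness relates three consecutive pieces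
    and needs a predecessor of k.\<close>
  proof (cases k)
    case 0
    then have "\<alpha> t q q' = \<zero>\<^bsub>Y\<^esub>" if "t \<in> T" "q \<in> P ?s t" "q' \<in> P (\<not> ?s) t" for t q q'
      using placesD[OF *(4) that] by simp
    then show ?thesis using x_closed YF_zero
      by (intro comb_mem[OF Y_rmod YF_carrier YF_zero YF_add]) auto
  next
    case (Suc l)
    have sum': "comb M ?s ?f\<alpha> \<in> U k"
    proof -
      have "f y0 \<oplus>\<^bsub>M\<^esub> comb M ?s ?f\<alpha> = \<zero>\<^bsub>M\<^esub>" using sum fcl by (simp add: c0 f_zero fc)
      then have "comb M ?s ?f\<alpha> \<oplus>\<^bsub>M\<^esub> f y0 = \<zero>\<^bsub>M\<^esub>" using fcl fc M.a_comm by metis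
      then have "comb M ?s ?f\<alpha> = (\<ominus> \<one>) \<odot>\<^bsub>M\<^esub> f y0"
        using fcl fc M.minus_equality[of "comb M ?s ?f\<alpha>" "f y0"] by (simp add: act_minus_left)
      then show ?thesis using U_kappa[OF kappa_closed(5)[OF kappa_closed(2)] fy0] by simp
    qed
    \<comment> \<open>All products of the coefficients with one column of letters. The relation
      itself only contains q'' = q', but strictness places all of them in \<open>U l\<close>, and
      all are needed to recover the coefficients by the inverse matrix.\<close>
    let ?\<beta> = "\<lambda>t q' q''. \<Oplus>\<^bsub>M\<^esub>q\<in>P ?s t. x ?s t q q'' \<odot>\<^bsub>M\<^esub> ?f\<alpha> t q q'"
    have \<beta>U: "?\<beta> t q' q'' \<in> U l" if "t \<in> T" "q' \<in> P (\<not> ?s) t" "q'' \<in> P (\<not> ?s) t" for t q' q''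
      by (rule U_strict[of ?s l ?f\<alpha>]) (use Suc f\<alpha> sum' that in auto)
    define b where "b = (\<lambda>t q' q''. SOME y. y \<in> YF l \<and> f y = ?\<beta> t q' q'')"
    have b: "b t q' q'' \<in> YF l" "f (b t q' q'') = ?\<beta> t q' q''"
      if "t \<in> T" "q' \<in> P (\<not> ?s) t" "q'' \<in> P (\<not> ?s) t" for t q' q''
    proof -
      have "?\<beta> t q' q'' \<in> f ` YF l" unfolding f_image by (rule \<beta>U[OF that])
      then obtain y where y: "?\<beta> t q' q'' = f y" "y \<in> YF l" by (rule imageE)
      have "b t q' q'' \<in> YF l \<and> f (b t q' q'') = ?\<beta> t q' q''"
        unfolding b_def by (rule someI[of _ y]) (rule conjI[OF y(2) y(1)[symmetric]])
      from conjunct1[OF this] conjunct2[OF this] show "b t q' q'' \<in> YF l" "f (b t q' q'') = ?\<beta> t q' q''" .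
    qed
    have sl: "even l = (\<not> ?s)" "odd l = ?s" using Suc by simp_all
    \<comment> \<open>Both sides lie in \<open>YF k\<close> and have the same image by
      \<open>x_inverse\<close>; the induction hypothesis makes them equal before applying
      \<open>f\<close>. The left side lies there because the letters of the other side are those of
      step l.\<close>
    have \<alpha>': "(\<Oplus>\<^bsub>Y\<^esub>q''\<in>P (\<not> ?s) t. x (\<not> ?s) t q'' q \<odot>\<^bsub>Y\<^esub> b t q' q'') = p (loc ?s t q) \<odot>\<^bsub>Y\<^esub> \<alpha> t q q'"
      if t: "t \<in> T" "q \<in> P ?s t" "q' \<in> P (\<not> ?s) t" for t q q'
    proof -
      let ?a = "\<Oplus>\<^bsub>Y\<^esub>q''\<in>P (\<not> ?s) t. x (\<not> ?s) t q'' q \<odot>\<^bsub>Y\<^esub> b t q' q''"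
      have st: "x (\<not> ?s) t q'' q \<odot>\<^bsub>Y\<^esub> b t q' q'' \<in> YF k" if "q'' \<in> P (\<not> ?s) t" for q''
        using YF_step[of "b t q' q''" l t q'' q, unfolded sl not_not, OF b(1)[OF t(1,3) that] t(1) that t(2)]
        unfolding Suc[symmetric] .
      have a: "?a \<in> YF k"
        using st YF_zero YF_add YF_carrier by (intro Y.M.finsum_mem) auto
      have \<alpha>c: "\<alpha> t q1 q' \<in> YF k" if "q1 \<in> P ?s t" for q1 using placesD[OF *(4) t(1) that t(3)] .
      have pa: "p (loc ?s t q) \<odot>\<^bsub>Y\<^esub> \<alpha> t q q' \<in> YF k" using YF_p[OF loc_V \<alpha>c] t by simp
      have fa1: "f (\<alpha> t q1 q') \<in> carrier M" if "q1 \<in> P ?s t" for q1 using f_closed[OF YF_mem[OF \<alpha>c[OF that]]] .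
      have x1: "x ?s t q1 q'' \<in> carrier L" "x (\<not> ?s) t q'' q \<in> carrier L" if "q1 \<in> P ?s t" "q'' \<in> P (\<not> ?s) t" for q1 q''
        using x_closed[of t q1 ?s q''] x_closed[of t q'' "\<not> ?s" q] t that by simp_all
      have "f ?a = (\<Oplus>\<^bsub>M\<^esub>q''\<in>P (\<not> ?s) t. f (x (\<not> ?s) t q'' q \<odot>\<^bsub>Y\<^esub> b t q' q''))"
        using YF_mem[OF st] by (rule f_finsum)
      also have "\<dots> = (\<Oplus>\<^bsub>M\<^esub>q''\<in>P (\<not> ?s) t. x (\<not> ?s) t q'' q \<odot>\<^bsub>M\<^esub> ?\<beta> t q' q'')"
      proof (rule M.finsum_cong')
        fix q'' assume q'': "q'' \<in> P (\<not> ?s) t"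
        show "f (x (\<not> ?s) t q'' q \<odot>\<^bsub>Y\<^esub> b t q' q'') = x (\<not> ?s) t q'' q \<odot>\<^bsub>M\<^esub> ?\<beta> t q' q''"
          using f_act[OF x1(2)[OF t(2) q''] YF_mem[OF b(1)[OF t(1,3) q'']]] b(2)[OF t(1,3) q''] by simp
      qed (use x1(1) x1(2)[OF t(2)] fa1 in \<open>auto intro!: M.finsum_closed act_closed\<close>)
      also have "\<dots> = p (loc ?s t q) \<odot>\<^bsub>M\<^esub> f (\<alpha> t q q')" by (rule x_inverse[OF rmod t(1,2) fa1])
      also have "\<dots> = f (p (loc ?s t q) \<odot>\<^bsub>Y\<^esub> \<alpha> t q q')"
        using p_closed loc_V t YF_mem[OF \<alpha>c] by (subst f_act) auto
      finally have "f (?a \<ominus>\<^bsub>Y\<^esub> p (loc ?s t q) \<odot>\<^bsub>Y\<^esub> \<alpha> t q q') = \<zero>\<^bsub>M\<^esub>"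
        using YF_mem[OF a] YF_mem[OF pa] f_closed by (simp add: a_minus_def f_add f_minus M.r_neg)
      moreover have "?a \<ominus>\<^bsub>Y\<^esub> p (loc ?s t q) \<odot>\<^bsub>Y\<^esub> \<alpha> t q q' \<in> YF k"
        unfolding a_minus_def by (rule YF_add[OF a YF_minus[OF pa]])
      ultimately have "?a \<ominus>\<^bsub>Y\<^esub> p (loc ?s t q) \<odot>\<^bsub>Y\<^esub> \<alpha> t q q' = \<zero>\<^bsub>Y\<^esub>" using Suc.IH by blast
      then show ?thesis using YF_mem[OF a] YF_mem[OF pa] by (simp add: Y.M.minus_eq_zero_iff)
    qed
    \<comment> \<open>With the coefficients expressed through b, the two matrices cancel and leave
      an entry of b, which lies in \<open>YF l\<close>.\<close>
    have "(\<Oplus>\<^bsub>Y\<^esub>q\<in>P ?s t. x ?s t q q' \<odot>\<^bsub>Y\<^esub> \<alpha> t q q') \<in> YF l" if t: "t \<in> T" "q' \<in> P (\<not> ?s) t" for t q'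
    proof -
      have \<alpha>c: "\<alpha> t q q' \<in> carrier Y" if "q \<in> P ?s t" for q using YF_mem[OF placesD[OF *(4) t(1) that t(2)]] .
      have bc: "b t q' q'' \<in> carrier Y" if "q'' \<in> P (\<not> ?s) t" for q'' using YF_mem[OF b(1)[OF t that]] .
      have x1: "x ?s t q q' \<in> carrier L" if "q \<in> P ?s t" for q using x_closed[OF t(1) that t(2)] .
      have "(\<Oplus>\<^bsub>Y\<^esub>q\<in>P ?s t. x ?s t q q' \<odot>\<^bsub>Y\<^esub> \<alpha> t q q')
          = (\<Oplus>\<^bsub>Y\<^esub>q\<in>P ?s t. x ?s t q q' \<odot>\<^bsub>Y\<^esub> (\<Oplus>\<^bsub>Y\<^esub>q''\<in>P (\<not> ?s) t. x (\<not> ?s) t q'' q \<odot>\<^bsub>Y\<^esub> b t q' q''))"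
      proof (intro Y.M.finsum_cong' refl funcsetI)
        fix q assume q: "q \<in> P ?s t"
        have "x ?s t q q' \<odot>\<^bsub>Y\<^esub> \<alpha> t q q' = (p (loc ?s t q) \<otimes> x ?s t q q') \<odot>\<^bsub>Y\<^esub> \<alpha> t q q'"
          using p_x[OF t(1) q t(2)] by simp
        then show "x ?s t q q' \<odot>\<^bsub>Y\<^esub> \<alpha> t q q' = x ?s t q q' \<odot>\<^bsub>Y\<^esub> (\<Oplus>\<^bsub>Y\<^esub>q''\<in>P (\<not> ?s) t. x (\<not> ?s) t q'' q \<odot>\<^bsub>Y\<^esub> b t q' q'')"
          unfolding \<alpha>'[OF t(1) q t(2)] using p_closed[OF loc_V[OF t(1) q]] x1[OF q] \<alpha>c[OF q] by (simp add: Y.act_mult)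
        show "x ?s t q q' \<odot>\<^bsub>Y\<^esub> (\<Oplus>\<^bsub>Y\<^esub>q''\<in>P (\<not> ?s) t. x (\<not> ?s) t q'' q \<odot>\<^bsub>Y\<^esub> b t q' q'') \<in> carrier Y"
          unfolding \<alpha>'[OF t(1) q t(2)] using p_closed[OF loc_V[OF t(1) q]] x1[OF q] \<alpha>c[OF q] by simp
      qed
      also have "\<dots> = p (loc (\<not> ?s) t q') \<odot>\<^bsub>Y\<^esub> b t q' q'"
        using x_inverse[OF Y_rmod, of t q' "\<not> ?s" "b t q'"] t bc by simp
      also have "\<dots> \<in> YF l" using YF_p loc_V b(1) t by blast
      finally show ?thesis .
    qed
    then have "comb Y ?s \<alpha> \<in> YF l"
      unfolding comb_def using YF_zero YF_add YF_carrier
      by (intro Y.M.finsum_mem[where A = T] Y.M.finsum_mem[where A = "P (\<not> ?s) t" for t]) simp_all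
    then have "comb Y ?s \<alpha> \<in> YF (Suc l)" by (rule subsetD[OF YF_mono])
    then show ?thesis unfolding Suc[symmetric] .
  qed
  then have "y \<in> YF k" unfolding y using *(2) by (intro YF_add)
  then show ?case using Suc.IH Suc.prems(2) by simp
qed simp

end

context filtered_module
begin

interpretation Y: rmodule L Y by (rule Y_rmod)

text \<open>The elements of L for which this holds form a subring containing
  \<open>\<kappa>\<close>, the idempotents and the letters, hence all of L. No bound on the number
  of steps is needed.\<close>

lemma YF_act: "a \<in> carrier L \<Longrightarrow> y \<in> YF k \<Longrightarrow> \<exists>k'. a \<odot>\<^bsub>Y\<^esub> y \<in> YF k'"
proof -
  let ?S = "{a \<in> carrier L. \<forall>k. \<forall>y\<in>YF k. \<exists>k'. a \<odot>\<^bsub>Y\<^esub> y \<in> YF k'}"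
  have "?S = carrier L"
  proof (rule generated)
    show "\<kappa> \<subseteq> ?S" using kappa_carrier YF_kappa by blast
    show "p v \<in> ?S" if "v \<in> V" for v using that p_closed YF_p by blast
    show "x s t q q' \<in> ?S" if t: "t \<in> T" "q \<in> P s t" "q' \<in> P (\<not> s) t" for s t q q'
    proof -
      have "\<exists>k'. x s t q q' \<odot>\<^bsub>Y\<^esub> y \<in> YF k'" if y: "y \<in> YF k" for k y
      proof (cases "s = even k")
        case True
        then show ?thesis using YF_step[OF y t(1)] t(2,3) by blast
      next
        case False
        \<comment> \<open>The letter is on the wrong side for step k; it becomes available one step
          later, where y still belongs to the filtration.\<close>
        then have s: "s = even (Suc k)" by simp
        have "y \<in> YF (Suc k)" using y YF_mono by blast
        then show ?thesis using YF_step[of y "Suc k" t q q'] t unfolding s by blast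
      qed
      then show ?thesis using x_closed[OF t] by blast
    qed
    show "a \<oplus> b \<in> ?S" if "a \<in> ?S" "b \<in> ?S" for a b
    proof -
      have "\<exists>k'. (a \<oplus> b) \<odot>\<^bsub>Y\<^esub> y \<in> YF k'" if y: "y \<in> YF k" for k y
      proof -
        obtain k1 k2 where k: "a \<odot>\<^bsub>Y\<^esub> y \<in> YF k1" "b \<odot>\<^bsub>Y\<^esub> y \<in> YF k2"
          using \<open>a \<in> ?S\<close> \<open>b \<in> ?S\<close> y by blast
        have "a \<odot>\<^bsub>Y\<^esub> y \<in> YF (max k1 k2)" "b \<odot>\<^bsub>Y\<^esub> y \<in> YF (max k1 k2)"
          using k YF_mono'[of k1 "max k1 k2"] YF_mono'[of k2 "max k1 k2"] by auto
        then have "a \<odot>\<^bsub>Y\<^esub> y \<oplus>\<^bsub>Y\<^esub> b \<odot>\<^bsub>Y\<^esub> y \<in> YF (max k1 k2)" by (rule YF_add)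
        then show ?thesis using \<open>a \<in> ?S\<close> \<open>b \<in> ?S\<close> YF_mem[OF y] by (auto simp: Y.act_add_left)
      qed
      then show ?thesis using that by auto
    qed
    show "a \<otimes> b \<in> ?S" if "a \<in> ?S" "b \<in> ?S" for a b
    proof -
      have "\<exists>k'. (a \<otimes> b) \<odot>\<^bsub>Y\<^esub> y \<in> YF k'" if y: "y \<in> YF k" for k y
      proof -
        obtain k1 where "a \<odot>\<^bsub>Y\<^esub> y \<in> YF k1" using \<open>a \<in> ?S\<close> y by blast
        then obtain k2 where "b \<odot>\<^bsub>Y\<^esub> (a \<odot>\<^bsub>Y\<^esub> y) \<in> YF k2" using \<open>b \<in> ?S\<close> by blast
        then show ?thesis using \<open>a \<in> ?S\<close> \<open>b \<in> ?S\<close> YF_mem[OF y] by (auto simp: Y.act_mult)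
      qed
      then show ?thesis using that by auto
    qed
  qed auto
  then show "a \<in> carrier L \<Longrightarrow> y \<in> YF k \<Longrightarrow> \<exists>k'. a \<odot>\<^bsub>Y\<^esub> y \<in> YF k'" by blast
qed

text \<open>A component fixed by \<open>pp\<close> is its generator, which lies in some piece,
  multiplied by an element of L.\<close>

lemma YF_exhaust:
  assumes "a \<in> carrier Y" "pp a = a"
  shows "\<exists>k. a \<in> YF k"
proof -
  have s: "\<exists>k. single L j (a j) \<in> YF k" if "j \<in> supp L a" for j
  proof -
    have j: "j \<in> X" using that assms(1) by (auto simp: fsupp_simps(4))
    have "a j = p (vt j) \<otimes> a j" using fun_cong[OF assms(2), of j] j by (simp add: pp_def)
    then have "single L j (a j) = a j \<odot>\<^bsub>Y\<^esub> single L j (p (vt j))"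
      using Y_apply(1)[OF assms(1), of j] by (auto simp: single_def fsupp_simps(3))
    then show ?thesis using YF_act[OF Y_apply(1)[OF assms(1), of j] YF_single[OF j]] by simp
  qed
  have "(\<Oplus>\<^bsub>Y\<^esub>j\<in>supp L a. single L j (a j)) \<in> (\<Union>k. YF k)"
  proof (rule Y.M.finsum_mem)
    show "y \<oplus>\<^bsub>Y\<^esub> z \<in> (\<Union>k. YF k)" if yz: "y \<in> (\<Union>k. YF k)" "z \<in> (\<Union>k. YF k)" for y z
    proof -
      obtain k1 k2 where "y \<in> YF k1" "z \<in> YF k2" using yz by blast
      then have "y \<in> YF (max k1 k2)" "z \<in> YF (max k1 k2)"
        using YF_mono'[of k1 "max k1 k2"] YF_mono'[of k2 "max k1 k2"] by auto
      then show ?thesis using YF_add by blast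
    qed
    show "single L j (a j) \<in> (\<Union>k. YF k)" if "j \<in> supp L a" for j using s[OF that] by blast
    show "\<zero>\<^bsub>Y\<^esub> \<in> (\<Union>k. YF k)" using YF_zero by blast
    show "(\<Union>k. YF k) \<subseteq> carrier Y" using YF_carrier by blast
  qed
  then have "a \<in> (\<Union>k. YF k)" by (subst fsupp_expand[OF ring_axioms assms(1)])
  then show ?thesis by blast
qed

theorem basis_inj: "\<lbrakk>a \<in> carrier Y; pp a = a; f a = \<zero>\<^bsub>M\<^esub>\<rbrakk> \<Longrightarrow> a = \<zero>\<^bsub>Y\<^esub>"
  using YF_exhaust f_inj by blast

lemma pp_diff: "y \<in> carrier Y \<Longrightarrow> z \<in> carrier Y \<Longrightarrow> pp (y \<ominus>\<^bsub>Y\<^esub> z) = pp y \<ominus>\<^bsub>Y\<^esub> pp z"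
proof -
  assume y: "y \<in> carrier Y" and z: "z \<in> carrier Y"
  have "pp (\<ominus>\<^bsub>Y\<^esub> z) = \<ominus>\<^bsub>Y\<^esub> pp z"
    by (rule additive_minus[of Y Y pp]) (use z pp_closed pp_add in \<open>auto simp: Y.M.abelian_group_axioms\<close>)
  then show "pp (y \<ominus>\<^bsub>Y\<^esub> z) = pp y \<ominus>\<^bsub>Y\<^esub> pp z" using y z by (simp add: a_minus_def pp_add)
qed

lemma pp_idem: "y \<in> carrier Y \<Longrightarrow> pp (pp y) = pp y"
proof
  fix j
  assume y: "y \<in> carrier Y"
  show "pp (pp y) j = pp y j"
  proof (cases "j \<in> X")
    case True
    have "p (vt j) \<otimes> (p (vt j) \<otimes> y j) = (p (vt j) \<otimes> p (vt j)) \<otimes> y j"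
      using p_closed[OF X_props(1)[OF True]] Y_apply(1)[OF y, of j] by (simp add: m_assoc)
    then show ?thesis using True p_mult[OF X_props(1)[OF True] X_props(1)[OF True]] by (simp add: pp_def)
  qed (simp add: pp_def)
qed

text \<open>Together with \<open>basis_inj\<close> this says that \<open>f\<close> restricts to an
  isomorphism from the direct sum of the modules vL onto M.\<close>

theorem basis_surj:
  assumes "z \<in> carrier M"
  obtains a where "a \<in> carrier Y" "pp a = a" "f a = z"
proof -
  obtain k where "z \<in> U k" using assms U_exhaust by blast
  then have "z \<in> f ` YF k" by (simp add: f_image)
  then obtain y where y: "y \<in> YF k" "z = f y" by blast
  show thesis
    by (rule that[of "pp y"]) (use YF_mem[OF y(1)] y(2) in \<open>simp_all add: pp_closed pp_idem f_pp\<close>)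
qed

end

section \<open>Splitting an idempotent matrix through a diagonal matrix of vertices\<close>

section \<open>Idempotent matrices over a filtered algebra\<close>

text \<open>L as a right module over itself; the scalar, written first, multiplies from the
  right.\<close>

definition rreg :: "('a, 'm) ring_scheme \<Rightarrow> ('a, 'a) module" where
  "rreg L = \<lparr>carrier = carrier L, mult = undefined, one = undefined, zero = zero L, add = add L,
     smult = (\<lambda>a z. z \<otimes>\<^bsub>L\<^esub> a)\<rparr>"

lemma rreg_simps:
  "carrier (rreg L) = carrier L" "zero (rreg L) = zero L" "add (rreg L) = add L"
  "a \<odot>\<^bsub>rreg L\<^esub> z = z \<otimes>\<^bsub>L\<^esub> a"
  by (simp_all add: rreg_def)

lemma rreg_finsum: "finsum (rreg L) = finsum L"
  by (simp add: finsum_def finprod_def rreg_def fun_eq_iff)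

lemma (in ring) rreg_rmodule: "rmodule R (rreg R)"
proof -
  have "abelian_group (rreg R)"
  proof (rule abelian_groupI)
    show "\<exists>y\<in>carrier (rreg R). y \<oplus>\<^bsub>rreg R\<^esub> x = \<zero>\<^bsub>rreg R\<^esub>" if "x \<in> carrier (rreg R)" for x
      using that by (intro bexI[of _ "\<ominus> x"]) (auto simp: rreg_simps l_neg)
  qed (auto simp: rreg_simps a_ac)
  then interpret M: abelian_group "rreg R" .
  show ?thesis
    by unfold_locales (auto simp: rreg_simps l_distr r_distr m_assoc)
qed

locale filtered_algebra = two_sided L \<kappa> V p T P loc x + reg: filtered_module L \<kappa> V p T P loc x "rreg L" G
  for L :: "('a, 'm) ring_scheme" (structure) and \<kappa> :: "'a set" and V :: "'v set" and p :: "'v \<Rightarrow> 'a"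
    and T :: "'t set" and P :: "bool \<Rightarrow> 't \<Rightarrow> 'q set" and loc :: "bool \<Rightarrow> 't \<Rightarrow> 'q \<Rightarrow> 'v"
    and x :: "bool \<Rightarrow> 't \<Rightarrow> 'q \<Rightarrow> 'q \<Rightarrow> 'a" and G :: "nat \<Rightarrow> 'a set"
begin

lemma G_mono': "k \<le> l \<Longrightarrow> G k \<subseteq> G l"
  by (induction l rule: dec_induct) (use reg.U_mono in blast)+

text \<open>The image of an idempotent matrix acting on columns of length m. Describing it by fixed
  points makes membership an equation, and the right action of L visibly preserves it.\<close>

definition fixed :: "nat \<Rightarrow> (nat \<Rightarrow> nat \<Rightarrow> 'a) \<Rightarrow> ('a, nat \<Rightarrow> 'a) module" where
  "fixed m e = (fsupp L {..<m})\<lparr>carrier :=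
     {z \<in> carrier (fsupp L {..<m}). \<forall>i<m. z i = (\<Oplus>j\<in>{..<m}. e i j \<otimes> z j)}\<rparr>"

context
  fixes m :: nat and e :: "nat \<Rightarrow> nat \<Rightarrow> 'a"
  assumes e_closed: "\<And>i j. i < m \<Longrightarrow> j < m \<Longrightarrow> e i j \<in> carrier L"
    and e_idem: "\<And>i k. i < m \<Longrightarrow> k < m \<Longrightarrow> (\<Oplus>j\<in>{..<m}. e i j \<otimes> e j k) = e i k"
begin

abbreviation "N \<equiv> fixed m e"

lemma N_simps: "zero N = (\<lambda>_. \<zero>)" "add N = (\<lambda>f g j. f j \<oplus> g j)" "smult N = (\<lambda>a f j. f j \<otimes> a)"
  by (simp_all add: fixed_def fsupp_simps)

lemma N_iff: "z \<in> carrier N \<longleftrightarrow> (\<forall>j. z j \<in> carrier L) \<and> (\<forall>j\<ge>m. z j = \<zero>) \<and> (\<forall>i<m. z i = (\<Oplus>j\<in>{..<m}. e i j \<otimes> z j))"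
proof -
  have "finite (supp L z) \<and> supp L z \<subseteq> {..<m} \<longleftrightarrow> (\<forall>j\<ge>m. z j = \<zero>)"
  proof
    assume "\<forall>j\<ge>m. z j = \<zero>"
    then have "supp L z \<subseteq> {..<m}" unfolding supp_def using not_le by blast
    then show "finite (supp L z) \<and> supp L z \<subseteq> {..<m}" using finite_subset by blast
  next
    assume "finite (supp L z) \<and> supp L z \<subseteq> {..<m}"
    then show "\<forall>j\<ge>m. z j = \<zero>" unfolding supp_def using not_less by blast
  qed
  then show ?thesis unfolding fixed_def by (simp add: fsupp_simps) blast
qed

lemma N_mem: "z \<in> carrier N \<Longrightarrow> z j \<in> carrier L"
  by (simp add: N_iff)

lemma N_fix: "z \<in> carrier N \<Longrightarrow> i < m \<Longrightarrow> (\<Oplus>j\<in>{..<m}. e i j \<otimes> z j) = z i"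
  unfolding N_iff by metis

lemma N_out: "z \<in> carrier N \<Longrightarrow> m \<le> i \<Longrightarrow> z i = \<zero>"
  by (simp add: N_iff)

lemma N_rmod: "rmodule L N"
proof -
  have add: "y \<oplus>\<^bsub>N\<^esub> z \<in> carrier N" if "y \<in> carrier N" "z \<in> carrier N" for y z
  proof -
    have "y i \<oplus> z i = (\<Oplus>j\<in>{..<m}. e i j \<otimes> (y j \<oplus> z j))" if "i < m" for i
    proof -
      have "y i \<oplus> z i = (\<Oplus>j\<in>{..<m}. e i j \<otimes> y j) \<oplus> (\<Oplus>j\<in>{..<m}. e i j \<otimes> z j)"
        using \<open>y \<in> _\<close> \<open>z \<in> _\<close> that by (simp add: N_fix)
      also have "\<dots> = (\<Oplus>j\<in>{..<m}. e i j \<otimes> (y j \<oplus> z j))"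
        using \<open>y \<in> _\<close> \<open>z \<in> _\<close> that e_closed by (intro finsum_addI[symmetric]) (auto simp: N_mem r_distr)
      finally show ?thesis .
    qed
    then show ?thesis using that unfolding N_iff by (simp add: N_simps)
  qed
  have act: "a \<odot>\<^bsub>N\<^esub> z \<in> carrier N" if a: "a \<in> carrier L" and z: "z \<in> carrier N" for a z
  proof -
    have "z i \<otimes> a = (\<Oplus>j\<in>{..<m}. e i j \<otimes> (z j \<otimes> a))" if "i < m" for i
    proof -
      have "z i \<otimes> a = (\<Oplus>j\<in>{..<m}. e i j \<otimes> z j) \<otimes> a"
        using z that by (simp add: N_fix)
      also have "\<dots> = (\<Oplus>j\<in>{..<m}. e i j \<otimes> z j \<otimes> a)"
        using z that a e_closed by (intro finsum_ldistr) (auto simp: N_mem)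
      also have "\<dots> = (\<Oplus>j\<in>{..<m}. e i j \<otimes> (z j \<otimes> a))"
        using z that a e_closed by (intro finsum_cong') (auto simp: N_mem m_assoc)
      finally show ?thesis .
    qed
    then show ?thesis using that unfolding N_iff by (simp add: N_simps)
  qed
  have zero: "\<zero>\<^bsub>N\<^esub> \<in> carrier N"
    using e_closed by (auto simp: N_iff N_simps intro!: finsum_zeroI[symmetric])
  have ag: "abelian_group N"
  proof (rule abelian_groupI)
    show "\<exists>y\<in>carrier N. y \<oplus>\<^bsub>N\<^esub> z = \<zero>\<^bsub>N\<^esub>" if "z \<in> carrier N" for z
      using act[OF _ that, of "\<ominus> \<one>"] that
      by (intro bexI[of _ "(\<ominus> \<one>) \<odot>\<^bsub>N\<^esub> z"]) (auto simp: N_simps N_mem r_minus l_neg)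
  qed (use add zero in \<open>auto simp: N_simps N_mem a_ac\<close>)
  interpret N: abelian_group N by fact
  show ?thesis
    by unfold_locales (use act in \<open>auto simp: N_simps N_mem l_distr r_distr m_assoc\<close>)
qed

interpretation N: rmodule L N by (rule N_rmod)

lemma N_comb: "\<alpha> \<in> places s (carrier N) \<Longrightarrow> comb N s \<alpha> i = comb (rreg L) s (\<lambda>t q q'. \<alpha> t q q' i)"
  by (rule comb_hom[OF N_rmod rreg_rmodule, where f = "\<lambda>z. z i"]) (auto simp: N_mem N_simps rreg_simps)

lemma N_finsum: "(\<And>j. j \<in> S \<Longrightarrow> h j \<in> carrier N) \<Longrightarrow> finsum N h S i = (\<Oplus>j\<in>S. h j i)"
  by (rule additive_finsum[of N L "\<lambda>z. z i"])
    (auto simp: N.M.abelian_group_axioms abelian_group_axioms N_mem N_simps)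

definition Ufix :: "nat \<Rightarrow> (nat \<Rightarrow> 'a) set" where
  "Ufix k = {z \<in> carrier N. \<forall>i. z i \<in> G k}"

text \<open>The filtration is the intersection of the image of e with the entrywise filtration of
  L^m; e need not preserve the latter. Every axiom, strictness included, asserts that elements
  obtained by the action and by addition lie in a piece, so it can be checked on each entry.\<close>

lemma N_filtered: "filtered_module L \<kappa> V p T P loc x N Ufix"
proof unfold_locales
  show "Ufix k \<subseteq> carrier N" for k by (auto simp: Ufix_def)
  show "Ufix 0 = {\<zero>\<^bsub>N\<^esub>}"
    using N.M.zero_closed by (auto simp: Ufix_def reg.U_0 rreg_simps N_simps)
  show "\<zero>\<^bsub>N\<^esub> \<in> Ufix k" for k
    using N.M.zero_closed reg.U_zero[of k] by (auto simp: Ufix_def rreg_simps N_simps)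
  show "y \<oplus>\<^bsub>N\<^esub> z \<in> Ufix k" if "y \<in> Ufix k" "z \<in> Ufix k" for y z k
    using N.M.a_closed[of y z] reg.U_add[of _ k] that by (auto simp: Ufix_def rreg_simps N_simps)
  show "c \<odot>\<^bsub>N\<^esub> z \<in> Ufix k" if "c \<in> \<kappa>" "z \<in> Ufix k" for c z k
    using N.act_closed[OF kappa_carrier] reg.U_kappa[of c _ k] that by (auto simp: Ufix_def rreg_simps N_simps)
  show "p v \<odot>\<^bsub>N\<^esub> z \<in> Ufix k" if "v \<in> V" "z \<in> Ufix k" for v z k
    using N.act_closed[OF p_closed] reg.U_p[of v _ k] that by (auto simp: Ufix_def rreg_simps N_simps)
  show "Ufix k \<subseteq> Ufix (Suc k)" for k using reg.U_mono[of k] by (auto simp: Ufix_def)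
  show "x (even k) t q q' \<odot>\<^bsub>N\<^esub> z \<in> Ufix (Suc k)"
    if "z \<in> Ufix k" "t \<in> T" "q \<in> P (even k) t" "q' \<in> P (odd k) t" for z k t q q'
    using N.act_closed[OF x_closed[of t q "even k" q']] reg.U_step[of _ k t q q'] that
    by (auto simp: Ufix_def rreg_simps N_simps)
  show "carrier N = (\<Union>k. Ufix k)"
  proof (intro equalityI subsetI)
    fix z assume z: "z \<in> carrier N"
    have "\<exists>k. z i \<in> G k" for i using N_mem[OF z, of i] reg.U_exhaust by (auto simp: rreg_simps)
    then obtain k where k: "\<And>i. z i \<in> G (k i)" by metis
    \<comment> \<open>Only the first m entries can be nonzero; \<open>insert 0\<close> keeps the
      maximum meaningful for m = 0.\<close>
    let ?k = "Max (insert 0 (k ` {..<m}))"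
    have "z i \<in> G ?k" for i
    proof (cases "i < m")
      case True
      then show ?thesis using k[of i] G_mono'[of "k i" ?k] by auto
    next
      case False
      then show ?thesis using N_out[OF z, of i] reg.U_zero[of ?k] by (simp add: rreg_simps)
    qed
    then show "z \<in> (\<Union>k. Ufix k)" using z by (auto simp: Ufix_def)
  qed (auto simp: Ufix_def)
  show "(\<Oplus>\<^bsub>N\<^esub>q\<in>P s t. x s t q q'' \<odot>\<^bsub>N\<^esub> \<alpha> t q q') \<in> Ufix k"
    if s: "s = even (Suc k)" and \<alpha>: "\<alpha> \<in> places s (Ufix (Suc k))" and c: "comb N s \<alpha> \<in> Ufix (Suc k)"
      and t: "t \<in> T" "q' \<in> P (\<not> s) t" "q'' \<in> P (\<not> s) t" for s k \<alpha> t q' q''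
  proof -
    have \<alpha>N: "\<alpha> \<in> places s (carrier N)" using \<alpha> by (auto simp: places_def Ufix_def)
    have c': "x s t q q'' \<odot>\<^bsub>N\<^esub> \<alpha> t q q' \<in> carrier N" if "q \<in> P s t" for q
      using N.act_closed[OF x_closed[OF t(1) that t(3)] placesD[OF \<alpha>N t(1) that t(2)]] .
    have "(\<Oplus>\<^bsub>N\<^esub>q\<in>P s t. x s t q q'' \<odot>\<^bsub>N\<^esub> \<alpha> t q q') i \<in> G k" for i
    proof -
      have "(\<Oplus>\<^bsub>rreg L\<^esub>q\<in>P s t. x s t q q'' \<odot>\<^bsub>rreg L\<^esub> \<alpha> t q q' i) \<in> G k"
      proof (rule reg.U_strict[OF s _ _ t, where \<alpha> = "\<lambda>t q q'. \<alpha> t q q' i"])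
        show "(\<lambda>t q q'. \<alpha> t q q' i) \<in> places s (G (Suc k))" using \<alpha> by (auto simp: places_def Ufix_def)
        show "comb (rreg L) s (\<lambda>t q q'. \<alpha> t q q' i) \<in> G (Suc k)"
          using c unfolding N_comb[OF \<alpha>N, symmetric] by (simp add: Ufix_def)
      qed
      also have "(\<Oplus>\<^bsub>rreg L\<^esub>q\<in>P s t. x s t q q'' \<odot>\<^bsub>rreg L\<^esub> \<alpha> t q q' i) = (\<Oplus>\<^bsub>N\<^esub>q\<in>P s t. x s t q q'' \<odot>\<^bsub>N\<^esub> \<alpha> t q q') i"
        using N_finsum[of "P s t" "\<lambda>q. x s t q q'' \<odot>\<^bsub>N\<^esub> \<alpha> t q q'" i, OF c']
        by (simp add: rreg_finsum rreg_simps N_simps(3))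
      finally show ?thesis .
    qed
    moreover have "(\<Oplus>\<^bsub>N\<^esub>q\<in>P s t. x s t q q'' \<odot>\<^bsub>N\<^esub> \<alpha> t q q') \<in> carrier N"
      using c' by (intro N.M.finsum_closed) auto
    ultimately show ?thesis by (simp add: Ufix_def)
  qed
qed

text \<open>Put the generators of the image of e into the columns of b, and the coordinates of the
  columns of e into c. Then bc = e holds by definition, and cb is the diagonal matrix because
  coordinates with respect to the generators are unique.\<close>

theorem idempotent_splits:
  obtains J :: "(nat \<times> 'v \<times> (nat \<Rightarrow> 'a)) set" and vs b c
  where "finite J" "\<And>k. k \<in> J \<Longrightarrow> vs k \<in> V"
    "\<And>i k. i < m \<Longrightarrow> k \<in> J \<Longrightarrow> b i k \<in> carrier L \<and> b i k \<otimes> p (vs k) = b i k"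
    "\<And>i k. i < m \<Longrightarrow> k \<in> J \<Longrightarrow> c k i \<in> carrier L \<and> p (vs k) \<otimes> c k i = c k i"
    "\<And>i j. i < m \<Longrightarrow> j < m \<Longrightarrow> (\<Oplus>k\<in>J. b i k \<otimes> c k j) = e i j"
    "\<And>k l. k \<in> J \<Longrightarrow> l \<in> J \<Longrightarrow> (\<Oplus>i\<in>{..<m}. c k i \<otimes> b i l) = (if k = l then p (vs k) else \<zero>)"
proof -
  interpret F: filtered_module L \<kappa> V p T P loc x N Ufix by (rule N_filtered)
  interpret Y: rmodule L F.Y by (rule F.Y_rmod)
  define col where "col k = (\<lambda>i. if i < m then e i k else \<zero>)" for k
  have col: "col k \<in> carrier N" if "k < m" for k
  proof -
    have "(\<Oplus>j\<in>{..<m}. e i j \<otimes> col k j) = e i k" if "i < m" for i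
    proof -
      have "(\<Oplus>j\<in>{..<m}. e i j \<otimes> col k j) = (\<Oplus>j\<in>{..<m}. e i j \<otimes> e j k)"
        using e_closed that \<open>k < m\<close> by (intro finsum_cong') (auto simp: col_def)
      then show ?thesis using e_idem[OF that \<open>k < m\<close>] by simp
    qed
    then show ?thesis unfolding N_iff using that e_closed by (simp add: col_def)
  qed
  have "\<exists>a. a \<in> carrier F.Y \<and> F.pp a = a \<and> F.f a = col k" if "k < m" for k
    using F.basis_surj[OF col[OF that]] by metis
  then obtain a where a: "\<And>k. k < m \<Longrightarrow> a k \<in> carrier F.Y" "\<And>k. k < m \<Longrightarrow> F.pp (a k) = a k"
    "\<And>k. k < m \<Longrightarrow> F.f (a k) = col k" by metis
  \<comment> \<open>Only finitely many generators occur in the m columns of e, which makes the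
    middle index set finite.\<close>
  define J where "J = (\<Union>k<m. supp L (a k))"
  have J: "finite J" "J \<subseteq> F.X" using a(1) by (auto simp: J_def fsupp_simps)
  have JX: "j \<in> F.X" if "j \<in> J" for j using that J(2) by (rule rev_subsetD)
  have gN: "F.g j \<in> carrier N" if "j \<in> J" for j using funcset_mem[OF F.g_fun JX[OF that]] .
  show thesis
  proof (rule that[of J F.vt "\<lambda>i k. F.g k i" "\<lambda>k i. a i k"])
    show "finite J" by (rule J)
    show "F.vt k \<in> V" if "k \<in> J" for k using F.X_props(1)[OF JX[OF that]] .
    show "F.g k i \<in> carrier L \<and> F.g k i \<otimes> p (F.vt k) = F.g k i" if "i < m" "k \<in> J" for i k
    proof -
      have "p (F.vt k) \<odot>\<^bsub>N\<^esub> F.g k = F.g k" using F.X_props(3)[OF JX[OF that(2)]] .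
      from fun_cong[OF this, of i] show ?thesis using N_mem[OF gN[OF that(2)]] by (simp add: N_simps)
    qed
    show "a i k \<in> carrier L \<and> p (F.vt k) \<otimes> a i k = a i k" if "i < m" "k \<in> J" for i k
      using fun_cong[OF a(2)[OF that(1)], of k] JX[OF that(2)] F.Y_apply(1)[OF a(1)[OF that(1)], of k]
      by (simp add: F.pp_def)
    show "(\<Oplus>k\<in>J. F.g k i \<otimes> a j k) = e i j" if "i < m" "j < m" for i j
    proof -
      have "F.f (a j) = (\<Oplus>\<^bsub>N\<^esub>k\<in>J. a j k \<odot>\<^bsub>N\<^esub> F.g k)"
        using that a(1) J by (intro N.lin_superset[OF F.g_fun]) (auto simp: J_def)
      then have "col j = (\<Oplus>\<^bsub>N\<^esub>k\<in>J. a j k \<odot>\<^bsub>N\<^esub> F.g k)" using a(3)[OF that(2)] by metis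
      from fun_cong[OF this, of i] have "e i j = (\<Oplus>\<^bsub>N\<^esub>k\<in>J. a j k \<odot>\<^bsub>N\<^esub> F.g k) i"
        using that(1) by (simp add: col_def)
      also have "\<dots> = (\<Oplus>k\<in>J. (a j k \<odot>\<^bsub>N\<^esub> F.g k) i)"
        using gN F.Y_apply(1)[OF a(1)[OF that(2)]] by (intro N_finsum N.act_closed)
      finally show ?thesis by (simp add: N_simps)
    qed
    show "(\<Oplus>i\<in>{..<m}. a i k \<otimes> F.g l i) = (if k = l then p (F.vt k) else \<zero>)" if kl: "k \<in> J" "l \<in> J" for k l
    proof -
      have lX: "l \<in> F.X" using JX[OF kl(2)] .
      have gl: "F.g l i \<in> carrier L" for i using N_mem[OF gN[OF kl(2)]] .
      \<comment> \<open>Column l of the product cb, as an element of the direct sum; it is compared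
        with the l-th generator \<open>?\<delta>\<close>.\<close>
      let ?S = "\<Oplus>\<^bsub>F.Y\<^esub>i\<in>{..<m}. F.g l i \<odot>\<^bsub>F.Y\<^esub> a i"
      let ?\<delta> = "single L l (p (F.vt l))"
      have Sc: "?S \<in> carrier F.Y" using gl a(1) by (auto intro!: Y.M.finsum_closed Y.act_closed)
      have \<delta>c: "?\<delta> \<in> carrier F.Y" using lX p_closed F.X_props(1) by (simp add: single_closed)
      have \<delta>p: "F.pp ?\<delta> = ?\<delta>"
      proof
        fix j
        show "F.pp ?\<delta> j = ?\<delta> j"
          using lX p_closed[OF F.X_props(1)] p_mult[OF F.X_props(1) F.X_props(1)]
          by (cases "j = l") (auto simp: F.pp_def single_def)
      qed
      have Sj: "?S j = (\<Oplus>i\<in>{..<m}. a i j \<otimes> F.g l i)" for j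
        using gl a(1) Y.act_closed[OF gl a(1)] by (subst fsupp_finsum_apply[OF ring_axioms]) (auto simp: fsupp_simps(3))
      have Sp: "F.pp ?S = ?S"
      proof
        fix j
        show "F.pp ?S j = ?S j"
        proof (cases "j \<in> F.X")
          case True
          have pj: "p (F.vt j) \<in> carrier L" using p_closed[OF F.X_props(1)[OF True]] .
          have aj: "a i j \<in> carrier L" "p (F.vt j) \<otimes> a i j = a i j" if "i < m" for i
            using F.Y_apply(1)[OF a(1)[OF that]] fun_cong[OF a(2)[OF that], of j] True by (auto simp: F.pp_def)
          have "p (F.vt j) \<otimes> ?S j = (\<Oplus>i\<in>{..<m}. p (F.vt j) \<otimes> (a i j \<otimes> F.g l i))"
            unfolding Sj using pj aj gl by (intro finsum_rdistr) auto
          also have "\<dots> = ?S j" unfolding Sj using pj aj gl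
            by (intro finsum_cong') (auto simp flip: m_assoc)
          finally show ?thesis using True by (simp add: F.pp_def)
        next
          case False
          then show ?thesis using F.Y_apply(2)[OF Sc False] by (simp add: F.pp_def)
        qed
      qed
      \<comment> \<open>Applying \<open>f\<close> gives the matrix e times the column of the l-th
        generator, which is that column again because it lies in the image of e.\<close>
      have fS: "F.f ?S = F.g l"
      proof
        fix i
        have "F.f ?S = (\<Oplus>\<^bsub>N\<^esub>j\<in>{..<m}. F.f (F.g l j \<odot>\<^bsub>F.Y\<^esub> a j))"
          using gl a(1) by (intro F.f_finsum) auto
        also have "\<dots> = (\<Oplus>\<^bsub>N\<^esub>j\<in>{..<m}. F.g l j \<odot>\<^bsub>N\<^esub> col j)"
          using gl a(1,3) col by (intro N.M.finsum_cong') (auto simp: F.f_act)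
        finally have "F.f ?S i = (\<Oplus>\<^bsub>N\<^esub>j\<in>{..<m}. F.g l j \<odot>\<^bsub>N\<^esub> col j) i" by simp
        also have "\<dots> = (\<Oplus>j\<in>{..<m}. (F.g l j \<odot>\<^bsub>N\<^esub> col j) i)"
          using gl col by (intro N_finsum N.act_closed) simp_all
        also have "\<dots> = (\<Oplus>j\<in>{..<m}. col j i \<otimes> F.g l j)" by (simp add: N_simps)
        also have "\<dots> = F.g l i"
        proof (cases "i < m")
          case True
          have "(\<Oplus>j\<in>{..<m}. e i j \<otimes> F.g l j) = F.g l i" using N_fix[OF gN[OF kl(2)] True] .
          then show ?thesis using True by (simp add: col_def)
        next
          case False
          have "F.g l i = \<zero>" using N_out[OF gN[OF kl(2)]] False by simp
          then show ?thesis using False gl by (auto simp: col_def intro!: finsum_zeroI)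
        qed
        finally show "F.f ?S i = F.g l i" .
      qed
      have f\<delta>: "F.f ?\<delta> = F.g l"
        using lX F.g_fun p_closed F.X_props by (subst N.lin_single) auto
      have "F.f (?S \<ominus>\<^bsub>F.Y\<^esub> ?\<delta>) = \<zero>\<^bsub>N\<^esub>"
        using Sc \<delta>c fS f\<delta> gN[OF kl(2)] by (simp add: a_minus_def F.f_add F.f_minus N.M.r_neg)
      moreover have "F.pp (?S \<ominus>\<^bsub>F.Y\<^esub> ?\<delta>) = ?S \<ominus>\<^bsub>F.Y\<^esub> ?\<delta>"
        using F.pp_diff[OF Sc \<delta>c] Sp \<delta>p by simp
      ultimately have "?S \<ominus>\<^bsub>F.Y\<^esub> ?\<delta> = \<zero>\<^bsub>F.Y\<^esub>" using Sc \<delta>c by (intro F.basis_inj) auto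
      then have "?S = ?\<delta>" using Sc \<delta>c by (simp add: Y.M.minus_eq_zero_iff)
      then have "?S k = ?\<delta> k" by (rule fun_cong)
      then show ?thesis unfolding Sj by (auto simp: single_def)
    qed
  qed
qed

end

end

section \<open>The space spanned by normal words, with its operators\<close>

section \<open>The module of normal words\<close>

text \<open>Words grow at their right end, the end at which the algebra acts. The root supplies the
  starting vertex, so the trivial path at each vertex is a word too.\<close>

datatype ('v, 't, 'q) path = Root 'v | Ext "('v, 't, 'q) path" bool 't 'q 'q

lemma fsupp_module:
  assumes "cring K"
  shows "module K (fsupp K J)"
proof -
  interpret cring K by fact
  interpret M: rmodule K "fsupp K J" by (rule fsupp_rmodule) (rule ring_axioms)
  show ?thesis
  proof unfold_locales
    fix a b x assume "a \<in> carrier K" "b \<in> carrier K" "x \<in> carrier (fsupp K J)"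
    then show "(a \<otimes>\<^bsub>K\<^esub> b) \<odot>\<^bsub>fsupp K J\<^esub> x = a \<odot>\<^bsub>fsupp K J\<^esub> (b \<odot>\<^bsub>fsupp K J\<^esub> x)"
      using M.act_mult[of b a x] m_comm[of a b] by simp
  qed (simp_all add: M.act_add_left M.act_add_right)
qed

text \<open>
  The normal words are the paths in the letters \<open>x s t q q'\<close> in which no letter
  \<open>x (\<not> s) t q q'\<close> with \<open>q' = sp s t\<close> is followed by a letter \<open>x s t q' q''\<close>. The degree of a word
  is the step at which it appears when one multiplies alternately by letters of either side.
\<close>

locale word_module = cring K for K :: "('k, 'm) ring_scheme" (structure) +
  fixes V :: "'v set" and T :: "'t set" and P :: "bool \<Rightarrow> 't \<Rightarrow> 'q set"
    and loc :: "bool \<Rightarrow> 't \<Rightarrow> 'q \<Rightarrow> 'v" and sp :: "bool \<Rightarrow> 't \<Rightarrow> 'q"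
  assumes finite_P: "t \<in> T \<Longrightarrow> finite (P s t)"
    and sp_P: "t \<in> T \<Longrightarrow> sp s t \<in> P s t"
    and loc_V: "t \<in> T \<Longrightarrow> q \<in> P s t \<Longrightarrow> loc s t q \<in> V"
begin

fun pend :: "('v, 't, 'q) path \<Rightarrow> 'v" where
  "pend (Root v) = v"
| "pend (Ext u s t q q') = loc (\<not> s) t q'"

text \<open>The word ends in a letter whose right place is the distinguished one, and the next
  letter would start there. Only these products can be rewritten by the matrix relation; a single
  distinguished place per matrix suffices, since each relation is solved for one product.\<close>

fun blocked :: "('v, 't, 'q) path \<Rightarrow> bool \<Rightarrow> 't \<Rightarrow> 'q \<Rightarrow> bool" where
  "blocked (Root v) s t q = False"
| "blocked (Ext u s1 t1 q1 q2) s t q = (s1 = (\<not> s) \<and> t1 = t \<and> q2 = q \<and> q = sp s t)"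

fun normal :: "('v, 't, 'q) path \<Rightarrow> bool" where
  "normal (Root v) = (v \<in> V)"
| "normal (Ext u s t q q') = (normal u \<and> t \<in> T \<and> q \<in> P s t \<and> q' \<in> P (\<not> s) t \<and> pend u = loc s t q
     \<and> \<not> blocked u s t q)"

text \<open>Roots have degree 1, which leaves degree 0 for the zero space. A word of degree n may
  take a letter of side \<open>even n\<close> at once; a letter of the other side has to wait one
  step, which accounts for the summand 2.\<close>

fun deg :: "('v, 't, 'q) path \<Rightarrow> nat" where
  "deg (Root v) = 1"
| "deg (Ext u s t q q') = (if even (deg u) = s then deg u + 1 else deg u + 2)"

abbreviation "W \<equiv> fsupp K (Collect normal)"
abbreviation "\<delta> u \<equiv> single K u \<one>"

lemma W_module: "module K W"
  by (rule fsupp_module) (rule cring_axioms)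

interpretation W: rmodule K W by (rule fsupp_rmodule) (rule ring_axioms)

lemma delta_closed: "normal u \<Longrightarrow> \<delta> u \<in> carrier W"
  by (rule single_closed) auto

lemma normal_pend: "normal u \<Longrightarrow> pend u \<in> V"
  by (cases u) (auto intro: loc_V)

text \<open>Right multiplication of a word by a letter. For a blocked word it is the relation
  \<open>x_x\<close> of the other side, solved for the product at the distinguished place.\<close>

fun step :: "bool \<Rightarrow> 't \<Rightarrow> 'q \<Rightarrow> 'q \<Rightarrow> ('v, 't, 'q) path \<Rightarrow> ('v, 't, 'q) path \<Rightarrow> 'k" where
  "step s t q q' (Root v) = (if v = loc s t q then \<delta> (Ext (Root v) s t q q') else \<zero>\<^bsub>W\<^esub>)"
| "step s t q q' (Ext u s1 t1 q1 q2) =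
    (if s1 = (\<not> s) \<and> t1 = t \<and> q2 = q \<and> q = sp s t
     then (if q1 = q' then \<delta> u else \<zero>\<^bsub>W\<^esub>) \<ominus>\<^bsub>W\<^esub> (\<Oplus>\<^bsub>W\<^esub>r\<in>P s t - {q}. \<delta> (Ext (Ext u (\<not> s) t q1 r) s t r q'))
     else if loc (\<not> s1) t1 q2 = loc s t q then \<delta> (Ext (Ext u s1 t1 q1 q2) s t q q') else \<zero>\<^bsub>W\<^esub>)"

lemma step_unblocked: "\<not> blocked u s t q \<Longrightarrow> step s t q q' u = (if pend u = loc s t q then \<delta> (Ext u s t q q') else \<zero>\<^bsub>W\<^esub>)"
  by (cases u) auto

lemma step_blocked:
  "step s t (sp s t) q' (Ext u (\<not> s) t q1 (sp s t)) =
    (if q1 = q' then \<delta> u else \<zero>\<^bsub>W\<^esub>) \<ominus>\<^bsub>W\<^esub> (\<Oplus>\<^bsub>W\<^esub>r\<in>P s t - {sp s t}. \<delta> (Ext (Ext u (\<not> s) t q1 r) s t r q'))"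
  by simp

lemma blockedE:
  assumes "blocked u s t q"
  obtains u' q1 where "u = Ext u' (\<not> s) t q1 q" "q = sp s t"
  using assms by (cases u) auto

declare step.simps [simp del]

text \<open>The words produced by the rewriting are normal: replacing the distinguished place by
  another one unblocks the word, so no further rewriting is necessary.\<close>

lemma normal_alter: "\<lbrakk>normal (Ext u (\<not> s) t q1 q); r \<in> P s t; r \<noteq> sp s t; q' \<in> P (\<not> s) t\<rbrakk>
  \<Longrightarrow> normal (Ext (Ext u (\<not> s) t q1 r) s t r q')"
  by auto

lemma step_closed: "\<lbrakk>normal u; t \<in> T; q \<in> P s t; q' \<in> P (\<not> s) t\<rbrakk> \<Longrightarrow> step s t q q' u \<in> carrier W"
proof -
  assume u: "normal u" and t: "t \<in> T" "q \<in> P s t" "q' \<in> P (\<not> s) t"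
  show ?thesis
  proof (cases "blocked u s t q")
    case True
    then obtain u' q1 where e: "u = Ext u' (\<not> s) t q1 q" "q = sp s t" by (rule blockedE)
    have "\<delta> u' \<in> carrier W" using u e by (auto intro: delta_closed)
    moreover have "(\<Oplus>\<^bsub>W\<^esub>r\<in>P s t - {q}. \<delta> (Ext (Ext u' (\<not> s) t q1 r) s t r q')) \<in> carrier W"
      using normal_alter[of u' s t q1 q _ q'] u e t by (intro W.M.finsum_closed) (auto intro!: delta_closed)
    ultimately show ?thesis using e step_blocked[of s t q' u' q1] by auto
  next
    case False
    then show ?thesis using u t by (auto simp: step_unblocked intro!: delta_closed)
  qed
qed

definition op :: "bool \<Rightarrow> 't \<Rightarrow> 'q \<Rightarrow> 'q \<Rightarrow> (('v, 't, 'q) path \<Rightarrow> 'k) \<Rightarrow> (('v, 't, 'q) path \<Rightarrow> 'k)" where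
  "op s t q q' = (\<lambda>z\<in>carrier W. W.lin (step s t q q') z)"

definition vop :: "'v \<Rightarrow> (('v, 't, 'q) path \<Rightarrow> 'k) \<Rightarrow> (('v, 't, 'q) path \<Rightarrow> 'k)" where
  "vop v = (\<lambda>z\<in>carrier W. W.lin (\<lambda>u. if pend u = v then \<delta> u else \<zero>\<^bsub>W\<^esub>) z)"

lemma lin_endo:
  assumes "h \<in> Collect normal \<rightarrow> carrier W"
  shows "(\<lambda>z\<in>carrier W. W.lin h z) \<in> carrier (endo_alg K W)"
proof (rule endo_algI[OF _ _ _ W_module])
  show "W.lin h (y \<oplus>\<^bsub>W\<^esub> z) = W.lin h y \<oplus>\<^bsub>W\<^esub> W.lin h z" if "y \<in> carrier W" "z \<in> carrier W" for y z
    using W.lin_add[OF assms that] by (simp add: fsupp_simps(2))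
  show "W.lin h (c \<odot>\<^bsub>W\<^esub> z) = c \<odot>\<^bsub>W\<^esub> W.lin h z" if "c \<in> carrier K" "z \<in> carrier W" for c z
    using W.lin_act[OF assms that(2,1)] by (simp add: fsupp_simps(3))
qed (rule W.lin_closed[OF assms])

lemma op_endo: "\<lbrakk>t \<in> T; q \<in> P s t; q' \<in> P (\<not> s) t\<rbrakk> \<Longrightarrow> op s t q q' \<in> carrier (endo_alg K W)"
  unfolding op_def by (rule lin_endo) (auto intro: step_closed)

lemma vop_endo: "vop v \<in> carrier (endo_alg K W)"
  unfolding vop_def by (rule lin_endo) (auto intro: delta_closed)

lemma op_delta: "\<lbrakk>t \<in> T; q \<in> P s t; q' \<in> P (\<not> s) t; normal u\<rbrakk> \<Longrightarrow> op s t q q' (\<delta> u) = step s t q q' u"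
  using step_closed[of u t q s q'] by (simp add: op_def delta_closed W.lin_single)

lemma vop_delta: "normal u \<Longrightarrow> vop v (\<delta> u) = (if pend u = v then \<delta> u else \<zero>\<^bsub>W\<^esub>)"
  using delta_closed[of u] by (simp add: vop_def W.lin_single)

lemma W_induct [consumes 1, case_names delta zero add smult]:
  assumes "z \<in> carrier W" "\<And>u. normal u \<Longrightarrow> Q (\<delta> u)" "Q \<zero>\<^bsub>W\<^esub>"
    "\<And>y z. \<lbrakk>y \<in> carrier W; z \<in> carrier W; Q y; Q z\<rbrakk> \<Longrightarrow> Q (y \<oplus>\<^bsub>W\<^esub> z)"
    "\<And>c z. \<lbrakk>c \<in> carrier K; z \<in> carrier W; Q z\<rbrakk> \<Longrightarrow> Q (c \<odot>\<^bsub>W\<^esub> z)"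
  shows "Q z"
  using ring_axioms assms(1)
proof (induction rule: fsupp_induct)
  case zero
  then show ?case using assms(3) by (simp add: fsupp_simps(1))
next
  case (single u c)
  have "single K u c = c \<odot>\<^bsub>W\<^esub> \<delta> u" using single by (auto simp: fsupp_simps(3) single_def)
  then show ?case using assms(2)[of u] assms(5)[of c "\<delta> u"] single delta_closed by simp
next
  case (add y z)
  then show ?case using assms(4)[of y z] by (simp add: fsupp_simps(2))
qed

lemma endo_zero: "\<phi> \<in> carrier (endo_alg K W) \<Longrightarrow> \<phi> \<zero>\<^bsub>W\<^esub> = \<zero>\<^bsub>W\<^esub>"
  using endo_algD(1,2)[of \<phi> K W]
  by (intro additive_zero[of W W]) (auto simp: W.M.abelian_group_axioms)

lemma endo_eqI:
  assumes "\<phi> \<in> carrier (endo_alg K W)" "\<psi> \<in> carrier (endo_alg K W)"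
    "\<And>u. normal u \<Longrightarrow> \<phi> (\<delta> u) = \<psi> (\<delta> u)"
  shows "\<phi> = \<psi>"
proof (rule endo_alg_eqI[OF assms(1,2)])
  interpret E: algebra_over K "endo_alg K W" by (rule endo_algebra_over) (rule W_module)
  fix z assume "z \<in> carrier W"
  then show "\<phi> z = \<psi> z"
  proof (induction rule: W_induct)
    case zero
    then show ?case using assms(1,2)[THEN endo_zero] by simp
  qed (use assms endo_algD[of \<phi> K W] endo_algD[of \<psi> K W] in auto)
qed

interpretation E: algebra_over K "endo_alg K W" by (rule endo_algebra_over) (rule W_module)

lemma endo_minus: "\<phi> \<in> carrier (endo_alg K W) \<Longrightarrow> y \<in> carrier W \<Longrightarrow> z \<in> carrier W \<Longrightarrow> \<phi> (y \<ominus>\<^bsub>W\<^esub> z) = \<phi> y \<ominus>\<^bsub>W\<^esub> \<phi> z"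
  using endo_algD(1,2)[of \<phi> K W] additive_minus[of W W \<phi> z] W.M.abelian_group_axioms
  by (auto simp: a_minus_def)

lemma endo_finsum: "\<phi> \<in> carrier (endo_alg K W) \<Longrightarrow> (\<And>i. i \<in> S \<Longrightarrow> h i \<in> carrier W) \<Longrightarrow> \<phi> (finsum W h S) = (\<Oplus>\<^bsub>W\<^esub>i\<in>S. \<phi> (h i))"
  using endo_algD(1,2)[of \<phi> K W]
  by (intro additive_finsum[of W W]) (auto simp: W.M.abelian_group_axioms)

lemma vop_vop: "vop u \<otimes>\<^bsub>endo_alg K W\<^esub> vop v = (if u = v then vop u else \<zero>\<^bsub>endo_alg K W\<^esub>)"
  by (rule endo_eqI)
    (auto simp: vop_endo vop_delta endo_zero endo_alg_simps delta_closed intro!: E.B.m_closed)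

lemma vop_op:
  assumes t: "t \<in> T" "q \<in> P s t" "q' \<in> P (\<not> s) t"
  shows "vop (loc s t q) \<otimes>\<^bsub>endo_alg K W\<^esub> op s t q q' = op s t q q'"
proof (rule endo_eqI)
  fix u assume u: "normal u"
  have "step s t q q' u = \<zero>\<^bsub>W\<^esub>" if "pend u \<noteq> loc s t q"
  proof -
    have "\<not> blocked u s t q" using that by (auto elim: blockedE)
    then show ?thesis using that by (simp add: step_unblocked)
  qed
  then show "(vop (loc s t q) \<otimes>\<^bsub>endo_alg K W\<^esub> op s t q q') (\<delta> u) = op s t q q' (\<delta> u)"
    using u t by (auto simp: endo_alg_simps delta_closed vop_delta op_delta endo_zero op_endo)
qed (use t in \<open>auto intro!: E.B.m_closed vop_endo op_endo\<close>)

lemma op_vop: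
  assumes t: "t \<in> T" "q \<in> P s t" "q' \<in> P (\<not> s) t"
  shows "op s t q q' \<otimes>\<^bsub>endo_alg K W\<^esub> vop (loc (\<not> s) t q') = op s t q q'"
proof (rule endo_eqI)
  fix u assume u: "normal u"
  have "vop (loc (\<not> s) t q') (step s t q q' u) = step s t q q' u"
  proof (cases "blocked u s t q")
    case True
    then obtain u' q1 where e: "u = Ext u' (\<not> s) t q1 q" "q = sp s t" by (rule blockedE)
    let ?w = "\<lambda>r. Ext (Ext u' (\<not> s) t q1 r) s t r q'"
    have n: "normal (?w r)" if "r \<in> P s t - {q}" for r
      using normal_alter[of u' s t q1 q r q'] u e t that by auto
    have S: "(\<Oplus>\<^bsub>W\<^esub>r\<in>P s t - {q}. \<delta> (?w r)) \<in> carrier W"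
      using delta_closed[OF n] by (intro W.M.finsum_closed) blast
    have "vop (loc (\<not> s) t q') (\<Oplus>\<^bsub>W\<^esub>r\<in>P s t - {q}. \<delta> (?w r)) = (\<Oplus>\<^bsub>W\<^esub>r\<in>P s t - {q}. \<delta> (?w r))"
    proof -
      have "vop (loc (\<not> s) t q') (\<Oplus>\<^bsub>W\<^esub>r\<in>P s t - {q}. \<delta> (?w r)) = (\<Oplus>\<^bsub>W\<^esub>r\<in>P s t - {q}. vop (loc (\<not> s) t q') (\<delta> (?w r)))"
        using delta_closed[OF n] by (intro endo_finsum[OF vop_endo]) blast
      also have "\<dots> = (\<Oplus>\<^bsub>W\<^esub>r\<in>P s t - {q}. \<delta> (?w r))"
        using delta_closed[OF n] vop_delta[OF n] by (intro W.M.finsum_cong') simp_all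
      finally show ?thesis .
    qed
    moreover have "normal u'" "pend u' = loc (\<not> s) t q1" using u e by auto
    ultimately show ?thesis
      unfolding e step_blocked using S
      by (subst endo_minus[OF vop_endo]) (auto simp: delta_closed vop_delta endo_zero vop_endo e)
  next
    case False
    then show ?thesis using u t
      by (auto simp: step_unblocked vop_delta endo_zero vop_endo)
  qed
  then show "(op s t q q' \<otimes>\<^bsub>endo_alg K W\<^esub> vop (loc (\<not> s) t q')) (\<delta> u) = op s t q q' (\<delta> u)"
    using u t by (simp add: endo_alg_simps delta_closed op_delta)
qed (use t in \<open>auto intro!: E.B.m_closed vop_endo op_endo\<close>)

text \<open>Among the words obtained with the first letter, exactly one is blocked for the second
  letter, the one through the distinguished place. Its rewriting is \<open>\<delta> u\<close> or
  zero minus the contributions of all other places, so the sum collapses.\<close>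

lemma op_op_unblocked:
  assumes t: "t \<in> T" "q \<in> P s t" "q'' \<in> P s t" and u: "normal u" "pend u = loc s t q" "\<not> blocked u s t q"
  shows "(\<Oplus>\<^bsub>W\<^esub>q'\<in>P (\<not> s) t. op (\<not> s) t q' q'' (\<delta> (Ext u s t q q'))) = (if q = q'' then \<delta> u else \<zero>\<^bsub>W\<^esub>)"
proof -
  let ?s = "sp (\<not> s) t" and ?S = "P (\<not> s) t"
  let ?w = "\<lambda>r. \<delta> (Ext (Ext u s t q r) (\<not> s) t r q'')"
  have n: "normal (Ext u s t q q')" if "q' \<in> ?S" for q' using that u t by simp
  have o: "op (\<not> s) t q' q'' (\<delta> (Ext u s t q q')) = step (\<not> s) t q' q'' (Ext u s t q q')" if "q' \<in> ?S" for q'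
    using n[OF that] t that by (intro op_delta) auto
  have o': "op (\<not> s) t q' q'' (\<delta> (Ext u s t q q')) = ?w q'" if "q' \<in> ?S - {?s}" for q'
    using that o[of q'] by (subst o) (auto simp: step_unblocked)
  have w: "?w q' \<in> carrier W" if "q' \<in> ?S - {?s}" for q'
    using that u t by (intro delta_closed) auto
  have fin: "finite (?S - {?s})" using finite_P t by simp
  have sP: "?S = insert ?s (?S - {?s})" using sp_P t by auto
  let ?d = "if q = q'' then \<delta> u else \<zero>\<^bsub>W\<^esub>"
  have d: "?d \<in> carrier W" using u by (simp add: delta_closed)
  have S: "(\<Oplus>\<^bsub>W\<^esub>r\<in>?S - {?s}. ?w r) \<in> carrier W" using w by (intro W.M.finsum_closed) auto
  have os: "op (\<not> s) t ?s q'' (\<delta> (Ext u s t q ?s)) = ?d \<ominus>\<^bsub>W\<^esub> (\<Oplus>\<^bsub>W\<^esub>r\<in>?S - {?s}. ?w r)"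
    using o[of ?s] sp_P[OF t(1)] step_blocked[of "\<not> s" t q'' u q] by simp
  have "(\<Oplus>\<^bsub>W\<^esub>q'\<in>?S. op (\<not> s) t q' q'' (\<delta> (Ext u s t q q')))
      = op (\<not> s) t ?s q'' (\<delta> (Ext u s t q ?s)) \<oplus>\<^bsub>W\<^esub> (\<Oplus>\<^bsub>W\<^esub>q'\<in>?S - {?s}. op (\<not> s) t q' q'' (\<delta> (Ext u s t q q')))"
    using fin o' w os S d by (subst sP, intro W.M.finsum_insert) auto
  also have "(\<Oplus>\<^bsub>W\<^esub>q'\<in>?S - {?s}. op (\<not> s) t q' q'' (\<delta> (Ext u s t q q'))) = (\<Oplus>\<^bsub>W\<^esub>r\<in>?S - {?s}. ?w r)"
    using o' w by (intro W.M.finsum_cong') auto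
  also have "op (\<not> s) t ?s q'' (\<delta> (Ext u s t q ?s)) \<oplus>\<^bsub>W\<^esub> \<dots> = ?d"
    unfolding os using d S by (simp add: a_minus_def W.M.a_assoc W.M.l_neg)
  finally show ?thesis .
qed

text \<open>This is where the normal form is shown to be consistent: the operators satisfy the
  matrix relations exactly, also on words on which the first factor already has to be
  rewritten.\<close>

lemma op_op:
  assumes t: "t \<in> T" "q \<in> P s t" "q'' \<in> P s t"
  shows "(\<Oplus>\<^bsub>endo_alg K W\<^esub>q'\<in>P (\<not> s) t. op s t q q' \<otimes>\<^bsub>endo_alg K W\<^esub> op (\<not> s) t q' q'')
    = (if q = q'' then vop (loc s t q) else \<zero>\<^bsub>endo_alg K W\<^esub>)"
proof (rule endo_eqI)
  have c: "op s t q q' \<otimes>\<^bsub>endo_alg K W\<^esub> op (\<not> s) t q' q'' \<in> carrier (endo_alg K W)" if "q' \<in> P (\<not> s) t" for q'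
    using t that by (intro E.B.m_closed op_endo) auto
  then show "(\<Oplus>\<^bsub>endo_alg K W\<^esub>q'\<in>P (\<not> s) t. op s t q q' \<otimes>\<^bsub>endo_alg K W\<^esub> op (\<not> s) t q' q'') \<in> carrier (endo_alg K W)"
    by (intro E.finsum_closed) auto
  show "(if q = q'' then vop (loc s t q) else \<zero>\<^bsub>endo_alg K W\<^esub>) \<in> carrier (endo_alg K W)" by (simp add: vop_endo)
  fix u assume u: "normal u"
  have e': "op (\<not> s) t q' q'' \<in> carrier (endo_alg K W)" if "q' \<in> P (\<not> s) t" for q' using t that by (intro op_endo) auto
  have "(\<Oplus>\<^bsub>endo_alg K W\<^esub>q'\<in>P (\<not> s) t. op s t q q' \<otimes>\<^bsub>endo_alg K W\<^esub> op (\<not> s) t q' q'') (\<delta> u)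
      = (\<Oplus>\<^bsub>W\<^esub>q'\<in>P (\<not> s) t. (op s t q q' \<otimes>\<^bsub>endo_alg K W\<^esub> op (\<not> s) t q' q'') (\<delta> u))"
    by (rule endo_alg_finsum_apply[OF W_module c delta_closed[OF u]])
  also have "\<dots> = (\<Oplus>\<^bsub>W\<^esub>q'\<in>P (\<not> s) t. op (\<not> s) t q' q'' (step s t q q' u))"
    using u t step_closed endo_algD(1)[OF e']
    by (intro W.M.finsum_cong') (auto simp: endo_alg_simps delta_closed op_delta)
  also have "\<dots> = (if q = q'' \<and> pend u = loc s t q then \<delta> u else \<zero>\<^bsub>W\<^esub>)"
  proof (cases "blocked u s t q")
    case False
    show ?thesis
    proof (cases "pend u = loc s t q")
      case True
      then show ?thesis using op_op_unblocked[OF t u True False] by (simp add: step_unblocked False)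
    next
      case pn: False
      then show ?thesis using False e' by (auto simp: step_unblocked endo_zero intro!: W.M.finsum_zeroI)
    qed
  next
    case True
    \<comment> \<open>Overlap of two rewritings. The first letter is removed or moved to the places
      \<open>r \<noteq> q\<close>. In the first case the second letter extends u'; in the second
      case the relation for unblocked words applies to \<open>?v r\<close>.\<close>
    then obtain u' q1 where e: "u = Ext u' (\<not> s) t q1 q" "q = sp s t" by (rule blockedE)
    let ?R = "P s t - {q}"
    let ?v = "\<lambda>r. Ext u' (\<not> s) t q1 r"
    let ?w = "\<lambda>q' r. Ext (?v r) s t r q'"
    have nu: "normal u'" "pend u' = loc (\<not> s) t q1" "\<not> blocked u' (\<not> s) t q1" "q1 \<in> P (\<not> s) t" using u e by auto
    have nv: "normal (?v r)" if "r \<in> P s t" for r using u e that by auto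
    have nw: "normal (?w q' r)" if "r \<in> ?R" "q' \<in> P (\<not> s) t" for r q'
      using normal_alter[of u' s t q1 q r q'] u e t that by auto
    have wc: "op (\<not> s) t q' q'' (\<delta> (?w q' r)) \<in> carrier W" if "r \<in> ?R" "q' \<in> P (\<not> s) t" for r q'
      using endo_algD(1)[OF e'[OF that(2)] delta_closed[OF nw[OF that]]] .
    have Sc: "(\<Oplus>\<^bsub>W\<^esub>r\<in>?R. \<delta> (?w q' r)) \<in> carrier W" if "q' \<in> P (\<not> s) t" for q'
      using delta_closed[OF nw[OF _ that]] by (intro W.M.finsum_closed) blast
    have fin: "finite ?R" "finite (P (\<not> s) t)" using finite_P t by auto
    let ?A = "\<lambda>q'. if q1 = q' then op (\<not> s) t q1 q'' (\<delta> u') else \<zero>\<^bsub>W\<^esub>"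
    let ?B = "\<lambda>q'. \<Oplus>\<^bsub>W\<^esub>r\<in>?R. op (\<not> s) t q' q'' (\<delta> (?w q' r))"
    have Ac: "op (\<not> s) t q1 q'' (\<delta> u') \<in> carrier W" using endo_algD(1)[OF e'[OF nu(4)] delta_closed[OF nu(1)]] .
    have Bc: "?B q' \<in> carrier W" if "q' \<in> P (\<not> s) t" for q' using wc that by (intro W.M.finsum_closed) auto
    have st: "op (\<not> s) t q' q'' (step s t q q' u) = ?A q' \<ominus>\<^bsub>W\<^esub> ?B q'" if q': "q' \<in> P (\<not> s) t" for q'
    proof -
      have "op (\<not> s) t q' q'' (step s t q q' u)
          = op (\<not> s) t q' q'' (if q1 = q' then \<delta> u' else \<zero>\<^bsub>W\<^esub>) \<ominus>\<^bsub>W\<^esub> op (\<not> s) t q' q'' (\<Oplus>\<^bsub>W\<^esub>r\<in>?R. \<delta> (?w q' r))"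
        unfolding e step_blocked using delta_closed[OF nu(1)] Sc[OF q', unfolded e] by (intro endo_minus e' q') auto
      also have "op (\<not> s) t q' q'' (\<Oplus>\<^bsub>W\<^esub>r\<in>?R. \<delta> (?w q' r)) = ?B q'"
        using delta_closed[OF nw[OF _ q']] by (intro endo_finsum e' q') blast
      finally show ?thesis using endo_zero[OF e'[OF q']] by auto
    qed
    \<comment> \<open>The subtracted sum is carried to the other side, so that both sides can be
      computed separately.\<close>
    have "(\<Oplus>\<^bsub>W\<^esub>q'\<in>P (\<not> s) t. op (\<not> s) t q' q'' (step s t q q' u)) \<oplus>\<^bsub>W\<^esub> (\<Oplus>\<^bsub>W\<^esub>q'\<in>P (\<not> s) t. ?B q')
        = (\<Oplus>\<^bsub>W\<^esub>q'\<in>P (\<not> s) t. ?A q')"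
    proof (rule W.M.finsum_addI[symmetric])
      fix q' assume q': "q' \<in> P (\<not> s) t"
      have A: "?A q' \<in> carrier W" using Ac by (cases "q1 = q'") auto
      show "op (\<not> s) t q' q'' (step s t q q' u) \<in> carrier W" unfolding st[OF q'] using A Bc[OF q'] by simp
      show "?B q' \<in> carrier W" using Bc[OF q'] .
      show "?A q' = op (\<not> s) t q' q'' (step s t q q' u) \<oplus>\<^bsub>W\<^esub> ?B q'"
        unfolding st[OF q'] using A Bc[OF q'] by (simp add: a_minus_def W.M.a_assoc W.M.l_neg)
    qed
    also have "\<dots> = op (\<not> s) t q1 q'' (\<delta> u')"
      using Ac fin nu(4) W.M.finsum_delta'[of "P (\<not> s) t" q1 "\<lambda>_. op (\<not> s) t q1 q'' (\<delta> u')"] by simp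
    \<comment> \<open>As u is normal, u' is not blocked for its own last letter, and extending it by
      that kind of letter is plain juxtaposition.\<close>
    also have "\<dots> = \<delta> (?v q'')"
      using nu t by (subst op_delta) (auto simp: step_unblocked)
    also have "(\<Oplus>\<^bsub>W\<^esub>q'\<in>P (\<not> s) t. ?B q') = (\<Oplus>\<^bsub>W\<^esub>r\<in>?R. \<Oplus>\<^bsub>W\<^esub>q'\<in>P (\<not> s) t. op (\<not> s) t q' q'' (\<delta> (?w q' r)))"
      using fin wc by (intro W.M.finsum_swap) auto
    also have "\<dots> = (\<Oplus>\<^bsub>W\<^esub>r\<in>?R. if r = q'' then \<delta> (?v r) else \<zero>\<^bsub>W\<^esub>)"
    proof (rule W.M.finsum_cong')
      fix r assume r: "r \<in> ?R"
      show "(\<Oplus>\<^bsub>W\<^esub>q'\<in>P (\<not> s) t. op (\<not> s) t q' q'' (\<delta> (?w q' r))) = (if r = q'' then \<delta> (?v r) else \<zero>\<^bsub>W\<^esub>)"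
        using r e t nv by (intro op_op_unblocked) auto
    qed (use nv delta_closed in \<open>auto simp del: normal.simps\<close>)
    also have "\<dots> = (if q'' \<noteq> q then \<delta> (?v q'') else \<zero>\<^bsub>W\<^esub>)"
      using fin nv t delta_closed by (subst W.M.finsum_delta) (auto simp del: normal.simps)
    finally have eq: "(\<Oplus>\<^bsub>W\<^esub>q'\<in>P (\<not> s) t. op (\<not> s) t q' q'' (step s t q q' u)) \<oplus>\<^bsub>W\<^esub> (if q'' \<noteq> q then \<delta> (?v q'') else \<zero>\<^bsub>W\<^esub>) = \<delta> (?v q'')" .
    have sc: "(\<Oplus>\<^bsub>W\<^esub>q'\<in>P (\<not> s) t. op (\<not> s) t q' q'' (step s t q q' u)) \<in> carrier W"
      using endo_algD(1)[OF e'] step_closed u t by (intro W.M.finsum_closed) auto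
    have vc: "\<delta> (?v q'') \<in> carrier W" using delta_closed[OF nv[OF t(3)]] .
    show ?thesis
    proof (cases "q = q''")
      case True
      then show ?thesis using eq sc u e by simp
    next
      case False
      then have "(\<Oplus>\<^bsub>W\<^esub>q'\<in>P (\<not> s) t. op (\<not> s) t q' q'' (step s t q q' u)) \<oplus>\<^bsub>W\<^esub> \<delta> (?v q'') = \<zero>\<^bsub>W\<^esub> \<oplus>\<^bsub>W\<^esub> \<delta> (?v q'')"
        using eq vc by auto
      then show ?thesis using False sc vc by (simp del: W.M.l_zero)
    qed
  qed
  also have "\<dots> = (if q = q'' then vop (loc s t q) else \<zero>\<^bsub>endo_alg K W\<^esub>) (\<delta> u)"
    using u by (simp add: vop_delta endo_alg_simps delta_closed)
  finally show "(\<Oplus>\<^bsub>endo_alg K W\<^esub>q'\<in>P (\<not> s) t. op s t q q' \<otimes>\<^bsub>endo_alg K W\<^esub> op (\<not> s) t q' q'') (\<delta> u)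
    = (if q = q'' then vop (loc s t q) else \<zero>\<^bsub>endo_alg K W\<^esub>) (\<delta> u)" .
qed

end

section \<open>Degrees of normal words and strictness of the degree filtration\<close>

context word_module
begin

interpretation W: rmodule K W by (rule fsupp_rmodule) (rule ring_axioms)
interpretation E: algebra_over K "endo_alg K W" by (rule endo_algebra_over) (rule W_module)

text \<open>The last letter lies opposite to side s and has right place q. Such words arise by
  rewriting; \<open>alter\<close> below restores the place before the rewriting.\<close>

fun endsin :: "('v, 't, 'q) path \<Rightarrow> bool \<Rightarrow> 't \<Rightarrow> 'q \<Rightarrow> bool" where
  "endsin (Root v) s t q = False"
| "endsin (Ext u s1 t1 q1 q2) s t q = (s1 = (\<not> s) \<and> t1 = t \<and> q2 = q)"

fun alter :: "('v, 't, 'q) path \<Rightarrow> 'q \<Rightarrow> ('v, 't, 'q) path" where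
  "alter (Root v) a = Root v"
| "alter (Ext u s1 t1 q1 q2) a = Ext u s1 t1 q1 a"

lemma deg_alter [simp]: "deg (alter u a) = deg u"
  by (cases u) auto

lemma deg_pos: "0 < deg u"
  by (cases u) auto

lemma deg_parity: "odd (deg (Ext u s t q q')) = s"
  by auto

definition supported :: "(('v, 't, 'q) path \<Rightarrow> bool) \<Rightarrow> (('v, 't, 'q) path \<Rightarrow> 'k) set" where
  "supported Q = {z \<in> carrier W. \<forall>w. z w \<noteq> \<zero> \<longrightarrow> Q w}"

definition FK :: "nat \<Rightarrow> (('v, 't, 'q) path \<Rightarrow> 'k) set" where
  "FK n = supported (\<lambda>w. deg w \<le> n)"

lemma FK_iff: "z \<in> FK n \<longleftrightarrow> z \<in> carrier W \<and> (\<forall>w. z w \<noteq> \<zero> \<longrightarrow> deg w \<le> n)"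
  by (simp add: FK_def supported_def)

lemma W_apply: "z \<in> carrier W \<Longrightarrow> z w \<in> carrier K" "z \<in> carrier W \<Longrightarrow> z w \<noteq> \<zero> \<Longrightarrow> normal w"
  by (auto simp: fsupp_simps supp_def)

lemma supported_zero: "\<zero>\<^bsub>W\<^esub> \<in> supported Q"
  using W.M.zero_closed by (simp add: supported_def fsupp_simps(1))

lemma supported_add:
  "\<lbrakk>y \<in> supported Q; z \<in> supported Q\<rbrakk>
    \<Longrightarrow> y \<oplus>\<^bsub>W\<^esub> z \<in> supported Q"
proof -
  assume y: "y \<in> supported Q" and z: "z \<in> supported Q"
  have "Q w" if "y w \<oplus> z w \<noteq> \<zero>" for w
    using that y z W_apply(1)[of z w] by (cases "y w = \<zero>") (auto simp: supported_def)
  then show ?thesis using y z W.M.a_closed[of y z] by (simp add: supported_def fsupp_simps(2))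
qed

lemma supported_smult:
  "\<lbrakk>c \<in> carrier K; z \<in> supported Q\<rbrakk>
    \<Longrightarrow> c \<odot>\<^bsub>W\<^esub> z \<in> supported Q"
proof -
  assume c: "c \<in> carrier K" and z: "z \<in> supported Q"
  have "Q w" if "z w \<otimes> c \<noteq> \<zero>" for w
    using that c z by (cases "z w = \<zero>") (auto simp: supported_def)
  then show ?thesis using c z W.act_closed[of c z] by (simp add: supported_def fsupp_simps(3))
qed

lemma supported_minus:
  "\<lbrakk>y \<in> supported Q; z \<in> supported Q\<rbrakk>
    \<Longrightarrow> y \<ominus>\<^bsub>W\<^esub> z \<in> supported Q"
  unfolding a_minus_def using supported_smult[of "\<ominus> \<one>" z Q]
  by (intro supported_add) (auto simp: W.act_minus_left supported_def)

lemma supported_delta: "normal u \<Longrightarrow> Q u \<Longrightarrow> \<delta> u \<in> supported Q"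
  using delta_closed[of u] by (simp add: supported_def single_def)

lemma supported_finsum:
  "(\<And>i. i \<in> S \<Longrightarrow> h i \<in> supported Q) \<Longrightarrow> finsum W h S \<in> supported Q"
  by (rule W.M.finsum_mem[OF _ supported_zero supported_add]) (auto simp: supported_def)

lemma FK_induct [consumes 1, case_names delta zero add smult]:
  assumes "z \<in> FK n" "\<And>u. normal u \<Longrightarrow> deg u \<le> n \<Longrightarrow> Q (\<delta> u)" "Q \<zero>\<^bsub>W\<^esub>"
    "\<And>y z. \<lbrakk>y \<in> carrier W; z \<in> carrier W; Q y; Q z\<rbrakk> \<Longrightarrow> Q (y \<oplus>\<^bsub>W\<^esub> z)"
    "\<And>c z. \<lbrakk>c \<in> carrier K; z \<in> carrier W; Q z\<rbrakk> \<Longrightarrow> Q (c \<odot>\<^bsub>W\<^esub> z)"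
  shows "Q z"
proof -
  let ?D = "{w. normal w \<and> deg w \<le> n}"
  have sub: "carrier (fsupp K ?D) \<subseteq> carrier W" by (auto simp: fsupp_simps(4))
  have "z \<in> carrier (fsupp K ?D)"
    using assms(1) W_apply(2) by (auto simp: FK_iff fsupp_simps(4) supp_def)
  from ring_axioms this show ?thesis
  proof (induction rule: fsupp_induct)
    case zero
    then show ?case using assms(3) by (simp add: fsupp_simps(1))
  next
    case (single u c)
    have "single K u c = c \<odot>\<^bsub>W\<^esub> \<delta> u" using single by (auto simp: fsupp_simps(3) single_def)
    then show ?case using assms(2)[of u] assms(5)[of c "\<delta> u"] single delta_closed by simp
  next
    case (add y z)
    then show ?case using assms(4)[of y z] sub by (auto simp: fsupp_simps(2))
  qed
qed

lemma endo_supported: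
  assumes "\<phi> \<in> carrier (endo_alg K W)" "z \<in> FK n"
    "\<And>u. \<lbrakk>normal u; deg u \<le> n\<rbrakk> \<Longrightarrow> \<phi> (\<delta> u) \<in> supported Q"
  shows "\<phi> z \<in> supported Q"
  using assms(2)
proof (induction rule: FK_induct)
  case (delta u)
  then show ?case by (rule assms(3))
next
  case zero
  show ?case unfolding endo_zero[OF assms(1)] by (rule supported_zero)
next
  case (add y z)
  show ?case unfolding endo_algD(2)[OF assms(1) add(1,2)] by (rule supported_add[OF add(3,4)])
next
  case (smult c z)
  show ?case unfolding endo_algD(3)[OF assms(1) smult(1,2)] by (rule supported_smult[OF smult(1,3)])
qed

lemma FK_0: "FK 0 = {\<zero>\<^bsub>W\<^esub>}"
proof -
  have "z = \<zero>\<^bsub>W\<^esub>" if "z \<in> FK 0" for z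
  proof
    fix w
    show "z w = \<zero>\<^bsub>W\<^esub> w" using that deg_pos[of w] unfolding FK_iff fsupp_simps(1) by fastforce
  qed
  moreover have "\<zero>\<^bsub>W\<^esub> \<in> FK 0" unfolding FK_def by (rule supported_zero)
  ultimately show ?thesis by blast
qed

lemma FK_mono: "n \<le> m \<Longrightarrow> FK n \<subseteq> FK m"
  unfolding FK_iff subset_iff by (meson order_trans)

lemma FK_exhaust: "z \<in> carrier W \<Longrightarrow> \<exists>n. z \<in> FK n"
proof -
  assume z: "z \<in> carrier W"
  have "finite (supp K z)" using z by (simp add: fsupp_simps)
  then have "z \<in> FK (Max (insert 0 (deg ` supp K z)))"
    using z by (auto simp: FK_iff supp_def intro!: Max_ge)
  then show ?thesis by blast
qed

lemma vop_FK: "z \<in> FK n \<Longrightarrow> vop v z \<in> FK n"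
  unfolding FK_def
  by (rule endo_supported[OF vop_endo, of z n]) (simp_all add: FK_def vop_delta supported_zero supported_delta)

text \<open>Degree n is skipped. A word that has just received a letter of side
  \<open>even n\<close> has degree of the parity of n+1, and the shorter words left by the rewriting
  have degree below n.\<close>

lemma op_supported:
  assumes t: "t \<in> T" "q \<in> P s t" "q' \<in> P (\<not> s) t" and s: "s = even n" and z: "z \<in> FK n"
  shows "op s t q q' z \<in> supported (\<lambda>w. deg w \<le> Suc n \<and> deg w \<noteq> n)"
proof (rule endo_supported[OF op_endo[OF t] z])
  fix u assume u: "normal u" "deg u \<le> n"
  have d: "deg (Ext u s t q q') \<le> Suc n \<and> deg (Ext u s t q q') \<noteq> n"
    using u(2) s by (cases "deg u = n") auto
  show "op s t q q' (\<delta> u) \<in> supported (\<lambda>w. deg w \<le> Suc n \<and> deg w \<noteq> n)"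
  proof (cases "blocked u s t q")
    case True
    then obtain u' q1 where e: "u = Ext u' (\<not> s) t q1 q" "q = sp s t" by (rule blockedE)
    have n: "normal (Ext (Ext u' (\<not> s) t q1 r) s t r q')" if "r \<in> P s t - {q}" for r
      using normal_alter[of u' s t q1 q r q'] u e t that by auto
    have 1: "(if q1 = q' then \<delta> u' else \<zero>\<^bsub>W\<^esub>) \<in> supported (\<lambda>w. deg w \<le> Suc n \<and> deg w \<noteq> n)"
    proof -
      have "deg u' < deg u" by (simp add: e)
      then show ?thesis using u e supported_delta[of u' "\<lambda>w. deg w \<le> Suc n \<and> deg w \<noteq> n"]
          supported_zero[of "\<lambda>w. deg w \<le> Suc n \<and> deg w \<noteq> n"] by auto
    qed
    have 2: "(\<Oplus>\<^bsub>W\<^esub>r\<in>P s t - {q}. \<delta> (Ext (Ext u' (\<not> s) t q1 r) s t r q')) \<in> supported (\<lambda>w. deg w \<le> Suc n \<and> deg w \<noteq> n)"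
    proof (rule supported_finsum, rule supported_delta[OF n])
      fix r
      have "deg (Ext (Ext u' (\<not> s) t q1 r) s t r q') = deg (Ext u s t q q')" by (simp add: e)
      then show "deg (Ext (Ext u' (\<not> s) t q1 r) s t r q') \<le> Suc n \<and> deg (Ext (Ext u' (\<not> s) t q1 r) s t r q') \<noteq> n"
        using d by simp
    qed
    show ?thesis
      unfolding op_delta[OF t u(1)] using supported_minus[OF 1 2] unfolding e step_blocked .
  next
    case False
    have "normal (Ext u s t q q')" if "pend u = loc s t q" using that u t False by simp
    then have "(if pend u = loc s t q then \<delta> (Ext u s t q q') else \<zero>\<^bsub>W\<^esub>) \<in> supported (\<lambda>w. deg w \<le> Suc n \<and> deg w \<noteq> n)"
      using d supported_delta[of "Ext u s t q q'" "\<lambda>w. deg w \<le> Suc n \<and> deg w \<noteq> n"] supported_zero[of "\<lambda>w. deg w \<le> Suc n \<and> deg w \<noteq> n"]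
      by (cases "pend u = loc s t q") (simp_all del: normal.simps deg.simps)
    then show ?thesis unfolding op_delta[OF t u(1)] step_unblocked[OF False] .
  qed
qed

lemma op_FK: "\<lbrakk>t \<in> T; q \<in> P s t; q' \<in> P (\<not> s) t; s = even n; z \<in> FK n\<rbrakk> \<Longrightarrow> op s t q q' z \<in> FK (Suc n)"
  using op_supported[of t q s q' n z] by (auto simp: FK_iff supported_def)

text \<open>A word of top degree n+1 ending in the letter with places q, q' arises in two ways only:
  by extending u, or by rewriting the word in which u ended at the distinguished place, with a minus
  sign. The right side depends on q' only through the condition \<open>a' = q'\<close>;
  \<open>strict\<close> rests on this.\<close>

lemma op_coeff:
  assumes w: "normal (Ext u s t q q')" "deg (Ext u s t q q') = Suc n" and s: "s = even n" and z: "z \<in> FK n"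
    and t': "t' \<in> T" "a \<in> P s t'" "a' \<in> P (\<not> s) t'"
  shows "op s t' a a' z (Ext u s t q q') =
    (if t' = t \<and> a' = q' then (if a = q then z u else \<zero>)
       \<ominus> (if a = sp s t \<and> q \<noteq> a \<and> endsin u s t q then z (alter u a) else \<zero>) else \<zero>)"
  using z
proof (induction rule: FK_induct)
  case (delta v)
  have pu: "pend u = loc s t q" "\<not> blocked u s t q" using w by auto
  have st: "op s t' a a' (\<delta> v) = step s t' a a' v" by (rule op_delta[OF t' delta(1)])
  show ?case
  proof (cases "blocked v s t' a")
    case True
    then obtain v' q1 where e: "v = Ext v' (\<not> s) t' q1 a" "a = sp s t'" by (rule blockedE)
    let ?w = "\<lambda>r. Ext (Ext v' (\<not> s) t' q1 r) s t' r a'"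
    have n: "normal (?w r)" if "r \<in> P s t' - {a}" for r
      using normal_alter[of v' s t' q1 a r a'] delta(1) e t' that by auto
    have nv': "normal v'" using delta(1) e by simp
    have S: "(\<Oplus>\<^bsub>W\<^esub>r\<in>P s t' - {a}. \<delta> (?w r)) \<in> carrier W"
      using delta_closed[OF n] by (intro W.M.finsum_closed) blast
    have d': "(if q1 = a' then \<delta> v' else \<zero>\<^bsub>W\<^esub>) \<in> carrier W" using delta_closed[OF nv'] by simp
    \<comment> \<open>The word left after cancelling two letters is too short to have degree
      n+1.\<close>
    have z0: "(if q1 = a' then \<delta> v' else \<zero>\<^bsub>W\<^esub>) (Ext u s t q q') = \<zero>"
    proof -
      have "deg v' < deg v" by (simp add: e)
      then have "v' \<noteq> Ext u s t q q'" using delta(2) w(2) by (metis Suc_n_not_le_n less_imp_le_nat order_trans)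
      then show ?thesis by (simp add: single_def fsupp_simps(1))
    qed
    have "(\<Oplus>\<^bsub>W\<^esub>r\<in>P s t' - {a}. \<delta> (?w r)) (Ext u s t q q') = (\<Oplus>r\<in>P s t' - {a}. \<delta> (?w r) (Ext u s t q q'))"
      using delta_closed[OF n] by (rule fsupp_finsum_apply[OF ring_axioms])
    also have "\<dots> = (\<Oplus>r\<in>P s t' - {a}. if r = q then (if t' = t \<and> a' = q' \<and> u = Ext v' (\<not> s) t q1 q then \<one> else \<zero>) else \<zero>)"
      by (intro finsum_cong') (auto simp: single_def)
    also have "\<dots> = (if q \<noteq> a \<and> t' = t \<and> a' = q' \<and> u = Ext v' (\<not> s) t q1 q then \<one> else \<zero>)"
      using finite_P t' w(1) by (subst finsum_delta) auto
    finally have Sv: "(\<Oplus>\<^bsub>W\<^esub>r\<in>P s t' - {a}. \<delta> (?w r)) (Ext u s t q q') = \<dots>" .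
    have "op s t' a a' (\<delta> v) (Ext u s t q q')
        = ((if q1 = a' then \<delta> v' else \<zero>\<^bsub>W\<^esub>) \<ominus>\<^bsub>W\<^esub> (\<Oplus>\<^bsub>W\<^esub>r\<in>P s t' - {a}. \<delta> (?w r))) (Ext u s t q q')"
      unfolding st unfolding e step_blocked ..
    also have "\<dots> = \<ominus> (if q \<noteq> a \<and> t' = t \<and> a' = q' \<and> u = Ext v' (\<not> s) t q1 q then \<one> else \<zero>)"
      using z0 Sv S by (simp only: a_minus_def fsupp_simps(2) fsupp_minus_apply[OF ring_axioms S]) simp
    also have "\<dots> = (if t' = t \<and> a' = q' then (if a = q then \<delta> v u else \<zero>)
       \<ominus> (if a = sp s t \<and> q \<noteq> a \<and> endsin u s t q then \<delta> v (alter u a) else \<zero>) else \<zero>)"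
      using e pu(2) by (cases u) (auto simp: single_def a_minus_def)
    finally show ?thesis .
  next
    case False
    have "(if pend v = loc s t' a then \<delta> (Ext v s t' a a') else \<zero>\<^bsub>W\<^esub>) (Ext u s t q q')
        = (if t' = t \<and> a' = q' \<and> a = q then \<delta> v u else \<zero>)"
      using pu by (auto simp: single_def fsupp_simps(1))
    moreover have "(if t' = t \<and> a' = q' then (if a = q then \<delta> v u else \<zero>)
       \<ominus> (if a = sp s t \<and> q \<noteq> a \<and> endsin u s t q then \<delta> v (alter u a) else \<zero>) else \<zero>)
        = (if t' = t \<and> a' = q' \<and> a = q then \<delta> v u else \<zero>)"
      using False by (cases u) (auto simp: single_def a_minus_def)
    ultimately show ?thesis unfolding st step_unblocked[OF False] by simp
  qed
next
  case zero
  then show ?case unfolding endo_zero[OF op_endo[OF t']] by (simp add: fsupp_simps(1) a_minus_def)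
next
  case (add y z)
  have c: "y w \<in> carrier K" "z w \<in> carrier K" for w using add W_apply by auto
  have "op s t' a a' (y \<oplus>\<^bsub>W\<^esub> z) (Ext u s t q q') = op s t' a a' y (Ext u s t q q') \<oplus> op s t' a a' z (Ext u s t q q')"
    using endo_algD(2)[OF op_endo[OF t'] add(1,2)] by (simp add: fsupp_simps(2))
  then show ?case unfolding add using c
    by (auto simp: fsupp_simps(2) a_minus_def minus_add a_ac)
next
  case (smult c z)
  have cl: "z w \<in> carrier K" for w using smult W_apply by auto
  have "op s t' a a' (c \<odot>\<^bsub>W\<^esub> z) (Ext u s t q q') = op s t' a a' z (Ext u s t q q') \<otimes> c"
    using endo_algD(3)[OF op_endo[OF t'] smult(1,2)] by (simp add: fsupp_simps(3))
  then show ?case unfolding smult using cl smult(1)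
    by (auto simp: fsupp_simps(3) a_minus_def l_distr l_minus)
qed

text \<open>The top coefficients of a column do not depend on the right place of the letters that
  are attached. Those occurring in the given sum vanish, hence so do those with any other right
  place b'; since degree \<open>Suc k\<close> is skipped, everything of degree above k is then
  gone.\<close>

lemma strict:
  assumes s: "s = even (Suc k)"
    and z: "\<And>t q q'. \<lbrakk>t \<in> T; q \<in> P s t; q' \<in> P (\<not> s) t\<rbrakk> \<Longrightarrow> z t q q' \<in> FK (Suc k)"
    and fin: "finite T"
    and sum: "(\<Oplus>\<^bsub>W\<^esub>t\<in>T. \<Oplus>\<^bsub>W\<^esub>q'\<in>P (\<not> s) t. \<Oplus>\<^bsub>W\<^esub>q\<in>P s t. op s t q q' (z t q q')) \<in> FK (Suc k)"
    and t0: "t0 \<in> T" "b \<in> P (\<not> s) t0" "b' \<in> P (\<not> s) t0"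
  shows "(\<Oplus>\<^bsub>W\<^esub>q\<in>P s t0. op s t0 q b' (z t0 q b)) \<in> FK k"
proof -
  let ?n = "Suc k"
  \<comment> \<open>The common value of the top coefficients given by \<open>op_coeff\<close>,
    summed over the left place. The argument q' selects the family of coefficients and is not the
    place at which the word ends.\<close>
  define C where "C t q q' u = z t q q' u \<ominus> (if q \<noteq> sp s t \<and> endsin u s t q then z t (sp s t) q' (alter u (sp s t)) else \<zero>)" for t q q' u
  have zW: "z t q q' \<in> carrier W" if "t \<in> T" "q \<in> P s t" "q' \<in> P (\<not> s) t" for t q q'
    using z[OF that] by (simp add: FK_iff)
  have zc: "z t q q' w \<in> carrier K" if "t \<in> T" "q \<in> P s t" "q' \<in> P (\<not> s) t" for t q q' w
    using W_apply(1)[OF zW[OF that]] .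
  have opc: "op s t q q'' (z t q q') \<in> carrier W" if "t \<in> T" "q \<in> P s t" "q' \<in> P (\<not> s) t" "q'' \<in> P (\<not> s) t" for t q q' q''
    using endo_algD(1)[OF op_endo[OF that(1,2,4)] zW[OF that(1-3)]] .
  have Cs: "(\<Oplus>\<^bsub>W\<^esub>a\<in>P s t'. op s t' a a' (z t' a c)) (Ext u s t q q') = (if t' = t \<and> a' = q' then C t q c u else \<zero>)"
    if w: "normal (Ext u s t q q')" "deg (Ext u s t q q') = Suc ?n" and t': "t' \<in> T" "a' \<in> P (\<not> s) t'" "c \<in> P (\<not> s) t'"
    for u t q q' t' a' c
  proof -
    have "(\<Oplus>\<^bsub>W\<^esub>a\<in>P s t'. op s t' a a' (z t' a c)) (Ext u s t q q') = (\<Oplus>a\<in>P s t'. op s t' a a' (z t' a c) (Ext u s t q q'))"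
      using opc t' by (intro fsupp_finsum_apply[OF ring_axioms]) auto
    also have "\<dots> = (\<Oplus>a\<in>P s t'. if t' = t \<and> a' = q' then (if a = q then z t' a c u else \<zero>)
       \<ominus> (if a = sp s t \<and> q \<noteq> a \<and> endsin u s t q then z t' a c (alter u a) else \<zero>) else \<zero>)"
      using op_coeff[OF w s z t'(1) _ t'(2)] t' zc
      by (intro finsum_cong') (auto simp: a_minus_def)
    also have "\<dots> = (if t' = t \<and> a' = q' then C t q c u else \<zero>)"
    proof (cases "t' = t \<and> a' = q'")
      case True
      have q: "q \<in> P s t" using w by simp
      have fP: "finite (P s t)" using finite_P t' True by blast
      let ?A = "\<lambda>a. if a = q then z t a c u else \<zero>"
      let ?B = "\<lambda>a. if a = sp s t then (if q \<noteq> a \<and> endsin u s t q then z t a c (alter u a) else \<zero>) else \<zero>"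
      have cA: "?A a \<in> carrier K" "?B a \<in> carrier K" if "a \<in> P s t" for a using zc t' True that by auto
      have A: "finsum K ?A (P s t) = z t q c u" using q fP zc t' True by (subst finsum_delta) auto
      have B: "finsum K ?B (P s t) = (if q \<noteq> sp s t \<and> endsin u s t q then z t (sp s t) c (alter u (sp s t)) else \<zero>)"
        using sp_P fP zc t' True by (subst finsum_delta) auto
      have "finsum K ?A (P s t) = (\<Oplus>a\<in>P s t. ?A a \<ominus> ?B a) \<oplus> finsum K ?B (P s t)"
        using cA by (intro finsum_addI) (auto simp: a_minus_def a_assoc l_neg)
      moreover have "d = a \<ominus> b" if "a = d \<oplus> b" "d \<in> carrier K" "b \<in> carrier K" for a b d
        using that by (simp add: a_minus_def a_assoc r_neg)
      ultimately have "(\<Oplus>a\<in>P s t. ?A a \<ominus> ?B a) = finsum K ?A (P s t) \<ominus> finsum K ?B (P s t)"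
        using finsum_closed[of "\<lambda>a. ?A a \<ominus> ?B a" "P s t"] finsum_closed[of ?B "P s t"] cA by fast
      also have "\<dots> = C t q c u" unfolding A B C_def ..
      finally have "(\<Oplus>a\<in>P s t. ?A a \<ominus> ?B a) = C t q c u" .
      moreover have "(\<Oplus>a\<in>P s t'. if t' = t \<and> a' = q' then (if a = q then z t' a c u else \<zero>)
         \<ominus> (if a = sp s t \<and> q \<noteq> a \<and> endsin u s t q then z t' a c (alter u a) else \<zero>) else \<zero>) = (\<Oplus>a\<in>P s t. ?A a \<ominus> ?B a)"
        using True cA by (intro finsum_cong') auto
      ultimately show ?thesis using True by simp
    qed (auto intro: finsum_zeroI)
    finally show ?thesis .
  qed
  have Sc: "(\<Oplus>\<^bsub>W\<^esub>a\<in>P s t. op s t a q' (z t a q')) \<in> carrier W" if "t \<in> T" "q' \<in> P (\<not> s) t" for t q'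
    using opc that by (intro W.M.finsum_closed) auto
  \<comment> \<open>The hypothesis on the sum concerns letters whose right place is also the index
    of the coefficients; it determines C for all indices.\<close>
  have C0: "C t q q' u = \<zero>" if w: "normal (Ext u s t q q')" "deg (Ext u s t q q') = Suc ?n" for t q q' u
  proof -
    let ?w = "Ext u s t q q'"
    have t: "t \<in> T" "q \<in> P s t" "q' \<in> P (\<not> s) t" using w by auto
    have Cc: "C t q q' u \<in> carrier K" unfolding C_def using zc t sp_P by auto
    have "\<zero> = (\<Oplus>\<^bsub>W\<^esub>t\<in>T. \<Oplus>\<^bsub>W\<^esub>q'\<in>P (\<not> s) t. \<Oplus>\<^bsub>W\<^esub>q\<in>P s t. op s t q q' (z t q q')) ?w"
      using sum w(2) unfolding FK_iff by (metis (no_types, lifting) Suc_n_not_le_n)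
    also have "\<dots> = (\<Oplus>t\<in>T. (\<Oplus>\<^bsub>W\<^esub>q'\<in>P (\<not> s) t. \<Oplus>\<^bsub>W\<^esub>q\<in>P s t. op s t q q' (z t q q')) ?w)"
      using Sc by (intro fsupp_finsum_apply[OF ring_axioms] W.M.finsum_closed) auto
    also have "\<dots> = (\<Oplus>t'\<in>T. if t' = t then C t q q' u else \<zero>)"
    proof (rule finsum_cong')
      fix t' assume t': "t' \<in> T"
      have "(\<Oplus>\<^bsub>W\<^esub>q'\<in>P (\<not> s) t'. \<Oplus>\<^bsub>W\<^esub>q\<in>P s t'. op s t' q q' (z t' q q')) ?w = (\<Oplus>b\<in>P (\<not> s) t'. (\<Oplus>\<^bsub>W\<^esub>q\<in>P s t'. op s t' q b (z t' q b)) ?w)"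
        using Sc t' by (intro fsupp_finsum_apply[OF ring_axioms]) auto
      also have "\<dots> = (\<Oplus>b\<in>P (\<not> s) t'. if b = q' then (if t' = t then C t q q' u else \<zero>) else \<zero>)"
        using Cs[OF w t'] Cc by (intro finsum_cong') auto
      also have "\<dots> = (if t' = t then C t q q' u else \<zero>)"
        using Cc t t' finite_P by (subst finsum_delta) auto
      finally show "(\<Oplus>\<^bsub>W\<^esub>q'\<in>P (\<not> s) t'. \<Oplus>\<^bsub>W\<^esub>q\<in>P s t'. op s t' q q' (z t' q q')) ?w = (if t' = t then C t q q' u else \<zero>)" .
    qed (use Cc in auto)
    also have "\<dots> = C t q q' u" using Cc t fin by (subst finsum_delta) auto
    finally show ?thesis ..
  qed
  let ?S = "\<Oplus>\<^bsub>W\<^esub>q\<in>P s t0. op s t0 q b' (z t0 q b)"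
  have S: "?S \<in> supported (\<lambda>w. deg w \<le> Suc ?n \<and> deg w \<noteq> ?n)"
    using op_supported[OF t0(1) _ t0(3) s z[OF t0(1) _ t0(2)]] by (intro supported_finsum) blast
  have "deg w \<le> k" if w: "?S w \<noteq> \<zero>" for w
  proof (rule ccontr)
    assume "\<not> deg w \<le> k"
    moreover have "deg w \<le> Suc ?n \<and> deg w \<noteq> ?n" using S w unfolding supported_def by blast
    ultimately have d: "deg w = Suc ?n" by linarith
    have nw: "normal w" using S w W_apply(2) unfolding supported_def by blast
    obtain u s1 t q q' where e: "w = Ext u s1 t q q'" using d by (cases w) auto
    \<comment> \<open>The parity of the degree determines the side of the last letter.\<close>
    have "s1 = s" using deg_parity[of u s1 t q q'] d s unfolding e by auto
    then have e: "w = Ext u s t q q'" using e by simp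
    have "?S w = (if t0 = t \<and> b' = q' then C t q b u else \<zero>)"
      unfolding e by (rule Cs) (use nw d e t0 in auto)
    also have "\<dots> = \<zero>"
    proof (cases "t0 = t \<and> b' = q'")
      case True
      \<comment> \<open>C is read off at the word that ends in place b instead of b', which has the
        same degree and is normal as well.\<close>
      have "C t q b u = \<zero>" by (rule C0) (use nw d e True t0 in auto)
      then show ?thesis by simp
    qed auto
    finally show False using w by simp
  qed
  then show ?thesis using S by (simp add: FK_iff supported_def)
qed

end

section \<open>From the relations of L to the matrix form, and the filtration of L by normal
  words\<close>

section \<open>The filtration of a weighted Leavitt path algebra\<close>

lemma wlpa_familyD:
  assumes "wlpa_family E w B \<psi>"
  shows "g \<in> gens E w \<Longrightarrow> \<psi> g \<in> carrier B"
    "\<lbrakk>u \<in> verts E; v \<in> verts E\<rbrakk> \<Longrightarrow> \<psi> (Vert u) \<otimes>\<^bsub>B\<^esub> \<psi> (Vert v) = (if u = v then \<psi> (Vert u) else \<zero>\<^bsub>B\<^esub>)"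
    "\<lbrakk>e \<in> arcs E; i \<in> {1..w e}\<rbrakk> \<Longrightarrow> \<psi> (Vert (tail E e)) \<otimes>\<^bsub>B\<^esub> \<psi> (Edge e i) = \<psi> (Edge e i)"
    "\<lbrakk>e \<in> arcs E; i \<in> {1..w e}\<rbrakk> \<Longrightarrow> \<psi> (Edge e i) \<otimes>\<^bsub>B\<^esub> \<psi> (Vert (head E e)) = \<psi> (Edge e i)"
    "\<lbrakk>e \<in> arcs E; i \<in> {1..w e}\<rbrakk> \<Longrightarrow> \<psi> (Vert (head E e)) \<otimes>\<^bsub>B\<^esub> \<psi> (Ghost e i) = \<psi> (Ghost e i)"
    "\<lbrakk>e \<in> arcs E; i \<in> {1..w e}\<rbrakk> \<Longrightarrow> \<psi> (Ghost e i) \<otimes>\<^bsub>B\<^esub> \<psi> (Vert (tail E e)) = \<psi> (Ghost e i)"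
    "\<lbrakk>v \<in> regular_verts E; i \<in> {1..vertex_weight E w v}; j \<in> {1..vertex_weight E w v}\<rbrakk>
      \<Longrightarrow> (\<Oplus>\<^bsub>B\<^esub>e\<in>out_arcs E v. \<psi> (Edge e i) \<otimes>\<^bsub>B\<^esub> \<psi> (Ghost e j)) = (if i = j then \<psi> (Vert v) else \<zero>\<^bsub>B\<^esub>)"
    "\<lbrakk>v \<in> regular_verts E; e \<in> out_arcs E v; f \<in> out_arcs E v\<rbrakk>
      \<Longrightarrow> (\<Oplus>\<^bsub>B\<^esub>i\<in>{1..vertex_weight E w v}. \<psi> (Ghost e i) \<otimes>\<^bsub>B\<^esub> \<psi> (Edge f i)) = (if e = f then \<psi> (Vert (head E e)) else \<zero>\<^bsub>B\<^esub>)"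
  using assms unfolding wlpa_family_def by blast+

text \<open>Weight indices and edges are put into one sum type, so that both sides have places of
  the same type and every statement about letters covers edges and ghost edges at once.\<close>

definition lplaces :: "('v, 'e) pre_digraph \<Rightarrow> ('e \<Rightarrow> nat) \<Rightarrow> bool \<Rightarrow> 'v \<Rightarrow> ('e + nat) set" where
  "lplaces E w s v = (if s then Inr ` {1..vertex_weight E w v} else Inl ` out_arcs E v)"

definition lloc :: "('v, 'e) pre_digraph \<Rightarrow> bool \<Rightarrow> 'v \<Rightarrow> ('e + nat) \<Rightarrow> 'v" where
  "lloc E s v q = (if s then v else head E (projl q))"

definition letter :: "bool \<Rightarrow> ('e + nat) \<Rightarrow> ('e + nat) \<Rightarrow> ('v, 'e) gen" where
  "letter s q q' = (if s then Edge (projl q') (projr q) else Ghost (projl q) (projr q'))"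

context finite_vertex_weighted
begin

interpretation A: algebra_over K L by (rule wlpa_algebra)

abbreviation "pl \<equiv> lplaces E w"
abbreviation "xl s q q' \<equiv> gen (letter s q q')"

lemma regular_tail: "e \<in> arcs E \<Longrightarrow> tail E e \<in> reg \<and> e \<in> out_arcs E (tail E e)"
  using row_finite tail_in_verts by (auto simp: regular_verts_def)

lemma vertex_weight_pos: "v \<in> reg \<Longrightarrow> 0 < wt v"
  using regular_vertsD[of v] weight_pos by fastforce

lemma lplaces_finite: "v \<in> reg \<Longrightarrow> finite (pl s v)"
  using regular_vertsD(2) by (auto simp: lplaces_def)

lemma lplaces_ne:
  assumes "v \<in> reg"
  shows "(SOME q. q \<in> pl s v) \<in> pl s v"
proof -
  have "pl s v \<noteq> {}"
    using regular_vertsD(3)[OF assms] vertex_weight_pos[OF assms] by (simp add: lplaces_def Suc_le_eq)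
  then show ?thesis by (simp add: some_in_eq)
qed

lemma lloc_verts: "v \<in> reg \<Longrightarrow> q \<in> pl s v \<Longrightarrow> lloc E s v q \<in> verts E"
  using regular_vertsD(1,4)[of v] by (auto simp: lplaces_def lloc_def split: if_splits)

lemma letter_cases:
  assumes "v \<in> reg" "q \<in> pl s v" "q' \<in> pl (\<not> s) v"
  obtains e i where "e \<in> out_arcs E v" "i \<in> {1..w e}" "s" "q = Inr i" "q' = Inl e" "(letter s q q' :: ('v, 'e) gen) = Edge e i"
  | e i where "e \<in> out_arcs E v" "i \<in> {1..w e}" "\<not> s" "q = Inl e" "q' = Inr i" "(letter s q q' :: ('v, 'e) gen) = Ghost e i"
proof (cases s)
  case True
  then obtain e i where q: "q = Inr i" "q' = Inl e" and ei: "i \<in> {1..wt v}" "e \<in> out_arcs E v"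
    using assms(2,3) by (auto simp: lplaces_def)
  have we: "w e = wt v" using regular_vertsD(4)[OF assms(1) ei(2)] by simp
  show ?thesis
    by (rule that(1)[of e i]) (use ei we q True in \<open>simp_all only: letter_def if_True sum.sel\<close>)
next
  case False
  then obtain e i where q: "q' = Inr i" "q = Inl e" and ei: "i \<in> {1..wt v}" "e \<in> out_arcs E v"
    using assms(2,3) by (auto simp: lplaces_def)
  have we: "w e = wt v" using regular_vertsD(4)[OF assms(1) ei(2)] by simp
  show ?thesis
    by (rule that(2)[of e i]) (use ei we q False in \<open>simp_all only: letter_def if_False sum.sel not_False_eq_True\<close>)
qed

lemma letter_gens: "\<lbrakk>v \<in> reg; q \<in> pl s v; q' \<in> pl (\<not> s) v\<rbrakk> \<Longrightarrow> letter s q q' \<in> X"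
  by (erule (2) letter_cases) (simp_all only: gens_iff in_out_arcs_conv simp_thms)

lemma finsum_lplaces:
  assumes "abelian_monoid G" "v \<in> reg" "\<And>q. q \<in> pl s v \<Longrightarrow> f q \<in> carrier G"
  shows "finsum G f (pl s v) =
    (if s then \<Oplus>\<^bsub>G\<^esub>i\<in>{1..wt v}. f (Inr i) else \<Oplus>\<^bsub>G\<^esub>e\<in>out_arcs E v. f (Inl e))"
proof -
  interpret abelian_monoid G by fact
  show ?thesis using assms(3) unfolding lplaces_def
    by (cases s) (auto simp: finsum_reindex)
qed

abbreviation "kappa \<equiv> (\<lambda>c. c \<odot>\<^bsub>L\<^esub> \<one>\<^bsub>L\<^esub>) ` carrier K"

lemma gen_letter:
  assumes "v \<in> reg" "q \<in> pl s v" "q' \<in> pl (\<not> s) v"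
  shows "vert (lloc E s v q) \<cdot> xl s q q' = xl s q q'"
    "xl s q q' \<cdot> gen (Vert (lloc E (\<not> s) v q')) = xl s q q'"
proof -
  note D = wlpa_familyD[OF wlpa_family_gen]
  have "vert (lloc E s v q) \<cdot> xl s q q' = xl s q q'
    \<and> xl s q q' \<cdot> gen (Vert (lloc E (\<not> s) v q')) = xl s q q'"
    using assms
  proof (cases rule: letter_cases)
    case (1 e i)
    then have "e \<in> arcs E" "v = tail E e" by auto
    then show ?thesis using D(3,4)[of e i] 1 by (simp add: lloc_def)
  next
    case (2 e i)
    then have "e \<in> arcs E" "v = tail E e" by auto
    then show ?thesis using D(5,6)[of e i] 2 by (simp add: lloc_def)
  qed
  then show "vert (lloc E s v q) \<cdot> xl s q q' = xl s q q'"
    "xl s q q' \<cdot> gen (Vert (lloc E (\<not> s) v q')) = xl s q q'" by auto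
qed

text \<open>Relations (iii) and (iv) become one statement: with s true the sum runs over edges, with
  s false over weight indices.\<close>

lemma letter_letter:
  assumes "wlpa_family E w B \<psi>" "ring B" "v \<in> reg" "q \<in> pl s v" "q'' \<in> pl s v"
  shows "(\<Oplus>\<^bsub>B\<^esub>q'\<in>pl (\<not> s) v. \<psi> (letter s q q') \<otimes>\<^bsub>B\<^esub> \<psi> (letter (\<not> s) q' q''))
    = (if q = q'' then \<psi> (Vert (lloc E s v q)) else \<zero>\<^bsub>B\<^esub>)"
proof -
  interpret B: ring B by fact
  note D = wlpa_familyD[OF assms(1)]
  have "\<psi> (letter s q q') \<otimes>\<^bsub>B\<^esub> \<psi> (letter (\<not> s) q' q'') \<in> carrier B" if "q' \<in> pl (\<not> s) v" for q'
    using letter_gens[of v q s q'] letter_gens[of v q' "\<not> s" q''] assms that by (simp add: D(1))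
  then have *: "(\<Oplus>\<^bsub>B\<^esub>q'\<in>pl (\<not> s) v. \<psi> (letter s q q') \<otimes>\<^bsub>B\<^esub> \<psi> (letter (\<not> s) q' q'')) =
    (if \<not> s then \<Oplus>\<^bsub>B\<^esub>i\<in>{1..wt v}. \<psi> (letter s q (Inr i)) \<otimes>\<^bsub>B\<^esub> \<psi> (letter (\<not> s) (Inr i) q'')
     else \<Oplus>\<^bsub>B\<^esub>e\<in>out_arcs E v. \<psi> (letter s q (Inl e)) \<otimes>\<^bsub>B\<^esub> \<psi> (letter (\<not> s) (Inl e) q''))"
    by (rule finsum_lplaces[OF B.abelian_monoid_axioms assms(3)])
  show ?thesis
  proof (cases s)
    case True
    obtain i j where ij: "q = Inr i" "q'' = Inr j" "i \<in> {1..wt v}" "j \<in> {1..wt v}"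
      using assms(4,5) True by (auto simp: lplaces_def)
    show ?thesis unfolding * using D(7)[OF assms(3) ij(3,4)] True ij(1,2) by (simp add: letter_def lloc_def)
  next
    case False
    obtain e f where ef: "q = Inl e" "q'' = Inl f" "e \<in> out_arcs E v" "f \<in> out_arcs E v"
      using assms(4,5) False by (auto simp: lplaces_def)
    show ?thesis unfolding * using D(8)[OF assms(3) ef(3,4)] False ef(1,2) by (simp add: letter_def lloc_def)
  qed
qed

lemma kappa_field:
  assumes "c \<in> carrier K" "c \<odot>\<^bsub>L\<^esub> \<one>\<^bsub>L\<^esub> \<noteq> \<zero>\<^bsub>L\<^esub>"
  shows "inv c \<in> carrier K" "(c \<odot>\<^bsub>L\<^esub> \<one>\<^bsub>L\<^esub>) \<cdot> (inv c \<odot>\<^bsub>L\<^esub> \<one>\<^bsub>L\<^esub>) = \<one>\<^bsub>L\<^esub>"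
proof -
  have "c \<noteq> \<zero>" using assms(2) by auto
  then have u: "c \<in> Units K" using assms(1) K.field_Units by auto
  then show "inv c \<in> carrier K" by simp
  show "(c \<odot>\<^bsub>L\<^esub> \<one>\<^bsub>L\<^esub>) \<cdot> (inv c \<odot>\<^bsub>L\<^esub> \<one>\<^bsub>L\<^esub>) = \<one>\<^bsub>L\<^esub>"
    using u assms(1) by (simp add: A.smult_mult_left A.smult_mult_right flip: A.smult_assoc1)
qed

lemma wlpa_two_sided:
  "two_sided L kappa (verts E) vert reg pl (lloc E)
     (\<lambda>s t. xl s)"
proof
  show "kappa \<subseteq> carrier L" by auto
  show "\<one>\<^bsub>L\<^esub> \<in> kappa" by (auto intro!: image_eqI[of _ _ \<one>])
  show "a \<oplus>\<^bsub>L\<^esub> b \<in> kappa" if ab: "a \<in> kappa" "b \<in> kappa" for a b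
  proof -
    obtain c d where "c \<in> carrier K" "d \<in> carrier K" "a = c \<odot>\<^bsub>L\<^esub> \<one>\<^bsub>L\<^esub>" "b = d \<odot>\<^bsub>L\<^esub> \<one>\<^bsub>L\<^esub>" using ab by auto
    then show ?thesis by (intro image_eqI[of _ _ "c \<oplus> d"]) (simp_all add: A.smult_l_distr)
  qed
  show "a \<cdot> b \<in> kappa" if ab: "a \<in> kappa" "b \<in> kappa" for a b
  proof -
    obtain c d where "c \<in> carrier K" "d \<in> carrier K" "a = c \<odot>\<^bsub>L\<^esub> \<one>\<^bsub>L\<^esub>" "b = d \<odot>\<^bsub>L\<^esub> \<one>\<^bsub>L\<^esub>" using ab by auto
    then show ?thesis by (intro image_eqI[of _ _ "c \<otimes> d"]) (simp_all add: A.smult_mult_left A.smult_assoc1)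
  qed
  show "\<ominus>\<^bsub>L\<^esub> a \<in> kappa" if ab: "a \<in> kappa" for a
  proof -
    obtain c where "c \<in> carrier K" "a = c \<odot>\<^bsub>L\<^esub> \<one>\<^bsub>L\<^esub>" using ab by auto
    then show ?thesis by (intro image_eqI[of _ _ "\<ominus> c"]) (simp_all add: A.smult_l_minus)
  qed
  show "a \<cdot> b = b \<cdot> a" if "a \<in> kappa" "b \<in> carrier L" for a b
    using that by (auto simp: A.smult_mult_left A.smult_mult_right)
  show "\<exists>b\<in>kappa. a \<cdot> b = \<one>\<^bsub>L\<^esub>" if "a \<in> kappa" "a \<noteq> \<zero>\<^bsub>L\<^esub>" for a
    using that kappa_field by blast
  show "finite reg" by (simp add: regular_verts_def)
  show "vert v \<in> carrier L" if "v \<in> verts E" for v using that gen_closed by simp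
  show "vert u \<cdot> vert v = (if u = v then vert u else \<zero>\<^bsub>L\<^esub>)" if "u \<in> verts E" "v \<in> verts E" for u v
    using that wlpa_family_gen by (auto simp: wlpa_family_def)
  show "(\<Oplus>\<^bsub>L\<^esub>v\<in>verts E. vert v) = \<one>\<^bsub>L\<^esub>" by (simp add: wlpa_one)
  show "S = carrier L"
    if S: "S \<subseteq> carrier L" "kappa \<subseteq> S" "\<And>v. v \<in> verts E \<Longrightarrow> vert v \<in> S"
      "\<And>s t q q'. \<lbrakk>t \<in> reg; q \<in> pl s t; q' \<in> pl (\<not> s) t\<rbrakk> \<Longrightarrow> xl s q q' \<in> S"
      "\<And>a b. a \<in> S \<Longrightarrow> b \<in> S \<Longrightarrow> a \<oplus>\<^bsub>L\<^esub> b \<in> S" "\<And>a b. a \<in> S \<Longrightarrow> b \<in> S \<Longrightarrow> a \<cdot> b \<in> S" for S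
  proof -
    have "a \<in> S" if "a \<in> carrier L" for a
      using that
    proof (induction rule: wlpa_induct)
      case (gen g)
      have "gen (Edge e i) \<in> S \<and> gen (Ghost e i) \<in> S" if "e \<in> arcs E" "i \<in> {1..w e}" for e i
      proof -
        have "i \<in> {1..wt (tail E e)}" using that regular_tail[of e] regular_vertsD(4) by metis
        then show ?thesis
          using regular_tail[OF that(1)] S(4)[of "tail E e" "Inr i" True "Inl e"] S(4)[of "tail E e" "Inl e" False "Inr i"]
          by (simp add: lplaces_def letter_def)
      qed
      then show ?case using gen S(3) by (cases g) auto
    next
      case zero
      have "\<zero>\<^bsub>L\<^esub> \<in> kappa" by (rule image_eqI[of _ _ \<zero>]) simp_all
      then show ?case using S(2) by blast
    next
      case (smult c a)
      have "c \<odot>\<^bsub>L\<^esub> \<one>\<^bsub>L\<^esub> \<in> S" using S(2) smult(1) by blast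
      from S(6)[OF this smult(3)] show ?case using smult(1,2) by (simp add: A.smult_mult_left)
    qed (use S(5,6) in auto)
    then show ?thesis using S(1) by blast
  qed
qed (simp_all add: lplaces_finite lloc_verts gen_letter letter_letter[OF wlpa_family_gen A.B.ring_axioms] letter_gens gen_closed)

interpretation ts: two_sided L kappa "verts E" vert reg pl "lloc E"
     "\<lambda>s t. xl s"
  by (rule wlpa_two_sided)

abbreviation "sp \<equiv> \<lambda>s v. SOME q. q \<in> pl s v"

lemma wlpa_word_module: "word_module K (verts E) reg pl (lloc E) sp"
  by unfold_locales (simp_all add: lplaces_finite lplaces_ne lloc_verts)

interpretation wm: word_module K "verts E" reg pl "lloc E" sp
  by (rule wlpa_word_module)

text \<open>The operators on the word space that are to represent the generators. Once they satisfy
  the relations, the universal property turns the word space into a right module over L.\<close>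

definition rep :: "('v, 'e) gen \<Rightarrow> (('v, 'v, 'e + nat) path \<Rightarrow> 'k) \<Rightarrow> (('v, 'v, 'e + nat) path \<Rightarrow> 'k)" where
  "rep g = (case g of Vert v \<Rightarrow> wm.vop v
    | Edge e i \<Rightarrow> wm.op True (tail E e) (Inr i) (Inl e)
    | Ghost e i \<Rightarrow> wm.op False (tail E e) (Inl e) (Inr i))"

lemma rep_letter: "\<lbrakk>v \<in> reg; q \<in> pl s v; q' \<in> pl (\<not> s) v\<rbrakk>
  \<Longrightarrow> rep (letter s q q') = wm.op s v q q'"
  by (erule (2) letter_cases) (auto simp: rep_def)

lemma gens_cases:
  assumes "g \<in> X"
  obtains v where "v \<in> verts E" "g = Vert v"
  | s v q q' where "v \<in> reg" "q \<in> pl s v" "q' \<in> pl (\<not> s) v" "g = letter s q q'"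
proof (cases g)
  case (Vert v)
  then show ?thesis using that(1) assms by simp
next
  case (Edge e i)
  then have e: "e \<in> arcs E" "i \<in> {1..w e}" using assms by auto
  then have "i \<in> {1..wt (tail E e)}" using regular_tail[of e] regular_vertsD(4) by metis
  then show ?thesis using that(2)[of "tail E e" "Inr i" True "Inl e"] regular_tail[OF e(1)] Edge by (simp add: lplaces_def letter_def)
next
  case (Ghost e i)
  then have e: "e \<in> arcs E" "i \<in> {1..w e}" using assms by auto
  then have "i \<in> {1..wt (tail E e)}" using regular_tail[of e] regular_vertsD(4) by metis
  then show ?thesis using that(2)[of "tail E e" "Inl e" False "Inr i"] regular_tail[OF e(1)] Ghost by (simp add: lplaces_def letter_def)
qed

abbreviation "W \<equiv> wm.W"
abbreviation "EW \<equiv> endo_alg K W"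

interpretation E: algebra_over K EW by (rule endo_algebra_over) (rule wm.W_module)

lemma rep_closed: "g \<in> X \<Longrightarrow> rep g \<in> carrier EW"
  by (erule gens_cases) (simp add: rep_def wm.vop_endo, simp add: rep_letter wm.op_endo)

lemma rep_letters:
  assumes "v \<in> reg" "q \<in> pl s v" "q'' \<in> pl s v"
  shows "(\<Oplus>\<^bsub>EW\<^esub>q'\<in>pl (\<not> s) v. rep (letter s q q') \<otimes>\<^bsub>EW\<^esub> rep (letter (\<not> s) q' q''))
    = (if q = q'' then rep (Vert (lloc E s v q)) else \<zero>\<^bsub>EW\<^esub>)"
proof -
  have "(\<Oplus>\<^bsub>EW\<^esub>q'\<in>pl (\<not> s) v. rep (letter s q q') \<otimes>\<^bsub>EW\<^esub> rep (letter (\<not> s) q' q''))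
    = (\<Oplus>\<^bsub>EW\<^esub>q'\<in>pl (\<not> s) v. wm.op s v q q' \<otimes>\<^bsub>EW\<^esub> wm.op (\<not> s) v q' q'')"
    using assms by (intro E.M.finsum_cong') (auto simp: rep_letter wm.op_endo intro!: E.B.m_closed)
  then show ?thesis using wm.op_op[OF assms] by (simp add: rep_def)
qed

lemma rep_family: "wlpa_family E w EW rep"
proof -
  have c: "rep (letter s q q') \<otimes>\<^bsub>EW\<^esub> rep (letter (\<not> s) q' q'') \<in> carrier EW"
    if "v \<in> reg" "q \<in> pl s v" "q' \<in> pl (\<not> s) v" "q'' \<in> pl s v" for s v q q' q''
    using letter_gens[of v q s q'] letter_gens[of v q' "\<not> s" q''] that by (auto intro!: E.B.m_closed rep_closed)
  have iii: "(\<Oplus>\<^bsub>EW\<^esub>e\<in>out_arcs E v. rep (Edge e i) \<otimes>\<^bsub>EW\<^esub> rep (Ghost e j)) = (if i = j then rep (Vert v) else \<zero>\<^bsub>EW\<^esub>)"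
    if v: "v \<in> reg" "i \<in> {1..wt v}" "j \<in> {1..wt v}" for v i j
  proof -
    have q: "Inr i \<in> pl True v" "Inr j \<in> pl True v" using v by (simp_all add: lplaces_def del: One_nat_def)
    have "(\<Oplus>\<^bsub>EW\<^esub>q'\<in>pl (\<not> True) v. rep (letter True (Inr i) q') \<otimes>\<^bsub>EW\<^esub> rep (letter (\<not> True) q' (Inr j))) =
      (if \<not> True then \<Oplus>\<^bsub>EW\<^esub>k\<in>{1..wt v}. rep (letter True (Inr i) (Inr k)) \<otimes>\<^bsub>EW\<^esub> rep (letter (\<not> True) (Inr k) (Inr j))
       else \<Oplus>\<^bsub>EW\<^esub>e\<in>out_arcs E v. rep (letter True (Inr i) (Inl e)) \<otimes>\<^bsub>EW\<^esub> rep (letter (\<not> True) (Inl e) (Inr j)))"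
      by (rule finsum_lplaces[OF E.M.abelian_monoid_axioms v(1) c[OF v(1) q(1) _ q(2)]])
    then show ?thesis using rep_letters[OF v(1) q] by (simp add: letter_def lloc_def)
  qed
  have iv: "(\<Oplus>\<^bsub>EW\<^esub>i\<in>{1..wt v}. rep (Ghost e i) \<otimes>\<^bsub>EW\<^esub> rep (Edge f i)) = (if e = f then rep (Vert (head E e)) else \<zero>\<^bsub>EW\<^esub>)"
    if v: "v \<in> reg" "e \<in> out_arcs E v" "f \<in> out_arcs E v" for v e f
  proof -
    have q: "Inl e \<in> pl False v" "Inl f \<in> pl False v" using v unfolding lplaces_def by simp_all
    have "(\<Oplus>\<^bsub>EW\<^esub>q'\<in>pl (\<not> False) v. rep (letter False (Inl e) q') \<otimes>\<^bsub>EW\<^esub> rep (letter (\<not> False) q' (Inl f))) =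
      (if \<not> False then \<Oplus>\<^bsub>EW\<^esub>k\<in>{1..wt v}. rep (letter False (Inl e) (Inr k)) \<otimes>\<^bsub>EW\<^esub> rep (letter (\<not> False) (Inr k) (Inl f))
       else \<Oplus>\<^bsub>EW\<^esub>g\<in>out_arcs E v. rep (letter False (Inl e) (Inl g)) \<otimes>\<^bsub>EW\<^esub> rep (letter (\<not> False) (Inl g) (Inl f)))"
      by (rule finsum_lplaces[OF E.M.abelian_monoid_axioms v(1) c[OF v(1) q(1) _ q(2)]])
    then show ?thesis using rep_letters[OF v(1) q] by (simp add: letter_def lloc_def)
  qed
  have ii: "rep (Vert (lloc E s v q)) \<otimes>\<^bsub>EW\<^esub> rep (letter s q q') = rep (letter s q q')
      \<and> rep (letter s q q') \<otimes>\<^bsub>EW\<^esub> rep (Vert (lloc E (\<not> s) v q')) = rep (letter s q q')"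
    if "v \<in> reg" "q \<in> pl s v" "q' \<in> pl (\<not> s) v" for s v q q'
    using wm.vop_op[OF that] wm.op_vop[OF that] that by (simp add: rep_letter) (simp add: rep_def)
  have "rep (Vert (tail E e)) \<otimes>\<^bsub>EW\<^esub> rep (Edge e i) = rep (Edge e i)
      \<and> rep (Edge e i) \<otimes>\<^bsub>EW\<^esub> rep (Vert (head E e)) = rep (Edge e i)
      \<and> rep (Vert (head E e)) \<otimes>\<^bsub>EW\<^esub> rep (Ghost e i) = rep (Ghost e i)
      \<and> rep (Ghost e i) \<otimes>\<^bsub>EW\<^esub> rep (Vert (tail E e)) = rep (Ghost e i)" if e: "e \<in> arcs E" "i \<in> {1..w e}" for e i
  proof -
    have "i \<in> {1..wt (tail E e)}" using e regular_tail[of e] regular_vertsD(4) by metis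
    then show ?thesis
      using ii[of "tail E e" "Inr i" True "Inl e"] ii[of "tail E e" "Inl e" False "Inr i"] regular_tail[OF e(1)]
      by (simp add: lplaces_def letter_def lloc_def)
  qed
  moreover have "rep (Vert u) \<otimes>\<^bsub>EW\<^esub> rep (Vert v) = (if u = v then rep (Vert u) else \<zero>\<^bsub>EW\<^esub>)" for u v
    by (simp add: rep_def wm.vop_vop)
  ultimately show ?thesis
    unfolding wlpa_family_def using iii iv rep_closed by blast
qed

definition action :: "(('v, 'e) gen list \<Rightarrow> 'k) set \<Rightarrow> (('v, 'v, 'e + nat) path \<Rightarrow> 'k) \<Rightarrow> (('v, 'v, 'e + nat) path \<Rightarrow> 'k)" where
  "action = (SOME \<Phi>. alg_hom K L EW \<Phi> \<and> (\<forall>g\<in>X. \<Phi> (gen g) = rep g))"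

lemma action_hom: "alg_hom K L EW action" and action_gen: "g \<in> X \<Longrightarrow> action (gen g) = rep g"
proof -
  obtain \<Phi> where "alg_hom K L EW \<Phi>" "\<And>g. g \<in> X \<Longrightarrow> \<Phi> (gen g) = rep g"
    using wlpa_universal[OF E.algebra_over_axioms rep_family] by blast
  then have "\<exists>\<Phi>. alg_hom K L EW \<Phi> \<and> (\<forall>g\<in>X. \<Phi> (gen g) = rep g)" by blast
  from someI_ex[OF this] have "alg_hom K L EW action \<and> (\<forall>g\<in>X. action (gen g) = rep g)"
    unfolding action_def .
  then show "alg_hom K L EW action" "g \<in> X \<Longrightarrow> action (gen g) = rep g" by auto
qed

lemma action_closed: "\<lbrakk>a \<in> carrier L; z \<in> carrier W\<rbrakk> \<Longrightarrow> action a z \<in> carrier W"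
  using endo_algD(1)[OF alg_homD(1)[OF action_hom]] .

lemma action_mult: "\<lbrakk>a \<in> carrier L; b \<in> carrier L; z \<in> carrier W\<rbrakk> \<Longrightarrow> action (a \<cdot> b) z = action b (action a z)"
  using alg_homD(3)[OF action_hom] by (simp add: endo_alg_simps)

lemma action_add: "\<lbrakk>a \<in> carrier L; b \<in> carrier L; z \<in> carrier W\<rbrakk> \<Longrightarrow> action (a \<oplus>\<^bsub>L\<^esub> b) z = action a z \<oplus>\<^bsub>W\<^esub> action b z"
  using alg_homD(2)[OF action_hom] by (simp add: endo_alg_simps)

lemma action_smult: "\<lbrakk>c \<in> carrier K; a \<in> carrier L; z \<in> carrier W\<rbrakk> \<Longrightarrow> action (c \<odot>\<^bsub>L\<^esub> a) z = c \<odot>\<^bsub>W\<^esub> action a z"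
  using alg_homD(4)[OF action_hom] by (simp add: endo_alg_simps)

primrec wval :: "('v, 'v, 'e + nat) path \<Rightarrow> (('v, 'e) gen list \<Rightarrow> 'k) set" where
  "wval (Root v) = vert v"
| "wval (Ext u s t q q') = wval u \<cdot> xl s q q'"

lemma wval_closed: "wm.normal u \<Longrightarrow> wval u \<in> carrier L"
  by (induction u) (auto intro!: A.B.m_closed gen_closed letter_gens)

lemma wval_pend: "wm.normal u \<Longrightarrow> wval u \<cdot> vert (wm.pend u) = wval u"
proof (cases u)
  case (Root v)
  then show "wm.normal u \<Longrightarrow> ?thesis" using ts.p_mult[of v v] by simp
next
  case (Ext u' s t q q')
  assume u: "wm.normal u"
  then have t: "t \<in> reg" "q \<in> pl s t" "q' \<in> pl (\<not> s) t" "wm.normal u'" using Ext by auto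
  then show ?thesis
    using Ext gen_letter(2)[OF t(1-3)] wval_closed[OF t(4)] ts.x_closed[OF t(1-3)] ts.p_closed[OF lloc_verts[OF t(1,3)]]
    by (simp add: A.B.m_assoc)
qed

lemma wval_vert:
  assumes "wm.normal u" "v \<in> verts E"
  shows "wval u \<cdot> vert v = (if wm.pend u = v then wval u else \<zero>\<^bsub>L\<^esub>)"
proof -
  have c: "wval u \<in> carrier L" "vert (wm.pend u) \<in> carrier L" "vert v \<in> carrier L"
    using assms wval_closed wm.normal_pend[OF assms(1)] ts.p_closed by auto
  have "wval u \<cdot> vert v = (wval u \<cdot> vert (wm.pend u)) \<cdot> vert v"
    by (simp add: wval_pend[OF assms(1)])
  also have "\<dots> = wval u \<cdot> (vert (wm.pend u) \<cdot> vert v)" using c by (simp only: A.B.m_assoc)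
  also have "\<dots> = (if wm.pend u = v then wval u else \<zero>\<^bsub>L\<^esub>)"
    using c ts.p_mult[OF wm.normal_pend[OF assms(1)] assms(2)] wval_pend[OF assms(1)] by auto
  finally show ?thesis .
qed

interpretation LK: rmodule K L by (rule module_imp_rmodule) (rule A.module_axioms)
interpretation WK: rmodule K W by (rule fsupp_rmodule) (rule K.ring_axioms)

definition eval_word :: "(('v, 'v, 'e + nat) path \<Rightarrow> 'k) \<Rightarrow> (('v, 'e) gen list \<Rightarrow> 'k) set" where
  "eval_word z = LK.lin wval z"

lemma wval_fun: "wval \<in> Collect wm.normal \<rightarrow> carrier L"
  by (auto intro: wval_closed)

lemma eval_word_closed: "z \<in> carrier W \<Longrightarrow> eval_word z \<in> carrier L"
  unfolding eval_word_def by (rule LK.lin_closed[OF wval_fun])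

lemma eval_word_add: "\<lbrakk>y \<in> carrier W; z \<in> carrier W\<rbrakk> \<Longrightarrow> eval_word (y \<oplus>\<^bsub>W\<^esub> z) = eval_word y \<oplus>\<^bsub>L\<^esub> eval_word z"
  unfolding eval_word_def fsupp_simps(2) by (rule LK.lin_add[OF wval_fun])

lemma eval_word_smult: "\<lbrakk>c \<in> carrier K; z \<in> carrier W\<rbrakk> \<Longrightarrow> eval_word (c \<odot>\<^bsub>W\<^esub> z) = c \<odot>\<^bsub>L\<^esub> eval_word z"
  unfolding eval_word_def fsupp_simps(3) by (rule LK.lin_act[OF wval_fun])

lemma eval_word_zero: "eval_word \<zero>\<^bsub>W\<^esub> = \<zero>\<^bsub>L\<^esub>"
  unfolding eval_word_def fsupp_simps(1) by (rule LK.lin_zero)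

lemma eval_word_delta: "wm.normal u \<Longrightarrow> eval_word (wm.\<delta> u) = wval u"
  unfolding eval_word_def using LK.lin_single[of wval u \<one>] wval_closed by simp

lemma eval_word_finsum:
  "(\<And>i. i \<in> S \<Longrightarrow> f i \<in> carrier W) \<Longrightarrow> eval_word (finsum W f S) = (\<Oplus>\<^bsub>L\<^esub>i\<in>S. eval_word (f i))"
  using eval_word_closed eval_word_add
  by (intro additive_finsum[of W L]) (auto simp: WK.M.abelian_group_axioms A.M.abelian_group_axioms)

lemma eval_word_minus:
  assumes "y \<in> carrier W" "z \<in> carrier W"
  shows "eval_word (y \<ominus>\<^bsub>W\<^esub> z) = eval_word y \<ominus>\<^bsub>L\<^esub> eval_word z"
proof -
  have "eval_word (\<ominus>\<^bsub>W\<^esub> z) = \<ominus>\<^bsub>L\<^esub> eval_word z"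
    using eval_word_closed eval_word_add assms(2)
    by (intro additive_minus[of W L]) (auto simp: WK.M.abelian_group_axioms A.M.abelian_group_axioms)
  then show ?thesis using assms by (simp add: a_minus_def eval_word_add)
qed

text \<open>The rewriting is sound in L: for a blocked word it uses the matrix relation multiplied
  by the value of the shorter word. In the unblocked case a mismatch of vertices gives zero on both
  sides.\<close>

lemma eval_word_step:
  assumes t: "t \<in> reg" "q \<in> pl s t" "q' \<in> pl (\<not> s) t" and u: "wm.normal u"
  shows "eval_word (wm.step s t q q' u) = wval u \<cdot> xl s q q'"
proof (cases "wm.blocked u s t q")
  case True
  then obtain u' q1 where e: "u = Ext u' (\<not> s) t q1 q" "q = sp s t" by (rule wm.blockedE)
  let ?P = "pl s t"
  let ?w = "\<lambda>r. Ext (Ext u' (\<not> s) t q1 r) s t r q'"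
  have n: "wm.normal (?w r)" if "r \<in> ?P - {q}" for r
    using wm.normal_alter[of u' s t q1 q r q'] u e t that by auto
  have u': "wm.normal u'" "q1 \<in> pl (\<not> s) t" "wm.pend u' = lloc E (\<not> s) t q1" using u e by auto
  note q1 = u'(2)
  have c: "xl (\<not> s) q1 r \<in> carrier L" "xl s r q' \<in> carrier L" if "r \<in> ?P" for r
    using ts.x_closed[of t q1 "\<not> s" r] ts.x_closed[of t r s q'] t q1 that by auto
  have wc: "wval u' \<in> carrier L" using wval_closed u' by blast
  let ?f = "\<lambda>r. xl (\<not> s) q1 r \<cdot> xl s r q'"
  have fc: "?f r \<in> carrier L" if "r \<in> ?P" for r using c that by simp
  have fin: "finite ?P" using lplaces_finite[OF t(1)] .
  have "(if q1 = q' then gen (Vert (lloc E (\<not> s) t q1)) else \<zero>\<^bsub>L\<^esub>) = finsum L ?f ?P"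
    using ts.x_x[OF t(1) q1 t(3)] by simp
  also have "\<dots> = ?f q \<oplus>\<^bsub>L\<^esub> finsum L ?f (?P - {q})"
    using A.M.finsum_insert[of "?P - {q}" q ?f] fc fin t(2) by (auto simp: insert_absorb)
  finally have eq: "(if q1 = q' then gen (Vert (lloc E (\<not> s) t q1)) else \<zero>\<^bsub>L\<^esub>) = ?f q \<oplus>\<^bsub>L\<^esub> finsum L ?f (?P - {q})" .
  have Sc: "finsum L ?f (?P - {q}) \<in> carrier L" using fc by (intro A.M.finsum_closed) auto
  have "eval_word (wm.step s t q q' u) = eval_word (if q1 = q' then wm.\<delta> u' else \<zero>\<^bsub>W\<^esub>) \<ominus>\<^bsub>L\<^esub> eval_word (\<Oplus>\<^bsub>W\<^esub>r\<in>?P - {q}. wm.\<delta> (?w r))"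
    unfolding e wm.step_blocked using wm.delta_closed[OF n] wm.delta_closed[OF u'(1)]
    by (subst eval_word_minus) (auto simp: e intro!: WK.M.finsum_closed)
  also have "eval_word (if q1 = q' then wm.\<delta> u' else \<zero>\<^bsub>W\<^esub>) = wval u' \<cdot> (if q1 = q' then gen (Vert (lloc E (\<not> s) t q1)) else \<zero>\<^bsub>L\<^esub>)"
    using wval_pend[OF u'(1)] wc u'(3) by (auto simp: eval_word_delta[OF u'(1)] eval_word_zero)
  also have "eval_word (\<Oplus>\<^bsub>W\<^esub>r\<in>?P - {q}. wm.\<delta> (?w r)) = (\<Oplus>\<^bsub>L\<^esub>r\<in>?P - {q}. wval u' \<cdot> ?f r)"
  proof -
    have "eval_word (\<Oplus>\<^bsub>W\<^esub>r\<in>?P - {q}. wm.\<delta> (?w r)) = (\<Oplus>\<^bsub>L\<^esub>r\<in>?P - {q}. eval_word (wm.\<delta> (?w r)))"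
      using wm.delta_closed[OF n] by (intro eval_word_finsum) blast
    also have "\<dots> = (\<Oplus>\<^bsub>L\<^esub>r\<in>?P - {q}. wval u' \<cdot> ?f r)"
      using eval_word_delta[OF n] wc c by (intro A.M.finsum_cong') (simp_all add: A.B.m_assoc)
    finally show ?thesis .
  qed
  also have "\<dots> = wval u' \<cdot> finsum L ?f (?P - {q})"
    using fin wc fc by (intro A.B.finsum_rdistr[symmetric]) auto
  also have "wval u' \<cdot> (if q1 = q' then gen (Vert (lloc E (\<not> s) t q1)) else \<zero>\<^bsub>L\<^esub>) \<ominus>\<^bsub>L\<^esub> wval u' \<cdot> finsum L ?f (?P - {q})
      = wval u' \<cdot> ?f q"
    unfolding eq using wc fc[OF t(2)] Sc
    by (simp add: A.B.r_distr a_minus_def A.M.a_assoc A.M.r_neg)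
  also have "\<dots> = wval u \<cdot> xl s q q'" using wc c[OF t(2)] by (simp add: e(1) A.B.m_assoc)
  finally show ?thesis .
next
  case False
  note c = wval_closed[OF u] ts.x_closed[OF t] ts.p_closed[OF lloc_verts[OF t(1,2)]]
  have "wval u \<cdot> xl s q q' = (wval u \<cdot> vert (lloc E s t q)) \<cdot> xl s q q'"
    using gen_letter(1)[OF t] c by (simp add: A.B.m_assoc)
  also have "\<dots> = (if wm.pend u = lloc E s t q then wval u \<cdot> xl s q q' else \<zero>\<^bsub>L\<^esub>)"
    using c wval_vert[OF u lloc_verts[OF t(1,2)]] by simp
  also have "\<dots> = eval_word (if wm.pend u = lloc E s t q then wm.\<delta> (Ext u s t q q') else \<zero>\<^bsub>W\<^esub>)"
    using eval_word_delta[of "Ext u s t q q'"] t u False by (simp add: eval_word_zero)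
  finally show ?thesis using wm.step_unblocked[OF False] by simp
qed

lemma eval_word_rep:
  assumes "g \<in> X" "z \<in> carrier W"
  shows "eval_word (rep g z) = eval_word z \<cdot> gen g"
  using assms(2)
proof (induction rule: wm.W_induct)
  case (delta u)
  from assms(1) show ?case
  proof (cases rule: gens_cases)
    case (1 v)
    then show ?thesis using delta wval_vert[OF delta, of v]
      by (simp add: rep_def wm.vop_delta eval_word_delta eval_word_zero)
  next
    case (2 s v q q')
    then show ?thesis using delta eval_word_step[OF 2(1-3) delta]
      by (simp add: rep_letter wm.op_delta eval_word_delta)
  qed
next
  case zero
  then show ?case using gen_closed[OF assms(1)] wm.endo_zero[OF rep_closed[OF assms(1)]] by (simp add: eval_word_zero)
next
  case (add y z)
  then show ?case using endo_algD(1,2)[OF rep_closed[OF assms(1)]] gen_closed[OF assms(1)]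
    by (simp add: eval_word_add eval_word_closed A.B.l_distr)
next
  case (smult c z)
  then show ?case using endo_algD(1,3)[OF rep_closed[OF assms(1)]] gen_closed[OF assms(1)]
    by (simp add: eval_word_smult eval_word_closed A.smult_mult_left)
qed

text \<open>Evaluating words as products in L is a homomorphism of right modules; by induction it
  suffices to know this for generators.\<close>

lemma eval_word_action:
  assumes "a \<in> carrier L" "z \<in> carrier W"
  shows "eval_word (action a z) = eval_word z \<cdot> a"
  using assms
proof (induction arbitrary: z rule: wlpa_induct)
  case (gen g)
  then show ?case using eval_word_rep by (simp add: action_gen)
next
  case zero
  have "action \<zero>\<^bsub>L\<^esub> z = \<zero>\<^bsub>W\<^esub>" using action_smult[of \<zero> "\<zero>\<^bsub>L\<^esub>" z] zero action_closed[of "\<zero>\<^bsub>L\<^esub>" z] by simp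
  then show ?case using zero by (simp add: eval_word_zero eval_word_closed)
next
  case (add a b)
  then show ?case by (simp add: action_add eval_word_add action_closed eval_word_closed A.B.r_distr)
next
  case (mult a b)
  then show ?case by (simp add: action_mult action_closed eval_word_closed A.B.m_assoc)
next
  case (smult c a)
  then show ?case by (simp add: action_smult eval_word_smult action_closed eval_word_closed A.smult_mult_right)
qed

text \<open>The vector that plays the role of 1 in the word space. All roots are needed, because a
  single one is moved only by elements starting at its vertex.\<close>

definition root_sum :: "('v, 'v, 'e + nat) path \<Rightarrow> 'k" where
  "root_sum = (\<Oplus>\<^bsub>W\<^esub>v\<in>verts E. wm.\<delta> (Root v))"

lemma root_sum_closed: "root_sum \<in> carrier W"
  unfolding root_sum_def by (intro WK.M.finsum_closed) (auto intro: wm.delta_closed)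

lemma eval_word_root_sum: "eval_word root_sum = \<one>\<^bsub>L\<^esub>"
proof -
  have "eval_word root_sum = (\<Oplus>\<^bsub>L\<^esub>v\<in>verts E. eval_word (wm.\<delta> (Root v)))"
    unfolding root_sum_def by (intro eval_word_finsum wm.delta_closed) simp
  also have "\<dots> = (\<Oplus>\<^bsub>L\<^esub>v\<in>verts E. vert v)"
    by (intro A.M.finsum_cong') (auto simp: eval_word_delta gen_closed)
  finally show ?thesis by (simp add: wlpa_one)
qed

text \<open>Hence an element of L is recovered from its effect on \<open>root_sum\<close>. This
  embeds L into the word space as a right module, and the degree filtration can be pulled back
  without acquiring a kernel in degree 0.\<close>

lemma eval_word_root_action: "a \<in> carrier L \<Longrightarrow> eval_word (action a root_sum) = a"
  by (simp add: eval_word_action root_sum_closed eval_word_root_sum)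

definition wfilt :: "nat \<Rightarrow> (('v, 'e) gen list \<Rightarrow> 'k) set set" where
  "wfilt n = {a \<in> carrier L. action a root_sum \<in> wm.FK n}"

lemma root_action_finsum:
  assumes "\<And>i. i \<in> S \<Longrightarrow> f i \<in> carrier L"
  shows "action (finsum L f S) root_sum = (\<Oplus>\<^bsub>W\<^esub>i\<in>S. action (f i) root_sum)"
  using assms root_sum_closed action_closed action_add
  by (intro additive_finsum[of L W "\<lambda>a. action a root_sum"]) (auto simp: WK.M.abelian_group_axioms A.M.abelian_group_axioms)

end

context finite_vertex_weighted
begin

interpretation A: algebra_over K L by (rule wlpa_algebra)
interpretation ts: two_sided L kappa "verts E" vert reg pl "lloc E"
     "\<lambda>s t. xl s"
  by (rule wlpa_two_sided)
interpretation wm: word_module K "verts E" reg pl "lloc E" sp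
  by (rule wlpa_word_module)
interpretation WK: rmodule K W by (rule fsupp_rmodule) (rule K.ring_axioms)
interpretation R: rmodule L "rreg L" by (rule A.B.rreg_rmodule)

lemma root_action_letter:
  assumes "t \<in> reg" "q \<in> pl s t" "q' \<in> pl (\<not> s) t" "a \<in> carrier L"
  shows "action (a \<cdot> xl s q q') root_sum = wm.op s t q q' (action a root_sum)"
  using assms ts.x_closed[OF assms(1-3)] root_sum_closed
  by (simp add: action_mult action_gen letter_gens rep_letter)

lemma root_action_letters:
  assumes "\<And>q. q \<in> pl s t \<Longrightarrow> \<alpha> q \<in> carrier L" "t \<in> reg" "q' \<in> pl (\<not> s) t"
  shows "action (\<Oplus>\<^bsub>L\<^esub>q\<in>pl s t. \<alpha> q \<cdot> xl s q q') root_sum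
    = (\<Oplus>\<^bsub>W\<^esub>q\<in>pl s t. wm.op s t q q' (action (\<alpha> q) root_sum))"
proof -
  have c: "\<alpha> q \<cdot> xl s q q' \<in> carrier L" if "q \<in> pl s t" for q
    using ts.x_closed[OF assms(2) that assms(3)] assms(1)[OF that] by simp
  have "action (\<Oplus>\<^bsub>L\<^esub>q\<in>pl s t. \<alpha> q \<cdot> xl s q q') root_sum
    = (\<Oplus>\<^bsub>W\<^esub>q\<in>pl s t. action (\<alpha> q \<cdot> xl s q q') root_sum)"
    by (rule root_action_finsum[OF c])
  also have "\<dots> = (\<Oplus>\<^bsub>W\<^esub>q\<in>pl s t. wm.op s t q q' (action (\<alpha> q) root_sum))"
    using root_action_letter[OF assms(2) _ assms(3) assms(1)] action_closed[OF c root_sum_closed]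
    by (intro WK.M.finsum_cong') auto
  finally show ?thesis .
qed

text \<open>Each axiom is transported along the embedding of L into the word space; strictness
  becomes \<open>wm.strict\<close>, and the triviality of the zeroth piece is the injectivity of
  that embedding.\<close>

theorem wlpa_filtered:
  "filtered_algebra L kappa (verts E) vert reg pl (lloc E)
     (\<lambda>s t. xl s) wfilt"
proof -
  have "filtered_module L kappa (verts E) vert reg pl (lloc E)
     (\<lambda>s t. xl s) (rreg L) wfilt"
  proof (intro filtered_module.intro filtered_module_axioms.intro ts.two_sided_axioms R.rmodule_axioms; (unfold rreg_simps)?)
    fix k
    show "wfilt k \<subseteq> carrier L" by (auto simp: wfilt_def)
    have z: "action \<zero>\<^bsub>L\<^esub> root_sum = \<zero>\<^bsub>W\<^esub>" using root_action_finsum[of "{}"] by simp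
    then show "\<zero>\<^bsub>L\<^esub> \<in> wfilt k" using wm.supported_zero by (simp add: wfilt_def wm.FK_def)
    have "a = \<zero>\<^bsub>L\<^esub>" if "a \<in> carrier L" "action a root_sum = \<zero>\<^bsub>W\<^esub>" for a
      using eval_word_root_action[OF that(1)] that(2) eval_word_zero by simp
    then show "wfilt 0 = {\<zero>\<^bsub>L\<^esub>}" using z by (auto simp: wfilt_def wm.FK_0)
    show "y \<oplus>\<^bsub>L\<^esub> z \<in> wfilt k" if "y \<in> wfilt k" "z \<in> wfilt k" for y z
      using that wm.supported_add root_sum_closed by (simp add: wfilt_def wm.FK_def action_add)
    show "z \<cdot> c \<in> wfilt k" if "c \<in> kappa" "z \<in> wfilt k" for c z
      using that wm.supported_smult root_sum_closed by (auto simp: wfilt_def wm.FK_def action_smult A.smult_mult_right)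
    show "z \<cdot> vert v \<in> wfilt k" if "v \<in> verts E" "z \<in> wfilt k" for v z
      using that wm.vop_FK root_sum_closed ts.p_closed by (simp add: wfilt_def action_mult action_gen rep_def)
    show "wfilt k \<subseteq> wfilt (Suc k)" using wm.FK_mono[of k "Suc k"] by (auto simp: wfilt_def)
    show "z \<cdot> xl (even k) q q' \<in> wfilt (Suc k)"
      if "z \<in> wfilt k" "t \<in> reg" "q \<in> pl (even k) t" "q' \<in> pl (odd k) t" for z t q q'
    proof -
      have q': "q' \<in> pl (\<not> even k) t" using that(4) by simp
      have z: "z \<in> carrier L" "action z root_sum \<in> wm.FK k" using that(1) by (auto simp: wfilt_def)
      show ?thesis
        unfolding wfilt_def using root_action_letter[OF that(2,3) q' z(1)] wm.op_FK[OF that(2,3) q' refl z(2)]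
          z(1) ts.x_closed[OF that(2,3) q'] by simp
    qed
    show "carrier L = (\<Union>k. wfilt k)"
      using wm.FK_exhaust[OF action_closed[OF _ root_sum_closed]] by (auto simp: wfilt_def)
    show "(\<Oplus>\<^bsub>rreg L\<^esub>q\<in>pl s t. \<alpha> t q q' \<cdot> xl s q q'') \<in> wfilt k"
      if s: "s = even (Suc k)" and \<alpha>: "\<alpha> \<in> ts.places s (wfilt (Suc k))" and comb: "ts.comb (rreg L) s \<alpha> \<in> wfilt (Suc k)"
        and t: "t \<in> reg" "q' \<in> pl (\<not> s) t" "q'' \<in> pl (\<not> s) t" for s \<alpha> t q' q''
    proof -
      let ?z = "\<lambda>t q q'. action (\<alpha> t q q') root_sum"
      note D = ts.placesD[OF \<alpha>]
      have c: "\<alpha> t q q' \<in> carrier L" "?z t q q' \<in> wm.FK (Suc k)"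
        if "t \<in> reg" "q \<in> pl s t" "q' \<in> pl (\<not> s) t" for t q q'
        using D[OF that] by (auto simp: wfilt_def)
      have S: "(\<Oplus>\<^bsub>L\<^esub>q\<in>pl s t. \<alpha> t q q' \<cdot> xl s q q'') \<in> carrier L"
        if "t \<in> reg" "q' \<in> pl (\<not> s) t" "q'' \<in> pl (\<not> s) t" for t q' q''
        using c(1)[OF that(1) _ that(2)] ts.x_closed[OF that(1) _ that(3)] by (intro A.M.finsum_closed) auto
      have T: "action (\<Oplus>\<^bsub>L\<^esub>q\<in>pl s t. \<alpha> t q q' \<cdot> xl s q q'') root_sum
        = (\<Oplus>\<^bsub>W\<^esub>q\<in>pl s t. wm.op s t q q'' (?z t q q'))"
        if "t \<in> reg" "q' \<in> pl (\<not> s) t" "q'' \<in> pl (\<not> s) t" for t q' q''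
        using c(1)[OF that(1) _ that(2)] that by (intro root_action_letters) auto
      have C: "ts.comb (rreg L) s \<alpha> = (\<Oplus>\<^bsub>L\<^esub>t\<in>reg. \<Oplus>\<^bsub>L\<^esub>q'\<in>pl (\<not> s) t. \<Oplus>\<^bsub>L\<^esub>q\<in>pl s t. \<alpha> t q q' \<cdot> xl s q q')"
        by (simp only: ts.comb_def rreg_finsum rreg_simps)
      have U: "action (\<Oplus>\<^bsub>L\<^esub>q'\<in>pl (\<not> s) t. \<Oplus>\<^bsub>L\<^esub>q\<in>pl s t. \<alpha> t q q' \<cdot> xl s q q') root_sum
          = (\<Oplus>\<^bsub>W\<^esub>q'\<in>pl (\<not> s) t. \<Oplus>\<^bsub>W\<^esub>q\<in>pl s t. wm.op s t q q' (?z t q q'))"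
        if t: "t \<in> reg" for t
      proof -
        have "action (\<Oplus>\<^bsub>L\<^esub>q'\<in>pl (\<not> s) t. \<Oplus>\<^bsub>L\<^esub>q\<in>pl s t. \<alpha> t q q' \<cdot> xl s q q') root_sum
          = (\<Oplus>\<^bsub>W\<^esub>q'\<in>pl (\<not> s) t. action (\<Oplus>\<^bsub>L\<^esub>q\<in>pl s t. \<alpha> t q q' \<cdot> xl s q q') root_sum)"
          using S t by (intro root_action_finsum) auto
        also have "\<dots> = (\<Oplus>\<^bsub>W\<^esub>q'\<in>pl (\<not> s) t. \<Oplus>\<^bsub>W\<^esub>q\<in>pl s t. wm.op s t q q' (?z t q q'))"
          using T[OF t] action_closed[OF S[OF t] root_sum_closed] by (intro WK.M.finsum_cong') auto
        finally show ?thesis .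
      qed
      have Uc: "action (\<Oplus>\<^bsub>L\<^esub>q'\<in>pl (\<not> s) t. \<Oplus>\<^bsub>L\<^esub>q\<in>pl s t. \<alpha> t q q' \<cdot> xl s q q') root_sum \<in> carrier W"
        if t: "t \<in> reg" for t
        using S[OF t] by (intro action_closed[OF _ root_sum_closed] A.M.finsum_closed) auto
      have "action (ts.comb (rreg L) s \<alpha>) root_sum
        = (\<Oplus>\<^bsub>W\<^esub>t\<in>reg. action (\<Oplus>\<^bsub>L\<^esub>q'\<in>pl (\<not> s) t. \<Oplus>\<^bsub>L\<^esub>q\<in>pl s t. \<alpha> t q q' \<cdot> xl s q q') root_sum)"
        unfolding C using S by (intro root_action_finsum A.M.finsum_closed) auto
      also have "\<dots> = (\<Oplus>\<^bsub>W\<^esub>t\<in>reg. \<Oplus>\<^bsub>W\<^esub>q'\<in>pl (\<not> s) t. \<Oplus>\<^bsub>W\<^esub>q\<in>pl s t. wm.op s t q q' (?z t q q'))"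
        using Uc unfolding U by (intro WK.M.finsum_cong') (auto simp: U)
      finally have "(\<Oplus>\<^bsub>W\<^esub>t\<in>reg. \<Oplus>\<^bsub>W\<^esub>q'\<in>pl (\<not> s) t. \<Oplus>\<^bsub>W\<^esub>q\<in>pl s t. wm.op s t q q' (?z t q q')) \<in> wm.FK (Suc k)"
        using comb unfolding wfilt_def by simp
      from wm.strict[OF s c(2) ts.finite_T this t]
      show ?thesis using T[OF t] S[OF t] by (simp add: wfilt_def rreg_finsum)
    qed
  qed
  then show ?thesis by (rule filtered_algebra.intro[OF ts.two_sided_axioms])
qed

end

section \<open>A full idempotent yields mutually inverse rectangular matrices indexed by hair
  vertices\<close>

section \<open>Full idempotents\<close>

context ring
begin

text \<open>One entry of the associative law for products of rectangular matrices.\<close>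

lemma finsum_assoc:
  assumes "finite A" "finite B" "\<And>a. a \<in> A \<Longrightarrow> f a \<in> carrier R"
    "\<And>a b. a \<in> A \<Longrightarrow> b \<in> B \<Longrightarrow> g a b \<in> carrier R" "\<And>b. b \<in> B \<Longrightarrow> h b \<in> carrier R"
  shows "(\<Oplus>b\<in>B. (\<Oplus>a\<in>A. f a \<otimes> g a b) \<otimes> h b) = (\<Oplus>a\<in>A. f a \<otimes> (\<Oplus>b\<in>B. g a b \<otimes> h b))"
proof -
  have "(\<Oplus>b\<in>B. (\<Oplus>a\<in>A. f a \<otimes> g a b) \<otimes> h b) = (\<Oplus>b\<in>B. \<Oplus>a\<in>A. f a \<otimes> (g a b \<otimes> h b))"
  proof (intro finsum_cong' refl funcsetI)
    fix b assume b: "b \<in> B"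
    have "(\<Oplus>a\<in>A. f a \<otimes> g a b) \<otimes> h b = (\<Oplus>a\<in>A. (f a \<otimes> g a b) \<otimes> h b)"
      using assms b by (intro finsum_ldistr) auto
    also have "\<dots> = (\<Oplus>a\<in>A. f a \<otimes> (g a b \<otimes> h b))"
      using assms b by (intro finsum_cong') (auto simp: m_assoc)
    finally show "(\<Oplus>a\<in>A. f a \<otimes> g a b) \<otimes> h b = (\<Oplus>a\<in>A. f a \<otimes> (g a b \<otimes> h b))" .
  qed (use assms in \<open>auto intro!: finsum_closed\<close>)
  also have "\<dots> = (\<Oplus>a\<in>A. \<Oplus>b\<in>B. f a \<otimes> (g a b \<otimes> h b))"
    using assms by (intro finsum_swap) auto
  also have "\<dots> = (\<Oplus>a\<in>A. f a \<otimes> (\<Oplus>b\<in>B. g a b \<otimes> h b))"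
    using assms by (intro finsum_cong' finsum_rdistr[symmetric]) (auto intro!: finsum_closed)
  finally show ?thesis .
qed

lemma finsum_lessThan_add:
  assumes "\<And>i. f i \<in> carrier R"
  shows "(\<Oplus>i\<in>{..<m + n}. f i) = (\<Oplus>i\<in>{..<m}. f i) \<oplus> (\<Oplus>i\<in>{..<n::nat}. f (m + i))"
  by (induction n) (simp_all add: assms lessThan_Suc finsum_insert Pi_def finsum_closed a_ac)

text \<open>The finite sums of products \<open>a \<otimes> e \<otimes> b\<close> form an ideal. At
  least one summand is demanded because the number of summands becomes the size of the matrices;
  zero is written with zero factors.\<close>

lemma genideal_singleton_sum:
  assumes e: "e \<in> carrier R" and z: "z \<in> Idl {e}"
  shows "\<exists>(m::nat) a b. 0 < m \<and> (\<forall>i. a i \<in> carrier R \<and> b i \<in> carrier R) \<and> z = (\<Oplus>i\<in>{..<m}. a i \<otimes> e \<otimes> b i)"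
proof -
  define S where "S = {z. \<exists>(m::nat) a b. 0 < m \<and> (\<forall>i. a i \<in> carrier R \<and> b i \<in> carrier R) \<and> z = (\<Oplus>i\<in>{..<m}. a i \<otimes> e \<otimes> b i)}"
  have SI: "(\<Oplus>i\<in>{..<m}. a i \<otimes> e \<otimes> b i) \<in> S" if "0 < m" "\<And>i. a i \<in> carrier R" "\<And>i. b i \<in> carrier R" for m :: nat and a b
    unfolding S_def by (rule CollectI, rule exI[of _ m], rule exI[of _ a], rule exI[of _ b]) (simp add: that)
  have SE: "\<exists>(m::nat) a b. 0 < m \<and> (\<forall>i. a i \<in> carrier R \<and> b i \<in> carrier R) \<and> z = (\<Oplus>i\<in>{..<m}. a i \<otimes> e \<otimes> b i)" if "z \<in> S" for z
    using that unfolding S_def by (rule CollectD)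
  have S1: "a \<otimes> e \<otimes> b \<in> S" if "a \<in> carrier R" "b \<in> carrier R" for a b
  proof -
    have "(\<Oplus>i\<in>{..<1::nat}. a \<otimes> e \<otimes> b) = a \<otimes> e \<otimes> b" using that e by (simp add: lessThan_Suc finsum_insert)
    then show ?thesis using SI[of 1 "\<lambda>_. a" "\<lambda>_. b"] that by simp
  qed
  have S_sub: "S \<subseteq> carrier R" 
  proof
    fix z assume "z \<in> S"
    from SE[OF this] show "z \<in> carrier R" using e by (elim exE) (simp add: finsum_closed)
  qed
  have S_add: "y \<oplus> z \<in> S" if yz: "y \<in> S" "z \<in> S" for y z
  proof -
    obtain m a b where y: "0 < (m::nat) \<and> (\<forall>i. a i \<in> carrier R \<and> b i \<in> carrier R) \<and> y = (\<Oplus>i\<in>{..<m}. a i \<otimes> e \<otimes> b i)"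
      using SE[OF yz(1)] by (elim exE) (rule that)
    obtain n c d where z: "0 < (n::nat) \<and> (\<forall>i. c i \<in> carrier R \<and> d i \<in> carrier R) \<and> z = (\<Oplus>i\<in>{..<n}. c i \<otimes> e \<otimes> d i)"
      using SE[OF yz(2)] by (elim exE) (rule that)
    have yeq: "y = (\<Oplus>i\<in>{..<m}. a i \<otimes> e \<otimes> b i)" and zeq: "z = (\<Oplus>i\<in>{..<n}. c i \<otimes> e \<otimes> d i)" using y z by simp_all
    let ?a = "\<lambda>i. if i < m then a i else c (i - m)" and ?b = "\<lambda>i. if i < m then b i else d (i - m)"
    have "(\<Oplus>i\<in>{..<m + n}. ?a i \<otimes> e \<otimes> ?b i) = (\<Oplus>i\<in>{..<m}. ?a i \<otimes> e \<otimes> ?b i) \<oplus> (\<Oplus>i\<in>{..<n}. ?a (m + i) \<otimes> e \<otimes> ?b (m + i))"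
      using y z e by (intro finsum_lessThan_add) simp
    also have "(\<Oplus>i\<in>{..<m}. ?a i \<otimes> e \<otimes> ?b i) = y" unfolding yeq using y e by (intro finsum_cong') auto
    also have "(\<Oplus>i\<in>{..<n}. ?a (m + i) \<otimes> e \<otimes> ?b (m + i)) = z" unfolding zeq using z e by (intro finsum_cong') auto
    finally have "y \<oplus> z = (\<Oplus>i\<in>{..<m + n}. ?a i \<otimes> e \<otimes> ?b i)" ..
    moreover have "(\<Oplus>i\<in>{..<m + n}. ?a i \<otimes> e \<otimes> ?b i) \<in> S" by (rule SI) (use y z in auto)
    ultimately show ?thesis by (simp only:)
  qed
  have S_mult: "r \<otimes> y \<otimes> s \<in> S" if y: "y \<in> S" and rs: "r \<in> carrier R" "s \<in> carrier R" for y r s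
  proof -
    obtain m a b where y: "0 < (m::nat) \<and> (\<forall>i. a i \<in> carrier R \<and> b i \<in> carrier R) \<and> y = (\<Oplus>i\<in>{..<m}. a i \<otimes> e \<otimes> b i)"
      using SE[OF y] by (elim exE) (rule that)
    then have yeq: "y = (\<Oplus>i\<in>{..<m}. a i \<otimes> e \<otimes> b i)" by simp
    have "r \<otimes> y \<otimes> s = (\<Oplus>i\<in>{..<m}. r \<otimes> (a i \<otimes> e \<otimes> b i)) \<otimes> s"
      unfolding yeq using y e rs by (subst finsum_rdistr) auto
    also have "\<dots> = (\<Oplus>i\<in>{..<m}. r \<otimes> (a i \<otimes> e \<otimes> b i) \<otimes> s)"
      using y e rs by (intro finsum_ldistr) auto
    also have "\<dots> = (\<Oplus>i\<in>{..<m}. (r \<otimes> a i) \<otimes> e \<otimes> (b i \<otimes> s))"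
      using y e rs by (intro finsum_cong') (auto simp: m_assoc)
    finally have "r \<otimes> y \<otimes> s = (\<Oplus>i\<in>{..<m}. (r \<otimes> a i) \<otimes> e \<otimes> (b i \<otimes> s))" .
    moreover have "(\<Oplus>i\<in>{..<m}. (r \<otimes> a i) \<otimes> e \<otimes> (b i \<otimes> s)) \<in> S" by (rule SI) (use y rs in auto)
    ultimately show ?thesis by (simp only:)
  qed
  have S_neg: "\<ominus> y \<in> S" if y: "y \<in> S" for y
  proof -
    have "y \<in> carrier R" using S_sub y by blast
    then have "\<ominus> y = \<ominus> \<one> \<otimes> y \<otimes> \<one>" by (simp add: l_minus)
    then show ?thesis using S_mult[OF y, of "\<ominus> \<one>" \<one>] by simp
  qed
  have "ideal S R"
  proof (rule idealI[OF ring_axioms])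
    show "subgroup S (add_monoid R)"
      by (rule add.subgroupI[OF S_sub]) (use S1[of \<zero> \<zero>] S_neg S_add in auto)
    fix a x assume a: "a \<in> S" "x \<in> carrier R"
    have "a \<in> carrier R" using S_sub a by blast
    then show "x \<otimes> a \<in> S" "a \<otimes> x \<in> S"
      using S_mult[OF a(1) a(2) one_closed] S_mult[OF a(1) one_closed a(2)] a(2) by simp_all
  qed
  moreover have "e \<in> S" using S1[of \<one> \<one>] e by simp
  ultimately have "Idl {e} \<subseteq> S" by (intro genideal_minimal) auto
  then have "z \<in> S" using z by blast
  then show ?thesis by (rule SE)
qed

end

lemma (in abelian_group) add_cancel_zero: "\<lbrakk>x = y \<oplus> x; x \<in> carrier G; y \<in> carrier G\<rbrakk> \<Longrightarrow> y = \<zero>"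
  using add.r_cancel_one'[of x y] by simp

lemma (in abelian_monoid) finsum_Plus:
  assumes "finite A" "finite B" "\<And>k. k \<in> Sum_Type.Plus A B \<Longrightarrow> f k \<in> carrier G"
  shows "(\<Oplus>k\<in>Sum_Type.Plus A B. f k) = (\<Oplus>a\<in>A. f (Inl a)) \<oplus> (\<Oplus>b\<in>B. f (Inr b))"
proof -
  have "(\<Oplus>k\<in>Sum_Type.Plus A B. f k) = (\<Oplus>k\<in>Inl ` A. f k) \<oplus> (\<Oplus>k\<in>Inr ` B. f k)"
    unfolding Sum_Type.Plus_def using assms by (intro finsum_Un_disjoint) auto
  also have "(\<Oplus>k\<in>Inl ` A. f k) = (\<Oplus>a\<in>A. f (Inl a))" using assms by (intro finsum_reindex) auto
  also have "(\<Oplus>k\<in>Inr ` B. f k) = (\<Oplus>b\<in>B. f (Inr b))" using assms by (intro finsum_reindex) auto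
  finally show ?thesis .
qed

context filtered_algebra
begin

text \<open>The two matrices are assembled from two blocks. The first realises L, cut into the
  modules vL, as a summand of the m-fold sum of \<open>\<epsilon>L\<close>; the second realises the
  complement by means of \<open>idempotent_splits\<close>. The first block guarantees that every
  vertex occurs.\<close>

theorem full_idempotent_frame:
  assumes \<epsilon>: "\<epsilon> \<in> carrier L" "\<epsilon> \<otimes> \<epsilon> = \<epsilon>" and ab: "\<And>i. a i \<in> carrier L" "\<And>i. b i \<in> carrier L"
    and full: "(\<Oplus>i\<in>{..<m::nat}. a i \<otimes> \<epsilon> \<otimes> b i) = \<one>"
  obtains J :: "(nat \<times> 'v \<times> (nat \<Rightarrow> 'a)) set" and vs \<xi> \<eta>
  where "finite J" "vs \<in> J \<rightarrow> V"
    "\<And>i k. i < m \<Longrightarrow> k \<in> Sum_Type.Plus V J \<Longrightarrow> \<xi> i k \<in> carrier L \<and> \<epsilon> \<otimes> \<xi> i k = \<xi> i k \<and> \<xi> i k \<otimes> p (case_sum id vs k) = \<xi> i k"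
    "\<And>i k. i < m \<Longrightarrow> k \<in> Sum_Type.Plus V J \<Longrightarrow> \<eta> k i \<in> carrier L \<and> \<eta> k i \<otimes> \<epsilon> = \<eta> k i \<and> p (case_sum id vs k) \<otimes> \<eta> k i = \<eta> k i"
    "\<And>i j. i < m \<Longrightarrow> j < m \<Longrightarrow> (\<Oplus>k\<in>Sum_Type.Plus V J. \<xi> i k \<otimes> \<eta> k j) = (if i = j then \<epsilon> else \<zero>)"
    "\<And>k l. k \<in> Sum_Type.Plus V J \<Longrightarrow> l \<in> Sum_Type.Plus V J \<Longrightarrow> (\<Oplus>i\<in>{..<m}. \<eta> k i \<otimes> \<xi> i l) = (if k = l then p (case_sum id vs k) else \<zero>)"
proof -
  let ?M = "{..<m}"
  \<comment> \<open>A column and a row with entries absorbed by \<open>\<epsilon>\<close>; row times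
    column is 1, so column times row is an idempotent matrix whose image is isomorphic to L.\<close>
  define \<beta> where "\<beta> i = \<epsilon> \<otimes> b i" for i
  define \<alpha> where "\<alpha> i = a i \<otimes> \<epsilon>" for i
  have c: "\<alpha> i \<in> carrier L" "\<beta> i \<in> carrier L" for i using \<epsilon> ab by (auto simp: \<alpha>_def \<beta>_def)
  have \<epsilon>\<beta>: "\<epsilon> \<otimes> \<beta> i = \<beta> i" for i using \<epsilon> ab by (simp add: \<beta>_def flip: m_assoc)
  have \<alpha>\<epsilon>: "\<alpha> i \<otimes> \<epsilon> = \<alpha> i" for i using \<epsilon> ab by (simp add: \<alpha>_def m_assoc)
  have \<alpha>\<beta>: "(\<Oplus>i\<in>?M. \<alpha> i \<otimes> \<beta> i) = \<one>"
  proof -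
    have "\<alpha> i \<otimes> \<beta> i = a i \<otimes> \<epsilon> \<otimes> b i" for i
    proof -
      have "\<alpha> i \<otimes> \<beta> i = (\<alpha> i \<otimes> \<epsilon>) \<otimes> b i" using \<epsilon> ab c unfolding \<beta>_def by (simp add: m_assoc)
      then show ?thesis by (simp add: \<alpha>\<epsilon>) (simp add: \<alpha>_def)
    qed
    then show ?thesis using full by simp
  qed
  \<comment> \<open>The complementary idempotent in the matrices over
    \<open>\<epsilon>L\<epsilon>\<close>. It is killed by \<open>\<alpha>\<close> from the left and
    by \<open>\<beta>\<close> from the right, whence the orthogonality of the two blocks.\<close>
  define e where "e i j = (if i = j then \<epsilon> else \<zero>) \<ominus> \<beta> i \<otimes> \<alpha> j" for i j
  have ec: "e i j \<in> carrier L" for i j using c \<epsilon> by (simp add: e_def)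
  have \<alpha>e: "(\<Oplus>i\<in>?M. \<alpha> i \<otimes> e i j) = \<zero>" if j: "j < m" for j
  proof -
    have 1: "(\<Oplus>i\<in>?M. if i = j then \<alpha> i else \<zero>) = (\<Oplus>i\<in>?M. \<alpha> i \<otimes> e i j) \<oplus> (\<Oplus>i\<in>?M. (\<alpha> i \<otimes> \<beta> i) \<otimes> \<alpha> j)"
    proof (rule finsum_addI)
      fix i
      have "\<alpha> i \<otimes> e i j = (if i = j then \<alpha> i else \<zero>) \<ominus> (\<alpha> i \<otimes> \<beta> i) \<otimes> \<alpha> j"
        using c \<epsilon> \<alpha>\<epsilon> by (simp add: e_def r_distr a_minus_def r_minus m_assoc)
      then show "(if i = j then \<alpha> i else \<zero>) = \<alpha> i \<otimes> e i j \<oplus> (\<alpha> i \<otimes> \<beta> i) \<otimes> \<alpha> j"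
        using c by (simp add: a_minus_def a_assoc l_neg)
    qed (use c ec in auto)
    have 2: "(\<Oplus>i\<in>?M. if i = j then \<alpha> i else \<zero>) = \<alpha> j" using c j by (subst finsum_delta) auto
    have 3: "(\<Oplus>i\<in>?M. (\<alpha> i \<otimes> \<beta> i) \<otimes> \<alpha> j) = \<alpha> j" using c \<alpha>\<beta> by (subst finsum_ldistr[symmetric]) auto
    have 4: "(\<Oplus>i\<in>?M. \<alpha> i \<otimes> e i j) \<in> carrier L" using c ec by (intro finsum_closed) auto
    show ?thesis by (rule add_cancel_zero[OF 1[unfolded 2 3] c(1) 4])
  qed
  have e\<beta>: "(\<Oplus>j\<in>?M. e i j \<otimes> \<beta> j) = \<zero>" if i: "i < m" for i
  proof -
    have 1: "(\<Oplus>j\<in>?M. if j = i then \<beta> j else \<zero>) = (\<Oplus>j\<in>?M. e i j \<otimes> \<beta> j) \<oplus> (\<Oplus>j\<in>?M. \<beta> i \<otimes> (\<alpha> j \<otimes> \<beta> j))"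
    proof (rule finsum_addI)
      fix j
      have "e i j \<otimes> \<beta> j = (if j = i then \<beta> j else \<zero>) \<ominus> \<beta> i \<otimes> (\<alpha> j \<otimes> \<beta> j)"
        using c \<epsilon> \<epsilon>\<beta> by (simp add: e_def l_distr a_minus_def l_minus m_assoc)
      then show "(if j = i then \<beta> j else \<zero>) = e i j \<otimes> \<beta> j \<oplus> \<beta> i \<otimes> (\<alpha> j \<otimes> \<beta> j)"
        using c by (simp add: a_minus_def a_assoc l_neg)
    qed (use c ec in auto)
    have 2: "(\<Oplus>j\<in>?M. if j = i then \<beta> j else \<zero>) = \<beta> i" using c i by (subst finsum_delta) auto
    have 3: "(\<Oplus>j\<in>?M. \<beta> i \<otimes> (\<alpha> j \<otimes> \<beta> j)) = \<beta> i" using c \<alpha>\<beta> by (subst finsum_rdistr[symmetric]) auto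
    have 4: "(\<Oplus>j\<in>?M. e i j \<otimes> \<beta> j) \<in> carrier L" using c ec by (intro finsum_closed) auto
    show ?thesis by (rule add_cancel_zero[OF 1[unfolded 2 3] c(2) 4])
  qed
  have e\<epsilon>: "e i j \<otimes> \<epsilon> = e i j" "\<epsilon> \<otimes> e i j = e i j" for i j
    using c \<epsilon> \<alpha>\<epsilon> \<epsilon>\<beta> by (simp_all add: e_def l_distr r_distr a_minus_def l_minus r_minus m_assoc flip: m_assoc[of \<epsilon> "\<beta> i" "\<alpha> j"])
  have ee: "(\<Oplus>k\<in>?M. e i k \<otimes> e k j) = e i j" if i: "i < m" and j: "j < m" for i j
  proof -
    have "(\<Oplus>k\<in>?M. if k = j then e i k else \<zero>) = (\<Oplus>k\<in>?M. e i k \<otimes> e k j) \<oplus> (\<Oplus>k\<in>?M. (e i k \<otimes> \<beta> k) \<otimes> \<alpha> j)"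
    proof (rule finsum_addI)
      fix k
      have "e i k \<otimes> e k j = (if k = j then e i k else \<zero>) \<ominus> (e i k \<otimes> \<beta> k) \<otimes> \<alpha> j"
        using c \<epsilon> e\<epsilon> ec by (simp add: e_def[of k j] r_distr a_minus_def r_minus m_assoc)
      then show "(if k = j then e i k else \<zero>) = e i k \<otimes> e k j \<oplus> (e i k \<otimes> \<beta> k) \<otimes> \<alpha> j"
        using c ec by (simp add: a_minus_def a_assoc l_neg)
    qed (use c ec in auto)
    moreover have "(\<Oplus>k\<in>?M. if k = j then e i k else \<zero>) = e i j" using ec j by (subst finsum_delta) auto
    moreover have "(\<Oplus>k\<in>?M. (e i k \<otimes> \<beta> k) \<otimes> \<alpha> j) = \<zero>" using c ec e\<beta>[OF i] by (subst finsum_ldistr[symmetric]) auto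
    moreover have "(\<Oplus>k\<in>?M. e i k \<otimes> e k j) \<in> carrier L" using ec by (intro finsum_closed) auto
    ultimately show ?thesis by simp
  qed
  obtain J :: "(nat \<times> 'v \<times> (nat \<Rightarrow> 'a)) set" and vs f g
    where J: "finite J" "\<And>k. k \<in> J \<Longrightarrow> vs k \<in> V"
      "\<And>i k. i < m \<Longrightarrow> k \<in> J \<Longrightarrow> f i k \<in> carrier L \<and> f i k \<otimes> p (vs k) = f i k"
      "\<And>i k. i < m \<Longrightarrow> k \<in> J \<Longrightarrow> g k i \<in> carrier L \<and> p (vs k) \<otimes> g k i = g k i"
      "\<And>i j. i < m \<Longrightarrow> j < m \<Longrightarrow> (\<Oplus>k\<in>J. f i k \<otimes> g k j) = e i j"
      "\<And>k l. k \<in> J \<Longrightarrow> l \<in> J \<Longrightarrow> (\<Oplus>i\<in>?M. g k i \<otimes> f i l) = (if k = l then p (vs k) else \<zero>)"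
    using idempotent_splits[of m e] ec ee by blast
  let ?P = "Sum_Type.Plus V J"
  \<comment> \<open>The index in V gives the block of L, with \<open>\<beta>\<close> and
    \<open>\<alpha>\<close> cut into their vertex components; the index in J gives the block of the
    complement.\<close>
  define \<xi> where "\<xi> i = case_sum (\<lambda>v. \<beta> i \<otimes> p v) (f i)" for i
  define \<eta> where "\<eta> k i = case_sum (\<lambda>v. p v \<otimes> \<alpha> i) (\<lambda>k. g k i) k" for k i
  have fc: "f i k \<in> carrier L" "g k i \<in> carrier L" if "i < m" "k \<in> J" for i k using J(3,4)[OF that] by auto
  have pc: "p (vs k) \<in> carrier L" if "k \<in> J" for k using J(2)[OF that] p_closed by blast
  \<comment> \<open>The splitting fg = e with gf diagonal also gives ef = f and ge = g. Through
    these equations f and g inherit the compatibility with \<open>\<epsilon>\<close> and the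
    orthogonality to \<open>\<alpha>\<close> and \<open>\<beta>\<close> from e.\<close>
  have ef: "(\<Oplus>j\<in>?M. e i j \<otimes> f j k) = f i k" if i: "i < m" and k: "k \<in> J" for i k
  proof -
    have "(\<Oplus>j\<in>?M. e i j \<otimes> f j k) = (\<Oplus>j\<in>?M. (\<Oplus>l\<in>J. f i l \<otimes> g l j) \<otimes> f j k)"
      using J(5) i k fc ec by (intro finsum_cong') (auto intro!: finsum_closed)
    also have "\<dots> = (\<Oplus>l\<in>J. f i l \<otimes> (\<Oplus>j\<in>?M. g l j \<otimes> f j k))"
      using J(1) fc i k by (intro finsum_assoc) auto
    also have "\<dots> = (\<Oplus>l\<in>J. if l = k then f i k else \<zero>)"
      using J(6)[OF _ k] J(3)[OF i] fc i k by (intro finsum_cong') auto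
    also have "\<dots> = f i k" using J(1) fc i k by (subst finsum_delta) auto
    finally show ?thesis .
  qed
  have ge: "(\<Oplus>i\<in>?M. g k i \<otimes> e i j) = g k j" if j: "j < m" and k: "k \<in> J" for j k
  proof -
    have "(\<Oplus>i\<in>?M. g k i \<otimes> e i j) = (\<Oplus>i\<in>?M. g k i \<otimes> (\<Oplus>l\<in>J. f i l \<otimes> g l j))"
      using J(5) j k fc ec by (intro finsum_cong') (auto intro!: finsum_closed)
    also have "\<dots> = (\<Oplus>l\<in>J. (\<Oplus>i\<in>?M. g k i \<otimes> f i l) \<otimes> g l j)"
      using J(1) fc j k by (intro finsum_assoc[symmetric]) auto
    also have "\<dots> = (\<Oplus>l\<in>J. if l = k then g k j else \<zero>)"
      using J(6)[OF k] J(4)[OF j] fc j k by (intro finsum_cong') auto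
    also have "\<dots> = g k j" using J(1) fc j k by (subst finsum_delta) auto
    finally show ?thesis .
  qed
  have \<epsilon>f: "\<epsilon> \<otimes> f i k = f i k" if "i < m" "k \<in> J" for i k
  proof -
    have "\<epsilon> \<otimes> f i k = (\<Oplus>j\<in>?M. \<epsilon> \<otimes> (e i j \<otimes> f j k))"
      unfolding ef[OF that, symmetric] using ec fc that \<epsilon> by (intro finsum_rdistr) auto
    also have "\<dots> = (\<Oplus>j\<in>?M. e i j \<otimes> f j k)"
      using ec fc that \<epsilon> e\<epsilon> by (intro finsum_cong') (auto simp flip: m_assoc)
    finally show ?thesis by (simp add: ef[OF that])
  qed
  have g\<epsilon>: "g k i \<otimes> \<epsilon> = g k i" if "i < m" "k \<in> J" for i k
  proof -
    have "g k i \<otimes> \<epsilon> = (\<Oplus>j\<in>?M. (g k j \<otimes> e j i) \<otimes> \<epsilon>)"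
      unfolding ge[OF that, symmetric] using ec fc that \<epsilon> by (intro finsum_ldistr) auto
    also have "\<dots> = (\<Oplus>j\<in>?M. g k j \<otimes> e j i)"
      using ec fc that \<epsilon> e\<epsilon> by (intro finsum_cong') (auto simp: m_assoc)
    finally show ?thesis by (simp add: ge[OF that])
  qed
  have \<alpha>f: "(\<Oplus>i\<in>?M. \<alpha> i \<otimes> f i k) = \<zero>" if k: "k \<in> J" for k
  proof -
    have "(\<Oplus>i\<in>?M. \<alpha> i \<otimes> f i k) = (\<Oplus>i\<in>?M. \<alpha> i \<otimes> (\<Oplus>j\<in>?M. e i j \<otimes> f j k))"
      using ef[OF _ k] c fc k by (intro finsum_cong') auto
    also have "\<dots> = (\<Oplus>j\<in>?M. (\<Oplus>i\<in>?M. \<alpha> i \<otimes> e i j) \<otimes> f j k)"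
      using c ec fc k by (intro finsum_assoc[symmetric]) auto
    also have "\<dots> = \<zero>" using \<alpha>e fc k by (intro finsum_zeroI) auto
    finally show ?thesis .
  qed
  have g\<beta>: "(\<Oplus>i\<in>?M. g k i \<otimes> \<beta> i) = \<zero>" if k: "k \<in> J" for k
  proof -
    have "(\<Oplus>j\<in>?M. g k j \<otimes> \<beta> j) = (\<Oplus>j\<in>?M. (\<Oplus>i\<in>?M. g k i \<otimes> e i j) \<otimes> \<beta> j)"
      using ge[OF _ k] c fc k by (intro finsum_cong') auto
    also have "\<dots> = (\<Oplus>i\<in>?M. g k i \<otimes> (\<Oplus>j\<in>?M. e i j \<otimes> \<beta> j))"
      using c ec fc k by (intro finsum_assoc) auto
    also have "\<dots> = \<zero>" using e\<beta> fc k by (intro finsum_zeroI) auto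
    finally show ?thesis .
  qed
  have \<xi>_simps: "\<xi> i (Inl v) = \<beta> i \<otimes> p v" "\<xi> i (Inr k) = f i k" "\<eta> (Inl v) i = p v \<otimes> \<alpha> i" "\<eta> (Inr k) i = g k i" for i v k
    by (simp_all add: \<xi>_def \<eta>_def)
  show thesis
  proof (rule that[of J vs \<xi> \<eta>])
    show "finite J" "vs \<in> J \<rightarrow> V" using J(1,2) by auto
    show \<xi>: "\<xi> i k \<in> carrier L \<and> \<epsilon> \<otimes> \<xi> i k = \<xi> i k \<and> \<xi> i k \<otimes> p (case_sum id vs k) = \<xi> i k"
      if "i < m" "k \<in> ?P" for i k
      using that J(3) \<epsilon>f c p_closed p_mult \<epsilon> \<epsilon>\<beta>
      by (cases k) (auto simp: \<xi>_simps m_assoc simp flip: m_assoc[of \<epsilon>])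
    show \<eta>: "\<eta> k i \<in> carrier L \<and> \<eta> k i \<otimes> \<epsilon> = \<eta> k i \<and> p (case_sum id vs k) \<otimes> \<eta> k i = \<eta> k i"
      if "i < m" "k \<in> ?P" for i k
    proof (cases k)
      case (Inl v)
      then have v: "v \<in> V" using that by auto
      have "p v \<otimes> (p v \<otimes> \<alpha> i) = (p v \<otimes> p v) \<otimes> \<alpha> i" using v p_closed c by (simp add: m_assoc)
      then show ?thesis using v Inl c p_closed p_mult \<epsilon> \<alpha>\<epsilon> by (simp add: \<xi>_simps m_assoc)
    qed (use that J(4) g\<epsilon> in \<open>auto simp: \<xi>_simps\<close>)
    show "(\<Oplus>k\<in>?P. \<xi> i k \<otimes> \<eta> k j) = (if i = j then \<epsilon> else \<zero>)" if ij: "i < m" "j < m" for i j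
    proof -
      have "(\<Oplus>k\<in>?P. \<xi> i k \<otimes> \<eta> k j) = (\<Oplus>v\<in>V. \<xi> i (Inl v) \<otimes> \<eta> (Inl v) j) \<oplus> (\<Oplus>k\<in>J. \<xi> i (Inr k) \<otimes> \<eta> (Inr k) j)"
        using finite_V J(1) \<xi> \<eta> ij by (intro finsum_Plus) auto
      also have "(\<Oplus>k\<in>J. \<xi> i (Inr k) \<otimes> \<eta> (Inr k) j) = e i j" using J(5)[OF ij] by (simp add: \<xi>_simps)
      also have "(\<Oplus>v\<in>V. \<xi> i (Inl v) \<otimes> \<eta> (Inl v) j) = (\<Oplus>v\<in>V. (\<beta> i \<otimes> p v) \<otimes> \<alpha> j)"
      proof (intro finsum_cong' refl funcsetI)
        fix v assume v: "v \<in> V"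
        have "(\<beta> i \<otimes> p v) \<otimes> (p v \<otimes> \<alpha> j) = \<beta> i \<otimes> (p v \<otimes> p v) \<otimes> \<alpha> j" using v c p_closed by (simp add: m_assoc)
        then show "\<xi> i (Inl v) \<otimes> \<eta> (Inl v) j = (\<beta> i \<otimes> p v) \<otimes> \<alpha> j" using v p_mult by (simp add: \<xi>_simps)
      qed (use c p_closed in auto)
      also have "\<dots> = (\<Oplus>v\<in>V. \<beta> i \<otimes> p v) \<otimes> \<alpha> j" using finite_V c p_closed by (intro finsum_ldistr[symmetric]) auto
      also have "(\<Oplus>v\<in>V. \<beta> i \<otimes> p v) = \<beta> i \<otimes> (\<Oplus>v\<in>V. p v)" using finite_V c p_closed by (intro finsum_rdistr[symmetric]) auto
      also have "\<beta> i \<otimes> (\<Oplus>v\<in>V. p v) \<otimes> \<alpha> j \<oplus> e i j = (if i = j then \<epsilon> else \<zero>)"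
        using c \<epsilon> by (simp add: p_sum e_def a_minus_def a_lcomm r_neg)
      finally show ?thesis .
    qed
    show "(\<Oplus>i\<in>?M. \<eta> k i \<otimes> \<xi> i l) = (if k = l then p (case_sum id vs k) else \<zero>)"
      if kl: "k \<in> ?P" "l \<in> ?P" for k l
    proof (cases k; cases l)
      fix u v assume uv: "k = Inl u" "l = Inl v"
      then have V: "u \<in> V" "v \<in> V" using kl by auto
      have "(\<Oplus>i\<in>?M. \<eta> k i \<otimes> \<xi> i l) = (\<Oplus>i\<in>?M. p u \<otimes> ((\<alpha> i \<otimes> \<beta> i) \<otimes> p v))"
        using V c p_closed by (intro finsum_cong') (auto simp: uv \<xi>_simps m_assoc)
      also have "\<dots> = p u \<otimes> (\<Oplus>i\<in>?M. (\<alpha> i \<otimes> \<beta> i) \<otimes> p v)" using V c p_closed by (intro finsum_rdistr[symmetric]) auto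
      also have "(\<Oplus>i\<in>?M. (\<alpha> i \<otimes> \<beta> i) \<otimes> p v) = (\<Oplus>i\<in>?M. \<alpha> i \<otimes> \<beta> i) \<otimes> p v" using V c p_closed by (intro finsum_ldistr[symmetric]) auto
      finally show ?thesis using V p_mult p_closed by (auto simp: \<alpha>\<beta> uv)
    next
      fix u v assume uv: "k = Inl u" "l = Inr v"
      then have V: "u \<in> V" "v \<in> J" using kl by auto
      have "(\<Oplus>i\<in>?M. \<eta> k i \<otimes> \<xi> i l) = (\<Oplus>i\<in>?M. p u \<otimes> (\<alpha> i \<otimes> f i v))"
        using V c p_closed fc by (intro finsum_cong') (auto simp: uv \<xi>_simps m_assoc)
      also have "\<dots> = p u \<otimes> (\<Oplus>i\<in>?M. \<alpha> i \<otimes> f i v)" using V c p_closed fc by (intro finsum_rdistr[symmetric]) auto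
      finally show ?thesis using V p_closed by (simp add: \<alpha>f uv)
    next
      fix u v assume uv: "k = Inr u" "l = Inl v"
      then have V: "u \<in> J" "v \<in> V" using kl by auto
      have "(\<Oplus>i\<in>?M. \<eta> k i \<otimes> \<xi> i l) = (\<Oplus>i\<in>?M. (g u i \<otimes> \<beta> i) \<otimes> p v)"
        using V c p_closed fc by (intro finsum_cong') (auto simp: uv \<xi>_simps m_assoc)
      also have "\<dots> = (\<Oplus>i\<in>?M. g u i \<otimes> \<beta> i) \<otimes> p v" using V c p_closed fc by (intro finsum_ldistr[symmetric]) auto
      finally show ?thesis using V p_closed by (simp add: g\<beta> uv)
    next
      fix u v assume uv: "k = Inr u" "l = Inr v"
      then have "u \<in> J" "v \<in> J" using kl by auto
      then show ?thesis using J(6)[of u v] uv by (simp add: \<xi>_simps)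
    qed
  qed
qed

end

text \<open>The indices belonging to a vertex v are numbered along a hair: the copy coming from L
  gets number 0 and the copies coming from the complement follow.\<close>

lemma fiber_enumeration:
  assumes J: "finite J" "vs \<in> J \<rightarrow> V"
  obtains \<beta> where "bij_betw \<beta> {(v, j) |v j. v \<in> V \<and> j \<le> card {k \<in> J. vs k = v}} (Sum_Type.Plus V J)"
    "\<And>v j. \<lbrakk>v \<in> V; j \<le> card {k \<in> J. vs k = v}\<rbrakk> \<Longrightarrow> case_sum id vs (\<beta> (v, j)) = v"
proof -
  let ?J = "\<lambda>v. {k \<in> J. vs k = v}"
  let ?S = "{(v, j) |v j. v \<in> V \<and> j \<le> card (?J v)}"
  have "\<forall>v. \<exists>f. bij_betw f {1..card (?J v)} (?J v)" using J(1) ex_bij_betw_nat_finite_1[of "?J _"] by simp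
  then obtain f where f: "\<And>v. bij_betw (f v) {1..card (?J v)} (?J v)" by metis
  have fJ: "f v j \<in> J \<and> vs (f v j) = v" if "0 < j" "j \<le> card (?J v)" for v j
    using bij_betwE[OF f[of v]] that by (auto simp: Ball_def Suc_le_eq)
  define \<beta> where "\<beta> = (\<lambda>(v, j). if j = (0::nat) then Inl v else Inr (f v j))"
  have \<beta>: "\<beta> (v, 0) = Inl v" "0 < j \<Longrightarrow> \<beta> (v, j) = Inr (f v j)" for v j by (simp_all add: \<beta>_def)
  show thesis
  proof (rule that[of \<beta>])
    show l: "case_sum id vs (\<beta> (v, j)) = v" if "v \<in> V" "j \<le> card (?J v)" for v j
      using fJ[of j v] that by (cases "j = 0") (simp_all add: \<beta>)
    show "bij_betw \<beta> ?S (Sum_Type.Plus V J)"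
    proof (rule bij_betw_imageI)
      show "inj_on \<beta> ?S"
      proof (rule inj_onI, clarify)
        fix u i v j assume a: "u \<in> V" "i \<le> card (?J u)" "v \<in> V" "j \<le> card (?J v)" and eq: "\<beta> (u, i) = \<beta> (v, j)"
        have uv: "u = v" using l[OF a(1,2)] l[OF a(3,4)] eq by simp
        have "i = j"
        proof (cases "i = 0 \<or> j = 0")
          case True
          then show ?thesis using eq by (cases "i = 0"; cases "j = 0") (simp_all add: \<beta>)
        next
          case False
          then have "f v i = f v j" using eq uv by (simp add: \<beta>)
          then show ?thesis using inj_onD[OF bij_betw_imp_inj_on[OF f[of v]]] False a uv by auto
        qed
        then show "u = v \<and> i = j" using uv by simp
      qed
      show "\<beta> ` ?S = Sum_Type.Plus V J"
      proof (intro equalityI subsetI)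
        fix k assume "k \<in> \<beta> ` ?S"
        then obtain v j where "v \<in> V" "j \<le> card (?J v)" "k = \<beta> (v, j)" by auto
        then show "k \<in> Sum_Type.Plus V J" using fJ[of j v] by (cases "j = 0") (simp_all add: \<beta> InlI InrI)
      next
        fix k assume "k \<in> Sum_Type.Plus V J"
        then show "k \<in> \<beta> ` ?S"
        proof (elim PlusE)
          fix v assume "v \<in> V" "k = Inl v"
          then show ?thesis by (intro image_eqI[of _ _ "(v, 0)"]) (simp_all add: \<beta>)
        next
          fix l assume l: "l \<in> J" "k = Inr l"
          then have "l \<in> ?J (vs l)" by simp
          then obtain j where "j \<in> {1..card (?J (vs l))}" "f (vs l) j = l"
            using bij_betw_imp_surj_on[OF f[of "vs l"]] by (metis (no_types, lifting) imageE)
          then show ?thesis using l J(2) by (intro image_eqI[of _ _ "(vs l, j)"]) (auto simp: \<beta>)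
        qed
      qed
    qed
  qed
qed

context finite_vertex_weighted
begin

interpretation A: algebra_over K L by (rule wlpa_algebra)
interpretation fa: filtered_algebra L kappa "verts E" vert reg pl "lloc E"
     "\<lambda>s t. xl s" wfilt
  by (rule wlpa_filtered)

text \<open>Pure relabelling of the previous result, with the multiplicities of the vertices read as
  lengths of hairs. The number m of summands in the expression of 1 is kept as matrix size.\<close>

theorem full_idempotent_hair_frame:
  assumes "full_idempotent L \<epsilon>"
  obtains m :: nat and h x y where "0 < m" "\<And>v. 0 < h v"
    "\<And>i a. \<lbrakk>i < m; a \<in> verts (hair_graph E h)\<rbrakk> \<Longrightarrow> x i a \<in> carrier L \<and> \<epsilon> \<cdot> x i a = x i a \<and> x i a \<cdot> vert (fst a) = x i a"
    "\<And>i a. \<lbrakk>i < m; a \<in> verts (hair_graph E h)\<rbrakk> \<Longrightarrow> y a i \<in> carrier L \<and> y a i \<cdot> \<epsilon> = y a i \<and> vert (fst a) \<cdot> y a i = y a i"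
    "\<And>i j. \<lbrakk>i < m; j < m\<rbrakk> \<Longrightarrow> (\<Oplus>\<^bsub>L\<^esub>a\<in>verts (hair_graph E h). x i a \<cdot> y a j) = (if i = j then \<epsilon> else \<zero>\<^bsub>L\<^esub>)"
    "\<And>a b. \<lbrakk>a \<in> verts (hair_graph E h); b \<in> verts (hair_graph E h)\<rbrakk>
      \<Longrightarrow> (\<Oplus>\<^bsub>L\<^esub>i\<in>{..<m}. y a i \<cdot> x i b) = (if a = b then vert (fst a) else \<zero>\<^bsub>L\<^esub>)"
proof -
  have \<epsilon>: "\<epsilon> \<in> carrier L" "\<epsilon> \<cdot> \<epsilon> = \<epsilon>" "\<one>\<^bsub>L\<^esub> \<in> Idl\<^bsub>L\<^esub> {\<epsilon>}"
    using assms by (auto simp: full_idempotent_def)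
  obtain m a b where m': "0 < (m::nat) \<and> (\<forall>i. a i \<in> carrier L \<and> b i \<in> carrier L)
      \<and> \<one>\<^bsub>L\<^esub> = (\<Oplus>\<^bsub>L\<^esub>i\<in>{..<m}. a i \<cdot> \<epsilon> \<cdot> b i)"
    using A.B.genideal_singleton_sum[OF \<epsilon>(1,3)] by (elim exE) (rule that)
  then have m: "0 < m" "\<And>i. a i \<in> carrier L" "\<And>i. b i \<in> carrier L"
      "(\<Oplus>\<^bsub>L\<^esub>i\<in>{..<m}. a i \<cdot> \<epsilon> \<cdot> b i) = \<one>\<^bsub>L\<^esub>"
    by simp_all
  let ?P = "Sum_Type.Plus (verts E)"
  show thesis
  proof (rule fa.full_idempotent_frame[OF \<epsilon>(1,2) m(2-4)])
  fix J :: "(nat \<times> 'v \<times> (nat \<Rightarrow> _)) set" and vs x y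
    assume J: "finite J" "vs \<in> J \<rightarrow> verts E"
    and x: "\<And>i k. i < m \<Longrightarrow> k \<in> ?P J \<Longrightarrow> x i k \<in> carrier L \<and> \<epsilon> \<cdot> x i k = x i k \<and> x i k \<cdot> vert (case_sum id vs k) = x i k"
    and y: "\<And>i k. i < m \<Longrightarrow> k \<in> ?P J \<Longrightarrow> y k i \<in> carrier L \<and> y k i \<cdot> \<epsilon> = y k i \<and> vert (case_sum id vs k) \<cdot> y k i = y k i"
    and xy: "\<And>i j. i < m \<Longrightarrow> j < m \<Longrightarrow> (\<Oplus>\<^bsub>L\<^esub>k\<in>?P J. x i k \<cdot> y k j) = (if i = j then \<epsilon> else \<zero>\<^bsub>L\<^esub>)"
    and yx: "\<And>k l. k \<in> ?P J \<Longrightarrow> l \<in> ?P J \<Longrightarrow> (\<Oplus>\<^bsub>L\<^esub>i\<in>{..<m}. y k i \<cdot> x i l) = (if k = l then vert (case_sum id vs k) else \<zero>\<^bsub>L\<^esub>)"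
  \<comment> \<open>The successor counts the copy of v that comes from L; it makes h positive, and j
    ranges up to \<open>h v - 1\<close>, the size of the fiber.\<close>
  define h where "h v = Suc (card {k \<in> J. vs k = v})" for v
  let ?H = "verts (hair_graph E h)"
  obtain \<beta> where \<beta>: "bij_betw \<beta> {(v, j) |v j. v \<in> verts E \<and> j \<le> card {k \<in> J. vs k = v}} (?P J)"
    "\<And>v j. \<lbrakk>v \<in> verts E; j \<le> card {k \<in> J. vs k = v}\<rbrakk> \<Longrightarrow> case_sum id vs (\<beta> (v, j)) = v"
    using fiber_enumeration[OF J] by blast
  have H: "?H = {(v, j) |v j. v \<in> verts E \<and> j \<le> card {k \<in> J. vs k = v}}" by (simp add: hair_graph_def h_def)
  have bij: "bij_betw \<beta> ?H (?P J)" unfolding H by (rule \<beta>(1))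
  have mem: "\<beta> a \<in> ?P J" if "a \<in> ?H" for a using bij_betwE[OF bij] that by blast
  have loc: "case_sum id vs (\<beta> a) = fst a" if "a \<in> ?H" for a using that \<beta>(2) unfolding H by auto
  show ?thesis
  proof (rule that[of m h "\<lambda>i a. x i (\<beta> a)" "\<lambda>a i. y (\<beta> a) i"])
    show "x i (\<beta> a) \<in> carrier L \<and> \<epsilon> \<cdot> x i (\<beta> a) = x i (\<beta> a) \<and> x i (\<beta> a) \<cdot> vert (fst a) = x i (\<beta> a)"
      if "i < m" "a \<in> ?H" for i a
      using x[OF that(1) mem[OF that(2)]] loc[OF that(2)] by simp
    show "y (\<beta> a) i \<in> carrier L \<and> y (\<beta> a) i \<cdot> \<epsilon> = y (\<beta> a) i \<and> vert (fst a) \<cdot> y (\<beta> a) i = y (\<beta> a) i"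
      if "i < m" "a \<in> ?H" for i a
      using y[OF that(1) mem[OF that(2)]] loc[OF that(2)] by simp
    show "(\<Oplus>\<^bsub>L\<^esub>i\<in>{..<m}. y (\<beta> a) i \<cdot> x i (\<beta> b)) = (if a = b then vert (fst a) else \<zero>\<^bsub>L\<^esub>)"
      if "a \<in> ?H" "b \<in> ?H" for a b
      using yx[OF mem mem, OF that] loc[OF that(1)] inj_on_eq_iff[OF bij_betw_imp_inj_on[OF bij] that] by auto
    show "(\<Oplus>\<^bsub>L\<^esub>a\<in>?H. x i (\<beta> a) \<cdot> y (\<beta> a) j) = (if i = j then \<epsilon> else \<zero>\<^bsub>L\<^esub>)" if "i < m" "j < m" for i j
    proof -
      have "(\<Oplus>\<^bsub>L\<^esub>k\<in>\<beta> ` ?H. x i k \<cdot> y k j) = (\<Oplus>\<^bsub>L\<^esub>a\<in>?H. x i (\<beta> a) \<cdot> y (\<beta> a) j)"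
      proof (rule A.M.finsum_reindex)
        show "(\<lambda>k. x i k \<cdot> y k j) \<in> \<beta> ` ?H \<rightarrow> carrier L"
        proof
          fix k assume "k \<in> \<beta> ` ?H"
          then have "k \<in> ?P J" using mem by blast
          then show "x i k \<cdot> y k j \<in> carrier L" using x[OF that(1)] y[OF that(2)] by blast
        qed
      qed (rule bij_betw_imp_inj_on[OF bij])
      then show ?thesis using xy[OF that] bij_betw_imp_surj_on[OF bij] by simp
    qed
  qed (use m(1) in \<open>simp_all add: h_def\<close>)
qed
qed

end

section \<open>Recognising a matrix algebra over a corner\<close>

section \<open>Matrix algebras over corners\<close>

lemma corner_simps:
  "mult (corner A p) = mult A" "one (corner A p) = p" "zero (corner A p) = zero A" "add (corner A p) = add A"
  "smult (corner A p) = smult A" "carrier (corner A p) = {p \<otimes>\<^bsub>A\<^esub> x \<otimes>\<^bsub>A\<^esub> p |x. x \<in> carrier A}"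
  by (simp_all add: corner_def)

lemma (in ring) corner_iff:
  assumes "p \<in> carrier R" "p \<otimes> p = p"
  shows "a \<in> {p \<otimes> x \<otimes> p |x. x \<in> carrier R} \<longleftrightarrow> a \<in> carrier R \<and> p \<otimes> a = a \<and> a \<otimes> p = a"
proof -
  have "p \<otimes> (p \<otimes> x \<otimes> p) = p \<otimes> x \<otimes> p" "p \<otimes> x \<otimes> p \<otimes> p = p \<otimes> x \<otimes> p" if "x \<in> carrier R" for x
    using assms that by (simp_all add: m_assoc) (simp add: assms flip: m_assoc)
  moreover have "a = p \<otimes> a \<otimes> p" if "a \<in> carrier R" "p \<otimes> a = a" "a \<otimes> p = a" using that by simp
  ultimately show ?thesis using assms by blast
qed

lemma corner_carrier:
  fixes A :: "('k, 'a) module"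
  assumes "ring A" "p \<in> carrier A" "p \<otimes>\<^bsub>A\<^esub> p = p"
  shows "a \<in> carrier (corner A p) \<longleftrightarrow> a \<in> carrier A \<and> p \<otimes>\<^bsub>A\<^esub> a = a \<and> a \<otimes>\<^bsub>A\<^esub> p = a"
  unfolding corner_simps by (rule ring.corner_iff[OF assms])

lemma corner_abelian_group:
  fixes A :: "('k, 'a) module"
  assumes "ring A" "p \<in> carrier A" "p \<otimes>\<^bsub>A\<^esub> p = p"
  shows "abelian_group (corner A p)"
proof -
  interpret ring A by fact
  note C = corner_carrier[OF assms]
  show ?thesis
  proof (rule abelian_groupI)
    show "\<exists>y\<in>carrier (corner A p). y \<oplus>\<^bsub>corner A p\<^esub> x = \<zero>\<^bsub>corner A p\<^esub>" if "x \<in> carrier (corner A p)" for x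
      using that assms by (intro bexI[of _ "\<ominus>\<^bsub>A\<^esub> x"]) (simp_all add: C corner_simps(1-5) l_minus r_minus l_neg)
  qed (use assms in \<open>simp_all add: C corner_simps(1-5) l_distr r_distr a_ac\<close>)
qed

lemma corner_finsum:
  fixes A :: "('k, 'a) module"
  assumes "ring A" "p \<in> carrier A" "p \<otimes>\<^bsub>A\<^esub> p = p" "\<And>i. i \<in> S \<Longrightarrow> f i \<in> carrier (corner A p)"
  shows "finsum (corner A p) f S = finsum A f S"
proof -
  interpret ring A by fact
  have "(\<lambda>x. x) (finsum (corner A p) f S) = finsum A (\<lambda>i. (\<lambda>x. x) (f i)) S"
    by (rule additive_finsum[OF corner_abelian_group[OF assms(1-3)] abelian_group_axioms])
      (use assms(4)[unfolded corner_carrier[OF assms(1-3)]] in \<open>auto simp: corner_carrier[OF assms(1-3)] corner_simps(1-5)\<close>)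
  then show ?thesis by simp
qed

lemma mat_alg_simps:
  "carrier (mat_alg n A) = {..<n} \<times> {..<n} \<rightarrow>\<^sub>E carrier A"
  "\<lbrakk>i < n; j < n\<rbrakk> \<Longrightarrow> (M \<otimes>\<^bsub>mat_alg n A\<^esub> N) (i, j) = (\<Oplus>\<^bsub>A\<^esub>k\<in>{..<n}. M (i, k) \<otimes>\<^bsub>A\<^esub> N (k, j))"
  "\<lbrakk>i < n; j < n\<rbrakk> \<Longrightarrow> \<one>\<^bsub>mat_alg n A\<^esub> (i, j) = (if i = j then \<one>\<^bsub>A\<^esub> else \<zero>\<^bsub>A\<^esub>)"
  "\<lbrakk>i < n; j < n\<rbrakk> \<Longrightarrow> (M \<oplus>\<^bsub>mat_alg n A\<^esub> N) (i, j) = M (i, j) \<oplus>\<^bsub>A\<^esub> N (i, j)"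
  "\<lbrakk>i < n; j < n\<rbrakk> \<Longrightarrow> (c \<odot>\<^bsub>mat_alg n A\<^esub> M) (i, j) = c \<odot>\<^bsub>A\<^esub> M (i, j)"
  by (simp_all add: mat_alg_def Let_def)

context ring
begin

lemma finsum_congI:
  "\<lbrakk>\<And>i. i \<in> A \<Longrightarrow> f i = g i; \<And>i. i \<in> A \<Longrightarrow> g i \<in> carrier R\<rbrakk> \<Longrightarrow> finsum R f A = finsum R g A"
  by (rule finsum_cong') auto

lemma finsum_mult_finsum:
  assumes "finite A" "finite B" "\<And>a. a \<in> A \<Longrightarrow> f a \<in> carrier R" "\<And>b. b \<in> B \<Longrightarrow> g b \<in> carrier R"
  shows "(\<Oplus>a\<in>A. f a) \<otimes> (\<Oplus>b\<in>B. g b) = (\<Oplus>a\<in>A. \<Oplus>b\<in>B. f a \<otimes> g b)"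
proof -
  have "(\<Oplus>a\<in>A. f a) \<otimes> (\<Oplus>b\<in>B. g b) = (\<Oplus>a\<in>A. f a \<otimes> (\<Oplus>b\<in>B. g b))"
    using assms by (intro finsum_ldistr) (auto intro!: finsum_closed)
  also have "\<dots> = (\<Oplus>a\<in>A. \<Oplus>b\<in>B. f a \<otimes> g b)"
    using assms by (intro finsum_cong' finsum_rdistr) (auto intro!: finsum_closed)
  finally show ?thesis .
qed

lemma finsum_distr:
  assumes "finite A" "\<And>a. a \<in> A \<Longrightarrow> f a \<in> carrier R" "x \<in> carrier R" "y \<in> carrier R"
    "\<And>a. a \<in> A \<Longrightarrow> x \<otimes> f a \<otimes> y = h a"
  shows "x \<otimes> finsum R f A \<otimes> y = finsum R h A"
proof -
  have "x \<otimes> finsum R f A = (\<Oplus>a\<in>A. x \<otimes> f a)" using assms by (intro finsum_rdistr) auto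
  also have "\<dots> \<otimes> y = (\<Oplus>a\<in>A. x \<otimes> f a \<otimes> y)" using assms by (intro finsum_ldistr) auto
  also have "\<dots> = finsum R h A"
    using assms by (intro finsum_congI) (auto simp flip: assms(5))
  finally show ?thesis .
qed

lemma finsum2_distr:
  assumes "finite A" "finite B" "\<And>a b. a \<in> A \<Longrightarrow> b \<in> B \<Longrightarrow> f a b \<in> carrier R" "x \<in> carrier R" "y \<in> carrier R"
    "\<And>a b. a \<in> A \<Longrightarrow> b \<in> B \<Longrightarrow> x \<otimes> f a b \<otimes> y = h a b"
  shows "x \<otimes> (\<Oplus>a\<in>A. \<Oplus>b\<in>B. f a b) \<otimes> y = (\<Oplus>a\<in>A. \<Oplus>b\<in>B. h a b)"
  using assms by (intro finsum_distr) (auto intro!: finsum_closed)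

lemma finsum2_delta:
  assumes "finite A" "finite B" "i \<in> A" "j \<in> B" "c \<in> carrier R"
  shows "(\<Oplus>a\<in>A. \<Oplus>b\<in>B. if a = i \<and> b = j then c else \<zero>) = c"
proof -
  have "(\<Oplus>b\<in>B. if a = i \<and> b = j then c else \<zero>) = (if a = i then c else \<zero>)" for a
    using finsum_delta[of B j "\<lambda>_. c"] assms by (cases "a = i") auto
  then show ?thesis using finsum_delta[of A i "\<lambda>_. c"] assms by simp
qed

context
  fixes n :: nat and \<xi> \<eta> e
  assumes frame: "\<And>i. i < n \<Longrightarrow> \<xi> i \<in> carrier R" "\<And>i. i < n \<Longrightarrow> \<eta> i \<in> carrier R" "e \<in> carrier R"
      "\<And>i j. i < n \<Longrightarrow> j < n \<Longrightarrow> \<xi> i \<otimes> \<eta> j = (if i = j then e else \<zero>)"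
      "(\<Oplus>i\<in>{..<n}. \<eta> i \<otimes> \<xi> i) = \<one>"
begin

text \<open>The unit \<open>(\<Oplus>i\<in>{..<n}. \<eta> i \<otimes> \<xi> i) = \<one>\<close> is
  inserted between the factors. For elements written in terms of the entries
  \<open>\<xi> i \<otimes> z \<otimes> \<eta> j\<close> this is matrix multiplication.\<close>

lemma frame_mult:
  assumes "y \<in> carrier R" "z \<in> carrier R"
  shows "y \<otimes> z = (\<Oplus>k\<in>{..<n}. (y \<otimes> \<eta> k) \<otimes> (\<xi> k \<otimes> z))"
proof -
  have "y \<otimes> (\<Oplus>k\<in>{..<n}. \<eta> k \<otimes> \<xi> k) \<otimes> z = (\<Oplus>k\<in>{..<n}. (y \<otimes> \<eta> k) \<otimes> (\<xi> k \<otimes> z))"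
    using frame(1,2) assms by (intro finsum_distr) (auto simp: m_assoc)
  then show ?thesis using assms by (simp add: frame(5))
qed

text \<open>Inserting the unit next to \<open>\<xi> i\<close> leaves only the term k = i, which
  contributes e.\<close>

lemma frame_idem:
  assumes i: "i < n"
  shows "e \<otimes> \<xi> i = \<xi> i" "\<eta> i \<otimes> e = \<eta> i"
proof -
  have "\<xi> i = (\<Oplus>k\<in>{..<n}. (\<xi> i \<otimes> \<eta> k) \<otimes> \<xi> k)"
    using frame_mult[of "\<xi> i" \<one>] frame(1,2) i by (simp cong: finsum_cong)
  also have "\<dots> = (\<Oplus>k\<in>{..<n}. if k = i then e \<otimes> \<xi> i else \<zero>)"
    using frame(1-4) i by (intro finsum_congI) auto
  also have "\<dots> = e \<otimes> \<xi> i" using frame i by (subst finsum_delta) auto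
  finally show "e \<otimes> \<xi> i = \<xi> i" ..
  have "\<eta> i = (\<Oplus>k\<in>{..<n}. \<eta> k \<otimes> (\<xi> k \<otimes> \<eta> i))"
    using frame_mult[of \<one> "\<eta> i"] frame(1,2) i by (simp cong: finsum_cong)
  also have "\<dots> = (\<Oplus>k\<in>{..<n}. if k = i then \<eta> i \<otimes> e else \<zero>)"
    using frame(1-4) i by (intro finsum_congI) auto
  also have "\<dots> = \<eta> i \<otimes> e" using frame i by (subst finsum_delta) auto
  finally show "\<eta> i \<otimes> e = \<eta> i" ..
qed

lemma frame_expand:
  assumes "z \<in> carrier R"
  shows "z = (\<Oplus>i\<in>{..<n}. \<eta> i \<otimes> (\<Oplus>j\<in>{..<n}. (\<xi> i \<otimes> z \<otimes> \<eta> j) \<otimes> \<xi> j))"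
proof -
  have "z = (\<Oplus>i\<in>{..<n}. (\<one> \<otimes> \<eta> i) \<otimes> (\<xi> i \<otimes> z))" using frame_mult[of \<one> z] assms by simp
  also have "\<dots> = (\<Oplus>i\<in>{..<n}. \<eta> i \<otimes> (\<Oplus>j\<in>{..<n}. (\<xi> i \<otimes> z \<otimes> \<eta> j) \<otimes> \<xi> j))"
  proof (rule finsum_congI)
    fix i assume i: "i \<in> {..<n}"
    have "\<xi> i \<otimes> z = (\<Oplus>j\<in>{..<n}. (\<xi> i \<otimes> z \<otimes> \<eta> j) \<otimes> (\<xi> j \<otimes> \<one>))"
      using frame_mult[of "\<xi> i \<otimes> z" \<one>] frame(1) assms i by simp
    also have "\<dots> = (\<Oplus>j\<in>{..<n}. (\<xi> i \<otimes> z \<otimes> \<eta> j) \<otimes> \<xi> j)"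
      using frame(1,2) assms i by (intro finsum_congI) auto
    finally show "(\<one> \<otimes> \<eta> i) \<otimes> (\<xi> i \<otimes> z) = \<eta> i \<otimes> (\<Oplus>j\<in>{..<n}. (\<xi> i \<otimes> z \<otimes> \<eta> j) \<otimes> \<xi> j)"
      using frame(2) i by simp
  qed (use frame(1,2) assms in \<open>auto intro!: finsum_closed\<close>)
  finally show ?thesis .
qed

text \<open>An element is determined by its entries, by \<open>frame_expand\<close>. Every identity
  in the isomorphism below is verified in this way.\<close>

lemma frame_ext:
  assumes "y \<in> carrier R" "z \<in> carrier R" "\<And>i j. i < n \<Longrightarrow> j < n \<Longrightarrow> \<xi> i \<otimes> y \<otimes> \<eta> j = \<xi> i \<otimes> z \<otimes> \<eta> j"
  shows "y = z"
proof -
  have "(\<Oplus>i\<in>{..<n}. \<eta> i \<otimes> (\<Oplus>j\<in>{..<n}. (\<xi> i \<otimes> y \<otimes> \<eta> j) \<otimes> \<xi> j)) = (\<Oplus>i\<in>{..<n}. \<eta> i \<otimes> (\<Oplus>j\<in>{..<n}. (\<xi> i \<otimes> z \<otimes> \<eta> j) \<otimes> \<xi> j))"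
  proof (rule finsum_congI)
    fix i assume i: "i \<in> {..<n}"
    have "(\<Oplus>j\<in>{..<n}. (\<xi> i \<otimes> y \<otimes> \<eta> j) \<otimes> \<xi> j) = (\<Oplus>j\<in>{..<n}. (\<xi> i \<otimes> z \<otimes> \<eta> j) \<otimes> \<xi> j)"
      using frame(1,2) assms(2) i by (intro finsum_congI) (simp_all add: assms(3))
    then show "\<eta> i \<otimes> (\<Oplus>j\<in>{..<n}. (\<xi> i \<otimes> y \<otimes> \<eta> j) \<otimes> \<xi> j) = \<eta> i \<otimes> (\<Oplus>j\<in>{..<n}. (\<xi> i \<otimes> z \<otimes> \<eta> j) \<otimes> \<xi> j)" by simp
  qed (use frame(1,2) assms(2) in \<open>auto intro!: finsum_closed\<close>)
  then show ?thesis by (rule trans[OF frame_expand[OF assms(1)] trans[OF _ frame_expand[OF assms(2), symmetric]]])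
qed

text \<open>The entries must be absorbed by e on both sides, because each product
  \<open>\<xi> i \<otimes> \<eta> k\<close> leaves a factor e.\<close>

lemma frame_coeff:
  assumes m: "\<And>i j. i < n \<Longrightarrow> j < n \<Longrightarrow> m i j \<in> carrier R \<and> e \<otimes> m i j = m i j \<and> m i j \<otimes> e = m i j" and ij: "i < n" "j < n"
  shows "\<xi> i \<otimes> (\<Oplus>k\<in>{..<n}. \<Oplus>l\<in>{..<n}. \<eta> k \<otimes> m k l \<otimes> \<xi> l) \<otimes> \<eta> j = m i j"
proof -
  have "\<xi> i \<otimes> (\<eta> k \<otimes> m k l \<otimes> \<xi> l) \<otimes> \<eta> j = (if k = i \<and> l = j then m i j else \<zero>)" if "k < n" "l < n" for k l
  proof -
    have "\<xi> i \<otimes> (\<eta> k \<otimes> m k l \<otimes> \<xi> l) \<otimes> \<eta> j = (\<xi> i \<otimes> \<eta> k) \<otimes> m k l \<otimes> (\<xi> l \<otimes> \<eta> j)"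
      using frame(1-3) m[OF that] ij that by (simp only: m_assoc m_closed)
    then show ?thesis using frame(3,4) m that ij by simp
  qed
  then have "\<xi> i \<otimes> (\<Oplus>k\<in>{..<n}. \<Oplus>l\<in>{..<n}. \<eta> k \<otimes> m k l \<otimes> \<xi> l) \<otimes> \<eta> j = (\<Oplus>k\<in>{..<n}. \<Oplus>l\<in>{..<n}. if k = i \<and> l = j then m i j else \<zero>)"
    using frame m ij by (intro finsum2_distr) auto
  then show ?thesis using m ij by (subst (asm) finsum2_delta) auto
qed

end

section \<open>Transport of a pair of inverse matrices along partial isometries\<close>

context
  fixes J :: "'j set" and m :: nat and P P' v X Y e
  assumes fin: "finite J" and P: "\<And>a. a \<in> J \<Longrightarrow> P a \<in> carrier R" "\<And>a. a \<in> J \<Longrightarrow> P' a \<in> carrier R"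
      "\<And>a. a \<in> J \<Longrightarrow> v a \<in> carrier R" "\<And>a. a \<in> J \<Longrightarrow> P a \<otimes> v a = P a"
      "\<And>a b. a \<in> J \<Longrightarrow> b \<in> J \<Longrightarrow> P' a \<otimes> P b = (if a = b then v a else \<zero>)"
      "(\<Oplus>a\<in>J. P a \<otimes> P' a) = \<one>"
    and X: "\<And>i a. i < m \<Longrightarrow> a \<in> J \<Longrightarrow> X i a \<in> carrier R" "\<And>i a. i < m \<Longrightarrow> a \<in> J \<Longrightarrow> X i a \<otimes> v a = X i a"
    and Y: "\<And>i a. i < m \<Longrightarrow> a \<in> J \<Longrightarrow> Y a i \<in> carrier R"
    and XY: "\<And>i j. i < m \<Longrightarrow> j < m \<Longrightarrow> (\<Oplus>a\<in>J. X i a \<otimes> Y a j) = (if i = j then e else \<zero>)"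
    and YX: "\<And>a b. a \<in> J \<Longrightarrow> b \<in> J \<Longrightarrow> (\<Oplus>i\<in>{..<m}. Y a i \<otimes> X i b) = (if a = b then v a else \<zero>)"
begin

abbreviation (input) "\<xi> i \<equiv> \<Oplus>a\<in>J. X i a \<otimes> P' a"
abbreviation (input) "\<eta> i \<equiv> \<Oplus>a\<in>J. P a \<otimes> Y a i"

lemma transport_closed: "i < m \<Longrightarrow> \<xi> i \<in> carrier R" "i < m \<Longrightarrow> \<eta> i \<in> carrier R"
  using P(1,2) X(1) Y by (auto intro!: finsum_closed)

lemma transport_expand:
  assumes "i < m" "j < m" "z \<in> carrier R"
  shows "\<xi> i \<otimes> z \<otimes> \<eta> j = (\<Oplus>a\<in>J. \<Oplus>b\<in>J. X i a \<otimes> (P' a \<otimes> z \<otimes> P b) \<otimes> Y b j)"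
proof -
  have "\<xi> i \<otimes> z = (\<Oplus>a\<in>J. X i a \<otimes> P' a \<otimes> z)"
    using fin P(2) X(1) assms by (intro finsum_ldistr) auto
  also have "\<dots> \<otimes> \<eta> j = (\<Oplus>a\<in>J. \<Oplus>b\<in>J. (X i a \<otimes> P' a \<otimes> z) \<otimes> (P b \<otimes> Y b j))"
    using fin P(1,2) X(1) Y assms by (intro finsum_mult_finsum) auto
  also have "\<dots> = (\<Oplus>a\<in>J. \<Oplus>b\<in>J. X i a \<otimes> (P' a \<otimes> z \<otimes> P b) \<otimes> Y b j)"
    using P(1,2) X(1) Y assms by (intro finsum_congI) (auto simp: m_assoc intro!: finsum_closed)
  finally show ?thesis .
qed

text \<open>\<open>P' a\<close> and \<open>P b\<close> meet in the middle and give the idempotent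
  \<open>v a\<close> or zero; X absorbs this idempotent, so what remains is an entry of the product
  of X and Y.\<close>

lemma transport_mult:
  assumes "i < m" "j < m"
  shows "\<xi> i \<otimes> \<eta> j = (if i = j then e else \<zero>)"
proof -
  have P\<eta>: "P' a \<otimes> \<eta> j = v a \<otimes> Y a j" if a: "a \<in> J" for a
  proof -
    have "P' a \<otimes> \<eta> j = (\<Oplus>b\<in>J. P' a \<otimes> (P b \<otimes> Y b j))"
      using fin P(1,2) Y assms a by (intro finsum_rdistr) auto
    also have "\<dots> = (\<Oplus>b\<in>J. if b = a then v a \<otimes> Y a j else \<zero>)"
      using P(1,2,3,5) Y assms a by (intro finsum_congI) (auto simp flip: m_assoc)
    also have "\<dots> = v a \<otimes> Y a j" using fin P(3) Y assms a by (subst finsum_delta) auto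
    finally show ?thesis .
  qed
  have "\<xi> i \<otimes> \<eta> j = (\<Oplus>a\<in>J. X i a \<otimes> P' a \<otimes> \<eta> j)"
    using fin P(2) X(1) transport_closed assms by (intro finsum_ldistr) auto
  also have "\<dots> = (\<Oplus>a\<in>J. X i a \<otimes> Y a j)"
  proof (rule finsum_congI)
    fix a assume a: "a \<in> J"
    have "X i a \<otimes> P' a \<otimes> \<eta> j = (X i a \<otimes> v a) \<otimes> Y a j"
      using P(2,3) X(1) Y transport_closed assms a by (simp add: m_assoc P\<eta>)
    then show "X i a \<otimes> P' a \<otimes> \<eta> j = X i a \<otimes> Y a j" using X(2) assms a by simp
  qed (use X(1) Y assms in auto)
  finally show ?thesis using XY assms by simp
qed

text \<open>Here X and Y meet in the middle and give the diagonal matrix of the \<open>v a\<close>,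
  which \<open>P a\<close> absorbs; the remaining sum of the \<open>P a \<otimes> P' a\<close> is
  1.\<close>

lemma transport_one: "(\<Oplus>i\<in>{..<m}. \<eta> i \<otimes> \<xi> i) = \<one>"
proof -
  have "(\<Oplus>i\<in>{..<m}. \<eta> i \<otimes> \<xi> i) = (\<Oplus>a\<in>J. P a \<otimes> (\<Oplus>i\<in>{..<m}. Y a i \<otimes> \<xi> i))"
    using fin P(1) Y transport_closed by (intro finsum_assoc) auto
  also have "\<dots> = (\<Oplus>a\<in>J. P a \<otimes> P' a)"
  proof (rule finsum_congI)
    fix a assume a: "a \<in> J"
    have "(\<Oplus>i\<in>{..<m}. Y a i \<otimes> \<xi> i) = (\<Oplus>b\<in>J. (\<Oplus>i\<in>{..<m}. Y a i \<otimes> X i b) \<otimes> P' b)"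
      using fin P(2) X(1) Y a by (intro finsum_assoc[symmetric]) auto
    also have "\<dots> = (\<Oplus>b\<in>J. if b = a then v a \<otimes> P' a else \<zero>)"
      using P(2,3) YX a by (intro finsum_congI) auto
    also have "\<dots> = v a \<otimes> P' a" using fin P(2,3) a by (subst finsum_delta) auto
    finally show "P a \<otimes> (\<Oplus>i\<in>{..<m}. Y a i \<otimes> \<xi> i) = P a \<otimes> P' a"
      using P(1-4) a by (simp flip: m_assoc)
  qed (use P(1,2) in auto)
  finally show ?thesis using P(6) by simp
qed

end

end

text \<open>The elements \<open>\<xi> i\<close> and \<open>\<eta> i\<close> live in B and need not
  come from A. It suffices that the entries they cut out of B do; A may sit in B without sharing its
  unit.\<close>

theorem mat_alg_corner_iso:
  fixes A :: "('k, 'a) module" and B :: "('k, 'b) module" (structure)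
  assumes "algebra_over K A" "algebra_over K B" "alg_hom K A B \<theta>" "inj_on \<theta> (carrier A)"
    and \<epsilon>: "\<epsilon> \<in> carrier A" "\<epsilon> \<otimes>\<^bsub>A\<^esub> \<epsilon> = \<epsilon>"
    and \<xi>\<eta>: "\<And>i. i < n \<Longrightarrow> \<xi> i \<in> carrier B" "\<And>i. i < n \<Longrightarrow> \<eta> i \<in> carrier B"
      "\<And>i j. i < n \<Longrightarrow> j < n \<Longrightarrow> \<xi> i \<otimes> \<eta> j = (if i = j then \<theta> \<epsilon> else \<zero>)"
      "(\<Oplus>i\<in>{..<n}. \<eta> i \<otimes> \<xi> i) = \<one>"
    and img: "\<And>i j z. i < n \<Longrightarrow> j < n \<Longrightarrow> z \<in> carrier B \<Longrightarrow> \<xi> i \<otimes> z \<otimes> \<eta> j \<in> \<theta> ` carrier A"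
  shows "alg_iso K (mat_alg n (corner A \<epsilon>)) B"
proof -
  interpret A: algebra_over K A by fact
  interpret B: algebra_over K B by fact
  note \<theta> = alg_homD[OF assms(3)]
  let ?C = "corner A \<epsilon>" and ?N = "{..<n}"
  let ?M = "mat_alg n ?C"
  let ?\<chi> = "\<lambda>i j z. \<xi> i \<otimes> z \<otimes> \<eta> j"
  note C = corner_carrier[OF A.B.ring_axioms \<epsilon>]
  note cl = \<xi>\<eta>(1,2) \<theta>(1)[OF \<epsilon>(1)]
  note frame = cl \<xi>\<eta>(3,4)
  have \<theta>0: "\<theta> \<zero>\<^bsub>A\<^esub> = \<zero>"
    using \<theta>(1,2) by (intro additive_zero[OF A.M.abelian_group_axioms B.M.abelian_group_axioms]) auto
  have \<theta>_sum: "\<theta> (finsum A f S) = (\<Oplus>i\<in>S. \<theta> (f i))" if "\<And>i. i \<in> S \<Longrightarrow> f i \<in> carrier A" for f and S :: "nat set"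
    using \<theta>(1,2) that by (intro additive_finsum[OF A.M.abelian_group_axioms B.M.abelian_group_axioms]) auto
  have \<chi>_mult: "?\<chi> i j (z \<otimes> z') = (\<Oplus>k\<in>?N. ?\<chi> i k z \<otimes> ?\<chi> k j z')"
    if z: "i < n" "j < n" "z \<in> carrier B" "z' \<in> carrier B" for i j z z'
  proof -
    have "?\<chi> i j (z \<otimes> z') = (\<xi> i \<otimes> z) \<otimes> (z' \<otimes> \<eta> j)" using cl z by (simp add: B.B.m_assoc)
    also have "\<dots> = (\<Oplus>k\<in>?N. ?\<chi> i k z \<otimes> (\<xi> k \<otimes> (z' \<otimes> \<eta> j)))" using cl z by (intro B.B.frame_mult[OF frame]) auto
    also have "\<dots> = (\<Oplus>k\<in>?N. ?\<chi> i k z \<otimes> ?\<chi> k j z')" using cl z by (intro B.B.finsum_congI) (simp_all add: B.B.m_assoc)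
    finally show ?thesis .
  qed
  note ext = B.B.frame_ext[OF frame]
  \<comment> \<open>The inverse of taking entries. Working with this direction makes all properties
    of \<open>\<Phi>\<close> consequences of \<open>ext\<close> and of the formula for its
    entries.\<close>
  define \<Phi> where "\<Phi> M = (\<Oplus>i\<in>?N. \<Oplus>j\<in>?N. \<eta> i \<otimes> \<theta> (M (i, j)) \<otimes> \<xi> j)" for M
  have M: "M (i, j) \<in> carrier A" "\<epsilon> \<otimes>\<^bsub>A\<^esub> M (i, j) = M (i, j)" "M (i, j) \<otimes>\<^bsub>A\<^esub> \<epsilon> = M (i, j)" "M (i, j) \<in> carrier ?C"
    if "M \<in> carrier ?M" "i < n" "j < n" for M i j
  proof -
    show "M (i, j) \<in> carrier ?C" using that unfolding mat_alg_simps by (auto simp: PiE_def Pi_def)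
    then show "M (i, j) \<in> carrier A" "\<epsilon> \<otimes>\<^bsub>A\<^esub> M (i, j) = M (i, j)" "M (i, j) \<otimes>\<^bsub>A\<^esub> \<epsilon> = M (i, j)" unfolding C by auto
  qed
  have \<Phi>c: "\<Phi> M \<in> carrier B" if "M \<in> carrier ?M" for M
    unfolding \<Phi>_def using cl M[OF that] \<theta>(1) by (intro B.M.finsum_closed funcsetI) auto
  have \<chi>\<Phi>: "?\<chi> i j (\<Phi> M) = \<theta> (M (i, j))" if MC: "M \<in> carrier ?M" and ij: "i < n" "j < n" for M i j
    unfolding \<Phi>_def
  proof (rule B.B.frame_coeff[OF frame _ ij])
    fix i j assume ij: "i < n" "j < n"
    show "\<theta> (M (i, j)) \<in> carrier B \<and> \<theta> \<epsilon> \<otimes> \<theta> (M (i, j)) = \<theta> (M (i, j)) \<and> \<theta> (M (i, j)) \<otimes> \<theta> \<epsilon> = \<theta> (M (i, j))"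
      using M(1-3)[OF MC ij] \<theta>(1,3) \<epsilon>(1) by (simp flip: \<theta>(3))
  qed
  \<comment> \<open>An entry is unchanged by multiplication with \<open>\<theta> \<epsilon>\<close>
    on either side; as \<open>\<theta>\<close> is injective, its preimage in A already lies in the
    corner.\<close>
  have img': "\<exists>a\<in>carrier ?C. ?\<chi> i j z = \<theta> a" if ij: "i < n" "j < n" and z: "z \<in> carrier B" for i j z
  proof -
    obtain a where a: "a \<in> carrier A" "?\<chi> i j z = \<theta> a" using img[OF ij z] by auto
    have "\<theta> (\<epsilon> \<otimes>\<^bsub>A\<^esub> a \<otimes>\<^bsub>A\<^esub> \<epsilon>) = \<theta> \<epsilon> \<otimes> ?\<chi> i j z \<otimes> \<theta> \<epsilon>" using a \<epsilon> \<theta>(3) by simp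
    also have "\<dots> = (\<theta> \<epsilon> \<otimes> \<xi> i) \<otimes> z \<otimes> (\<eta> j \<otimes> \<theta> \<epsilon>)" using cl ij z by (simp add: B.B.m_assoc)
    also have "\<dots> = \<theta> a" using ij a B.B.frame_idem[OF frame] by simp
    finally have "\<epsilon> \<otimes>\<^bsub>A\<^esub> a \<otimes>\<^bsub>A\<^esub> \<epsilon> = a" using inj_onD[OF assms(4)] a \<epsilon> by simp
    then have "a \<in> carrier ?C" unfolding corner_simps using a by (metis (mono_tags, lifting) mem_Collect_eq)
    then show ?thesis using a by blast
  qed
  interpret C: abelian_group ?C by (rule corner_abelian_group[OF A.B.ring_axioms \<epsilon>])
  have mem: "(\<lambda>ij\<in>?N \<times> ?N. f ij) \<in> carrier ?M" if "\<And>i j. \<lbrakk>i < n; j < n\<rbrakk> \<Longrightarrow> f (i, j) \<in> carrier ?C" for f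
    using that unfolding mat_alg_simps by (intro restrict_PiE_iff[THEN iffD2]) auto
  have mulC: "M (i, k) \<otimes>\<^bsub>?C\<^esub> N (k, j) \<in> carrier ?C"
    if "M \<in> carrier ?M" "N \<in> carrier ?M" "i < n" "j < n" "k < n" for M N i j k
    using M(1-3)[OF that(1,3,5)] M(1-3)[OF that(2,5,4)] \<epsilon> unfolding C corner_simps(1)
    by (intro conjI) (simp, simp flip: A.B.m_assoc, simp add: A.B.m_assoc)
  have mult: "M \<otimes>\<^bsub>?M\<^esub> N \<in> carrier ?M"
    if "M \<in> carrier ?M" "N \<in> carrier ?M" for M N
  proof -
    have "(\<lambda>ij\<in>?N \<times> ?N. \<Oplus>\<^bsub>?C\<^esub>k\<in>?N. M (fst ij, k) \<otimes>\<^bsub>?C\<^esub> N (k, snd ij)) \<in> carrier ?M"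
      using mulC[OF that] by (intro mem C.finsum_closed) auto
    moreover have "M \<otimes>\<^bsub>?M\<^esub> N = (\<lambda>ij\<in>?N \<times> ?N. \<Oplus>\<^bsub>?C\<^esub>k\<in>?N. M (fst ij, k) \<otimes>\<^bsub>?C\<^esub> N (k, snd ij))"
      by (auto simp: mat_alg_def Let_def restrict_def fun_eq_iff)
    ultimately show ?thesis by simp
  qed
  have add: "M \<oplus>\<^bsub>?M\<^esub> N \<in> carrier ?M"
    if "M \<in> carrier ?M" "N \<in> carrier ?M" for M N
  proof -
    have "(\<lambda>ij\<in>?N \<times> ?N. M ij \<oplus>\<^bsub>?C\<^esub> N ij) \<in> carrier ?M"
      using M(4)[OF that(1)] M(4)[OF that(2)] by (intro mem C.a_closed) auto
    then show ?thesis by (simp add: mat_alg_def Let_def)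
  qed
  have smult: "c \<odot>\<^bsub>?M\<^esub> M \<in> carrier ?M"
    if c: "c \<in> carrier K" and MC: "M \<in> carrier ?M" for c M
  proof -
    have "c \<odot>\<^bsub>?C\<^esub> M (i, j) \<in> carrier ?C" if ij: "i < n" "j < n" for i j
      using M(1-3)[OF MC ij] c \<epsilon> by (simp add: C corner_simps(1-5) A.smult_mult_left A.smult_mult_right)
    then have "(\<lambda>ij\<in>?N \<times> ?N. c \<odot>\<^bsub>?C\<^esub> M ij) \<in> carrier ?M" by (rule mem)
    then show ?thesis by (simp add: mat_alg_def Let_def)
  qed
  have one: "\<one>\<^bsub>?M\<^esub> \<in> carrier ?M"
  proof -
    have "(\<lambda>ij\<in>?N \<times> ?N. if fst ij = snd ij then \<one>\<^bsub>?C\<^esub> else \<zero>\<^bsub>?C\<^esub>) \<in> carrier ?M"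
      using \<epsilon> by (intro mem) (simp add: C corner_simps(1-5))
    moreover have "\<one>\<^bsub>?M\<^esub> = (\<lambda>ij\<in>?N \<times> ?N. if fst ij = snd ij then \<one>\<^bsub>?C\<^esub> else \<zero>\<^bsub>?C\<^esub>)"
      by (auto simp: mat_alg_def Let_def restrict_def fun_eq_iff)
    ultimately show ?thesis by simp
  qed
  have \<chi>_add: "?\<chi> i j (z \<oplus> z') = ?\<chi> i j z \<oplus> ?\<chi> i j z'"
    if "i < n" "j < n" "z \<in> carrier B" "z' \<in> carrier B" for i j z z'
    using cl that by (simp add: B.B.l_distr B.B.r_distr)
  have \<chi>_smult: "?\<chi> i j (c \<odot> z) = c \<odot> ?\<chi> i j z"
    if "i < n" "j < n" "c \<in> carrier K" "z \<in> carrier B" for i j c z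
    using cl that by (simp add: B.smult_mult_left B.smult_mult_right)
  have "\<Phi> \<in> ring_hom ?M B"
  proof (rule ring_hom_memI)
    fix M N assume MN: "M \<in> carrier ?M" "N \<in> carrier ?M"
    show "\<Phi> (M \<otimes>\<^bsub>?M\<^esub> N) = \<Phi> M \<otimes> \<Phi> N"
    proof (rule ext)
      fix i j assume ij: "i < n" "j < n"
      have "?\<chi> i j (\<Phi> (M \<otimes>\<^bsub>?M\<^esub> N)) = \<theta> (\<Oplus>\<^bsub>?C\<^esub>k\<in>?N. M (i, k) \<otimes>\<^bsub>?C\<^esub> N (k, j))"
        using \<chi>\<Phi>[OF mult[OF MN] ij] ij by (simp add: mat_alg_simps)
      also have "(\<Oplus>\<^bsub>?C\<^esub>k\<in>?N. M (i, k) \<otimes>\<^bsub>?C\<^esub> N (k, j)) = (\<Oplus>\<^bsub>A\<^esub>k\<in>?N. M (i, k) \<otimes>\<^bsub>A\<^esub> N (k, j))"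
        using corner_finsum[OF A.B.ring_axioms \<epsilon>, of ?N "\<lambda>k. M (i, k) \<otimes>\<^bsub>?C\<^esub> N (k, j)"] mulC[OF MN ij]
        by (simp add: corner_simps(1))
      also have "\<theta> \<dots> = (\<Oplus>k\<in>?N. \<theta> (M (i, k) \<otimes>\<^bsub>A\<^esub> N (k, j)))"
        using M(1)[OF MN(1)] M(1)[OF MN(2)] ij by (intro \<theta>_sum) auto
      also have "\<dots> = (\<Oplus>k\<in>?N. ?\<chi> i k (\<Phi> M) \<otimes> ?\<chi> k j (\<Phi> N))"
        using \<chi>\<Phi>[OF MN(1)] \<chi>\<Phi>[OF MN(2)] ij M(1)[OF MN(1)] M(1)[OF MN(2)] \<theta>(1,3)
        by (intro B.M.finsum_cong') auto
      also have "\<dots> = ?\<chi> i j (\<Phi> M \<otimes> \<Phi> N)" using \<chi>_mult[OF ij \<Phi>c \<Phi>c, OF MN] ..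
      finally show "?\<chi> i j (\<Phi> (M \<otimes>\<^bsub>?M\<^esub> N)) = \<dots>" .
    qed (use \<Phi>c mult MN in auto)
    show "\<Phi> (M \<oplus>\<^bsub>?M\<^esub> N) = \<Phi> M \<oplus> \<Phi> N"
    proof (rule ext)
      fix i j assume ij: "i < n" "j < n"
      show "?\<chi> i j (\<Phi> (M \<oplus>\<^bsub>?M\<^esub> N)) = ?\<chi> i j (\<Phi> M \<oplus> \<Phi> N)"
        using \<chi>\<Phi>[OF add[OF MN] ij] \<chi>\<Phi>[OF MN(1) ij] \<chi>\<Phi>[OF MN(2) ij] \<chi>_add[OF ij \<Phi>c \<Phi>c, OF MN]
          \<theta>(2) M(1)[OF MN(1) ij] M(1)[OF MN(2) ij] ij
        by (simp add: mat_alg_simps corner_simps(1-5))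
    qed (use \<Phi>c add MN in auto)
  next
    show "\<Phi> \<one>\<^bsub>?M\<^esub> = \<one>"
    proof (rule ext)
      fix i j assume ij: "i < n" "j < n"
      show "?\<chi> i j (\<Phi> \<one>\<^bsub>?M\<^esub>) = ?\<chi> i j \<one>"
        using \<chi>\<Phi>[OF one ij] \<xi>\<eta>(3)[OF ij] ij cl \<theta>0 by (simp add: mat_alg_simps corner_simps(1-5))
    qed (use \<Phi>c one in auto)
  qed (rule \<Phi>c)
  moreover have "bij_betw \<Phi> (carrier ?M) (carrier B)"
  proof (rule bij_betw_imageI)
    show "inj_on \<Phi> (carrier ?M)"
    proof (rule inj_onI)
      fix M N assume MN: "M \<in> carrier ?M" "N \<in> carrier ?M" and eq: "\<Phi> M = \<Phi> N"
      have "M (i, j) = N (i, j)" if ij: "i < n" "j < n" for i j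
        using \<chi>\<Phi>[OF MN(1) ij] \<chi>\<Phi>[OF MN(2) ij] eq inj_onD[OF assms(4)] M(1)[OF MN(1) ij] M(1)[OF MN(2) ij] by simp
      then show "M = N" using MN unfolding mat_alg_simps by (intro PiE_ext[of M _ _ N]) auto
    qed
    show "\<Phi> ` carrier ?M = carrier B"
    proof (intro equalityI subsetI)
      fix z assume z: "z \<in> carrier B"
      \<comment> \<open>The existence claim covers indices outside the matrix as well, with value
        zero, so that the choice of all entries is made at once.\<close>
      have "\<exists>a. a \<in> carrier ?C \<and> (i < n \<and> j < n \<longrightarrow> ?\<chi> i j z = \<theta> a)" for i j
      proof (cases "i < n \<and> j < n")
        case False
        then show ?thesis using C.zero_closed by blast
      qed (use img'[OF _ _ z, of i j] in blast)
      then obtain f where f: "\<And>i j. f i j \<in> carrier ?C" "\<And>i j. \<lbrakk>i < n; j < n\<rbrakk> \<Longrightarrow> ?\<chi> i j z = \<theta> (f i j)" by metis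
      let ?F = "\<lambda>ij\<in>?N \<times> ?N. f (fst ij) (snd ij)"
      have MC: "?F \<in> carrier ?M" using f(1) by (intro mem) simp
      have "\<Phi> ?F = z"
      proof (rule ext)
        show "?\<chi> i j (\<Phi> ?F) = ?\<chi> i j z" if ij: "i < n" "j < n" for i j
          using \<chi>\<Phi>[OF MC ij] f(2)[OF ij] ij by simp
      qed (use \<Phi>c MC z in auto)
      then show "z \<in> \<Phi> ` carrier ?M" using MC by blast
    qed (use \<Phi>c in auto)
  qed
  moreover have "\<Phi> (c \<odot>\<^bsub>?M\<^esub> M) = c \<odot> \<Phi> M" if c: "c \<in> carrier K" and MC: "M \<in> carrier ?M" for c M
  proof (rule ext)
    fix i j assume ij: "i < n" "j < n"
    show "?\<chi> i j (\<Phi> (c \<odot>\<^bsub>?M\<^esub> M)) = ?\<chi> i j (c \<odot> \<Phi> M)"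
      using \<chi>\<Phi>[OF smult[OF c MC] ij] \<chi>\<Phi>[OF MC ij] \<chi>_smult[OF ij c \<Phi>c[OF MC]] \<theta>(4)[OF c M(1)[OF MC ij]] ij
      by (simp add: mat_alg_simps corner_simps(1-5))
  qed (use \<Phi>c smult c MC in auto)
  ultimately show ?thesis unfolding alg_iso_def ring_iso_def by blast
qed

section \<open>The algebra of a hair extension and the paths along its hairs\<close>

section \<open>Hair extensions\<close>

locale hair = finite_vertex_weighted K E w
  for K :: "('k, 'm) ring_scheme" (structure) and E :: "('v, 'e) pre_digraph" and w :: "'e \<Rightarrow> nat" +
  fixes h :: "'v \<Rightarrow> nat"
begin

abbreviation "E' \<equiv> hair_graph E h"
abbreviation "w' \<equiv> hair_weight w"

lemma hair_simps [simp]: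
  "(v, j) \<in> verts E' \<longleftrightarrow> v \<in> verts E \<and> j \<le> h v - 1"
  "Inl e \<in> arcs E' \<longleftrightarrow> e \<in> arcs E" "Inr (v, j) \<in> arcs E' \<longleftrightarrow> v \<in> verts E \<and> 1 \<le> j \<and> j \<le> h v - 1"
  "tail E' (Inl e) = (tail E e, 0)" "head E' (Inl e) = (head E e, 0)"
  "tail E' (Inr (v, j)) = (v, j)" "head E' (Inr (v, j)) = (v, j - 1)"
  "w' (Inl e) = w e" "w' (Inr z) = 1"
  by (auto simp: hair_graph_def hair_weight_def)

lemma hair_finite: "finite (verts E')" "finite (arcs E')"
proof -
  have *: "{(v, j) |v j. v \<in> verts E \<and> j \<le> h v - 1} = Sigma (verts E) (\<lambda>v. {..h v - 1})" by auto
  have "finite {(v, j) |v j. v \<in> verts E \<and> j \<le> h v - 1}" unfolding * by simp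
  then show "finite (verts E')" by (simp add: hair_graph_def)
  have "{(v, j) |v j. v \<in> verts E \<and> 1 \<le> j \<and> j \<le> h v - 1} \<subseteq> Sigma (verts E) (\<lambda>v. {..h v - 1})" by auto
  then have "finite {(v, j) |v j. v \<in> verts E \<and> 1 \<le> j \<and> j \<le> h v - 1}" by (rule finite_subset) simp
  then show "finite (arcs E')" by (simp add: hair_graph_def)
qed

lemma hair_out_arcs:
  "out_arcs E' (v, 0) = Inl ` out_arcs E v"
  "0 < j \<Longrightarrow> (v, j) \<in> verts E' \<Longrightarrow> out_arcs E' (v, j) = {Inr (v, j)}"
proof -
  have "a \<in> out_arcs E' (v, 0) \<longleftrightarrow> a \<in> Inl ` out_arcs E v" for a
    by (cases a) (auto simp: in_out_arcs_conv)
  then show "out_arcs E' (v, 0) = Inl ` out_arcs E v" by blast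
  assume "0 < j" "(v, j) \<in> verts E'"
  then have "a \<in> out_arcs E' (v, j) \<longleftrightarrow> a = Inr (v, j)" for a
    by (cases a) (auto simp: in_out_arcs_conv)
  then show "out_arcs E' (v, j) = {Inr (v, j)}" by blast
qed

lemma hair_regular:
  "(v, 0) \<in> regular_verts E' \<longleftrightarrow> v \<in> reg"
  "0 < j \<Longrightarrow> (v, j) \<in> regular_verts E' \<longleftrightarrow> (v, j) \<in> verts E'"
proof -
  have "finite (Inl ` out_arcs E v :: ('e + 'v \<times> nat) set) \<longleftrightarrow> finite (out_arcs E v)"
    by (rule finite_image_iff) simp
  then show "(v, 0) \<in> regular_verts E' \<longleftrightarrow> v \<in> reg"
    by (simp add: regular_verts_def hair_out_arcs)
  assume j: "0 < j"
  show "(v, j) \<in> regular_verts E' \<longleftrightarrow> (v, j) \<in> verts E'"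
  proof
    assume "(v, j) \<in> verts E'"
    then show "(v, j) \<in> regular_verts E'"
      unfolding regular_verts_def mem_Collect_eq by (simp only: hair_out_arcs(2)[OF j] simp_thms finite.intros insert_not_empty)
  qed (simp only: regular_verts_def mem_Collect_eq simp_thms)
qed

lemma hair_vertex_weight:
  "vertex_weight E' w' (v, 0) = wt v"
  "0 < j \<Longrightarrow> (v, j) \<in> verts E' \<Longrightarrow> vertex_weight E' w' (v, j) = 1"
proof -
  show "vertex_weight E' w' (v, 0) = wt v"
    by (simp add: vertex_weight_def hair_out_arcs(1) image_image)
  assume "0 < j" "(v, j) \<in> verts E'"
  from hair_out_arcs(2)[OF this] show "vertex_weight E' w' (v, j) = 1"
    by (simp only: vertex_weight_def image_insert image_empty hair_simps(9) Max_singleton)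
qed

text \<open>Vertices at height 0 emit exactly the old edges, and any other vertex emits a single
  edge of weight 1, so weights remain constant at each vertex. All results for L, in particular the
  universal property, hold for the extension too.\<close>

lemma hair_finite_vertex_weighted: "finite_vertex_weighted K E' w'"
proof -
  have wf: "wf_digraph E'"
  proof
    fix a assume a: "a \<in> arcs E'"
    show "tail E' a \<in> verts E'" "head E' a \<in> verts E'"
      using a tail_in_verts head_in_verts by (cases a; auto)+
  qed
  interpret wf: wf_digraph E' by (rule wf)
  have wg: "weighted_graph E' w'"
  proof
    fix a assume "a \<in> arcs E'"
    then show "0 < w' a" using weight_pos by (cases a) auto
  qed
  have fin: "fin_digraph E'" by unfold_locales (rule hair_finite)+
  have "row_finite_weighted_graph E' w'"
    by (intro row_finite_weighted_graph.intro wg row_finite_weighted_graph_axioms.intro)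
      (simp add: out_arcs_def hair_finite)
  moreover have "w' e = w' f" if v: "v \<in> regular_verts E'" and ef: "e \<in> out_arcs E' v" "f \<in> out_arcs E' v" for v e f
  proof (cases v)
    case (Pair u j)
    show ?thesis
    proof (cases "j = 0")
      case True
      then have u: "u \<in> reg" using v Pair hair_regular(1) by simp
      obtain e0 f0 where "e = Inl e0" "e0 \<in> out_arcs E u" "f = Inl f0" "f0 \<in> out_arcs E u"
        using ef unfolding Pair True hair_out_arcs(1) by (elim imageE)
      then show ?thesis using weight_const[OF u, of e0 f0] by (simp only: hair_simps)
    next
      case False
      then have "(u, j) \<in> verts E'" using v Pair hair_regular(2)[of j u] by simp
      from ef show ?thesis unfolding Pair hair_out_arcs(2)[OF False[THEN neq0_conv[THEN iffD1]] \<open>(u, j) \<in> verts E'\<close>] by (simp only: singleton_iff)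
    qed
  qed
  ultimately have "vertex_weighted_graph E' w'"
    by (rule vertex_weighted_graph.intro[OF _ vertex_weighted_graph_axioms.intro])
  then show ?thesis
    by (intro finite_vertex_weighted.intro finite_weighted_graph.intro wg fin K.field_axioms)
qed

sublocale H: finite_vertex_weighted K E' w'
  by (rule hair_finite_vertex_weighted)

abbreviation mult_HL (infixl "\<star>" 70) where "a \<star> b \<equiv> a \<otimes>\<^bsub>H.L\<^esub> b"

interpretation A: algebra_over K L by (rule wlpa_algebra)
interpretation B: algebra_over K H.L by (rule H.wlpa_algebra)

lemma map_gen_closed: "g \<in> X \<Longrightarrow> map_gen (\<lambda>v. (v, 0)) Inl g \<in> H.X"
  by (cases g) auto

text \<open>New edges end at old vertices but never start there. The matrix relations at
  \<open>(v, 0)\<close> therefore involve the same edges and weights as those at v.\<close>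

lemma hair_family: "wlpa_family E w H.L (\<lambda>g. H.gen (map_gen (\<lambda>v. (v, 0)) Inl g))"
proof -
  note D = wlpa_familyD[OF H.wlpa_family_gen]
  have iii: "(\<Oplus>\<^bsub>H.L\<^esub>e\<in>out_arcs E v. H.gen (Edge (Inl e) i) \<star> H.gen (Ghost (Inl e) j))
      = (if i = j then H.vert (v, 0) else \<zero>\<^bsub>H.L\<^esub>)"
    if v: "v \<in> reg" and ij: "i \<in> {1..wt v}" "j \<in> {1..wt v}" for v i j
  proof -
    have "(\<Oplus>\<^bsub>H.L\<^esub>e\<in>out_arcs E v. H.gen (Edge (Inl e) i) \<star> H.gen (Ghost (Inl e) j))
      = (\<Oplus>\<^bsub>H.L\<^esub>e\<in>Inl ` out_arcs E v. H.gen (Edge e i) \<star> H.gen (Ghost e j))"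
      using regular_vertsD(4)[OF v] ij by (intro B.M.finsum_reindex[symmetric]) (auto intro!: B.B.m_closed H.gen_closed)
    also have "\<dots> = (if i = j then H.vert (v, 0) else \<zero>\<^bsub>H.L\<^esub>)"
      using D(7)[of "(v, 0)" i j] v ij by (simp only: hair_out_arcs(1) hair_regular(1) hair_vertex_weight(1))
    finally show ?thesis .
  qed
  have iv: "(\<Oplus>\<^bsub>H.L\<^esub>i\<in>{1..wt v}. H.gen (Ghost (Inl e) i) \<star> H.gen (Edge (Inl f) i))
      = (if e = f then H.vert (head E e, 0) else \<zero>\<^bsub>H.L\<^esub>)"
    if v: "v \<in> reg" and ef: "e \<in> out_arcs E v" "f \<in> out_arcs E v" for v e f
    using D(8)[of "(v, 0)" "Inl e" "Inl f"] v ef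
    by (simp only: hair_out_arcs(1) hair_regular(1) hair_vertex_weight(1) hair_simps imageI sum.inject)
  have "H.vert (tail E e, 0) \<star> H.gen (Edge (Inl e) i) = H.gen (Edge (Inl e) i)
      \<and> H.gen (Edge (Inl e) i) \<star> H.vert (head E e, 0) = H.gen (Edge (Inl e) i)
      \<and> H.vert (head E e, 0) \<star> H.gen (Ghost (Inl e) i) = H.gen (Ghost (Inl e) i)
      \<and> H.gen (Ghost (Inl e) i) \<star> H.vert (tail E e, 0) = H.gen (Ghost (Inl e) i)"
    if "e \<in> arcs E" "i \<in> {1..w e}" for e i
    using D(3-6)[of "Inl e" i] that by simp
  moreover have "H.vert (u, 0) \<star> H.vert (v, 0) = (if u = v then H.vert (u, 0) else \<zero>\<^bsub>H.L\<^esub>)"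
    if "u \<in> verts E" "v \<in> verts E" for u v
    using D(2)[of "(u, 0)" "(v, 0)"] that by simp
  ultimately show ?thesis
    unfolding wlpa_family_def gen.map using iii iv map_gen_closed H.gen_closed by blast
qed

definition incl :: "(('v, 'e) gen list \<Rightarrow> 'k) set \<Rightarrow> (('v \<times> nat, 'e + 'v \<times> nat) gen list \<Rightarrow> 'k) set" where
  "incl = (SOME \<Phi>. alg_hom K L H.L \<Phi> \<and> (\<forall>g\<in>X. \<Phi> (gen g) = H.gen (map_gen (\<lambda>v. (v, 0)) Inl g)))"

lemma incl_hom: "alg_hom K L H.L incl"
  and incl_gen: "g \<in> X \<Longrightarrow> incl (gen g) = H.gen (map_gen (\<lambda>v. (v, 0)) Inl g)"
proof -
  obtain \<Phi> where "alg_hom K L H.L \<Phi>" "\<And>g. g \<in> X \<Longrightarrow> \<Phi> (gen g) = H.gen (map_gen (\<lambda>v. (v, 0)) Inl g)"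
    using wlpa_universal[OF B.algebra_over_axioms hair_family] by blast
  then have "\<exists>\<Phi>. alg_hom K L H.L \<Phi> \<and> (\<forall>g\<in>X. \<Phi> (gen g) = H.gen (map_gen (\<lambda>v. (v, 0)) Inl g))" by blast
  from someI_ex[OF this] have "alg_hom K L H.L incl \<and> (\<forall>g\<in>X. incl (gen g) = H.gen (map_gen (\<lambda>v. (v, 0)) Inl g))"
    unfolding incl_def .
  then show "alg_hom K L H.L incl" "g \<in> X \<Longrightarrow> incl (gen g) = H.gen (map_gen (\<lambda>v. (v, 0)) Inl g)" by auto
qed

text \<open>
  The product \<open>hpath (v, j)\<close> of the edges of a hair leads from $v^j$ to $v$; it is a partial
  isometry because each of these edges is the only edge emitted by its source.
\<close>

abbreviation "hedge v j \<equiv> H.gen (Edge (Inr (v, Suc j)) 1)"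
abbreviation "hghost v j \<equiv> H.gen (Ghost (Inr (v, Suc j)) 1)"

fun hpath :: "'v \<times> nat \<Rightarrow> (('v \<times> nat, 'e + 'v \<times> nat) gen list \<Rightarrow> 'k) set" where
  "hpath (v, 0) = H.vert (v, 0)"
| "hpath (v, Suc j) = hedge v j \<star> hpath (v, j)"

fun hpath' :: "'v \<times> nat \<Rightarrow> (('v \<times> nat, 'e + 'v \<times> nat) gen list \<Rightarrow> 'k) set" where
  "hpath' (v, 0) = H.vert (v, 0)"
| "hpath' (v, Suc j) = hpath' (v, j) \<star> hghost v j"

lemma hair_edge:
  assumes "(v, Suc j) \<in> verts E'"
  shows "hedge v j \<in> carrier H.L" "hghost v j \<in> carrier H.L"
    "H.vert (v, Suc j) \<in> carrier H.L" "H.vert (v, j) \<in> carrier H.L" "(v, j) \<in> verts E'"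
    "hedge v j \<star> hghost v j = H.vert (v, Suc j)"
    "hghost v j \<star> hedge v j = H.vert (v, j)"
    "H.vert (v, Suc j) \<star> hedge v j = hedge v j"
    "hedge v j \<star> H.vert (v, j) = hedge v j"
    "H.vert (v, j) \<star> hghost v j = hghost v j"
    "hghost v j \<star> H.vert (v, Suc j) = hghost v j"
proof -
  note D = wlpa_familyD[OF H.wlpa_family_gen]
  have a: "Inr (v, Suc j) \<in> arcs E'" using assms by simp
  show c: "hedge v j \<in> carrier H.L" "hghost v j \<in> carrier H.L"
    "H.vert (v, Suc j) \<in> carrier H.L" "H.vert (v, j) \<in> carrier H.L" "(v, j) \<in> verts E'"
    using assms by (auto intro!: H.gen_closed)
  note o = hair_out_arcs(2)[OF zero_less_Suc assms] hair_vertex_weight(2)[OF zero_less_Suc assms]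
  have r: "(v, Suc j) \<in> regular_verts E'" using assms hair_regular(2)[of "Suc j" v] by simp
  show "hedge v j \<star> hghost v j = H.vert (v, Suc j)"
    using D(7)[OF r, of 1 1] c unfolding o by (simp add: B.M.finsum_insert)
  show "hghost v j \<star> hedge v j = H.vert (v, j)"
    using D(8)[OF r, of "Inr (v, Suc j)" "Inr (v, Suc j)"] c unfolding o by (simp add: B.M.finsum_insert)
  show "H.vert (v, Suc j) \<star> hedge v j = hedge v j"
    "hedge v j \<star> H.vert (v, j) = hedge v j"
    "H.vert (v, j) \<star> hghost v j = hghost v j"
    "hghost v j \<star> H.vert (v, Suc j) = hghost v j"
    using D(3-6)[OF a, of 1] by simp_all
qed

text \<open>At a hair vertex both matrix relations have a single term, so the edge and its ghost are
  mutually inverse between the idempotents of its ends; products of such pairs telescope.\<close>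

lemma hpath_props:
  assumes "(v, j) \<in> verts E'"
  shows "hpath (v, j) \<in> carrier H.L \<and> hpath' (v, j) \<in> carrier H.L
    \<and> H.vert (v, j) \<star> hpath (v, j) = hpath (v, j) \<and> hpath (v, j) \<star> H.vert (v, 0) = hpath (v, j)
    \<and> hpath' (v, j) \<star> H.vert (v, j) = hpath' (v, j) \<and> H.vert (v, 0) \<star> hpath' (v, j) = hpath' (v, j)
    \<and> hpath (v, j) \<star> hpath' (v, j) = H.vert (v, j) \<and> hpath' (v, j) \<star> hpath (v, j) = H.vert (v, 0)"
  using assms
proof (induction j)
  case 0
  then show ?case using wlpa_familyD(1,2)[OF H.wlpa_family_gen] by simp
next
  case (Suc j)
  let ?q = "hedge v j" and ?q' = "hghost v j"
  note e = hair_edge[OF Suc.prems]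
  have z: "H.vert (v, 0) \<in> carrier H.L" using Suc.prems by (auto intro!: H.gen_closed)
  note IH = Suc.IH[OF e(5)]
  have p: "hpath (v, j) \<in> carrier H.L" "hpath' (v, j) \<in> carrier H.L" using IH by auto
  have 1: "(?q \<star> hpath (v, j)) \<star> (hpath' (v, j) \<star> ?q') = ?q \<star> (hpath (v, j) \<star> hpath' (v, j)) \<star> ?q'"
    using e(1-4) p by (simp only: B.B.m_assoc B.B.m_closed)
  have 2: "(hpath' (v, j) \<star> ?q') \<star> (?q \<star> hpath (v, j)) = hpath' (v, j) \<star> (?q' \<star> ?q) \<star> hpath (v, j)"
    using e(1-4) p by (simp only: B.B.m_assoc B.B.m_closed)
  have V0: "hpath (v, j) \<star> H.vert (v, 0) = hpath (v, j)" "H.vert (v, 0) \<star> hpath' (v, j) = hpath' (v, j)"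
    using IH by blast+
  have 3: "H.vert (v, Suc j) \<star> (?q \<star> hpath (v, j)) = ?q \<star> hpath (v, j)"
    using B.B.m_assoc[OF e(3,1) p(1)] by (simp only: e(8))
  have 4: "(?q \<star> hpath (v, j)) \<star> H.vert (v, 0) = ?q \<star> hpath (v, j)"
    using B.B.m_assoc[OF e(1) p(1) z] by (simp only: V0)
  have 5: "(hpath' (v, j) \<star> ?q') \<star> H.vert (v, Suc j) = hpath' (v, j) \<star> ?q'"
    using B.B.m_assoc[OF p(2) e(2,3)] by (simp only: e(11))
  have 6: "H.vert (v, 0) \<star> (hpath' (v, j) \<star> ?q') = hpath' (v, j) \<star> ?q'"
    using B.B.m_assoc[OF z p(2) e(2)] by (simp only: V0)
  have 7: "(?q \<star> hpath (v, j)) \<star> (hpath' (v, j) \<star> ?q') = H.vert (v, Suc j)"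
  proof -
    have "hpath (v, j) \<star> hpath' (v, j) = H.vert (v, j)" using IH by blast
    then show ?thesis unfolding 1 by (simp only: e(9,6))
  qed
  have 8: "(hpath' (v, j) \<star> ?q') \<star> (?q \<star> hpath (v, j)) = H.vert (v, 0)"
  proof -
    have "hpath' (v, j) \<star> H.vert (v, j) = hpath' (v, j)"
      "hpath' (v, j) \<star> hpath (v, j) = H.vert (v, 0)" using IH by blast+
    then show ?thesis unfolding 2 by (simp only: e(7))
  qed
  show ?case
    unfolding hpath.simps hpath'.simps
    by (intro conjI 3 4 5 6 7 8 B.B.m_closed e(1,2) p)
qed

end

section \<open>A representation of the hair extension by matrices over L\<close>

section \<open>The inclusion into a hair extension is injective\<close>

text \<open>Rows over L as a vector space over K. Matrices are realised as operators on rows, since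
  \<open>endo_alg\<close> is already known to be an algebra and its reversed product matches matrix
  multiplication from the right.\<close>

definition rows :: "('k, 'a, 'm) module_scheme \<Rightarrow> 'j set \<Rightarrow> ('k, 'j \<Rightarrow> 'a) module" where
  "rows B J = \<lparr>carrier = carrier (fsupp B J), mult = undefined, one = undefined,
     zero = zero (fsupp B J), add = add (fsupp B J), smult = (\<lambda>c f j. c \<odot>\<^bsub>B\<^esub> f j)\<rparr>"

lemma rows_simps:
  "carrier (rows B J) = carrier (fsupp B J)" "\<zero>\<^bsub>rows B J\<^esub> = (\<lambda>_. \<zero>\<^bsub>B\<^esub>)"
  "(f \<oplus>\<^bsub>rows B J\<^esub> g) = (\<lambda>j. f j \<oplus>\<^bsub>B\<^esub> g j)" "(c \<odot>\<^bsub>rows B J\<^esub> f) = (\<lambda>j. c \<odot>\<^bsub>B\<^esub> f j)"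
  by (simp_all add: rows_def fsupp_simps)

text \<open>Right multiplication of a row by the matrix with the single entry c in row a and column
  b.\<close>

definition unit_map :: "('k, 'a, 'm) module_scheme \<Rightarrow> 'j set \<Rightarrow> 'j \<Rightarrow> 'a \<Rightarrow> 'j \<Rightarrow> ('j \<Rightarrow> 'a) \<Rightarrow> ('j \<Rightarrow> 'a)" where
  "unit_map B J a c b = (\<lambda>z\<in>carrier (rows B J). single B b (z a \<otimes>\<^bsub>B\<^esub> c))"

context algebra_over
begin

lemma rows_module: "module K (rows B J)"
proof -
  interpret F: rmodule B "fsupp B J" by (rule fsupp_rmodule) (rule B.ring_axioms)
  have cl: "f j \<in> carrier B" if "f \<in> carrier (fsupp B J)" for f j using that by (simp add: fsupp_simps(4))
  have smult: "(\<lambda>j. c \<odot>\<^bsub>B\<^esub> f j) \<in> carrier (fsupp B J)" if "c \<in> carrier K" "f \<in> carrier (fsupp B J)" for c f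
  proof -
    have "supp B (\<lambda>j. c \<odot>\<^bsub>B\<^esub> f j) \<subseteq> supp B f" using that by (auto simp: supp_def)
    then show ?thesis using that finite_subset[of "supp B (\<lambda>j. c \<odot>\<^bsub>B\<^esub> f j)" "supp B f"] by (auto simp: fsupp_simps(4))
  qed
  have ag: "abelian_group (rows B J)"
  proof (rule abelian_groupI)
    show "\<exists>g\<in>carrier (rows B J). g \<oplus>\<^bsub>rows B J\<^esub> f = \<zero>\<^bsub>rows B J\<^esub>" if "f \<in> carrier (rows B J)" for f
      using F.M.l_neg[of f] F.M.a_inv_closed[of f] that by (auto simp: rows_def)
  qed (simp_all add: rows_def F.M.a_ac)
  show ?thesis
    by (rule moduleI[OF R.is_cring ag])
      (simp_all only: rows_simps smult, simp_all add: cl smult_l_distr smult_r_distr smult_assoc1)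
qed

abbreviation "ER J \<equiv> endo_alg K (rows B J)"

lemma row_apply: "z \<in> carrier (rows B J) \<Longrightarrow> z j \<in> carrier B"
  by (simp add: rows_simps fsupp_simps(4))

lemma single_row: "c \<in> carrier B \<Longrightarrow> b \<in> J \<Longrightarrow> single B b c \<in> carrier (rows B J)"
  unfolding rows_simps by (rule B.single_closed)

lemma unit_map_endo:
  assumes "c \<in> carrier B" "b \<in> J"
  shows "unit_map B J a c b \<in> carrier (ER J)"
  unfolding unit_map_def
proof (rule endo_algI[OF _ _ _ rows_module])
  show "single B b (z a \<otimes>\<^bsub>B\<^esub> c) \<in> carrier (rows B J)" if "z \<in> carrier (rows B J)" for z
    using row_apply[OF that] assms by (intro single_row) auto
  show "single B b ((y \<oplus>\<^bsub>rows B J\<^esub> z) a \<otimes>\<^bsub>B\<^esub> c) = single B b (y a \<otimes>\<^bsub>B\<^esub> c) \<oplus>\<^bsub>rows B J\<^esub> single B b (z a \<otimes>\<^bsub>B\<^esub> c)"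
    if "y \<in> carrier (rows B J)" "z \<in> carrier (rows B J)" for y z
    using row_apply[OF that(1)] row_apply[OF that(2)] assms by (auto simp: rows_simps single_def B.l_distr)
  show "single B b ((k \<odot>\<^bsub>rows B J\<^esub> z) a \<otimes>\<^bsub>B\<^esub> c) = k \<odot>\<^bsub>rows B J\<^esub> single B b (z a \<otimes>\<^bsub>B\<^esub> c)"
    if "k \<in> carrier K" "z \<in> carrier (rows B J)" for k z
    using row_apply[OF that(2)] that(1) assms by (auto simp: rows_simps single_def smult_mult_left)
qed

lemma unit_map_apply: "z \<in> carrier (rows B J) \<Longrightarrow> unit_map B J a c b z = single B b (z a \<otimes>\<^bsub>B\<^esub> c)"
  by (simp add: unit_map_def)

lemma unit_map_mult:
  assumes "c \<in> carrier B" "c' \<in> carrier B" "b \<in> J" "b' \<in> J"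
  shows "unit_map B J a c b \<otimes>\<^bsub>ER J\<^esub> unit_map B J a' c' b' = (if b = a' then unit_map B J a (c \<otimes>\<^bsub>B\<^esub> c') b' else \<zero>\<^bsub>ER J\<^esub>)"
proof -
  interpret E: algebra_over K "ER J" by (rule endo_algebra_over) (rule rows_module)
  show ?thesis
  proof (rule endo_alg_eqI[of _ K "rows B J"])
    fix z assume z: "z \<in> carrier (rows B J)"
    then show "(unit_map B J a c b \<otimes>\<^bsub>ER J\<^esub> unit_map B J a' c' b') z = (if b = a' then unit_map B J a (c \<otimes>\<^bsub>B\<^esub> c') b' else \<zero>\<^bsub>ER J\<^esub>) z"
      using row_apply[OF z] assms single_row[of "z a \<otimes>\<^bsub>B\<^esub> c" b J]
      by (auto simp: endo_alg_simps unit_map_apply B.m_assoc single_def rows_simps(2) fun_eq_iff)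
  qed (use assms in \<open>auto intro!: E.B.m_closed E.M.a_closed unit_map_endo\<close>)
qed

lemma unit_map_add:
  assumes "c \<in> carrier B" "c' \<in> carrier B" "b \<in> J"
  shows "unit_map B J a (c \<oplus>\<^bsub>B\<^esub> c') b = unit_map B J a c b \<oplus>\<^bsub>ER J\<^esub> unit_map B J a c' b"
proof -
  interpret E: algebra_over K "ER J" by (rule endo_algebra_over) (rule rows_module)
  show ?thesis
  proof (rule endo_alg_eqI[of _ K "rows B J"])
    fix z assume z: "z \<in> carrier (rows B J)"
    then show "unit_map B J a (c \<oplus>\<^bsub>B\<^esub> c') b z = (unit_map B J a c b \<oplus>\<^bsub>ER J\<^esub> unit_map B J a c' b) z"
      using row_apply[OF z] assms by (auto simp: endo_alg_simps unit_map_apply single_def rows_simps(3) B.r_distr fun_eq_iff)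
  qed (use assms in \<open>auto intro!: E.B.m_closed E.M.a_closed unit_map_endo\<close>)
qed

lemma unit_map_finsum:
  assumes "\<And>i. i \<in> S \<Longrightarrow> f i \<in> carrier B" "b \<in> J"
  shows "(\<Oplus>\<^bsub>ER J\<^esub>i\<in>S. unit_map B J a (f i) b) = unit_map B J a (finsum B f S) b"
proof -
  interpret E: algebra_over K "ER J" by (rule endo_algebra_over) (rule rows_module)
  show ?thesis
    by (rule additive_finsum[of B "ER J" "\<lambda>c. unit_map B J a c b", symmetric])
      (use assms unit_map_endo unit_map_add in \<open>auto simp: M.abelian_group_axioms E.M.abelian_group_axioms\<close>)
qed

lemma unit_map_zero: "b \<in> J \<Longrightarrow> unit_map B J a \<zero>\<^bsub>B\<^esub> b = \<zero>\<^bsub>ER J\<^esub>"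
proof -
  interpret E: algebra_over K "ER J" by (rule endo_algebra_over) (rule rows_module)
  show "b \<in> J \<Longrightarrow> ?thesis" using unit_map_finsum[of "{}" undefined b J a] by simp
qed

end

context hair
begin

interpretation A: algebra_over K L by (rule wlpa_algebra)
interpretation B: algebra_over K H.L by (rule H.wlpa_algebra)

abbreviation "J \<equiv> verts E'"
abbreviation "EJ \<equiv> endo_alg K (rows L J)"

interpretation EJ: algebra_over K EJ by (rule endo_algebra_over) (rule A.rows_module)

text \<open>The entry of the matrix that represents a generator. A hair edge over v moves between
  two copies of v and becomes the matrix unit with entry v, and so does its ghost.\<close>

definition coeff :: "('v \<times> nat, 'e + 'v \<times> nat) gen \<Rightarrow> (('v, 'e) gen list \<Rightarrow> 'k) set" where
  "coeff g = (case g of Vert a \<Rightarrow> vert (fst a)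
     | Edge (Inl e) i \<Rightarrow> gen (Edge e i) | Edge (Inr a) i \<Rightarrow> vert (fst a)
     | Ghost (Inl e) i \<Rightarrow> gen (Ghost e i) | Ghost (Inr a) i \<Rightarrow> vert (fst a))"

lemma coeff_simps [simp]:
  "coeff (Vert (v, j)) = vert v"
  "coeff (Edge (Inl e) i) = gen (Edge e i)" "coeff (Edge (Inr (v, j)) i) = vert v"
  "coeff (Ghost (Inl e) i) = gen (Ghost e i)" "coeff (Ghost (Inr (v, j)) i) = vert v"
  by (simp_all add: coeff_def)

definition row_rep :: "('v \<times> nat, 'e + 'v \<times> nat) gen \<Rightarrow> ('v \<times> nat \<Rightarrow> (('v, 'e) gen list \<Rightarrow> 'k) set) \<Rightarrow> 'v \<times> nat \<Rightarrow> (('v, 'e) gen list \<Rightarrow> 'k) set" where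
  "row_rep g = unit_map L J (H.gsource g) (coeff g) (H.gtarget g)"

lemma coeff_closed: "g \<in> H.X \<Longrightarrow> coeff g \<in> carrier L"
proof (cases g)
  case (Vert a)
  then show "g \<in> H.X \<Longrightarrow> ?thesis" by (cases a) (auto intro!: gen_closed)
next
  case (Edge e i)
  then show "g \<in> H.X \<Longrightarrow> ?thesis" by (cases e) (auto intro!: gen_closed)
next
  case (Ghost e i)
  then show "g \<in> H.X \<Longrightarrow> ?thesis" by (cases e) (auto intro!: gen_closed)
qed

lemma row_rep_closed: "g \<in> H.X \<Longrightarrow> row_rep g \<in> carrier EJ"
  unfolding row_rep_def by (intro A.unit_map_endo coeff_closed H.gen_verts)

lemma row_rep_mult:
  assumes "g \<in> H.X" "g' \<in> H.X"
  shows "row_rep g \<otimes>\<^bsub>EJ\<^esub> row_rep g' = (if H.gtarget g = H.gsource g' then unit_map L J (H.gsource g) (coeff g \<cdot> coeff g') (H.gtarget g') else \<zero>\<^bsub>EJ\<^esub>)"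
  unfolding row_rep_def using assms by (intro A.unit_map_mult coeff_closed H.gen_verts)

text \<open>Every generator acts by a matrix with one entry, placed at its source and target. Each
  relation thus reduces to a relation of L between the entries; at a hair vertex it is just that v
  is idempotent.\<close>

lemma row_rep_family: "wlpa_family E' w' EJ row_rep"
proof -
  note D = wlpa_familyD[OF wlpa_family_gen]
  have vv: "row_rep (Vert a) \<otimes>\<^bsub>EJ\<^esub> row_rep (Vert b) = (if a = b then row_rep (Vert a) else \<zero>\<^bsub>EJ\<^esub>)"
    if "a \<in> J" "b \<in> J" for a b
  proof (cases a; cases b)
    fix u i v j assume ab: "a = (u, i)" "b = (v, j)"
    then have "u \<in> verts E" using that by simp
    then show ?thesis
      using row_rep_mult[of "Vert a" "Vert b"] that ab D(2)[of u u] by (auto simp: H.gsource_def H.gtarget_def row_rep_def)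
  qed
  have edges: "row_rep (Vert (tail E' a)) \<otimes>\<^bsub>EJ\<^esub> row_rep (Edge a i) = row_rep (Edge a i)
      \<and> row_rep (Edge a i) \<otimes>\<^bsub>EJ\<^esub> row_rep (Vert (head E' a)) = row_rep (Edge a i)
      \<and> row_rep (Vert (head E' a)) \<otimes>\<^bsub>EJ\<^esub> row_rep (Ghost a i) = row_rep (Ghost a i)
      \<and> row_rep (Ghost a i) \<otimes>\<^bsub>EJ\<^esub> row_rep (Vert (tail E' a)) = row_rep (Ghost a i)"
    if a: "a \<in> arcs E'" "i \<in> {1..w' a}" for a i
  proof -
    have X: "Vert (tail E' a) \<in> H.X" "Vert (head E' a) \<in> H.X" "Edge a i \<in> H.X" "Ghost a i \<in> H.X" using a by simp_all
    have "coeff (Vert (tail E' a)) \<cdot> coeff (Edge a i) = coeff (Edge a i)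
      \<and> coeff (Edge a i) \<cdot> coeff (Vert (head E' a)) = coeff (Edge a i)
      \<and> coeff (Vert (head E' a)) \<cdot> coeff (Ghost a i) = coeff (Ghost a i)
      \<and> coeff (Ghost a i) \<cdot> coeff (Vert (tail E' a)) = coeff (Ghost a i)"
    proof (cases a)
      case (Inl e)
      then show ?thesis using D(3-6)[of e i] a by simp
    next
      case (Inr z)
      obtain v j where "z = (v, j)" by (cases z)
      then show ?thesis using D(2)[of v v] a Inr by simp
    qed
    then show ?thesis
      using row_rep_mult[OF X(1,3)] row_rep_mult[OF X(3,2)] row_rep_mult[OF X(2,4)] row_rep_mult[OF X(4,1)]
      by (simp add: H.gsource_def H.gtarget_def row_rep_def)
  qed
  have iii: "(\<Oplus>\<^bsub>EJ\<^esub>e\<in>out_arcs E' a. row_rep (Edge e i) \<otimes>\<^bsub>EJ\<^esub> row_rep (Ghost e j)) = (if i = j then row_rep (Vert a) else \<zero>\<^bsub>EJ\<^esub>)"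
    if a: "a \<in> regular_verts E'" and ij: "i \<in> {1..vertex_weight E' w' a}" "j \<in> {1..vertex_weight E' w' a}" for a i j
  proof -
    have aJ: "a \<in> J" using H.regular_vertsD(1)[OF a] .
    have e: "Edge e i \<in> H.X" "Ghost e j \<in> H.X" "tail E' e = a" if "e \<in> out_arcs E' a" for e
      using H.regular_vertsD(4)[OF a that] ij by simp_all
    have cc: "coeff (Edge e i) \<cdot> coeff (Ghost e j) \<in> carrier L" if "e \<in> out_arcs E' a" for e
      using coeff_closed[OF e(1)[OF that]] coeff_closed[OF e(2)[OF that]] by simp
    have "(\<Oplus>\<^bsub>EJ\<^esub>e\<in>out_arcs E' a. row_rep (Edge e i) \<otimes>\<^bsub>EJ\<^esub> row_rep (Ghost e j))
      = (\<Oplus>\<^bsub>EJ\<^esub>e\<in>out_arcs E' a. unit_map L J a (coeff (Edge e i) \<cdot> coeff (Ghost e j)) a)"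
    proof (intro EJ.M.finsum_cong' refl funcsetI)
      fix e assume e': "e \<in> out_arcs E' a"
      show "row_rep (Edge e i) \<otimes>\<^bsub>EJ\<^esub> row_rep (Ghost e j) = unit_map L J a (coeff (Edge e i) \<cdot> coeff (Ghost e j)) a"
        using row_rep_mult[OF e(1,2)[OF e']] e(3)[OF e'] by (simp add: H.gsource_def H.gtarget_def)
      show "unit_map L J a (coeff (Edge e i) \<cdot> coeff (Ghost e j)) a \<in> carrier EJ"
        by (rule A.unit_map_endo[OF cc[OF e'] aJ])
    qed
    also have "\<dots> = unit_map L J a (\<Oplus>\<^bsub>L\<^esub>e\<in>out_arcs E' a. coeff (Edge e i) \<cdot> coeff (Ghost e j)) a"
      by (rule A.unit_map_finsum[OF cc aJ])
    also have "(\<Oplus>\<^bsub>L\<^esub>e\<in>out_arcs E' a. coeff (Edge e i) \<cdot> coeff (Ghost e j)) = (if i = j then coeff (Vert a) else \<zero>\<^bsub>L\<^esub>)"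
    proof (cases a)
      case (Pair v k)
      show ?thesis
      proof (cases "k = 0")
        case True
        have v: "v \<in> reg" using a unfolding Pair True hair_regular(1) .
        have ij': "i \<in> {1..wt v}" "j \<in> {1..wt v}" using ij unfolding Pair True hair_vertex_weight(1) .
        have "(\<Oplus>\<^bsub>L\<^esub>e\<in>Inl ` out_arcs E v. coeff (Edge e i) \<cdot> coeff (Ghost e j)) = (\<Oplus>\<^bsub>L\<^esub>e\<in>out_arcs E v. coeff (Edge (Inl e) i) \<cdot> coeff (Ghost (Inl e) j))"
          using cc unfolding Pair True hair_out_arcs(1) by (intro A.M.finsum_reindex) (auto simp del: coeff_simps)
        then show ?thesis using D(7)[OF v ij'] unfolding Pair True hair_out_arcs(1) by simp
      next
        case False
        then have k: "0 < k" by simp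
        have vk: "(v, k) \<in> J" "v \<in> verts E" using aJ Pair by auto
        have "i = 1" "j = 1" using ij unfolding Pair hair_vertex_weight(2)[OF k vk(1)] by simp_all
        then show ?thesis using D(1)[of "Vert v"] D(2)[of v v] vk unfolding Pair hair_out_arcs(2)[OF k vk(1)] by (simp add: A.M.finsum_insert)
      qed
    qed
    also have "unit_map L J a (if i = j then coeff (Vert a) else \<zero>\<^bsub>L\<^esub>) a = (if i = j then row_rep (Vert a) else \<zero>\<^bsub>EJ\<^esub>)"
      using A.unit_map_zero[OF aJ] by (simp add: row_rep_def H.gsource_def H.gtarget_def)
    finally show ?thesis .
  qed
  have iv: "(\<Oplus>\<^bsub>EJ\<^esub>i\<in>{1..vertex_weight E' w' a}. row_rep (Ghost e i) \<otimes>\<^bsub>EJ\<^esub> row_rep (Edge f i)) = (if e = f then row_rep (Vert (head E' e)) else \<zero>\<^bsub>EJ\<^esub>)"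
    if a: "a \<in> regular_verts E'" and ef: "e \<in> out_arcs E' a" "f \<in> out_arcs E' a" for a e f
  proof -
    have e: "Ghost e i \<in> H.X" "Edge f i \<in> H.X" if "i \<in> {1..vertex_weight E' w' a}" for i
      using H.regular_vertsD(4)[OF a ef(1)] H.regular_vertsD(4)[OF a ef(2)] that by simp_all
    have t: "tail E' e = a" "tail E' f = a" "head E' f \<in> J"
      using H.regular_vertsD(4)[OF a ef(1)] H.regular_vertsD(4)[OF a ef(2)] by simp_all
    have cc: "coeff (Ghost e i) \<cdot> coeff (Edge f i) \<in> carrier L" if "i \<in> {1..vertex_weight E' w' a}" for i
      using coeff_closed[OF e(1)[OF that]] coeff_closed[OF e(2)[OF that]] by simp
    have "(\<Oplus>\<^bsub>EJ\<^esub>i\<in>{1..vertex_weight E' w' a}. row_rep (Ghost e i) \<otimes>\<^bsub>EJ\<^esub> row_rep (Edge f i))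
      = (\<Oplus>\<^bsub>EJ\<^esub>i\<in>{1..vertex_weight E' w' a}. unit_map L J (head E' e) (coeff (Ghost e i) \<cdot> coeff (Edge f i)) (head E' f))"
    proof (intro EJ.M.finsum_cong' refl funcsetI)
      fix i assume i: "i \<in> {1..vertex_weight E' w' a}"
      show "row_rep (Ghost e i) \<otimes>\<^bsub>EJ\<^esub> row_rep (Edge f i) = unit_map L J (head E' e) (coeff (Ghost e i) \<cdot> coeff (Edge f i)) (head E' f)"
        using row_rep_mult[OF e[OF i]] t by (simp add: H.gsource_def H.gtarget_def)
      show "unit_map L J (head E' e) (coeff (Ghost e i) \<cdot> coeff (Edge f i)) (head E' f) \<in> carrier EJ"
        by (rule A.unit_map_endo[OF cc[OF i] t(3)])
    qed
    also have "\<dots> = unit_map L J (head E' e) (\<Oplus>\<^bsub>L\<^esub>i\<in>{1..vertex_weight E' w' a}. coeff (Ghost e i) \<cdot> coeff (Edge f i)) (head E' f)"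
      by (rule A.unit_map_finsum[OF cc t(3)])
    also have "(\<Oplus>\<^bsub>L\<^esub>i\<in>{1..vertex_weight E' w' a}. coeff (Ghost e i) \<cdot> coeff (Edge f i)) = (if e = f then coeff (Vert (head E' e)) else \<zero>\<^bsub>L\<^esub>)"
    proof (cases a)
      case (Pair v k)
      show ?thesis
      proof (cases "k = 0")
        case True
        have v: "v \<in> reg" using a unfolding Pair True hair_regular(1) .
        obtain e0 f0 where "e = Inl e0" "e0 \<in> out_arcs E v" "f = Inl f0" "f0 \<in> out_arcs E v"
          using ef unfolding Pair True hair_out_arcs(1) by (elim imageE)
        then show ?thesis using D(8)[OF v, of e0 f0] unfolding Pair True hair_vertex_weight(1) by simp
      next
        case False
        then have k: "0 < k" by simp
        have vk: "(v, k) \<in> J" "v \<in> verts E" using H.regular_vertsD(1)[OF a] Pair by auto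
        have "e = Inr (v, k)" "f = Inr (v, k)" using ef unfolding Pair hair_out_arcs(2)[OF k vk(1)] by simp_all
        then show ?thesis using D(1)[of "Vert v"] D(2)[of v v] vk unfolding Pair hair_vertex_weight(2)[OF k vk(1)] by (simp add: A.M.finsum_insert)
      qed
    qed
    also have "unit_map L J (head E' e) (if e = f then coeff (Vert (head E' e)) else \<zero>\<^bsub>L\<^esub>) (head E' f) = (if e = f then row_rep (Vert (head E' e)) else \<zero>\<^bsub>EJ\<^esub>)"
      using A.unit_map_zero[OF t(3)] by (simp add: row_rep_def H.gsource_def H.gtarget_def)
    finally show ?thesis .
  qed
  show ?thesis unfolding wlpa_family_def using vv edges iii iv row_rep_closed by blast
qed

text \<open>The row of z, cut into its vertex components and placed at height 0. On rows of this
  form, elements coming from L act by right multiplication on z.\<close>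

definition top_row :: "(('v, 'e) gen list \<Rightarrow> 'k) set \<Rightarrow> 'v \<times> nat \<Rightarrow> (('v, 'e) gen list \<Rightarrow> 'k) set" where
  "top_row z = (\<lambda>(v, j). if j = 0 \<and> v \<in> verts E then z \<cdot> vert v else \<zero>\<^bsub>L\<^esub>)"

lemma top_row_closed: "z \<in> carrier L \<Longrightarrow> top_row z \<in> carrier (rows L J)"
proof -
  assume z: "z \<in> carrier L"
  have s: "supp L (top_row z) \<subseteq> J" by (auto simp: supp_def top_row_def split: if_splits)
  moreover have "top_row z a \<in> carrier L" for a using z by (cases a) (auto simp: top_row_def intro!: A.B.m_closed gen_closed)
  ultimately show ?thesis using finite_subset[OF s hair_finite(1)] by (simp add: rows_simps(1) fsupp_simps(4))
qed

lemma row_rep_top_row: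
  assumes g: "g \<in> X" and z: "z \<in> carrier L"
  shows "row_rep (map_gen (\<lambda>v. (v, 0)) Inl g) (top_row z) = top_row (z \<cdot> gen g)"
proof -
  note c = gen_closed[OF g] gen_verts[OF g]
  have p: "vert v \<in> carrier L" if "v \<in> verts E" for v using that by (auto intro!: gen_closed)
  have m: "H.gsource (map_gen (\<lambda>v. (v, 0)) Inl g) = (gsource g, 0)" "H.gtarget (map_gen (\<lambda>v. (v, 0)) Inl g) = (gtarget g, 0)"
    "coeff (map_gen (\<lambda>v. (v, 0)) Inl g) = gen g"
    by (cases g; simp add: H.gsource_def H.gtarget_def gsource_def gtarget_def)+
  have "top_row z (gsource g, 0) \<cdot> gen g = z \<cdot> gen g"
    using c p z vert_gen(1)[OF c(2) g] by (simp add: top_row_def A.B.m_assoc)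
  then have "row_rep (map_gen (\<lambda>v. (v, 0)) Inl g) (top_row z) = single L (gtarget g, 0) (z \<cdot> gen g)"
    unfolding row_rep_def m by (simp add: A.unit_map_apply[OF top_row_closed[OF z]])
  also have "\<dots> = top_row (z \<cdot> gen g)"
  proof
    fix a show "single L (gtarget g, 0) (z \<cdot> gen g) a = top_row (z \<cdot> gen g) a"
    proof (cases a)
      case (Pair v j)
      have "z \<cdot> gen g \<cdot> vert v = (if v = gtarget g then z \<cdot> gen g else \<zero>\<^bsub>L\<^esub>)" if v: "v \<in> verts E"
        using A.B.m_assoc[OF z c(1) p[OF v]] vert_gen(2)[OF v g] z by simp
      then show ?thesis using c(3) Pair by (auto simp: top_row_def single_def)
    qed
  qed
  finally show ?thesis .
qed

text \<open>The image of a, represented on rows and applied to the row of 1, gives the row of a,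
  from which a is recovered.\<close>

theorem incl_inj: "inj_on incl (carrier L)"
proof -
  obtain \<Phi> where \<Phi>: "alg_hom K H.L EJ \<Phi>" "\<And>g. g \<in> H.X \<Longrightarrow> \<Phi> (H.gen g) = row_rep g"
    using H.wlpa_universal[OF EJ.algebra_over_axioms row_rep_family] by blast
  note i = alg_homD[OF incl_hom] and f = alg_homD[OF \<Phi>(1)]
  interpret R: module K "rows L J" by (rule A.rows_module)
  have tadd: "top_row (y \<oplus>\<^bsub>L\<^esub> z) = top_row y \<oplus>\<^bsub>rows L J\<^esub> top_row z" if "y \<in> carrier L" "z \<in> carrier L" for y z
    using that by (auto simp: top_row_def rows_simps fun_eq_iff A.B.l_distr gen_closed)
  have tsmult: "top_row (c \<odot>\<^bsub>L\<^esub> z) = c \<odot>\<^bsub>rows L J\<^esub> top_row z" if "c \<in> carrier K" "z \<in> carrier L" for c z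
    using that rmodule.act_zero_right[OF module_imp_rmodule[OF A.module_axioms]]
    by (auto simp: top_row_def rows_simps fun_eq_iff A.smult_mult_left gen_closed)
  have key: "\<Phi> (incl a) (top_row z) = top_row (z \<cdot> a)" if "a \<in> carrier L" "z \<in> carrier L" for a z
    using that
  proof (induction arbitrary: z rule: wlpa_induct)
    case (gen g)
    then show ?case using row_rep_top_row by (simp add: incl_gen \<Phi>(2) map_gen_closed)
  next
    case zero
    have "incl \<zero>\<^bsub>L\<^esub> = \<zero>\<^bsub>H.L\<^esub>"
      using i(1,2) by (intro additive_zero[OF A.M.abelian_group_axioms B.M.abelian_group_axioms]) auto
    moreover have "\<Phi> \<zero>\<^bsub>H.L\<^esub> = \<zero>\<^bsub>EJ\<^esub>"
      using f(1,2) by (intro additive_zero[OF B.M.abelian_group_axioms EJ.M.abelian_group_axioms]) auto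
    moreover have "top_row \<zero>\<^bsub>L\<^esub> = \<zero>\<^bsub>rows L J\<^esub>" by (auto simp: top_row_def rows_simps(2) fun_eq_iff gen_closed)
    ultimately show ?case using top_row_closed[OF zero] zero by (simp add: endo_alg_simps)
  next
    case (add a b)
    then show ?case using i f by (simp add: endo_alg_simps top_row_closed tadd A.B.r_distr)
  next
    case (mult a b)
    then show ?case using i f by (simp add: endo_alg_simps top_row_closed A.B.m_assoc)
  next
    case (smult c a)
    then show ?case using i f by (simp add: endo_alg_simps top_row_closed tsmult A.smult_mult_right)
  qed
  show ?thesis
  proof (rule inj_onI)
    fix a b assume ab: "a \<in> carrier L" "b \<in> carrier L" "incl a = incl b"
    have T: "top_row a = top_row b" using key[OF ab(1), of "\<one>\<^bsub>L\<^esub>"] key[OF ab(2), of "\<one>\<^bsub>L\<^esub>"] ab by simp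
    have eq: "a \<cdot> vert v = b \<cdot> vert v" if "v \<in> verts E" for v
      using that fun_cong[OF T, of "(v, 0)"] by (simp add: top_row_def)
    \<comment> \<open>The row only shows the components \<open>c \<cdot> vert v\<close>; their sum
      is c because the vertices add up to 1.\<close>
    have "c = (\<Oplus>\<^bsub>L\<^esub>v\<in>verts E. c \<cdot> vert v)" if "c \<in> carrier L" for c
      using A.B.finsum_rdistr[of "verts E" c vert] that by (simp add: wlpa_one[symmetric] gen_closed Pi_def)
    from this[OF ab(1)] this[OF ab(2)] show "a = b"
      using eq A.M.finsum_cong'[of "verts E" "verts E" "\<lambda>v. b \<cdot> vert v" "\<lambda>v. a \<cdot> vert v"] ab(2)
      by (simp add: gen_closed Pi_def)
  qed
qed

end

section \<open>Compression to L along the hairs, and the isomorphism\<close>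

section \<open>Proof of the main theorem\<close>

context hair
begin

interpretation A: algebra_over K L by (rule wlpa_algebra)
interpretation B: algebra_over K H.L by (rule H.wlpa_algebra)

lemma hpath:
  assumes "a \<in> J"
  shows "hpath a \<in> carrier H.L" "hpath' a \<in> carrier H.L"
    "H.vert a \<star> hpath a = hpath a" "hpath a \<star> H.vert (fst a, 0) = hpath a"
    "hpath' a \<star> H.vert a = hpath' a" "H.vert (fst a, 0) \<star> hpath' a = hpath' a"
    "hpath a \<star> hpath' a = H.vert a" "hpath' a \<star> hpath a = H.vert (fst a, 0)"
    "H.vert a \<in> carrier H.L"
  using hpath_props[of "fst a" "snd a"] assms H.gen_closed[of "Vert a"] by simp_all

text \<open>Paths from different hair vertices begin at orthogonal idempotents, even when they end
  at the same vertex of E.\<close>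

lemma hpath_orth:
  assumes "a \<in> J" "b \<in> J"
  shows "hpath' a \<star> hpath b = (if a = b then H.vert (fst a, 0) else \<zero>\<^bsub>H.L\<^esub>)"
proof (cases "a = b")
  case False
  note a = hpath[OF assms(1)] and b = hpath[OF assms(2)]
  have "hpath' a \<star> hpath b = (hpath' a \<star> H.vert a) \<star> (H.vert b \<star> hpath b)"
    by (simp only: a(5) b(3))
  also have "\<dots> = hpath' a \<star> (H.vert a \<star> H.vert b) \<star> hpath b"
    using a(2,9) b(1,9) by (simp only: B.B.m_assoc B.B.m_closed)
  also have "H.vert a \<star> H.vert b = \<zero>\<^bsub>H.L\<^esub>" using wlpa_familyD(2)[OF H.wlpa_family_gen assms] False by simp
  also have "hpath' a \<star> \<zero>\<^bsub>H.L\<^esub> \<star> hpath b = \<zero>\<^bsub>H.L\<^esub>" using a(2) b(1) by simp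
  finally show ?thesis using False by simp
qed (use hpath(8)[OF assms(1)] in simp)

lemma incl_image_add: "\<lbrakk>y \<in> incl ` carrier L; z \<in> incl ` carrier L\<rbrakk> \<Longrightarrow> y \<oplus>\<^bsub>H.L\<^esub> z \<in> incl ` carrier L"
proof (elim imageE)
  fix a b assume ab: "y = incl a" "a \<in> carrier L" "z = incl b" "b \<in> carrier L"
  have "incl (a \<oplus>\<^bsub>L\<^esub> b) = y \<oplus>\<^bsub>H.L\<^esub> z" unfolding ab(1,3) by (rule alg_homD(2)[OF incl_hom ab(2,4)])
  then show "y \<oplus>\<^bsub>H.L\<^esub> z \<in> incl ` carrier L" using A.M.a_closed[OF ab(2,4)] by (rule image_eqI[OF sym])
qed

lemma incl_image_mult: "\<lbrakk>y \<in> incl ` carrier L; z \<in> incl ` carrier L\<rbrakk> \<Longrightarrow> y \<star> z \<in> incl ` carrier L"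
proof (elim imageE)
  fix a b assume ab: "y = incl a" "a \<in> carrier L" "z = incl b" "b \<in> carrier L"
  have "incl (a \<cdot> b) = y \<star> z" unfolding ab(1,3) by (rule alg_homD(3)[OF incl_hom ab(2,4)])
  then show "y \<star> z \<in> incl ` carrier L" using A.B.m_closed[OF ab(2,4)] by (rule image_eqI[OF sym])
qed

lemma incl_image_smult: "\<lbrakk>c \<in> carrier K; z \<in> incl ` carrier L\<rbrakk> \<Longrightarrow> c \<odot>\<^bsub>H.L\<^esub> z \<in> incl ` carrier L"
proof (elim imageE)
  fix a assume a: "c \<in> carrier K" "z = incl a" "a \<in> carrier L"
  have "incl (c \<odot>\<^bsub>L\<^esub> a) = c \<odot>\<^bsub>H.L\<^esub> z" unfolding a(2) by (rule alg_homD(4)[OF incl_hom a(1,3)])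
  then show "c \<odot>\<^bsub>H.L\<^esub> z \<in> incl ` carrier L" using A.smult_closed[OF a(1,3)] by (rule image_eqI[OF sym])
qed

lemma incl_zero: "incl \<zero>\<^bsub>L\<^esub> = \<zero>\<^bsub>H.L\<^esub>"
  using alg_homD[OF incl_hom] by (intro additive_zero[OF A.M.abelian_group_axioms B.M.abelian_group_axioms]) auto

lemma incl_image_finsum: "(\<And>i. i \<in> S \<Longrightarrow> f i \<in> incl ` carrier L) \<Longrightarrow> finsum H.L f S \<in> incl ` carrier L"
  using alg_homD(1)[OF incl_hom] incl_zero[symmetric]
  by (intro B.M.finsum_mem incl_image_add) auto

lemma incl_finsum: "(\<And>i. i \<in> S \<Longrightarrow> f i \<in> carrier L) \<Longrightarrow> incl (finsum L f S) = (\<Oplus>\<^bsub>H.L\<^esub>i\<in>S. incl (f i))"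
  using alg_homD[OF incl_hom] by (intro additive_finsum[OF A.M.abelian_group_axioms B.M.abelian_group_axioms]) auto

lemma sum_hpath: "(\<Oplus>\<^bsub>H.L\<^esub>a\<in>J. hpath a \<star> hpath' a) = \<one>\<^bsub>H.L\<^esub>"
  unfolding H.wlpa_one using hpath(7,9) by (intro B.M.finsum_cong') auto

lemma incl_vert: "v \<in> verts E \<Longrightarrow> H.vert (v, 0) = incl (vert v)"
  by (simp add: incl_gen)

text \<open>At height 0 the paths are vertices and disappear, so an old edge stays itself. A hair
  edge is absorbed into the longer of the two adjacent paths, and the path then cancels against its
  inverse.\<close>

lemma compress_gen:
  assumes g: "g \<in> H.X"
  shows "hpath' (H.gsource g) \<star> H.gen g \<star> hpath (H.gtarget g) \<in> incl ` carrier L"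
proof -
  have V: "H.vert (v, 0) \<in> incl ` carrier L" if "v \<in> verts E" for v
    unfolding incl_vert[OF that] using that by (intro imageI gen_closed) simp
  have e: "\<exists>e0. e = Inl e0 \<and> e0 \<in> arcs E \<or> (\<exists>v j. e = Inr (v, Suc j) \<and> (v, Suc j) \<in> J)" if "e \<in> arcs E'" for e
  proof (cases e)
    case (Inr z)
    obtain v j where z: "z = (v, j)" by (cases z)
    then show ?thesis using that Inr by (cases j) auto
  qed (use that in auto)
  note D = wlpa_familyD[OF H.wlpa_family_gen]
  show ?thesis
  proof (cases g)
    case (Vert a)
    then have a: "a \<in> J" using g by simp
    then have "fst a \<in> verts E" by (cases a) auto
    then show ?thesis using hpath(5,8)[OF a] V Vert by (simp add: H.gsource_def H.gtarget_def)
  next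
    case (Edge a i)
    then have a: "a \<in> arcs E'" "i \<in> {1..w' a}" using g by simp_all
    from e[OF a(1)] show ?thesis
    proof (elim exE disjE conjE)
      fix e0 assume e0: "a = Inl e0" "e0 \<in> arcs E"
      have "incl (gen (Edge e0 i)) = H.gen (Edge a i)" "gen (Edge e0 i) \<in> carrier L"
        using e0 a by (simp_all add: incl_gen gen_closed)
      then have "H.gen (Edge a i) \<in> incl ` carrier L" by (metis imageI)
      then show ?thesis using D(3,4)[OF a] e0 Edge by (simp add: H.gsource_def H.gtarget_def)
    next
      fix v j assume vj: "a = Inr (v, Suc j)" "(v, Suc j) \<in> J"
      have i: "i = 1" using a vj by simp
      note p = hpath[OF vj(2)] and p' = hpath[OF hair_edge(5)[OF vj(2)]]
      \<comment> \<open>The edge and the path from \<open>(v, j)\<close> combine to the path from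
        \<open>(v, Suc j)\<close> by the definition of \<open>hpath\<close>.\<close>
      have "hpath' (v, Suc j) \<star> H.gen (Edge a i) \<star> hpath (v, j) = hpath' (v, Suc j) \<star> hpath (v, Suc j)"
        unfolding hpath.simps(2) vj(1) i by (rule B.B.m_assoc[OF p(2) hair_edge(1)[OF vj(2)] p'(1)])
      also have "\<dots> = H.vert (v, 0)" using p(8) by (simp only: fst_conv)
      finally show ?thesis using V[of v] vj Edge by (simp add: H.gsource_def H.gtarget_def del: hpath.simps hpath'.simps)
    qed
  next
    case (Ghost a i)
    then have a: "a \<in> arcs E'" "i \<in> {1..w' a}" using g by simp_all
    from e[OF a(1)] show ?thesis
    proof (elim exE disjE conjE)
      fix e0 assume e0: "a = Inl e0" "e0 \<in> arcs E"
      have "incl (gen (Ghost e0 i)) = H.gen (Ghost a i)" "gen (Ghost e0 i) \<in> carrier L"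
        using e0 a by (simp_all add: incl_gen gen_closed)
      then have "H.gen (Ghost a i) \<in> incl ` carrier L" by (metis imageI)
      then show ?thesis using D(5,6)[OF a] e0 Ghost by (simp add: H.gsource_def H.gtarget_def)
    next
      fix v j assume vj: "a = Inr (v, Suc j)" "(v, Suc j) \<in> J"
      have i: "i = 1" using a vj by simp
      note p = hpath[OF vj(2)]
      have "hpath' (v, j) \<star> H.gen (Ghost a i) \<star> hpath (v, Suc j) = H.vert (v, 0)"
        unfolding hpath'.simps(2)[symmetric] vj(1) i using p(8) by (simp only: fst_conv)
      then show ?thesis using V[of v] vj Ghost by (simp add: H.gsource_def H.gtarget_def del: hpath.simps hpath'.simps)
    qed
  qed
qed

text \<open>The statement is multiplicative only if all pairs of hair vertices are treated
  simultaneously, hence the generalisation over a and b.\<close>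

lemma compress:
  assumes "z \<in> carrier H.L" "a \<in> J" "b \<in> J"
  shows "hpath' a \<star> z \<star> hpath b \<in> incl ` carrier L"
  using assms
proof (induction arbitrary: a b rule: H.wlpa_induct)
  case (gen g)
  note a = hpath[OF gen(2)] and b = hpath[OF gen(3)] and c = H.gen_closed[OF gen(1)]
  have "hpath' a \<star> H.gen g \<star> hpath b
    = (hpath' a \<star> H.vert a) \<star> H.gen g \<star> (H.vert b \<star> hpath b)"
    by (simp only: a(5) b(3))
  also have "\<dots> = hpath' a \<star> ((H.vert a \<star> H.gen g) \<star> H.vert b) \<star> hpath b"
    using a(2,9) b(1,9) c by (simp only: B.B.m_assoc B.B.m_closed)
  also have "(H.vert a \<star> H.gen g) \<star> H.vert b = (if a = H.gsource g \<and> b = H.gtarget g then H.gen g else \<zero>\<^bsub>H.L\<^esub>)"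
    using H.vert_gen(1)[OF gen(2,1)] H.vert_gen(2)[OF gen(3,1)] b(9) by auto
  finally have eq: "hpath' a \<star> H.gen g \<star> hpath b
    = hpath' a \<star> (if a = H.gsource g \<and> b = H.gtarget g then H.gen g else \<zero>\<^bsub>H.L\<^esub>) \<star> hpath b" .
  show ?case
  proof (cases "a = H.gsource g \<and> b = H.gtarget g")
    case True
    then show ?thesis using compress_gen[OF gen(1)] by simp
  next
    case False
    have "\<zero>\<^bsub>H.L\<^esub> \<in> incl ` carrier L" using incl_image_finsum[of "{}"] by simp
    then show ?thesis unfolding eq using False a(2) b(1) by auto
  qed
next
  case zero
  have "\<zero>\<^bsub>H.L\<^esub> \<in> incl ` carrier L" using incl_image_finsum[of "{}"] by simp
  then show ?case using hpath(1,2)[OF zero(1)] hpath(1,2)[OF zero(2)] by simp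
next
  case (add y z)
  note a = hpath[OF add(5)] and b = hpath[OF add(6)]
  have "hpath' a \<star> (y \<oplus>\<^bsub>H.L\<^esub> z) \<star> hpath b = hpath' a \<star> y \<star> hpath b \<oplus>\<^bsub>H.L\<^esub> hpath' a \<star> z \<star> hpath b"
    using a(2) b(1) add(1,2) by (simp add: B.B.l_distr B.B.r_distr)
  then show ?case using incl_image_add[OF add(3)[OF add(5,6)] add(4)[OF add(5,6)]] by simp
next
  case (mult y z)
  note a = hpath[OF mult(5)] and b = hpath[OF mult(6)]
  \<comment> \<open>The unit, written as the sum of all \<open>hpath c \<star> hpath' c\<close>, is
    inserted between y and z; every summand then splits into two compressed factors.\<close>
  have "hpath' a \<star> (y \<star> z) \<star> hpath b
    = (hpath' a \<star> y) \<star> (\<Oplus>\<^bsub>H.L\<^esub>c\<in>J. hpath c \<star> hpath' c) \<star> (z \<star> hpath b)"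
    using a(2) b(1) mult(1,2) unfolding sum_hpath by (simp add: B.B.m_assoc)
  also have "\<dots> = (\<Oplus>\<^bsub>H.L\<^esub>c\<in>J. (hpath' a \<star> y) \<star> (hpath c \<star> hpath' c)) \<star> (z \<star> hpath b)"
    using a(2) mult(1) hpath(1,2) hair_finite(1) by (subst B.B.finsum_rdistr) auto
  also have "\<dots> = (\<Oplus>\<^bsub>H.L\<^esub>c\<in>J. (hpath' a \<star> y) \<star> (hpath c \<star> hpath' c) \<star> (z \<star> hpath b))"
    using a(2) b(1) mult(1,2) hpath(1,2) hair_finite(1) by (intro B.B.finsum_ldistr) auto
  also have "\<dots> \<in> incl ` carrier L"
  proof (rule incl_image_finsum)
    fix c assume c: "c \<in> J"
    have "(hpath' a \<star> y) \<star> (hpath c \<star> hpath' c) \<star> (z \<star> hpath b)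
      = (hpath' a \<star> y \<star> hpath c) \<star> (hpath' c \<star> z \<star> hpath b)"
      using a(2) b(1) mult(1,2) hpath(1,2)[OF c] by (simp only: B.B.m_assoc B.B.m_closed)
    then show "(hpath' a \<star> y) \<star> (hpath c \<star> hpath' c) \<star> (z \<star> hpath b) \<in> incl ` carrier L"
      using incl_image_mult[OF mult(3)[OF mult(5) c] mult(4)[OF c mult(6)]] by simp
  qed
  finally show ?case .
next
  case (smult c z)
  note a = hpath[OF smult(4)] and b = hpath[OF smult(5)]
  have "hpath' a \<star> (c \<odot>\<^bsub>H.L\<^esub> z) \<star> hpath b = c \<odot>\<^bsub>H.L\<^esub> (hpath' a \<star> z \<star> hpath b)"
    using a(2) b(1) smult(1,2) by (simp add: B.smult_mult_left B.smult_mult_right)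
  then show ?case using incl_image_smult[OF smult(1) smult(3)[OF smult(4,5)]] by simp
qed

text \<open>The matrices x and y over L, combined with the paths along the hairs, give the frame
  required by \<open>mat_alg_corner_iso\<close>. The entries it cuts out are sums of compressed
  elements multiplied by entries of x and y, so they come from L.\<close>

theorem frame_iso:
  assumes \<epsilon>: "\<epsilon> \<in> carrier L" "\<epsilon> \<cdot> \<epsilon> = \<epsilon>"
    and x: "\<And>i a. \<lbrakk>i < m; a \<in> J\<rbrakk> \<Longrightarrow> x i a \<in> carrier L \<and> x i a \<cdot> vert (fst a) = x i a"
    and y: "\<And>i a. \<lbrakk>i < m; a \<in> J\<rbrakk> \<Longrightarrow> y a i \<in> carrier L"
    and xy: "\<And>i j. \<lbrakk>i < m; j < m\<rbrakk> \<Longrightarrow> (\<Oplus>\<^bsub>L\<^esub>a\<in>J. x i a \<cdot> y a j) = (if i = j then \<epsilon> else \<zero>\<^bsub>L\<^esub>)"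
    and yx: "\<And>a b. \<lbrakk>a \<in> J; b \<in> J\<rbrakk> \<Longrightarrow> (\<Oplus>\<^bsub>L\<^esub>i\<in>{..<m}. y a i \<cdot> x i b) = (if a = b then vert (fst a) else \<zero>\<^bsub>L\<^esub>)"
  shows "alg_iso K (mat_alg m (corner L \<epsilon>)) H.L"
proof -
  note i = alg_homD[OF incl_hom]
  have v: "fst a \<in> verts E" "vert (fst a) \<in> carrier L" if "a \<in> J" for a
    using that by (cases a; auto intro!: gen_closed)+
  have P: "hpath a \<in> carrier H.L" "hpath' a \<in> carrier H.L" "incl (vert (fst a)) \<in> carrier H.L"
    "hpath a \<star> incl (vert (fst a)) = hpath a" if "a \<in> J" for a
    using hpath(1,2,4)[OF that] incl_vert[OF v(1)[OF that]] i(1)[OF v(2)[OF that]] by simp_all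
  have PP: "hpath' a \<star> hpath b = (if a = b then incl (vert (fst a)) else \<zero>\<^bsub>H.L\<^esub>)" if "a \<in> J" "b \<in> J" for a b
    using hpath_orth[OF that] incl_vert[OF v(1)[OF that(1)]] by auto
  have X: "incl (x i a) \<in> carrier H.L" "incl (x i a) \<star> incl (vert (fst a)) = incl (x i a)" if "i < m" "a \<in> J" for i a
    using x[OF that] i(1) i(3)[of "x i a" "vert (fst a)"] v(2)[OF that(2)] by auto
  have Y: "incl (y a i) \<in> carrier H.L" if "i < m" "a \<in> J" for i a
    using i(1)[OF y[OF that]] .
  have XY: "(\<Oplus>\<^bsub>H.L\<^esub>a\<in>J. incl (x i a) \<star> incl (y a j)) = (if i = j then incl \<epsilon> else \<zero>\<^bsub>H.L\<^esub>)" if ij: "i < m" "j < m" for i j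
  proof -
    have "(\<Oplus>\<^bsub>H.L\<^esub>a\<in>J. incl (x i a) \<star> incl (y a j)) = (\<Oplus>\<^bsub>H.L\<^esub>a\<in>J. incl (x i a \<cdot> y a j))"
      using x[OF ij(1)] y[OF ij(2)] i(1,3) by (intro B.B.finsum_congI) auto
    also have "\<dots> = incl (\<Oplus>\<^bsub>L\<^esub>a\<in>J. x i a \<cdot> y a j)"
      using x[OF ij(1)] y[OF ij(2)] by (intro incl_finsum[symmetric]) auto
    finally show ?thesis using xy[OF ij] by (simp add: incl_zero)
  qed
  have YX: "(\<Oplus>\<^bsub>H.L\<^esub>i\<in>{..<m}. incl (y a i) \<star> incl (x i b)) = (if a = b then incl (vert (fst a)) else \<zero>\<^bsub>H.L\<^esub>)"
    if ab: "a \<in> J" "b \<in> J" for a b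
  proof -
    have "(\<Oplus>\<^bsub>H.L\<^esub>i\<in>{..<m}. incl (y a i) \<star> incl (x i b)) = (\<Oplus>\<^bsub>H.L\<^esub>i\<in>{..<m}. incl (y a i \<cdot> x i b))"
      using x[OF _ ab(2)] y[OF _ ab(1)] i(1,3) by (intro B.B.finsum_congI) auto
    also have "\<dots> = incl (\<Oplus>\<^bsub>L\<^esub>i\<in>{..<m}. y a i \<cdot> x i b)"
      using x[OF _ ab(2)] y[OF _ ab(1)] by (intro incl_finsum[symmetric]) auto
    finally show ?thesis using yx[OF ab] by (simp add: incl_zero)
  qed
  note T = hair_finite(1) P PP sum_hpath X Y XY YX
  show ?thesis
  proof (rule mat_alg_corner_iso[OF wlpa_algebra H.wlpa_algebra incl_hom incl_inj \<epsilon>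
      B.B.transport_closed[OF T] B.B.transport_mult[OF T] B.B.transport_one[OF T]])
    fix i j z assume ij: "i < m" "j < m" and z: "z \<in> carrier H.L"
    show "(\<Oplus>\<^bsub>H.L\<^esub>a\<in>J. incl (x i a) \<star> hpath' a) \<star> z \<star> (\<Oplus>\<^bsub>H.L\<^esub>a\<in>J. hpath a \<star> incl (y a j)) \<in> incl ` carrier L"
      by (subst B.B.transport_expand[OF T ij z])
        (assumption | intro incl_image_finsum incl_image_mult[OF incl_image_mult[OF imageI compress[OF z]] imageI]
         | use x[OF ij(1)] y[OF ij(2)] in auto)+
  qed
qed

end

theorem corollary3p9:
  fixes K :: "('k, 'm) ring_scheme"
    and E :: "('v, 'e) pre_digraph"
    and w :: "'e \<Rightarrow> nat"
    and \<epsilon> :: "(('v, 'e) gen list \<Rightarrow> 'k) set"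
  assumes "field K"
    and "finite_weighted_graph E w"
    and "vertex_weighted_graph E w"
    and "full_idempotent (wlpa K E w) \<epsilon>"
  shows "\<exists>n E' w'. 0 < n \<and> hair_extension E w E' w' \<and>
           alg_iso K (mat_alg n (corner (wlpa K E w) \<epsilon>)) (wlpa K E' w')"
proof -
  interpret finite_vertex_weighted K E w
    by (intro finite_vertex_weighted.intro assms)
  have \<epsilon>: "\<epsilon> \<in> carrier L" "\<epsilon> \<cdot> \<epsilon> = \<epsilon>" using assms(4) by (auto simp: full_idempotent_def)
  show ?thesis
  proof (rule full_idempotent_hair_frame[OF assms(4)])
    \<comment> \<open>The matrix size m is the number of terms used to write 1 as a sum of products
      through \<open>\<epsilon>\<close>; h counts how often each vertex occurs in the m-fold sum of
      \<open>\<epsilon>L\<close>.\<close>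
    fix m :: nat and h :: "'v \<Rightarrow> nat" and x y
    assume m: "0 < m" and h: "\<And>v. 0 < h v"
      and x: "\<And>i a. \<lbrakk>i < m; a \<in> verts (hair_graph E h)\<rbrakk> \<Longrightarrow> x i a \<in> carrier L \<and> \<epsilon> \<cdot> x i a = x i a \<and> x i a \<cdot> gen (Vert (fst a)) = x i a"
      and y: "\<And>i a. \<lbrakk>i < m; a \<in> verts (hair_graph E h)\<rbrakk> \<Longrightarrow> y a i \<in> carrier L \<and> y a i \<cdot> \<epsilon> = y a i \<and> gen (Vert (fst a)) \<cdot> y a i = y a i"
      and xy: "\<And>i j. \<lbrakk>i < m; j < m\<rbrakk> \<Longrightarrow> (\<Oplus>\<^bsub>L\<^esub>a\<in>verts (hair_graph E h). x i a \<cdot> y a j) = (if i = j then \<epsilon> else \<zero>\<^bsub>L\<^esub>)"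
      and yx: "\<And>a b. \<lbrakk>a \<in> verts (hair_graph E h); b \<in> verts (hair_graph E h)\<rbrakk>
        \<Longrightarrow> (\<Oplus>\<^bsub>L\<^esub>i\<in>{..<m}. y a i \<cdot> x i b) = (if a = b then gen (Vert (fst a)) else \<zero>\<^bsub>L\<^esub>)"
    interpret hair K E w h by unfold_locales
    have "alg_iso K (mat_alg m (corner L \<epsilon>)) (wlpa K (hair_graph E h) (hair_weight w))"
      by (rule frame_iso[OF \<epsilon>, of m x y]) (use x y xy yx in auto)
    moreover have "hair_extension E w (hair_graph E h) (hair_weight w)"
      unfolding hair_extension_def using h by (intro exI[of _ h]) simp
    ultimately show ?thesis using m by blast
  qed
qed

end
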